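(* Let $0<p\le q<\infty$, $\omega\in\mathcal{D}$, $\Phi,\Psi\in\mathcal{L}$, and let $\mu$ be a finite positive Borel measure on $\mathbb{D}$. Then the following statements hold: (i) $\mu$ is a $(q,\Phi)$-Carleson measure for $A^p_{\omega,\Psi}$ if and only if $$\sup_{a\in\mathbb{D}}\frac{\mu(S(a))\,\Phi\left(\frac{1}{\omega(S(a))}\right)}{\left(\omega(S(a))\,\Psi\left(\frac{1}{\omega(S(a))}\right)\right)^{\frac{q}{p}}}<\infty;$$ (ii) the identity mapping $I:A^p_{\omega,\Psi}\to L^q_{\mu,\Phi}$ is compact if and only if $$\lim_{|a|\to1^-}\frac{\mu(S(a))\,\Phi\left(\frac{1}{\omega(S(a))}\right)}{\left(\omega(S(a))\,\Psi\left(\frac{1}{\omega(S(a))}\right)\right)^{\frac{q}{p}}}=0.$$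
   Context: $\mathbb{D}=\{z\in\mathbb{C}:|z|<1\}$, and $dA=\frac{dx\,dy}{\pi}$ is the normalized area measure on $\mathbb{D}$. Class $\mathcal{L}$: a function $\Psi:[0,\infty)\to(0,\infty)$ belongs to $\mathcal{L}$ if (1) it is essentially monotonic, i.e. either essentially increasing (there is a constant $C>0$ with $\Psi(x)\le C\Psi(y)$ for all $0\le x\le y$) or essentially decreasing (there is a constant $C>0$ with $\Psi(y)\le C\Psi(x)$ for all $0\le x\le y$), and (2) $\Psi(x)\asymp\Psi(x^2)$ for $0\le x<\infty$, i.e. there is a constant $C\ge1$ with $C^{-1}\Psi(x)\le\Psi(x^2)\le C\Psi(x)$ for all $x\ge0$. The functions $\Psi,\Phi$ are understood to be Borel measurable so that the integrals below make sense. Weights: a weight is an integrable function $\omega:\mathbb{D}\to[0,\infty)$; it is radial if $\omega(z)=\omega(|z|)$. For a radial weight, $\widehat{\omega}(z)=\int_{|z|}^1\omega(s)\,ds$, and it is assumed that $\widehat{\omega}>0$ on $\mathbb{D}$. A radial weight belongs to $\widehat{\mathcal{D}}$ if there is $C\ge1$ with $\widehat{\omega}(r)\le C\widehat{\omega}\left(\frac{1+r}{2}\right)$ for all $0\le r<1$; it belongs to $\check{\mathcal{D}}$ if there are $K>1$ and $C>1$ with $\widehat{\omega}(r)\ge C\widehat{\omega}\left(1-\frac{1-r}{K}\right)$ for all $0\le r<1$; and $\mathcal{D}=\widehat{\mathcal{D}}\cap\check{\mathcal{D}}$. For measurable $S\subset\mathbb{D}$, $\omega(S)=\int_S\omega\,dA$.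 Carleson squares: for $a\in\mathbb{D}\setminus\{0\}$, $S(a)=\{z\in\mathbb{D}:|z|\ge|a|,\ |\arg a-\arg z|<\frac12(1-|a|)\}$ (the difference of arguments being taken modulo $2\pi$), and $S(0)=\mathbb{D}$. Spaces: for $0<p<\infty$ and a finite positive Borel measure $\mu$ on $\mathbb{D}$, $L^p_{\mu,\Psi}$ consists of all measurable functions $f$ on $\mathbb{D}$ with $\|f\|_{L^p_{\mu,\Psi}}=\left(\int_{\mathbb{D}}|f|^p\Psi(|f|)\,d\mu\right)^{1/p}<\infty$; $L^p_{\omega,\Psi}$ is the case $d\mu=\omega\,dA$; and $A^p_{\omega,\Psi}$ is the set of all analytic functions on $\mathbb{D}$ belonging to $L^p_{\omega,\Psi}$, with $\|f\|_{A^p_{\omega,\Psi}}=\|f\|_{L^p_{\omega,\Psi}}$. These are quasinorms that need not be absolutely homogeneous. An operator between such spaces is bounded if it maps bounded sets into bounded sets, and compact if it sends a neighborhood of the origin onto a relatively compact subset of the target space. The measure $\mu$ is a $(q,\Phi)$-Carleson measure for $A^p_{\omega,\Psi}$ if the identity mapping $I:A^p_{\omega,\Psi}\to L^q_{\mu,\Phi}$, $I(f)=f$, is bounded (in particular it maps $A^p_{\omega,\Psi}$ into $L^q_{\mu,\Phi}$). *)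

theory Defs
  imports "HOL-Analysis.Analysis"
begin

section \<open>The class of growth functions\<close>

definition ess_increasing :: "(real \<Rightarrow> real) \<Rightarrow> bool" where
  "ess_increasing \<Psi> \<longleftrightarrow> (\<exists>C>0. \<forall>x y. 0 \<le> x \<and> x \<le> y \<longrightarrow> \<Psi> x \<le> C * \<Psi> y)"

definition ess_decreasing :: "(real \<Rightarrow> real) \<Rightarrow> bool" where
  "ess_decreasing \<Psi> \<longleftrightarrow> (\<exists>C>0. \<forall>x y. 0 \<le> x \<and> x \<le> y \<longrightarrow> \<Psi> y \<le> C * \<Psi> x)"

text \<open>Only the values on \<open>[0,\<infinity>)\<close> matter.\<close>

definition class_L :: "(real \<Rightarrow> real) set" where
  "class_L = {\<Psi>. \<Psi> \<in> borel_measurable (restrict_space borel {0..})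
     \<and> (\<forall>x\<ge>0. \<Psi> x > 0)
     \<and> (ess_increasing \<Psi> \<or> ess_decreasing \<Psi>)
     \<and> (\<exists>C\<ge>1. \<forall>x\<ge>0. inverse C * \<Psi> x \<le> \<Psi> (x\<^sup>2) \<and> \<Psi> (x\<^sup>2) \<le> C * \<Psi> x)}"


section \<open>Radial weights on the unit disc\<close>

abbreviation unit_disc :: "complex set" where
  "unit_disc \<equiv> ball 0 1"

definition disc_area :: "complex measure" where
  "disc_area = scale_measure (ennreal (1 / pi)) (lebesgue_on unit_disc)"

definition weight :: "(complex \<Rightarrow> real) \<Rightarrow> bool" where
  "weight \<omega> \<longleftrightarrow> (\<forall>z\<in>unit_disc. \<omega> z \<ge> 0) \<and> integrable disc_area \<omega>"

definition radial :: "(complex \<Rightarrow> real) \<Rightarrow> bool" where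
  "radial \<omega> \<longleftrightarrow> (\<forall>z\<in>unit_disc. \<omega> z = \<omega> (of_real (cmod z)))"

definition weight_hat :: "(complex \<Rightarrow> real) \<Rightarrow> complex \<Rightarrow> real" where
  "weight_hat \<omega> z = (LINT s:{cmod z..<1}|lebesgue. \<omega> (of_real s))"

text \<open>
  A radial weight that is integrable over the disc need not have an integrable profile near
  \<open>s = 0\<close>, in which case \<^term>\<open>weight_hat \<omega> 0\<close> is \<open>0\<close> by the convention for
  non-integrable functions. Positivity of \<^const>\<open>weight_hat\<close> at \<open>0\<close> rules such weights out,
  just as the doubling condition at \<open>r = 0\<close> does when the integral is given the value \<open>\<infinity>\<close>.
\<close>

definition radial_weight :: "(complex \<Rightarrow> real) \<Rightarrow> bool" where
  "radial_weight \<omega> \<longleftrightarrow> weight \<omega> \<and> radial \<omega> \<and> (\<forall>z\<in>unit_disc. weight_hat \<omega> z > 0)"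

definition class_D_hat :: "(complex \<Rightarrow> real) set" where
  "class_D_hat = {\<omega>. radial_weight \<omega> \<and>
     (\<exists>C\<ge>1. \<forall>r::real. 0 \<le> r \<and> r < 1 \<longrightarrow>
        weight_hat \<omega> (of_real r) \<le> C * weight_hat \<omega> (of_real ((1 + r) / 2)))}"

definition class_D_check :: "(complex \<Rightarrow> real) set" where
  "class_D_check = {\<omega>. radial_weight \<omega> \<and>
     (\<exists>K>1. \<exists>C>1. \<forall>r::real. 0 \<le> r \<and> r < 1 \<longrightarrow>
        weight_hat \<omega> (of_real r) \<ge> C * weight_hat \<omega> (of_real (1 - (1 - r) / K)))}"

definition class_D :: "(complex \<Rightarrow> real) set" where
  "class_D = class_D_hat \<inter> class_D_check"

definition weighted_area :: "(complex \<Rightarrow> real) \<Rightarrow> complex measure" where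
  "weighted_area \<omega> = density disc_area (\<lambda>z. ennreal (\<omega> z))"

definition finite_borel_measure_on_disc :: "complex measure \<Rightarrow> bool" where
  "finite_borel_measure_on_disc \<mu> \<longleftrightarrow>
     sets \<mu> = sets (restrict_space borel unit_disc) \<and> finite_measure \<mu>"

text \<open>The integer \<open>k\<close> implements the difference of arguments modulo \<open>2\<pi>\<close>.\<close>

definition carleson_square :: "complex \<Rightarrow> complex set" where
  "carleson_square a = (if a = 0 then unit_disc
     else {z \<in> unit_disc. cmod a \<le> cmod z \<and>
             (\<exists>k::int. \<bar>Arg a - Arg z + 2 * pi * of_int k\<bar> < (1 - cmod a) / 2)})"


section \<open>The function spaces\<close>

definition modular :: "real \<Rightarrow> (real \<Rightarrow> real) \<Rightarrow> complex measure \<Rightarrow> (complex \<Rightarrow> complex) \<Rightarrow> ennreal"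
  where "modular p \<Psi> M f = (\<integral>\<^sup>+z. ennreal (cmod (f z) powr p * \<Psi> (cmod (f z))) \<partial>M)"

definition L_space :: "real \<Rightarrow> (real \<Rightarrow> real) \<Rightarrow> complex measure \<Rightarrow> (complex \<Rightarrow> complex) set" where
  "L_space p \<Psi> M = {f \<in> borel_measurable M. modular p \<Psi> M f < \<infinity>}"

definition L_norm :: "real \<Rightarrow> (real \<Rightarrow> real) \<Rightarrow> complex measure \<Rightarrow> (complex \<Rightarrow> complex) \<Rightarrow> real" where
  "L_norm p \<Psi> M f = enn2real (modular p \<Psi> M f) powr (1 / p)"

definition A_space :: "real \<Rightarrow> (real \<Rightarrow> real) \<Rightarrow> (complex \<Rightarrow> real) \<Rightarrow> (complex \<Rightarrow> complex) set" where
  "A_space p \<Psi> \<omega> = {f \<in> L_space p \<Psi> (weighted_area \<omega>). f analytic_on unit_disc}"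

abbreviation A_norm :: "real \<Rightarrow> (real \<Rightarrow> real) \<Rightarrow> (complex \<Rightarrow> real) \<Rightarrow> (complex \<Rightarrow> complex) \<Rightarrow> real"
  where "A_norm p \<Psi> \<omega> \<equiv> L_norm p \<Psi> (weighted_area \<omega>)"


section \<open>Bounded and compact operators between quasinormed function spaces\<close>

text \<open>
  A space is given by a carrier \<open>X\<close> and a quasinorm \<open>N\<close>. Elements are functions rather than
  equivalence classes, so the topology below need not be Hausdorff: functions that agree almost
  everywhere are topologically indistinguishable. Boundedness, and compactness of closures,
  are the same as in the quotient.
\<close>

definition qn_open :: "(complex \<Rightarrow> complex) set \<Rightarrow> ((complex \<Rightarrow> complex) \<Rightarrow> real)
    \<Rightarrow> (complex \<Rightarrow> complex) set \<Rightarrow> bool" where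
  "qn_open X N U \<longleftrightarrow> U \<subseteq> X \<and>
     (\<forall>f\<in>U. \<exists>\<epsilon>>0. \<forall>g\<in>X. N (\<lambda>z. g z - f z) < \<epsilon> \<longrightarrow> g \<in> U)"

definition qn_topology :: "(complex \<Rightarrow> complex) set \<Rightarrow> ((complex \<Rightarrow> complex) \<Rightarrow> real)
    \<Rightarrow> (complex \<Rightarrow> complex) topology" where
  "qn_topology X N = topology (qn_open X N)"

lemma istopology_qn_open: "istopology (qn_open X N)"
  unfolding istopology_def
proof (intro conjI allI impI)
  fix S T assume S: "qn_open X N S" and T: "qn_open X N T"
  show "qn_open X N (S \<inter> T)"
    unfolding qn_open_def
  proof (intro conjI ballI)
    show "S \<inter> T \<subseteq> X" using S by (auto simp: qn_open_def)
    fix f assume "f \<in> S \<inter> T"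
    then obtain d e where "d > 0" "e > 0"
      and "\<forall>g\<in>X. N (\<lambda>z. g z - f z) < d \<longrightarrow> g \<in> S"
      and "\<forall>g\<in>X. N (\<lambda>z. g z - f z) < e \<longrightarrow> g \<in> T"
      using S T unfolding qn_open_def by (metis IntE)
    then show "\<exists>\<epsilon>>0. \<forall>g\<in>X. N (\<lambda>z. g z - f z) < \<epsilon> \<longrightarrow> g \<in> S \<inter> T"
      by (intro exI[of _ "min d e"]) auto
  qed
next
  fix \<K> assume "\<forall>K\<in>\<K>. qn_open X N K"
  then show "qn_open X N (\<Union>\<K>)"
    unfolding qn_open_def by (meson Union_iff Union_least)
qed

lemma openin_qn_topology: "openin (qn_topology X N) U \<longleftrightarrow> qn_open X N U"
  by (simp add: qn_topology_def istopology_qn_open)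

lemma topspace_qn_topology: "topspace (qn_topology X N) = X"
proof -
  have "qn_open X N X"
    unfolding qn_open_def by (auto intro: exI[of _ 1])
  then show ?thesis
    unfolding topspace_def openin_qn_topology by (auto simp: qn_open_def)
qed

definition qn_bounded :: "((complex \<Rightarrow> complex) \<Rightarrow> real) \<Rightarrow> (complex \<Rightarrow> complex) set \<Rightarrow> bool" where
  "qn_bounded N B \<longleftrightarrow> (\<exists>R. \<forall>f\<in>B. N f \<le> R)"

definition nbhd_of_origin :: "(complex \<Rightarrow> complex) topology \<Rightarrow> (complex \<Rightarrow> complex) set \<Rightarrow> bool" where
  "nbhd_of_origin \<tau> U \<longleftrightarrow> U \<subseteq> topspace \<tau> \<and> (\<exists>V. openin \<tau> V \<and> (\<lambda>z. 0) \<in> V \<and> V \<subseteq> U)"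

definition relatively_compact_in :: "'a topology \<Rightarrow> 'a set \<Rightarrow> bool" where
  "relatively_compact_in \<tau> S \<longleftrightarrow> S \<subseteq> topspace \<tau> \<and> compactin \<tau> (\<tau> closure_of S)"

definition bounded_operator ::
  "(complex \<Rightarrow> complex) set \<Rightarrow> ((complex \<Rightarrow> complex) \<Rightarrow> real)
    \<Rightarrow> (complex \<Rightarrow> complex) set \<Rightarrow> ((complex \<Rightarrow> complex) \<Rightarrow> real)
    \<Rightarrow> ((complex \<Rightarrow> complex) \<Rightarrow> (complex \<Rightarrow> complex)) \<Rightarrow> bool" where
  "bounded_operator X N\<^sub>X Y N\<^sub>Y T \<longleftrightarrow> T ` X \<subseteq> Y \<and>
     (\<forall>B\<subseteq>X. qn_bounded N\<^sub>X B \<longrightarrow> qn_bounded N\<^sub>Y (T ` B))"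

definition compact_operator ::
  "(complex \<Rightarrow> complex) set \<Rightarrow> ((complex \<Rightarrow> complex) \<Rightarrow> real)
    \<Rightarrow> (complex \<Rightarrow> complex) set \<Rightarrow> ((complex \<Rightarrow> complex) \<Rightarrow> real)
    \<Rightarrow> ((complex \<Rightarrow> complex) \<Rightarrow> (complex \<Rightarrow> complex)) \<Rightarrow> bool" where
  "compact_operator X N\<^sub>X Y N\<^sub>Y T \<longleftrightarrow> T ` X \<subseteq> Y \<and>
     (\<exists>U. nbhd_of_origin (qn_topology X N\<^sub>X) U \<and>
          relatively_compact_in (qn_topology Y N\<^sub>Y) (T ` U))"

definition carleson_measure :: "real \<Rightarrow> (real \<Rightarrow> real) \<Rightarrow> real \<Rightarrow> (real \<Rightarrow> real)
    \<Rightarrow> (complex \<Rightarrow> real) \<Rightarrow> complex measure \<Rightarrow> bool" where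
  "carleson_measure q \<Phi> p \<Psi> \<omega> \<mu> \<longleftrightarrow>
     bounded_operator (A_space p \<Psi> \<omega>) (A_norm p \<Psi> \<omega>) (L_space q \<Phi> \<mu>) (L_norm q \<Phi> \<mu>) (\<lambda>f. f)"

definition carleson_quotient :: "real \<Rightarrow> (real \<Rightarrow> real) \<Rightarrow> real \<Rightarrow> (real \<Rightarrow> real)
    \<Rightarrow> (complex \<Rightarrow> real) \<Rightarrow> complex measure \<Rightarrow> complex \<Rightarrow> real" where
  "carleson_quotient q \<Phi> p \<Psi> \<omega> \<mu> a =
     (let S = carleson_square a; w = measure (weighted_area \<omega>) S
      in measure \<mu> S * \<Phi> (1 / w) / (w * \<Psi> (1 / w)) powr (q / p))"

end

theory Submission
  imports Defs "HOL-Complex_Analysis.Complex_Analysis"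
begin

text \<open>
  Write \<open>M\<^sub>p(x) = x\<^sup>p \<Psi>(x)\<close> and \<open>M\<^sub>q(x) = x\<^sup>q \<Phi>(x)\<close>, so that the modulars are the integrals of
  \<open>M\<^sub>p(|f|)\<close> and \<open>M\<^sub>q(|f|)\<close>. The condition \<open>\<Psi>(x) \<asymp> \<Psi>(x\<^sup>2)\<close> makes \<open>\<Psi>\<close> insensitive to powers: it has
  comparable values at two points as soon as each is bounded by a power of the other
  (\<open>class_L_slow\<close>), and it grows and decays more slowly than every power (\<open>class_L_potter\<close>). Let
  \<open>r\<^sub>j = 1 - 2\<^sup>-\<^sup>j\<close> and let \<open>v\<^sub>j = 2\<^sup>-\<^sup>j \<omega>^(r\<^sub>j)\<close>, where \<open>\<omega>^\<close> is the tail of the weight; this is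
  comparable to \<open>\<omega>(S(a))\<close> for \<open>r\<^sub>j \<le> |a| < r\<^sub>j\<^sub>+\<^sub>1\<close> (\<open>carleson_square_mass\<close>). A function with modular
  about 1 that lives on \<open>S(a)\<close> has the size \<open>c\<^sub>j\<close> with \<open>v\<^sub>j M\<^sub>p(c\<^sub>j) \<asymp> 1\<close>, and the quotient in the
  theorem is comparable to \<open>\<mu>(S(a)) Q\<^sub>j\<close> with \<open>Q\<^sub>j = M\<^sub>q(c\<^sub>j)\<close> (\<open>carleson_quotient_compare\<close>). This is
  the \<open>\<mu>\<close>-modular of such a function, so the condition says that functions concentrated on
  single Carleson squares are treated well.

  Sufficiency is the lemma \<open>embedding_estimate\<close>. The function \<open>M\<^sub>p\<close> is comparable to a convex
  increasing function of \<open>x\<^bsup>p/2\<^esup>\<close> (\<open>growth_convex_model\<close>), and for such functions the circle means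
  of a holomorphic function increase with the radius, by a maximum principle for sums over
  rotated copies. Hence \<open>M\<^sub>p(|f|)\<close> satisfies a sub-mean value inequality with a constant, and
  its area integral over an annulus is bounded by a normalised integral with respect to \<open>\<omega> dA\<close>
  over an annulus further out, where the second doubling condition guarantees enough mass
  (\<open>annulus_transfer\<close>). Integrating the sub-mean inequality in \<open>\<mu>\<close> and exchanging the integrals
  bounds the \<open>\<mu>\<close>-integral of \<open>M\<^sub>p(|f|)\<close> over the annulus \<open>r\<^sub>j \<le> |z| < r\<^sub>j\<^sub>+\<^sub>1\<close> by \<open>sup \<mu>(S(a)) / v\<^sub>j\<close>
  times a part of the modular of \<open>f\<close>. It remains to pass from \<open>M\<^sub>p\<close> to \<open>M\<^sub>q\<close>. Where \<open>|f|\<close> is at least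
  a small exponential \<open>2\<^bsup>\<delta>j\<^esup>\<close>, the pointwise bound \<open>v\<^sub>j M\<^sub>p(|f|) \<le> C\<close> puts \<open>|f|\<close> and \<open>1/v\<^sub>j\<close> within
  powers of each other, hence \<open>\<Psi>\<close> and \<open>\<Phi>\<close> take the same values as at \<open>c\<^sub>j\<close> up to constants, and
  \<open>q \<ge> p\<close> gives \<open>M\<^sub>q(|f|) \<le> C v\<^sub>j Q\<^sub>j M\<^sub>p(|f|)\<close>. Where \<open>|f|\<close> is smaller, \<open>M\<^sub>q(|f|)\<close> is at most \<open>C 2\<^bsup>\<epsilon>j\<^esup>\<close>, and
  this is harmless: about \<open>2\<^sup>j\<close> squares cover the annulus, so its \<open>\<mu>\<close>-mass is at most \<open>C 2\<^sup>j / Q\<^sub>j\<close>,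
  while \<open>Q\<^sub>j\<close> exceeds \<open>2\<^sup>j\<close> by an exponential factor, because the second doubling condition makes
  \<open>v\<^sub>j\<close> smaller than \<open>2\<^sup>-\<^sup>j\<close> by such a factor. So these parts sum to a constant even for \<open>q = p\<close>.

  Necessity uses the functions \<open>c\<^sub>J (2\<^sup>-\<^sup>J / (1 - r\<^sub>J cnj(\<zeta>) z))\<^sup>n\<close> (\<open>test_functions\<close>), which have
  size \<open>c\<^sub>J\<close> on \<open>S(a)\<close> for \<open>a\<close> in the direction \<open>\<zeta>\<close> and bounded modulars; the latter follows from the
  mean of the Poisson kernel and the first doubling condition.

  For compactness, the estimate is linear in the supremum of the quotient and applies to the
  part \<open>|z| \<ge> r\<^sub>J\<close> alone, so a vanishing quotient gives uniformly small tails, and normal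
  families do the rest. Conversely the test functions tend to 0 locally uniformly, so a
  cluster point of their images has modular 0 by Fatou's lemma, which forces the quotient to
  vanish. The spaces are only quasi-metric, and the passage between sequences, cluster
  points and the topology is made for quasi-metrics directly.
\<close>


section \<open>Regularity of growth functions\<close>

lemma class_L_pos: "\<Psi> \<in> class_L \<Longrightarrow> 0 \<le> x \<Longrightarrow> 0 < \<Psi> x"
  by (auto simp: class_L_def)

text \<open>
  Passing to the reciprocal exchanges the two kinds of monotonicity, so estimates need to be
  proved for essentially increasing functions only.
\<close>

lemma class_L_inverse:
  assumes "\<Psi> \<in> class_L"
  shows "(\<lambda>x. inverse (\<Psi> x)) \<in> class_L"
proof -
  have pos: "0 < \<Psi> x" if "0 \<le> x" for x
    using assms that by (rule class_L_pos)
  have "ess_decreasing (\<lambda>x. inverse (\<Psi> x))" if inc: "ess_increasing \<Psi>"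
  proof -
    obtain C where C: "C > 0" "\<And>x y. 0 \<le> x \<Longrightarrow> x \<le> y \<Longrightarrow> \<Psi> x \<le> C * \<Psi> y"
      using inc by (auto simp: ess_increasing_def)
    show ?thesis unfolding ess_decreasing_def
      by (rule exI[of _ C]) (use C pos in \<open>auto simp: field_simps\<close>)
  qed
  moreover have "ess_increasing (\<lambda>x. inverse (\<Psi> x))" if dec: "ess_decreasing \<Psi>"
  proof -
    obtain C where C: "C > 0" "\<And>x y. 0 \<le> x \<Longrightarrow> x \<le> y \<Longrightarrow> \<Psi> y \<le> C * \<Psi> x"
      using dec by (auto simp: ess_decreasing_def)
    have "inverse (\<Psi> x) \<le> C * inverse (\<Psi> y)" if "0 \<le> x" "x \<le> y" for x y
      using C(2)[OF that] pos[of x] pos[of y] that by (auto simp: field_simps)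
    then show ?thesis unfolding ess_increasing_def
      using C(1) by blast
  qed
  moreover have "\<exists>C\<ge>1. \<forall>x\<ge>0. inverse C * inverse (\<Psi> x) \<le> inverse (\<Psi> (x\<^sup>2)) \<and>
      inverse (\<Psi> (x\<^sup>2)) \<le> C * inverse (\<Psi> x)"
  proof -
    obtain C where C: "C \<ge> 1" "\<And>x. x \<ge> 0 \<Longrightarrow> inverse C * \<Psi> x \<le> \<Psi> (x\<^sup>2) \<and> \<Psi> (x\<^sup>2) \<le> C * \<Psi> x"
      using assms by (auto simp: class_L_def)
    show ?thesis
    proof (intro exI[of _ C] conjI allI impI)
      fix x :: real assume x: "x \<ge> 0"
      note * = C(2)[OF x] pos[OF x] pos[of "x\<^sup>2"] C(1)
      show "inverse C * inverse (\<Psi> x) \<le> inverse (\<Psi> (x\<^sup>2))"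
        using * by (auto simp: field_simps)
      show "inverse (\<Psi> (x\<^sup>2)) \<le> C * inverse (\<Psi> x)"
        using * by (auto simp: field_simps)
    qed (rule C)
  qed
  ultimately show ?thesis
    using assms by (auto simp: class_L_def)
qed

text \<open>
  A power \<open>A (1 + x)\<^sup>k\<close> with \<open>x \<ge> 2\<close> is at most \<open>x\<^bsup>2^n\<^esup>\<close> for some \<open>n\<close>, and \<open>n\<close> squarings of the argument
  cost the factor \<open>D\<^sup>n\<close>. For \<open>x \<le> 2\<close> everything stays in a bounded range, where \<open>\<Psi>\<close> is bounded
  above and below.
\<close>

lemma class_L_slow_increasing:
  fixes A :: real
  assumes "\<Psi> \<in> class_L" and inc: "ess_increasing \<Psi>" and A: "A \<ge> 1"
  shows "\<exists>C\<ge>1. \<forall>x\<ge>0. \<forall>y\<ge>0. 1 + y \<le> A * (1 + x) ^ k \<longrightarrow> \<Psi> y \<le> C * \<Psi> x"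
proof -
  have pos: "0 < \<Psi> x" if "0 \<le> x" for x
    using assms(1) that by (rule class_L_pos)
  obtain C where C: "C > 0" "\<And>x y. 0 \<le> x \<Longrightarrow> x \<le> y \<Longrightarrow> \<Psi> x \<le> C * \<Psi> y"
    using inc by (auto simp: ess_increasing_def)
  obtain D where D: "D \<ge> 1" "\<And>x. x \<ge> 0 \<Longrightarrow> \<Psi> (x\<^sup>2) \<le> D * \<Psi> x"
    using assms by (auto simp: class_L_def)
  obtain m where m: "A < 2 ^ m"
    using real_arch_pow[of 2 A] by auto
  \<comment> \<open>for \<open>x \<ge> 2\<close>: \<open>A \<le> x\<^sup>m\<close> and \<open>1 + x \<le> x\<^sup>2\<close>, hence \<open>A (1 + x)\<^sup>k \<le> x\<^sup>n \<le> x\<^bsup>2^n\<^esup>\<close>\<close>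
  define n where "n = m + 2 * k"
  define B where "B = A * 3 ^ k"
  define E where "E = max 1 (max (C * D ^ n) (C * C * \<Psi> B / \<Psi> 0))"
  have B: "B \<ge> 0" using A by (auto simp: B_def)
  have iter: "\<Psi> (x ^ (2 ^ i)) \<le> D ^ i * \<Psi> x" if "x \<ge> 0" for x i
  proof (induction i)
    case (Suc i)
    have "\<Psi> (x ^ (2 ^ Suc i)) = \<Psi> ((x ^ (2 ^ i))\<^sup>2)"
      by (simp add: power_mult[symmetric] mult.commute)
    also have "\<dots> \<le> D * \<Psi> (x ^ (2 ^ i))" using that by (intro D) auto
    also have "\<dots> \<le> D * (D ^ i * \<Psi> x)" using Suc D by (intro mult_left_mono) auto
    finally show ?case by (simp add: mult_ac)
  qed auto
  show ?thesis
  proof (intro exI[of _ E] conjI allI impI)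
    show "E \<ge> 1" by (simp add: E_def)
    fix x y :: real assume xy: "x \<ge> 0" "y \<ge> 0" "1 + y \<le> A * (1 + x) ^ k"
    show "\<Psi> y \<le> E * \<Psi> x"
    proof (cases "x \<ge> 2")
      case True
      have "2 * x \<le> x * x" using True by (intro mult_right_mono) auto
      moreover have "1 + x \<le> 2 * x" using True by simp
      ultimately have "1 + x \<le> x ^ 2" unfolding power2_eq_square by (rule order_trans[rotated])
      then have "A * (1 + x) ^ k \<le> 2 ^ m * (x ^ 2) ^ k"
        using m A True by (intro mult_mono power_mono) auto
      also have "\<dots> \<le> x ^ m * (x ^ 2) ^ k"
        using True by (intro mult_right_mono power_mono) auto
      also have "\<dots> = x ^ n" by (simp add: n_def power_add power_mult)
      also have "\<dots> \<le> x ^ (2 ^ n)"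
        using True by (intro power_increasing) auto
      finally have "y \<le> x ^ (2 ^ n)" using xy by simp
      then have "\<Psi> y \<le> C * \<Psi> (x ^ (2 ^ n))" using xy by (intro C) auto
      also have "\<dots> \<le> C * (D ^ n * \<Psi> x)"
        using C(1) xy iter by (intro mult_left_mono) auto
      also have "\<dots> \<le> E * \<Psi> x"
        using pos[OF xy(1)] by (auto simp: E_def mult.assoc[symmetric])
      finally show ?thesis .
    next
      case False
      have "A * (1 + x) ^ k \<le> B"
        unfolding B_def using False xy A by (intro mult_left_mono power_mono) auto
      then have "y \<le> B" using xy by simp
      then have "\<Psi> y \<le> C * \<Psi> B" using xy by (intro C) auto
      also have "\<dots> = (C * \<Psi> B / \<Psi> 0) * \<Psi> 0" using pos[of 0] by auto
      also have "\<dots> \<le> (C * \<Psi> B / \<Psi> 0) * (C * \<Psi> x)"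
        using C xy pos[of 0] pos[OF B] by (intro mult_left_mono) auto
      also have "\<dots> = (C * C * \<Psi> B / \<Psi> 0) * \<Psi> x" by simp
      also have "\<dots> \<le> E * \<Psi> x"
        using pos[OF xy(1)] by (intro mult_right_mono) (auto simp: E_def)
      finally show ?thesis .
    qed
  qed
qed

text \<open>
  The form in which slow variation is used throughout: comparability of \<open>x\<close> and \<open>y\<close> up to powers
  is enough. The shift by 1 avoids a separate discussion of arguments near 0.
\<close>

lemma class_L_slow:
  fixes A :: real
  assumes "\<Psi> \<in> class_L" and A: "A \<ge> 1"
  obtains C where "C \<ge> 1" "\<And>x y. 0 \<le> x \<Longrightarrow> 0 \<le> y \<Longrightarrow> 1 + y \<le> A * (1 + x) ^ k
      \<Longrightarrow> 1 + x \<le> A * (1 + y) ^ k \<Longrightarrow> \<Psi> x \<le> C * \<Psi> y"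
proof (cases "ess_increasing \<Psi>")
  case True
  from class_L_slow_increasing[OF assms(1) True A, of k] that show ?thesis by blast
next
  case False
  then have "ess_decreasing \<Psi>" using assms by (auto simp: class_L_def)
  have pos: "0 < \<Psi> x" if "0 \<le> x" for x
    using assms(1) that by (rule class_L_pos)
  from \<open>ess_decreasing \<Psi>\<close> have "ess_increasing (\<lambda>x. inverse (\<Psi> x))"
  proof -
    obtain C where C: "C > 0" "\<And>x y. 0 \<le> x \<Longrightarrow> x \<le> y \<Longrightarrow> \<Psi> y \<le> C * \<Psi> x"
      using \<open>ess_decreasing \<Psi>\<close> by (auto simp: ess_decreasing_def)
    have "inverse (\<Psi> x) \<le> C * inverse (\<Psi> y)" if "0 \<le> x" "x \<le> y" for x y
      using C(2)[OF that] pos[of x] pos[of y] that by (auto simp: field_simps)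
    then show ?thesis unfolding ess_increasing_def
      using C(1) by blast
  qed
  from class_L_slow_increasing[OF class_L_inverse[OF assms(1)] this A, of k]
  obtain C where C: "C \<ge> 1" "\<And>x y. 0 \<le> x \<Longrightarrow> 0 \<le> y \<Longrightarrow> 1 + y \<le> A * (1 + x) ^ k
      \<Longrightarrow> inverse (\<Psi> y) \<le> C * inverse (\<Psi> x)" by blast
  show ?thesis
  proof (rule that[OF C(1)])
    fix x y :: real assume "0 \<le> x" "0 \<le> y" "1 + y \<le> A * (1 + x) ^ k"
    from C(2)[OF this] pos[OF this(1)] pos[OF this(2)] show "\<Psi> x \<le> C * \<Psi> y"
      by (auto simp: field_simps)
  qed
qed

text \<open>
  By \<open>class_L_slow\<close> the values of \<open>\<Psi>\<close> at two points of ratio at most \<open>l\<close> are comparable with a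
  constant \<open>A\<close> that does not depend on \<open>l\<close>, as long as the points are large compared with \<open>l\<close>:
  then \<open>l (1 + x) \<le> (1 + x)\<^sup>2\<close>. Choosing \<open>l\<close> with \<open>l\<^sup>e \<ge> A\<close> and moving along the points \<open>l\<^sup>n (1 + x)\<close>,
  every step loses at most the factor that the power gains.
\<close>

lemma class_L_potter_decay:
  fixes e :: real
  assumes \<Psi>: "\<Psi> \<in> class_L" and e: "e > 0"
  shows "\<exists>C\<ge>1. \<forall>x y. 0 \<le> x \<longrightarrow> x \<le> y \<longrightarrow> \<Psi> x \<le> C * ((1 + y) / (1 + x)) powr e * \<Psi> y"
proof -
  have pos: "0 < \<Psi> x" if "0 \<le> x" for x
    using assms(1) that by (rule class_L_pos)
  obtain A where A: "A \<ge> 1" "\<And>x y. 0 \<le> x \<Longrightarrow> 0 \<le> y \<Longrightarrow> 1 + y \<le> 1 * (1 + x) ^ 2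
      \<Longrightarrow> 1 + x \<le> 1 * (1 + y) ^ 2 \<Longrightarrow> \<Psi> x \<le> A * \<Psi> y"
    by (rule class_L_slow[OF \<Psi> order_refl]) (rule that)
  define l where "l = max 2 (A powr (1 / e))"
  have l2: "l \<ge> 2" by (simp add: l_def)
  then have l1: "l \<ge> 1" by simp
  have le: "l powr e \<ge> A"
  proof -
    have "A = (A powr (1 / e)) powr e" using A(1) e by (simp add: powr_powr)
    also have "\<dots> \<le> l powr e" using e by (intro powr_mono2) (auto simp: l_def)
    finally show ?thesis .
  qed
  have step: "\<Psi> x \<le> A * \<Psi> y" if "l \<le> 1 + x" "x \<le> y" "1 + y \<le> l * (1 + x)" for x y
  proof (rule A(2))
    show "0 \<le> x" "0 \<le> y" using that l2 by auto
    have "l * (1 + x) \<le> (1 + x) * (1 + x)" using that l2 by (intro mult_right_mono) auto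
    then show "1 + y \<le> 1 * (1 + x)\<^sup>2" using that by (simp add: power2_eq_square)
    have "1 * (1 + y) \<le> (1 + y) * (1 + y)" using that l2 by (intro mult_right_mono) auto
    then show "1 + x \<le> 1 * (1 + y)\<^sup>2" using that by (simp add: power2_eq_square)
  qed
  have main: "\<Psi> x \<le> A * ((1 + y) / (1 + x)) powr e * \<Psi> y"
    if "l \<le> 1 + x" "x \<le> y" "1 + y \<le> l ^ Suc n * (1 + x)" for x y n
    using that
  proof (induction n arbitrary: x)
    case 0
    have "\<Psi> x \<le> A * \<Psi> y" using 0 by (intro step) auto
    also have "A * \<Psi> y \<le> A * ((1 + y) / (1 + x)) powr e * \<Psi> y"
    proof (rule mult_right_mono)
      have "((1 + y) / (1 + x)) powr e \<ge> 1"
        using 0 l2 e by (intro ge_one_powr_ge_zero) (auto simp: field_simps)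
      then show "A \<le> A * ((1 + y) / (1 + x)) powr e" using A(1) by simp
    qed (use 0 l2 in \<open>auto intro!: less_imp_le pos\<close>)
    finally show ?case .
  next
    case (Suc n)
    show ?case
    proof (cases "1 + y \<le> l * (1 + x)")
      case True
      have "\<Psi> x \<le> A * \<Psi> y" using True Suc by (intro step) auto
      also have "A * \<Psi> y \<le> A * ((1 + y) / (1 + x)) powr e * \<Psi> y"
      proof (rule mult_right_mono)
        have "((1 + y) / (1 + x)) powr e \<ge> 1"
          using Suc.prems l2 e by (intro ge_one_powr_ge_zero) (auto simp: field_simps)
        then show "A \<le> A * ((1 + y) / (1 + x)) powr e" using A(1) by simp
      qed (use Suc.prems l2 in \<open>auto intro!: less_imp_le pos\<close>)
      finally show ?thesis .
    next
      case False
      define x' where "x' = l * (1 + x) - 1"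
      have x': "1 + x' = l * (1 + x)" by (simp add: x'_def)
      have "1 * (1 + x) \<le> l * (1 + x)" using Suc.prems l2 by (intro mult_right_mono) auto
      then have xx': "x \<le> x'" by (simp add: x'_def)
      have "\<Psi> x \<le> A * \<Psi> x'" using Suc.prems xx' x' by (intro step) auto
      also have "\<dots> \<le> A * (A * ((1 + y) / (1 + x')) powr e * \<Psi> y)"
        using Suc.prems xx' x' False A by (intro mult_left_mono Suc.IH) (auto simp: mult_ac)
      also have "((1 + y) / (1 + x')) powr e = ((1 + y) / (1 + x)) powr e / l powr e"
        using Suc.prems l2 by (simp add: x' powr_divide powr_mult mult.commute)
      also have "A * (A * (((1 + y) / (1 + x)) powr e / l powr e) * \<Psi> y) =
          (A / l powr e) * (A * ((1 + y) / (1 + x)) powr e * \<Psi> y)" by simp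
      also have "\<dots> \<le> 1 * (A * ((1 + y) / (1 + x)) powr e * \<Psi> y)"
      proof (rule mult_right_mono)
        show "A / l powr e \<le> 1" using le l2 by (simp add: divide_le_eq_1)
        show "0 \<le> A * ((1 + y) / (1 + x)) powr e * \<Psi> y"
          using A(1) Suc.prems l2 pos[of y] by auto
      qed
      finally show ?thesis by simp
    qed
  qed
  have big: "\<Psi> x \<le> A * ((1 + y) / (1 + x)) powr e * \<Psi> y" if "l \<le> 1 + x" "x \<le> y" for x y
  proof -
    obtain n where n: "(1 + y) / (1 + x) < l ^ n"
      using real_arch_pow[of l] l2 by force
    also have "l ^ n \<le> l ^ Suc n" using l2 by (intro power_increasing) auto
    finally have "1 + y \<le> l ^ Suc n * (1 + x)" using that l2 by (simp add: field_simps)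
    from main[OF that this] show ?thesis .
  qed
  \<comment> \<open>below \<open>l\<close> all values are comparable, which removes the restriction on \<open>x\<close>\<close>
  obtain B where B: "B \<ge> 1" "\<And>x y. 0 \<le> x \<Longrightarrow> 0 \<le> y \<Longrightarrow> 1 + y \<le> l * (1 + x) ^ 1
      \<Longrightarrow> 1 + x \<le> l * (1 + y) ^ 1 \<Longrightarrow> \<Psi> x \<le> B * \<Psi> y"
    by (rule class_L_slow[OF \<Psi> l1]) (rule that)
  show ?thesis
  proof (intro exI[of _ "A * B"] conjI allI impI)
    show "1 \<le> A * B" using A(1) B(1) mult_mono[of 1 A 1 B] by simp
    fix x y :: real assume xy: "0 \<le> x" "x \<le> y"
    have r1: "((1 + y) / (1 + x)) powr e \<ge> 1"
      using xy e by (intro ge_one_powr_ge_zero) (auto simp: field_simps)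
    have py: "\<Psi> y > 0" using xy pos by simp
    consider "l \<le> 1 + x" | "1 + x < l" "1 + y \<le> l" | "1 + x < l" "l < 1 + y" by linarith
    then show "\<Psi> x \<le> A * B * ((1 + y) / (1 + x)) powr e * \<Psi> y"
    proof cases
      case 1
      have "\<Psi> x \<le> A * ((1 + y) / (1 + x)) powr e * \<Psi> y" by (rule big[OF 1 xy(2)])
      also have "\<dots> \<le> B * (A * ((1 + y) / (1 + x)) powr e * \<Psi> y)"
        using B(1) A(1) py mult_right_mono[of 1 B "A * ((1 + y) / (1 + x)) powr e * \<Psi> y"] by simp
      finally show ?thesis by (simp add: mult_ac)
    next
      case 2
      have "\<Psi> x \<le> B * \<Psi> y"
      proof (rule B(2))
        have "l * 1 \<le> l * (1 + x)" using l2 xy by (intro mult_left_mono) auto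
        then show "1 + y \<le> l * (1 + x) ^ 1" using 2 by simp
        have "1 * (1 + y) \<le> l * (1 + y)" using l2 xy by (intro mult_right_mono) auto
        moreover have "1 + x \<le> 1 * (1 + y)" using xy by simp
        ultimately show "1 + x \<le> l * (1 + y) ^ 1" unfolding power_one_right by (rule order_trans[rotated])
      qed (use xy in auto)
      also have "\<dots> = 1 * 1 * (B * \<Psi> y)" by simp
      also have "\<dots> \<le> A * ((1 + y) / (1 + x)) powr e * (B * \<Psi> y)"
        using A(1) B(1) py r1 by (intro mult_mono) auto
      finally show ?thesis by (simp add: mult_ac)
    next
      case 3
      define x' where "x' = l - 1"
      have "\<Psi> x \<le> B * \<Psi> x'"
      proof (rule B(2))
        have "l * 1 \<le> l * (1 + x)" using l2 xy by (intro mult_left_mono) auto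
        then show "1 + x' \<le> l * (1 + x) ^ 1" by (simp add: x'_def)
        have "1 * l \<le> l * l" using l2 by (intro mult_right_mono) auto
        then show "1 + x \<le> l * (1 + x') ^ 1" using 3 by (simp add: x'_def)
      qed (use xy l2 in \<open>auto simp: x'_def\<close>)
      also have "\<dots> \<le> B * (A * ((1 + y) / (1 + x')) powr e * \<Psi> y)"
        using B(1) 3 by (intro mult_left_mono big) (auto simp: x'_def)
      also have "\<dots> \<le> B * (A * ((1 + y) / (1 + x)) powr e * \<Psi> y)"
        using B(1) A(1) py e xy l2 3
        by (intro mult_left_mono mult_right_mono powr_mono2 divide_left_mono)
           (auto simp: x'_def)
      finally show ?thesis by (simp add: mult_ac)
    qed
  qed
qed

text \<open>
  The analogue for \<open>class_L\<close> of Potter's bounds for slowly varying functions: \<open>\<Psi>\<close> changes by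
  less than any prescribed power, in both directions.
\<close>

lemma class_L_potter:
  fixes e :: real
  assumes \<Psi>: "\<Psi> \<in> class_L" and e: "e > 0"
  obtains C where "C \<ge> 1"
    "\<And>x y. 0 \<le> x \<Longrightarrow> x \<le> y \<Longrightarrow> \<Psi> x \<le> C * ((1 + y) / (1 + x)) powr e * \<Psi> y"
    "\<And>x y. 0 \<le> x \<Longrightarrow> x \<le> y \<Longrightarrow> \<Psi> y \<le> C * ((1 + y) / (1 + x)) powr e * \<Psi> x"
proof -
  obtain C1 where C1: "C1 \<ge> 1"
    "\<And>x y. 0 \<le> x \<Longrightarrow> x \<le> y \<Longrightarrow> \<Psi> x \<le> C1 * ((1 + y) / (1 + x)) powr e * \<Psi> y"
    using class_L_potter_decay[OF assms] by blast
  obtain C2 where C2: "C2 \<ge> 1"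
    "\<And>x y. 0 \<le> x \<Longrightarrow> x \<le> y \<Longrightarrow> inverse (\<Psi> x) \<le> C2 * ((1 + y) / (1 + x)) powr e * inverse (\<Psi> y)"
    using class_L_potter_decay[OF class_L_inverse[OF \<Psi>] e] by blast
  show ?thesis
  proof (rule that[of "max C1 C2"])
    show "max C1 C2 \<ge> 1" using C1 by simp
    fix x y :: real assume xy: "0 \<le> x" "x \<le> y"
    have p: "\<Psi> x > 0" "\<Psi> y > 0" using class_L_pos[OF \<Psi>] xy by auto
    have "\<Psi> x \<le> C1 * ((1 + y) / (1 + x)) powr e * \<Psi> y" by (rule C1(2)[OF xy])
    also have "\<dots> \<le> max C1 C2 * ((1 + y) / (1 + x)) powr e * \<Psi> y"
      using p by (intro mult_right_mono) auto
    finally show "\<Psi> x \<le> max C1 C2 * ((1 + y) / (1 + x)) powr e * \<Psi> y" .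
    have "\<Psi> y \<le> C2 * ((1 + y) / (1 + x)) powr e * \<Psi> x"
      using C2(2)[OF xy] p by (simp add: field_simps)
    also have "\<dots> \<le> max C1 C2 * ((1 + y) / (1 + x)) powr e * \<Psi> x"
      using p by (intro mult_right_mono) auto
    finally show "\<Psi> y \<le> max C1 C2 * ((1 + y) / (1 + x)) powr e * \<Psi> x" .
  qed
qed

text \<open>
  \<open>class_L_potter\<close> with one of the points at 0.
\<close>

lemma class_L_power_bounds:
  fixes e :: real
  assumes \<Psi>: "\<Psi> \<in> class_L" and e: "e > 0"
  obtains C where "C \<ge> 1" "\<And>x. x \<ge> 0 \<Longrightarrow> \<Psi> x \<le> C * (1 + x) powr e"
    "\<And>x. x \<ge> 0 \<Longrightarrow> 1 \<le> C * (1 + x) powr e * \<Psi> x"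
proof -
  obtain C where C: "C \<ge> 1"
    "\<And>x y. 0 \<le> x \<Longrightarrow> x \<le> y \<Longrightarrow> \<Psi> x \<le> C * ((1 + y) / (1 + x)) powr e * \<Psi> y"
    "\<And>x y. 0 \<le> x \<Longrightarrow> x \<le> y \<Longrightarrow> \<Psi> y \<le> C * ((1 + y) / (1 + x)) powr e * \<Psi> x"
    by (rule class_L_potter[OF \<Psi> e]) (rule that)
  have p0: "\<Psi> 0 > 0" using class_L_pos[OF \<Psi>] by simp
  define B where "B = max 1 (max (C * \<Psi> 0) (C / \<Psi> 0))"
  show ?thesis
  proof (rule that[of B])
    fix x :: real assume x: "x \<ge> 0"
    have "\<Psi> x \<le> (C * \<Psi> 0) * (1 + x) powr e" using C(3)[of 0 x] x by (simp add: mult_ac)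
    also have "\<dots> \<le> B * (1 + x) powr e" by (intro mult_right_mono) (auto simp: B_def)
    finally show "\<Psi> x \<le> B * (1 + x) powr e" .
    have "1 \<le> (C / \<Psi> 0) * ((1 + x) powr e * \<Psi> x)" using C(2)[of 0 x] x p0 by (simp add: field_simps)
    also have "\<dots> \<le> B * ((1 + x) powr e * \<Psi> x)"
      using class_L_pos[OF \<Psi> x] by (intro mult_right_mono) (auto simp: B_def)
    finally show "1 \<le> B * (1 + x) powr e * \<Psi> x" by (simp add: mult.assoc)
  qed (simp add: B_def)
qed

definition growth :: "real \<Rightarrow> (real \<Rightarrow> real) \<Rightarrow> real \<Rightarrow> real" where
  "growth p \<Psi> x = x powr p * \<Psi> x"

lemma growth_0 [simp]: "growth p \<Psi> 0 = 0"
  by (simp add: growth_def)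

lemma growth_nonneg: "\<Psi> \<in> class_L \<Longrightarrow> 0 \<le> x \<Longrightarrow> 0 \<le> growth p \<Psi> x"
  using class_L_pos[of \<Psi> x] by (simp add: growth_def)

lemma growth_pos: "\<Psi> \<in> class_L \<Longrightarrow> 0 < x \<Longrightarrow> 0 < growth p \<Psi> x"
  using class_L_pos[of \<Psi> x] by (simp add: growth_def)

text \<open>
  Half of the exponent \<open>p\<close> absorbs the variation of \<open>\<Psi>\<close>, so that \<open>growth p \<Psi> x / x powr (p / 2)\<close>
  is still essentially increasing.
\<close>

lemma growth_contract:
  assumes \<Psi>: "\<Psi> \<in> class_L" and p: "p > 0"
  obtains C where "C \<ge> 1"
    "\<And>x y. 0 \<le> x \<Longrightarrow> x \<le> y \<Longrightarrow> growth p \<Psi> x \<le> C * (x / y) powr (p / 2) * growth p \<Psi> y"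
proof -
  obtain C where C: "C \<ge> 1"
    "\<And>x y. 0 \<le> x \<Longrightarrow> x \<le> y \<Longrightarrow> \<Psi> x \<le> C * ((1 + y) / (1 + x)) powr (p/2) * \<Psi> y"
    "\<And>x y. 0 \<le> x \<Longrightarrow> x \<le> y \<Longrightarrow> \<Psi> y \<le> C * ((1 + y) / (1 + x)) powr (p/2) * \<Psi> x"
    by (rule class_L_potter[OF \<Psi> half_gt_zero[OF p]]) (rule that)
  show ?thesis
  proof (rule that[OF C(1)])
    fix x y :: real assume xy: "0 \<le> x" "x \<le> y"
    show "growth p \<Psi> x \<le> C * (x / y) powr (p / 2) * growth p \<Psi> y"
    proof (cases "x = 0")
      case False
      then have x: "x > 0" "y > 0" using xy by auto
      have py: "\<Psi> y > 0" using class_L_pos[OF \<Psi>] xy by auto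
      have "((1 + y) / (1 + x)) powr (p/2) \<le> (y / x) powr (p/2)"
        using x xy p by (intro powr_mono2) (auto simp: field_simps)
      then have "C * ((1 + y) / (1 + x)) powr (p/2) * \<Psi> y \<le> C * (y / x) powr (p/2) * \<Psi> y"
        using C(1) py by (intro mult_right_mono mult_left_mono) auto
      with C(2)[OF xy] have "\<Psi> x \<le> C * (y / x) powr (p/2) * \<Psi> y" by linarith
      then have "growth p \<Psi> x \<le> x powr p * (C * (y / x) powr (p/2) * \<Psi> y)"
        unfolding growth_def by (intro mult_left_mono) auto
      also have "x powr p * (C * (y / x) powr (p/2) * \<Psi> y) = C * (x / y) powr (p / 2) * growth p \<Psi> y"
      proof -
        have "x powr p = x powr (p/2) * x powr (p/2)" "y powr p = y powr (p/2) * y powr (p/2)"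
          by (simp_all add: powr_add[symmetric])
        then show ?thesis using x by (simp add: growth_def powr_divide field_simps)
      qed
      finally show ?thesis .
    qed simp
  qed
qed

lemma growth_dilate:
  assumes \<Psi>: "\<Psi> \<in> class_L" and p: "p > 0" and l: "l \<ge> 1"
  obtains C where "C \<ge> 1"
    "\<And>x y. 0 \<le> x \<Longrightarrow> 0 \<le> y \<Longrightarrow> y \<le> l * x \<Longrightarrow> growth p \<Psi> y \<le> C * growth p \<Psi> x"
proof -
  obtain C where C: "C \<ge> 1"
    "\<And>x y. 0 \<le> x \<Longrightarrow> x \<le> y \<Longrightarrow> growth p \<Psi> x \<le> C * (x / y) powr (p / 2) * growth p \<Psi> y"
    by (rule growth_contract[OF \<Psi> p]) (rule that)
  obtain D where D: "D \<ge> 1"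
    "\<And>x y. 0 \<le> x \<Longrightarrow> x \<le> y \<Longrightarrow> \<Psi> x \<le> D * ((1 + y) / (1 + x)) powr 1 * \<Psi> y"
    "\<And>x y. 0 \<le> x \<Longrightarrow> x \<le> y \<Longrightarrow> \<Psi> y \<le> D * ((1 + y) / (1 + x)) powr 1 * \<Psi> x"
    by (rule class_L_potter[OF \<Psi> zero_less_one]) (rule that)
  define E where "E = max C (l powr p * (D * l))"
  show ?thesis
  proof (rule that[of E])
    show "E \<ge> 1" using C by (simp add: E_def)
    fix x y :: real assume xy: "0 \<le> x" "0 \<le> y" "y \<le> l * x"
    have gx: "growth p \<Psi> x \<ge> 0" using growth_nonneg[OF \<Psi>] xy by simp
    show "growth p \<Psi> y \<le> E * growth p \<Psi> x"
    proof (cases "y \<le> x")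
      case True
      have "growth p \<Psi> y \<le> C * (y / x) powr (p / 2) * growth p \<Psi> x" by (rule C(2)[OF xy(2) True])
      also have "(y / x) powr (p / 2) \<le> 1" using True xy p by (intro powr_le1) (auto simp: divide_le_eq_1)
      then have "C * (y / x) powr (p / 2) * growth p \<Psi> x \<le> C * 1 * growth p \<Psi> x"
        using C(1) gx by (intro mult_right_mono mult_left_mono) auto
      also have "\<dots> \<le> E * growth p \<Psi> x" using gx by (intro mult_right_mono) (auto simp: E_def)
      finally show ?thesis .
    next
      case False
      have px: "\<Psi> x > 0" using class_L_pos[OF \<Psi>] xy by auto
      have "\<Psi> y \<le> D * ((1 + y) / (1 + x)) powr 1 * \<Psi> x" using xy False by (intro D) auto
      also have "\<dots> \<le> D * l * \<Psi> x"
      proof -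
        have "1 + y \<le> l * (1 + x)" using xy l by (simp add: algebra_simps)
        then have "(1 + y) / (1 + x) \<le> l" using xy by (simp add: field_simps)
        then show ?thesis using D(1) px xy by (intro mult_right_mono mult_left_mono) auto
      qed
      finally have "growth p \<Psi> y \<le> (l * x) powr p * (D * l * \<Psi> x)"
        unfolding growth_def using xy p l class_L_pos[OF \<Psi> xy(2)]
        by (intro mult_mono powr_mono2) auto
      also have "\<dots> = (l powr p * (D * l)) * growth p \<Psi> x"
        using xy l by (simp add: growth_def powr_mult)
      also have "\<dots> \<le> E * growth p \<Psi> x" using gx by (intro mult_right_mono) (auto simp: E_def)
      finally show ?thesis .
    qed
  qed
qed

lemma growth_add:
  assumes \<Psi>: "\<Psi> \<in> class_L" and p: "p > 0"
  obtains C where "C \<ge> 1"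
    "\<And>x y z. 0 \<le> x \<Longrightarrow> 0 \<le> y \<Longrightarrow> 0 \<le> z \<Longrightarrow> z \<le> x + y \<Longrightarrow> growth p \<Psi> z \<le> C * (growth p \<Psi> x + growth p \<Psi> y)"
proof -
  obtain C where C: "C \<ge> 1"
    "\<And>x y. 0 \<le> x \<Longrightarrow> 0 \<le> y \<Longrightarrow> y \<le> 2 * x \<Longrightarrow> growth p \<Psi> y \<le> C * growth p \<Psi> x"
    using one_le_numeral by (rule growth_dilate[OF \<Psi> p]) (rule that)
  show ?thesis
  proof (rule that[OF C(1)])
    fix x y z :: real assume xyz: "0 \<le> x" "0 \<le> y" "0 \<le> z" "z \<le> x + y"
    have g: "C * growth p \<Psi> x \<ge> 0" "C * growth p \<Psi> y \<ge> 0"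
      using growth_nonneg[OF \<Psi>] xyz C(1) by auto
    consider "z \<le> 2 * x" | "z \<le> 2 * y" using xyz by linarith
    then show "growth p \<Psi> z \<le> C * (growth p \<Psi> x + growth p \<Psi> y)"
    proof cases
      case 1 then show ?thesis using C(2)[of x z] xyz g by (auto simp: algebra_simps)
    next
      case 2 then show ?thesis using C(2)[of y z] xyz g by (auto simp: algebra_simps)
    qed
  qed
qed

text \<open>
  With \<open>s = p / 2\<close> and \<open>L(y) = growth p \<Psi> (y\<^bsup>1/s\<^esup>)\<close>, the quotient \<open>m(t) = L(t) / t\<close> is essentially
  increasing by \<open>growth_contract\<close>. The supremum of the functions \<open>m(t) (y - t)\<^sup>+\<close> over \<open>t > 0\<close> is
  convex and increasing; it is at most \<open>C L(y)\<close> since \<open>m(t) \<le> C m(y)\<close> for \<open>t \<le> y\<close>, and the member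
  with \<open>t = y / 2\<close> shows that it is at least \<open>L(y / 2)\<close>, which is comparable to \<open>L(y)\<close>.
\<close>

lemma growth_convex_model:
  assumes \<Psi>: "\<Psi> \<in> class_L" and p: "p > 0"
  obtains N :: "real \<Rightarrow> real" and C where "C \<ge> 1" "convex_on UNIV N" "mono N"
    "\<And>x. 0 \<le> x \<Longrightarrow> growth p \<Psi> x \<le> C * N (x powr (p / 2))"
    "\<And>x. 0 \<le> x \<Longrightarrow> N (x powr (p / 2)) \<le> C * growth p \<Psi> x"
proof -
  define s where "s = p / 2"
  have s: "s > 0" using p by (simp add: s_def)
  obtain C where C: "C \<ge> 1"
    "\<And>x y. 0 \<le> x \<Longrightarrow> x \<le> y \<Longrightarrow> growth p \<Psi> x \<le> C * (x / y) powr s * growth p \<Psi> y"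
    by (rule growth_contract[OF \<Psi> p, folded s_def]) (rule that)
  define L where "L y = growth p \<Psi> (y powr (1 / s))" for y
  define m where "m t = L t / t" for t
  have L0: "L y \<ge> 0" for y using growth_nonneg[OF \<Psi>] by (simp add: L_def)
  have m0: "m t \<ge> 0" if "t > 0" for t using that L0 by (simp add: m_def)
  have m_le: "m t \<le> C * m y" if "0 < t" "t \<le> y" for t y
  proof -
    have "L t \<le> C * (t powr (1/s) / y powr (1/s)) powr s * L y"
      unfolding L_def using that s by (intro C) (auto intro!: powr_mono2)
    also have "(t powr (1/s) / y powr (1/s)) powr s = t / y"
      using that s by (simp add: powr_divide powr_powr)
    finally show ?thesis using that by (simp add: m_def field_simps)
  qed
  define N where "N y = (SUP t\<in>{0<..}. m t * max 0 (y - t))" for y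
  have bnd: "m t * max 0 (y - t) \<le> C * L (max 0 y)" if "t > 0" for t y
  proof (cases "t \<le> y")
    case True
    then have y: "y > 0" using that by simp
    have "m t * max 0 (y - t) \<le> (C * m y) * y"
      using that True m0[OF that] m_le[OF that True] by (intro mult_mono) auto
    also have "\<dots> = C * L (max 0 y)" using y by (simp add: m_def)
    finally show ?thesis .
  qed (use that C(1) L0 in auto)
  have bdd: "bdd_above ((\<lambda>t. m t * max 0 (y - t)) ` {0<..})" for y
    using bnd by (intro bdd_aboveI2[where M="C * L (max 0 y)"]) auto
  have upper: "N y \<le> C * L (max 0 y)" for y
    unfolding N_def using bnd by (intro cSUP_least) auto
  have ge: "m t * max 0 (y - t) \<le> N y" if "t > 0" for t y
    unfolding N_def using that bdd by (intro cSUP_upper) auto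
  have "convex_on UNIV N"
  proof (rule convex_onI)
    fix t x y :: real assume t: "0 < t" "t < 1"
    show "N ((1 - t) *\<^sub>R x + t *\<^sub>R y) \<le> (1 - t) * N x + t * N y"
      unfolding N_def[of "(1 - t) *\<^sub>R x + t *\<^sub>R y"]
    proof (rule cSUP_least)
      fix u :: real assume "u \<in> {0<..}"
      then have u: "u > 0" by simp
      have *: "max 0 ((1 - t) *\<^sub>R x + t *\<^sub>R y - u) \<le> (1 - t) * max 0 (x - u) + t * max 0 (y - u)"
      proof -
        have "(1 - t) * (x - u) \<le> (1 - t) * max 0 (x - u)" "t * (y - u) \<le> t * max 0 (y - u)"
          using t by (auto intro!: mult_left_mono)
        then have "(1 - t) *\<^sub>R x + t *\<^sub>R y - u \<le> (1 - t) * max 0 (x - u) + t * max 0 (y - u)"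
          by (simp add: algebra_simps)
        moreover have "0 \<le> (1 - t) * max 0 (x - u) + t * max 0 (y - u)" using t by auto
        ultimately show ?thesis by simp
      qed
      have "m u * max 0 ((1 - t) *\<^sub>R x + t *\<^sub>R y - u)
          \<le> m u * ((1 - t) * max 0 (x - u) + t * max 0 (y - u))"
        using * m0[OF u] by (intro mult_left_mono) auto
      also have "\<dots> = (1 - t) * (m u * max 0 (x - u)) + t * (m u * max 0 (y - u))"
        by (simp add: algebra_simps)
      also have "\<dots> \<le> (1 - t) * N x + t * N y"
        using t ge[OF u] by (intro add_mono mult_left_mono) auto
      finally show "m u * max 0 ((1 - t) *\<^sub>R x + t *\<^sub>R y - u) \<le> (1 - t) * N x + t * N y" .
    qed auto
  qed auto
  moreover have "mono N"
  proof (rule monoI)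
    fix x y :: real assume "x \<le> y"
    show "N x \<le> N y" unfolding N_def[of x]
    proof (rule cSUP_least)
      fix u :: real assume "u \<in> {0<..}"
      then have u: "u > 0" by simp
      have "m u * max 0 (x - u) \<le> m u * max 0 (y - u)"
        using m0[OF u] \<open>x \<le> y\<close> by (intro mult_left_mono) auto
      also have "\<dots> \<le> N y" by (rule ge[OF u])
      finally show "m u * max 0 (x - u) \<le> N y" .
    qed auto
  qed
  moreover have "2 powr (1/s) \<ge> 1" using s by (simp add: ge_one_powr_ge_zero)
  then obtain D where D: "D \<ge> 1"
    "\<And>x y. 0 \<le> x \<Longrightarrow> 0 \<le> y \<Longrightarrow> y \<le> 2 powr (1/s) * x \<Longrightarrow> growth p \<Psi> y \<le> D * growth p \<Psi> x"
    by (rule growth_dilate[OF \<Psi> p]) (rule that)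
  moreover have "growth p \<Psi> x \<le> max C D * N (x powr s)" if x: "0 \<le> x" for x
  proof (cases "x = 0")
    case True
    have "0 \<le> N 0" using ge[of 1 0] by simp
    then show ?thesis using True s C(1) by simp
  next
    case False
    define y where "y = x powr s"
    have y: "y > 0" using False by (simp add: y_def)
    have yx: "y powr (1/s) = x" using x s by (simp add: y_def powr_powr)
    have "growth p \<Psi> x \<le> D * growth p \<Psi> ((y/2) powr (1/s))"
      using x y s by (intro D) (auto simp: powr_divide yx)
    also have "growth p \<Psi> ((y/2) powr (1/s)) = m (y/2) * max 0 (y - y/2)"
      using y by (simp add: m_def L_def)
    also have "D * \<dots> \<le> D * N y" using ge[of "y/2" y] y D(1) by (intro mult_left_mono) auto
    also have "\<dots> \<le> max C D * N y"
    proof (rule mult_right_mono)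
      show "0 \<le> N y" using ge[of y y] y by simp
    qed auto
    finally show ?thesis by (simp add: y_def)
  qed
  moreover have "N (x powr s) \<le> max C D * growth p \<Psi> x" if x: "0 \<le> x" for x
  proof -
    have "N (x powr s) \<le> C * L (x powr s)" using upper[of "x powr s"] by simp
    also have "L (x powr s) = growth p \<Psi> x" using x s by (simp add: L_def powr_powr)
    also have "C * growth p \<Psi> x \<le> max C D * growth p \<Psi> x"
      using growth_nonneg[OF \<Psi> x] by (intro mult_right_mono) auto
    finally show ?thesis .
  qed
  moreover have "max C D \<ge> 1" using C(1) by simp
  ultimately show ?thesis unfolding s_def by (intro that)
qed


section \<open>Monotonicity of circle means\<close>

text \<open>
  The sum is subharmonic, but the proof needs no theory of subharmonic functions. Let \<open>b\<close> be a
  maximum point of largest modulus in the closed disc. Replacing \<open>N\<close> by its supporting lines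
  at \<open>|f\<^sub>k(b)|\<^sup>s\<close>, whose slopes \<open>\<kappa>\<^sub>k\<close> are nonnegative, bounds the sum near \<open>b\<close> from below by its
  value at \<open>b\<close> plus \<open>Re H(z) - Re H(b)\<close>, where \<open>H\<close> is the sum of the branches
  \<open>\<kappa>\<^sub>k |f\<^sub>k(b)|\<^sup>s (f\<^sub>k(z) / f\<^sub>k(b))\<^sup>s\<close> over the indices with \<open>f\<^sub>k(b) \<noteq> 0\<close>; at the other indices \<open>b\<close> is a
  minimum point of \<open>|f\<^sub>k|\<close>. If \<open>b\<close> were an interior point, then \<open>Re H\<close> would have a local maximum
  at \<open>b\<close> and be constant near \<open>b\<close>. So all points near \<open>b\<close> would be maximum points, including some
  of larger modulus.
\<close>

lemma sum_convex_powr_max_principle: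
  fixes N :: "real \<Rightarrow> real" and f :: "nat \<Rightarrow> complex \<Rightarrow> complex" and s :: real
  assumes N: "convex_on UNIV N" "mono N" and s: "s > 0" and r: "r > 0"
    and hol: "\<And>k. k < n \<Longrightarrow> f k holomorphic_on ball 0 R" and rR: "r < R"
    and z: "z \<in> cball 0 r"
  shows "\<exists>w. cmod w = r \<and> (\<Sum>k<n. N (cmod (f k z) powr s)) \<le> (\<Sum>k<n. N (cmod (f k w) powr s))"
proof -
  define F where "F z = (\<Sum>k<n. N (cmod (f k z) powr s))" for z
  have contN: "continuous_on UNIV N"
    using N(1) by (intro convex_on_continuous) auto
  have sub: "cball 0 r \<subseteq> ball (0::complex) R" using rR by auto
  have contF: "continuous_on (cball 0 r) F"
  proof -
    have "continuous_on (cball 0 r) (\<lambda>z. cmod (f k z) powr s)" if "k < n" for k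
    proof -
      have "continuous_on (cball 0 r) (f k)"
        using hol[OF that] sub holomorphic_on_imp_continuous_on continuous_on_subset by blast
      then show ?thesis using s by (intro continuous_on_powr') (auto intro!: continuous_intros)
    qed
    then show ?thesis unfolding F_def
      by (intro continuous_on_sum continuous_on_compose2[OF contN]) auto
  qed
  obtain a where a: "a \<in> cball 0 r" "\<And>w. w \<in> cball 0 r \<Longrightarrow> F w \<le> F a"
    using continuous_attains_sup[OF compact_cball _ contF] r by auto
  define K where "K = {w \<in> cball 0 r. F w = F a}"
  have "closedin (top_of_set (cball 0 r)) (cball 0 r \<inter> F -` {F a})"
    by (intro continuous_closedin_preimage contF) auto
  moreover have "cball 0 r \<inter> F -` {F a} = K" by (auto simp: K_def)
  ultimately have "closed K"
    by (metis closed_cball closedin_closed_trans)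
  then have "compact K" unfolding K_def
    by (metis (no_types, lifting) bounded_cball bounded_subset compact_eq_bounded_closed mem_Collect_eq subsetI)
  moreover have "a \<in> K" using a by (simp add: K_def)
  ultimately obtain b where b: "b \<in> K" "\<And>w. w \<in> K \<Longrightarrow> cmod w \<le> cmod b"
    using continuous_attains_sup[of K cmod] continuous_on_norm_id by blast
  have bmax: "F w \<le> F b" if "w \<in> cball 0 r" for w
    using b a that by (auto simp: K_def)
  have "cmod b = r"
  proof (rule ccontr)
    assume "cmod b \<noteq> r"
    then have br: "cmod b < r" using b(1) by (auto simp: K_def)
    \<comment> \<open>supporting lines of \<open>N\<close>, with nonnegative slopes because \<open>N\<close> is increasing\<close>
    have slope: "\<exists>\<kappa>\<ge>0. \<forall>y. N y \<ge> N x + \<kappa> * (y - x)" for x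
    proof -
      define \<kappa> where "\<kappa> = Inf ((\<lambda>t. (N x - N t) / (x - t)) ` ({x<..} \<inter> UNIV))"
      have "N x + \<kappa> * (y - x) \<le> N y" for y
        unfolding \<kappa>_def by (rule convex_le_Inf_differential[OF N(1)]) auto
      moreover have "\<kappa> \<ge> 0" unfolding \<kappa>_def
      proof (rule cINF_greatest)
        fix t assume "t \<in> {x<..} \<inter> UNIV"
        then show "0 \<le> (N x - N t) / (x - t)"
          using monoD[OF N(2), of x t] by (auto simp: divide_nonpos_neg)
      qed (auto intro: exI[of _ "x + 1"])
      ultimately show ?thesis by blast
    qed
    then obtain \<kappa> where \<kappa>: "\<And>x. \<kappa> x \<ge> 0" "\<And>x y. N y \<ge> N x + \<kappa> x * (y - x)" by metis
    define y where "y k = cmod (f k b) powr s" for k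
    \<comment> \<open>near \<open>b\<close> each quotient \<open>f k z / f k b\<close> stays in the right half-plane, where the principal
      branch of the power is holomorphic\<close>
    define good where "good z \<longleftrightarrow> z \<in> ball 0 r \<and> (\<forall>k<n. f k b \<noteq> 0 \<longrightarrow> Re (f k z / f k b) > 0)" for z
    have "\<exists>e>0. \<forall>z\<in>ball b e. good z"
    proof -
      have ev: "\<forall>\<^sub>F z in nhds b. f k b \<noteq> 0 \<longrightarrow> Re (f k z / f k b) > 0" if "k < n" for k
      proof (cases "f k b = 0")
        case False
        have "continuous_on (ball 0 R) (f k)" using hol[OF that] holomorphic_on_imp_continuous_on by blast
        then have "isCont (f k) b" using br rR
          by (auto simp: continuous_on_eq_continuous_at)
        then have "isCont (\<lambda>z. Re (f k z / f k b)) b" using False by (auto intro!: continuous_intros)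
        then have "((\<lambda>z. Re (f k z / f k b)) \<longlongrightarrow> 1) (nhds b)"
          using False by (simp add: isCont_def tendsto_nhds_iff)
        from order_tendstoD(1)[OF this, of 0] show ?thesis by (simp add: False)
      qed auto
      have "\<forall>\<^sub>F z in nhds b. \<forall>k\<in>{..<n}. f k b \<noteq> 0 \<longrightarrow> Re (f k z / f k b) > 0"
        using ev by (subst eventually_ball_finite_distrib) auto
      moreover have "\<forall>\<^sub>F z in nhds b. z \<in> ball 0 r"
        using br by (intro eventually_nhds_in_open) auto
      ultimately have "\<forall>\<^sub>F z in nhds b. good z"
        by eventually_elim (auto simp: good_def)
      then show ?thesis unfolding eventually_nhds_metric by (auto simp: dist_commute)
    qed
    then obtain e where e: "e > 0" "\<And>z. z \<in> ball b e \<Longrightarrow> good z" by blast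
    define h where "h k z = (if f k b = 0 then 0 else
        complex_of_real (\<kappa> (y k) * y k) * exp (of_real s * Ln (f k z / f k b)))" for k z
    define H where "H z = (\<Sum>k<n. h k z)" for z
    have holH: "H holomorphic_on ball b e"
      unfolding H_def
    proof (rule holomorphic_on_sum)
      fix k assume "k \<in> {..<n}"
      then have k: "k < n" by simp
      show "h k holomorphic_on ball b e"
      proof (cases "f k b = 0")
        case True
        then have "h k = (\<lambda>z. 0)" by (simp add: h_def fun_eq_iff)
        then show ?thesis by simp
      next
        case False
        then have hk: "h k = (\<lambda>z. complex_of_real (\<kappa> (y k) * y k) * exp (of_real s * Ln (f k z / f k b)))"
          by (simp add: h_def fun_eq_iff)
        have sb: "ball b e \<subseteq> ball 0 R" using e(2) rR by (fastforce simp: good_def)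
        have 1: "f k holomorphic_on ball b e"
          using hol[OF k] sb by (rule holomorphic_on_subset)
        have 2: "f k z / f k b \<notin> \<real>\<^sub>\<le>\<^sub>0" if "z \<in> ball b e" for z
          using e(2)[OF that] False k
          by (auto simp: good_def complex_nonpos_Reals_iff)
        show ?thesis
          unfolding hk using False 1 2
          by (auto intro!: holomorphic_intros)
      qed
    qed
    have lower: "F z \<ge> F b + Re (H z) - Re (H b)" if z: "z \<in> ball b e" for z
    proof -
      have "N (cmod (f k z) powr s) \<ge> N (y k) + (Re (h k z) - Re (h k b))" if k: "k < n" for k
      proof (cases "f k b = 0")
        case True
        then have "N (y k) \<le> N (cmod (f k z) powr s)"
          using s by (intro monoD[OF N(2)]) (auto simp: y_def)
        then show ?thesis using True by (simp add: h_def)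
      next
        case False
        have nz: "f k z \<noteq> 0" using e(2)[OF z] False k by (auto simp: good_def)
        have "cmod (exp (of_real s * Ln (f k z / f k b))) = cmod (f k z / f k b) powr s"
          using False nz by (simp add: powr_def norm_divide ln_div)
        then have "Re (exp (of_real s * Ln (f k z / f k b))) \<le> cmod (f k z / f k b) powr s"
          using complex_Re_le_cmod by metis
        then have "\<kappa> (y k) * y k * Re (exp (of_real s * Ln (f k z / f k b)))
            \<le> \<kappa> (y k) * y k * cmod (f k z / f k b) powr s"
          using \<kappa>(1) by (intro mult_left_mono) (auto simp: y_def)
        also have "y k * cmod (f k z / f k b) powr s = cmod (f k z) powr s"
          using False by (simp add: y_def norm_divide powr_divide)
        then have "\<kappa> (y k) * y k * cmod (f k z / f k b) powr s = \<kappa> (y k) * cmod (f k z) powr s"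
          by (simp only: mult.assoc)
        finally have "Re (h k z) \<le> \<kappa> (y k) * cmod (f k z) powr s"
          using False by (simp add: h_def)
        moreover have "Re (h k b) = \<kappa> (y k) * y k" using False by (simp add: h_def)
        ultimately show ?thesis using \<kappa>(2)[of "y k" "cmod (f k z) powr s"]
          by (simp add: algebra_simps)
      qed
      then have "(\<Sum>k<n. N (cmod (f k z) powr s)) \<ge> (\<Sum>k<n. N (y k) + (Re (h k z) - Re (h k b)))"
        by (intro sum_mono) auto
      then show ?thesis
        by (simp add: F_def H_def y_def sum.distrib sum_subtractf)
    qed
    have "(\<lambda>z. exp (H z)) constant_on ball b e"
    proof (rule maximum_modulus_principle[where U = "ball b e" and \<xi> = b])
      fix z assume z: "z \<in> ball b e"
      have "F z \<le> F b" using e(2)[OF z] by (intro bmax) (auto simp: good_def)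
      with lower[OF z] show "cmod (exp (H z)) \<le> cmod (exp (H b))" by simp
    qed (use e holH in \<open>auto intro!: holomorphic_intros\<close>)
    then obtain c where c: "\<And>z. z \<in> ball b e \<Longrightarrow> exp (H z) = c"
      unfolding constant_on_def by blast
    \<comment> \<open>a point of the neighbourhood that is farther away from 0 than \<open>b\<close>\<close>
    define d where "d = (if b = 0 then 1 else sgn b)"
    define w where "w = b + of_real (e / 2) * d"
    have "cmod d = 1" by (auto simp: d_def norm_sgn)
    have wb: "w \<in> ball b e" using e(1) \<open>cmod d = 1\<close> by (simp add: w_def dist_norm norm_mult)
    have "cmod w > cmod b"
    proof (cases "b = 0")
      case False
      then have "w = of_real (cmod b + e / 2) * sgn b"
        by (simp add: w_def d_def sgn_div_norm field_simps scaleR_conv_of_real)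
      then have "cmod w = \<bar>cmod b + e / 2\<bar>" using False
        by (simp only: norm_mult norm_of_real norm_sgn) auto
      then show ?thesis using e(1) by simp
    qed (use e in \<open>auto simp: w_def d_def\<close>)
    have "cmod (exp (H w)) = cmod (exp (H b))" using c[OF wb] c[of b] e(1) by simp
    then have "Re (H w) = Re (H b)" by simp
    with lower[OF wb] have "F w \<ge> F b" by simp
    moreover have wr: "w \<in> cball 0 r" using e(2)[OF wb] by (auto simp: good_def)
    ultimately have "w \<in> K" using bmax[OF wr] b(1) by (auto simp: K_def)
    from b(2)[OF this] \<open>cmod w > cmod b\<close> show False by simp
  qed
  then show ?thesis using bmax[OF z] by (auto simp: F_def)
qed

lemma integral_periodic_shift:
  fixes h :: "real \<Rightarrow> real"
  assumes cont: "continuous_on UNIV h" and per: "\<And>x. h (x + 2 * pi) = h x"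
    and a: "0 \<le> a" "a \<le> 2 * pi"
  shows "integral {0..2*pi} (\<lambda>t. h (a + t)) = integral {0..2*pi} h"
proof -
  have int: "h integrable_on {u..v}" for u v
    by (intro integrable_continuous_real continuous_on_subset[OF cont]) auto
  have "integral {0..2*pi} (\<lambda>t. h (a + t)) = integral {a..a + 2*pi} h"
    using integral_shift_Icc_real[of 0 "2*pi" h a] by (simp add: add.commute o_def)
  also have "\<dots> = integral {a..2*pi} h + integral {2*pi..a + 2*pi} h"
    using a by (intro Henstock_Kurzweil_Integration.integral_combine[symmetric] int) auto
  also have "integral {2*pi..a + 2*pi} h = integral {0..a} (\<lambda>t. h (t + 2*pi))"
    using integral_shift_Icc_real[of 0 a h "2*pi"] by (simp add: add.commute o_def)
  also have "\<dots> = integral {0..a} h" by (simp add: per)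
  also have "integral {a..2*pi} h + integral {0..a} h = integral {0..2*pi} h"
    using Henstock_Kurzweil_Integration.integral_combine[of 0 a "2*pi" h] a int by simp
  finally show ?thesis .
qed

text \<open>
  Uniformity in the shift \<open>a\<close> is essential below: the maximum principle provides some point of
  the circle without any information about its argument.
\<close>

lemma rotated_riemann_sum_uniform:
  fixes h :: "real \<Rightarrow> real"
  assumes cont: "continuous_on UNIV h" and per: "\<And>x. h (x + 2 * pi) = h x" and e: "e > 0"
  obtains m where "\<And>n a. n \<ge> m \<Longrightarrow> 0 < n \<and> (0 \<le> a \<longrightarrow> a \<le> 2 * pi \<longrightarrow>
     \<bar>2 * pi / real n * (\<Sum>k<n. h (a + 2 * pi * real k / real n)) - integral {0..2*pi} h\<bar> \<le> e)"
proof -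
  define e' where "e' = e / (2 * pi)"
  have e': "e' > 0" using e by (simp add: e'_def)
  have "uniformly_continuous_on {0..4*pi} h"
    by (intro compact_uniformly_continuous continuous_on_subset[OF cont]) auto
  then obtain d where d: "d > 0" "\<And>x y. x \<in> {0..4*pi} \<Longrightarrow> y \<in> {0..4*pi} \<Longrightarrow> dist x y < d \<Longrightarrow> dist (h x) (h y) < e'"
    unfolding uniformly_continuous_on_def using e' by (metis dist_commute)
  obtain m :: nat where m: "2 * pi / d < real m" using reals_Archimedean2 by blast
  show ?thesis
  proof (rule that[of "Suc m"], intro conjI impI)
    fix n :: nat and a :: real assume n: "n \<ge> Suc m"
    then show n0: "0 < n" by simp
    assume a: "0 \<le> a" "a \<le> 2 * pi"
    define x where "x k = 2 * pi * real k / real n" for k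
    have "2 * pi / d < real n" using m n by simp
    then have small: "2 * pi / real n < d" using d(1) n0 by (simp add: field_simps)
    have x0: "x 0 = 0" "x n = 2 * pi" using n0 by (auto simp: x_def)
    have xs: "x (Suc k) = x k + 2 * pi / real n" for k by (simp add: x_def field_simps add_divide_distrib)
    have xmono: "x k \<le> x (Suc k)" for k using n0 by (simp add: xs)
    have xr: "0 \<le> x k" "x k \<le> 2 * pi" if "k \<le> n" for k using that n0 by (auto simp: x_def field_simps)
    have ci: "(\<lambda>t. h (a + t)) integrable_on {u..v}" for u v
      by (intro integrable_continuous_real continuous_intros continuous_on_compose2[OF cont]) auto
    have split: "integral {0..x k} (\<lambda>t. h (a + t)) = (\<Sum>i<k. integral {x i..x (Suc i)} (\<lambda>t. h (a + t)))" for k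
    proof (induction k)
      case (Suc k)
      have "integral {0..x (Suc k)} (\<lambda>t. h (a + t)) = integral {0..x k} (\<lambda>t. h (a + t)) + integral {x k..x (Suc k)} (\<lambda>t. h (a + t))"
        using xmono[of k] n0 by (intro Henstock_Kurzweil_Integration.integral_combine[symmetric] ci) (auto simp: x_def)
      then show ?case using Suc by simp
    qed (simp add: x0)
    have "integral {0..2*pi} h = (\<Sum>k<n. integral {x k..x (Suc k)} (\<lambda>t. h (a + t)))"
      using split[of n] integral_periodic_shift[OF cont per a] by (simp add: x0)
    moreover have "2 * pi / real n * (\<Sum>k<n. h (a + x k)) = (\<Sum>k<n. integral {x k..x (Suc k)} (\<lambda>t. h (a + x k)))"
      using xmono by (simp add: sum_distrib_left xs)
    ultimately have "2 * pi / real n * (\<Sum>k<n. h (a + x k)) - integral {0..2*pi} h =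
        (\<Sum>k<n. integral {x k..x (Suc k)} (\<lambda>t. h (a + x k) - h (a + t)))"
      by (simp only: sum_subtractf[symmetric] Henstock_Kurzweil_Integration.integral_diff[OF integrable_const_ivl ci])
    also have "\<bar>\<dots>\<bar> \<le> (\<Sum>k<n. e' * (x (Suc k) - x k))"
    proof (rule order_trans[OF sum_abs sum_mono])
      fix k assume "k \<in> {..<n}"
      then have k: "k < n" by simp
      have "norm (integral {x k..x (Suc k)} (\<lambda>t. h (a + x k) - h (a + t))) \<le> e' * (x (Suc k) - x k)"
      proof (rule integral_bound)
        show "continuous_on {x k..x (Suc k)} (\<lambda>t. h (a + x k) - h (a + t))"
          by (intro continuous_intros continuous_on_compose2[OF cont]) auto
        fix t assume t: "t \<in> {x k..x (Suc k)}"
        have "dist (h (a + x k)) (h (a + t)) < e'"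
          using t xs[of k] xr[of k] xr[of "Suc k"] k a small by (intro d) (auto simp: dist_real_def)
        then show "norm (h (a + x k) - h (a + t)) \<le> e'" by (simp add: dist_norm)
      qed (rule xmono)
      then show "\<bar>integral {x k..x (Suc k)} (\<lambda>t. h (a + x k) - h (a + t))\<bar> \<le> e' * (x (Suc k) - x k)" by simp
    qed
    also have "\<dots> = e' * (x n - x 0)"
      using sum_lessThan_telescope[of x n] by (simp add: sum_distrib_left[symmetric])
    also have "\<dots> = e" by (simp add: x0 e'_def)
    finally show "\<bar>2 * pi / real n * (\<Sum>k<n. h (a + 2 * pi * real k / real n)) - integral {0..2*pi} h\<bar> \<le> e"
      by (simp add: x_def)
  qed
qed

text \<open>
  A circle mean is a limit of averages over \<open>n\<close> equally spaced rotations. For fixed \<open>n\<close> the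
  average is a function to which \<open>sum_convex_powr_max_principle\<close> applies, so its value at \<open>z\<close> is
  at most its value at some point \<open>v\<close> with \<open>|v| = |w|\<close>; by uniformity in the shift, this is
  close to the mean over the circle through \<open>w\<close>.
\<close>

lemma circle_mean_mono:
  fixes N :: "real \<Rightarrow> real" and f :: "complex \<Rightarrow> complex" and s :: real
  assumes N: "convex_on UNIV N" "mono N" and s: "s > 0"
    and hol: "f holomorphic_on ball 0 R" and zw: "cmod z \<le> cmod w" "cmod w < R"
  shows "integral {0..2*pi} (\<lambda>t. N (cmod (f (z * cis t)) powr s))
    \<le> integral {0..2*pi} (\<lambda>t. N (cmod (f (w * cis t)) powr s))"
proof (cases "w = 0")
  case True
  then show ?thesis using zw by simp
next
  case False
  define u where "u z = N (cmod (f z) powr s)" for z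
  have contN: "continuous_on UNIV N"
    using N(1) by (intro convex_on_continuous) auto
  have cont: "continuous_on UNIV (\<lambda>t. u (v * cis t))" if "cmod v < R" for v
  proof -
    have "continuous_on UNIV (\<lambda>t. f (v * cis t))"
      using that by (intro continuous_on_compose2[OF holomorphic_on_imp_continuous_on[OF hol]] continuous_intros)
         (auto simp: norm_mult)
    then show ?thesis unfolding u_def using s
      by (intro continuous_on_compose2[OF contN] continuous_on_powr' continuous_intros) auto
  qed
  have per: "u (v * cis (t + 2 * pi)) = u (v * cis t)" for v t
    by (simp add: cis_mult[symmetric])
  have wz: "cmod z < R" "cmod w > 0" using zw False by auto
  have "integral {0..2*pi} (\<lambda>t. u (z * cis t)) \<le> integral {0..2*pi} (\<lambda>t. u (w * cis t)) + e" if e: "e > 0" for e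
  proof -
    obtain m1 where m1: "\<And>n a. n \<ge> m1 \<Longrightarrow> 0 < n \<and> (0 \<le> a \<longrightarrow> a \<le> 2 * pi \<longrightarrow>
     \<bar>2 * pi / real n * (\<Sum>k<n. u (z * cis (a + 2 * pi * real k / real n))) - integral {0..2*pi} (\<lambda>t. u (z * cis t))\<bar> \<le> e / 2)"
      by (rule rotated_riemann_sum_uniform[OF cont[OF wz(1)] per half_gt_zero[OF e]]) (rule that)
    obtain m2 where m2: "\<And>n a. n \<ge> m2 \<Longrightarrow> 0 < n \<and> (0 \<le> a \<longrightarrow> a \<le> 2 * pi \<longrightarrow>
     \<bar>2 * pi / real n * (\<Sum>k<n. u (w * cis (a + 2 * pi * real k / real n))) - integral {0..2*pi} (\<lambda>t. u (w * cis t))\<bar> \<le> e / 2)"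
      by (rule rotated_riemann_sum_uniform[OF cont[OF zw(2)] per half_gt_zero[OF e]]) (rule that)
    define n where "n = max m1 m2"
    have n: "n > 0" using m1[of n 0] by (simp add: n_def)
    define S where "S v = (\<Sum>k<n. u (v * cis (2 * pi * real k / real n)))" for v
    have "\<exists>v. cmod v = cmod w \<and> S z \<le> S v"
      unfolding S_def u_def
    proof (rule sum_convex_powr_max_principle[where R = R and f = "\<lambda>k z. f (z * cis (2 * pi * real k / real n))"])
      show "(\<lambda>z. f (z * cis (2 * pi * real k / real n))) holomorphic_on ball 0 R" for k
        by (intro holomorphic_on_compose_gen[OF _ hol, unfolded o_def] holomorphic_intros)
          (auto simp: norm_mult)
    qed (use N s wz zw in auto)
    then obtain v where v: "cmod v = cmod w" "S z \<le> S v" by blast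
    \<comment> \<open>\<open>v\<close> is a rotation of \<open>w\<close> by the angle \<open>a\<close>\<close>
    define a where "a = Arg2pi (v / w)"
    have "cmod (v / w) = 1" using v wz by (simp add: norm_divide)
    then have a: "0 \<le> a" "a < 2 * pi" "v / w = exp (\<i> * of_real a)"
      using Arg2pi_eq[of "v / w"] Arg2pi_ge_0[of "v / w"] Arg2pi_lt_2pi[of "v / w"]
      by (auto simp: a_def)
    have va: "v = w * cis a" using a(3) wz by (simp add: cis_conv_exp field_simps)
    have "\<bar>2 * pi / real n * S z - integral {0..2*pi} (\<lambda>t. u (z * cis t))\<bar> \<le> e / 2"
      using conjunct2[OF m1[of n 0]] unfolding S_def by (simp add: n_def)
    then have "integral {0..2*pi} (\<lambda>t. u (z * cis t)) \<le> 2 * pi / real n * S z + e / 2"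
      by linarith
    also have "\<dots> \<le> 2 * pi / real n * S v + e / 2"
      using v(2) n by (intro add_right_mono mult_left_mono) auto
    also have "S v = (\<Sum>k<n. u (w * cis (a + 2 * pi * real k / real n)))"
      by (simp add: S_def va cis_mult mult.assoc)
    also have "2 * pi / real n * \<dots> + e / 2 \<le> integral {0..2*pi} (\<lambda>t. u (w * cis t)) + e"
    proof -
      have "\<bar>2 * pi / real n * (\<Sum>k<n. u (w * cis (a + 2 * pi * real k / real n)))
          - integral {0..2*pi} (\<lambda>t. u (w * cis t))\<bar> \<le> e / 2"
        using conjunct2[OF m2[of n a]] a by (simp add: n_def)
      then show ?thesis by linarith
    qed
    finally show ?thesis .
  qed
  then show ?thesis unfolding u_def[symmetric] by (rule field_le_epsilon)
qed


section \<open>Area integrals, rotations and polar coordinates\<close>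

lemma measurable_Complex [measurable]:
  "(\<lambda>(x, y). Complex x y) \<in> borel_measurable (borel :: (real \<times> real) measure)"
  by (intro borel_measurable_continuous_onI)
     (auto simp: case_prod_beta Complex_eq intro!: continuous_intros)

text \<open>
  Relates area measure to the product measure, so that Tonelli's theorem applies in real
  coordinates.
\<close>

lemma lborel_complex: "lborel = distr (lborel :: (real \<times> real) measure) borel (\<lambda>(x, y). Complex x y)"
proof (rule lborel_eqI)
  fix l u :: complex
  assume lu: "\<And>b. b \<in> Basis \<Longrightarrow> l \<bullet> b \<le> u \<bullet> b"
  have lu': "Re l \<le> Re u" "Im l \<le> Im u"
    using lu[of 1] lu[of \<i>] by (auto simp: Basis_complex_def)
  have "emeasure (distr lborel borel (\<lambda>(x, y). Complex x y)) (box l u) =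
    emeasure lborel ((\<lambda>(x, y). Complex x y) -` box l u)"
    by (subst emeasure_distr) auto
  also have "(\<lambda>(x, y). Complex x y) -` box l u = box (Re l, Im l) (Re u, Im u)"
    by (auto simp: box_def Basis_complex_def Basis_prod_def)
  also have "emeasure lborel \<dots> = ennreal (\<Prod>b\<in>Basis. ((Re u, Im u) - (Re l, Im l)) \<bullet> b)"
    using lu' by (intro emeasure_lborel_box) (auto simp: Basis_prod_def)
  also have "(\<Prod>b\<in>Basis. ((Re u, Im u) - (Re l, Im l)) \<bullet> b) = (\<Prod>b\<in>Basis. (u - l) \<bullet> b)"
    by (simp add: Basis_prod_def Basis_complex_def prod.union_disjoint prod.insert)
  finally show "emeasure (distr lborel borel (\<lambda>(x, y). Complex x y)) (box l u) =
    ennreal (\<Prod>b\<in>Basis. (u - l) \<bullet> b)" .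
qed auto

lemma nn_integral_lborel_complex:
  fixes f :: "complex \<Rightarrow> ennreal"
  assumes [measurable]: "f \<in> borel_measurable borel"
  shows "(\<integral>\<^sup>+z. f z \<partial>lborel) = (\<integral>\<^sup>+y. \<integral>\<^sup>+x. f (Complex x y) \<partial>lborel \<partial>lborel)"
    and "(\<integral>\<^sup>+z. f z \<partial>lborel) = (\<integral>\<^sup>+x. \<integral>\<^sup>+y. f (Complex x y) \<partial>lborel \<partial>lborel)"
proof -
  have [measurable]: "(\<lambda>p. f (case p of (x, y) \<Rightarrow> Complex x y)) \<in> borel_measurable (lborel \<Otimes>\<^sub>M lborel)"
    by (simp add: lborel_prod)
  have "(\<integral>\<^sup>+z. f z \<partial>lborel) = (\<integral>\<^sup>+p. f (case p of (x, y) \<Rightarrow> Complex x y) \<partial>(lborel \<Otimes>\<^sub>M lborel))"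
    by (subst lborel_complex) (simp add: nn_integral_distr lborel_prod)
  then show "(\<integral>\<^sup>+z. f z \<partial>lborel) = (\<integral>\<^sup>+y. \<integral>\<^sup>+x. f (Complex x y) \<partial>lborel \<partial>lborel)"
    "(\<integral>\<^sup>+z. f z \<partial>lborel) = (\<integral>\<^sup>+x. \<integral>\<^sup>+y. f (Complex x y) \<partial>lborel \<partial>lborel)"
    using lborel_pair.nn_integral_snd[of "\<lambda>p. f (case p of (x, y) \<Rightarrow> Complex x y)"]
      lborel.nn_integral_fst[of "\<lambda>p. f (case p of (x, y) \<Rightarrow> Complex x y)" lborel] by simp_all
qed

lemma nn_integral_shear:
  fixes f :: "complex \<Rightarrow> ennreal"
  assumes [measurable]: "f \<in> borel_measurable borel"
  shows "(\<integral>\<^sup>+z. f (Complex (Re z + a * Im z) (Im z)) \<partial>lborel) = (\<integral>\<^sup>+z. f z \<partial>lborel)"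
    and "(\<integral>\<^sup>+z. f (Complex (Re z) (Im z + a * Re z)) \<partial>lborel) = (\<integral>\<^sup>+z. f z \<partial>lborel)"
proof -
  have [measurable]: "(\<lambda>z. Complex (Re z + a * Im z) (Im z)) \<in> borel_measurable borel"
    "(\<lambda>z. Complex (Re z) (Im z + a * Re z)) \<in> borel_measurable borel"
    by (intro borel_measurable_continuous_onI; simp add: Complex_eq; intro continuous_intros)+
  have tr: "(\<integral>\<^sup>+x. g (c + x) \<partial>lborel) = (\<integral>\<^sup>+x. g x \<partial>lborel)" if "g \<in> borel_measurable borel"
    for g :: "real \<Rightarrow> ennreal" and c
    using nn_integral_real_affine[OF that, of 1 c] by simp
  have [measurable]: "(\<lambda>x. f (Complex x y)) \<in> borel_measurable borel"
      "(\<lambda>x. f (Complex y x)) \<in> borel_measurable borel" for y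
    by (intro measurable_compose[OF _ assms] borel_measurable_continuous_onI;
        simp add: Complex_eq; intro continuous_intros)+
  show "(\<integral>\<^sup>+z. f (Complex (Re z + a * Im z) (Im z)) \<partial>lborel) = (\<integral>\<^sup>+z. f z \<partial>lborel)"
    using tr[of "\<lambda>x. f (Complex x y)" "a * y" for y] by (simp add: nn_integral_lborel_complex(1) add.commute)
  show "(\<integral>\<^sup>+z. f (Complex (Re z) (Im z + a * Re z)) \<partial>lborel) = (\<integral>\<^sup>+z. f z \<partial>lborel)"
    using tr[of "\<lambda>x. f (Complex y x)" "a * y" for y] by (simp add: nn_integral_lborel_complex(2) add.commute)
qed

text \<open>
  A rotation by an angle \<open>t\<close> with \<open>cos t \<noteq> -1\<close> is a product of three shears, and a shear
  preserves area because it translates every line parallel to an axis along itself.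
\<close>

lemma nn_integral_rotate:
  fixes f :: "complex \<Rightarrow> ennreal"
  assumes [measurable]: "f \<in> borel_measurable borel"
  shows "(\<integral>\<^sup>+z. f (z * cis t) \<partial>lborel) = (\<integral>\<^sup>+z. f z \<partial>lborel)"
proof -
  have main: "(\<integral>\<^sup>+z. f (z * cis t) \<partial>lborel) = (\<integral>\<^sup>+z. f z \<partial>lborel)"
    if ct: "cos t \<noteq> -1" and [measurable]: "f \<in> borel_measurable borel"
    for t and f :: "complex \<Rightarrow> ennreal"
  proof -
    \<comment> \<open>the shear factors \<open>- tan (t / 2)\<close>, \<open>sin t\<close>, \<open>- tan (t / 2)\<close>, horizontal for the outer ones\<close>
    define a where "a = - sin t / (1 + cos t)"
    have c1: "1 + cos t \<noteq> 0" using ct by simp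
    define X where "X z = Complex (Re z + a * Im z) (Im z)" for z
    define Y where "Y z = Complex (Re z) (Im z + sin t * Re z)" for z
    have [measurable]: "X \<in> borel_measurable borel" "Y \<in> borel_measurable borel"
      unfolding X_def Y_def
      by (intro borel_measurable_continuous_onI; simp add: Complex_eq; intro continuous_intros)+
    have sX: "(\<integral>\<^sup>+z. g (X z) \<partial>lborel) = (\<integral>\<^sup>+z. g z \<partial>lborel)"
      and sY: "(\<integral>\<^sup>+z. g (Y z) \<partial>lborel) = (\<integral>\<^sup>+z. g z \<partial>lborel)"
      if "g \<in> borel_measurable borel" for g :: "complex \<Rightarrow> ennreal"
      using nn_integral_shear[OF that] by (simp_all add: X_def Y_def)
    have sc: "sin t * sin t = (1 - cos t) * (1 + cos t)"
      using sin_cos_squared_add[of t] by (simp add: power2_eq_square algebra_simps)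
    have e1: "1 + a * sin t = cos t"
      using c1 sc by (simp add: a_def field_simps)
    have "a * (1 + cos t) = - sin t" using c1 by (simp add: a_def)
    then have e2: "a + a * cos t = - sin t" by (simp add: algebra_simps)
    have "X (Y (X z)) = z * cis t" for z
    proof -
      have "Re z + a * Im z + a * (Im z + sin t * (Re z + a * Im z)) =
          Re z * (1 + a * sin t) + Im z * (a + a * (1 + a * sin t))"
        by (simp add: algebra_simps)
      moreover have "Im z + sin t * (Re z + a * Im z) = Re z * sin t + Im z * (1 + a * sin t)"
        by (simp add: algebra_simps)
      ultimately show ?thesis
        by (simp add: X_def Y_def complex_eq_iff e1 e2)
    qed
    then have "(\<integral>\<^sup>+z. f (z * cis t) \<partial>lborel) = (\<integral>\<^sup>+z. f (X (Y (X z))) \<partial>lborel)" by simp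
    also have "\<dots> = (\<integral>\<^sup>+z. f (X (Y z)) \<partial>lborel)" by (rule sX) measurable
    also have "\<dots> = (\<integral>\<^sup>+z. f (X z) \<partial>lborel)" by (rule sY) measurable
    also have "\<dots> = (\<integral>\<^sup>+z. f z \<partial>lborel)" by (rule sX) measurable
    finally show ?thesis .
  qed
  show ?thesis
  proof (cases "cos t = -1")
    case False then show ?thesis by (intro main) auto
  next
    case True
    \<comment> \<open>\<open>t\<close> is an odd multiple of \<open>\<pi>\<close>, and rotating twice by \<open>t / 2\<close> falls under the first case\<close>
    have "cos (2 * (t / 2)) = 2 * (cos (t/2))\<^sup>2 - 1" by (rule cos_double_cos)
    then have "cos (t / 2) \<noteq> -1" using True by auto
    note m = main[OF this]
    have [measurable]: "(\<lambda>z. z * cis (t/2)) \<in> borel_measurable borel"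
      by (intro borel_measurable_continuous_onI continuous_intros)
    have "(\<integral>\<^sup>+z. f (z * cis t) \<partial>lborel) = (\<integral>\<^sup>+z. f (z * cis (t/2) * cis (t/2)) \<partial>lborel)"
      by (simp add: mult.assoc cis_mult)
    also have "\<dots> = (\<integral>\<^sup>+z. f (z * cis (t/2)) \<partial>lborel)"
      by (rule m[of "\<lambda>z. f (z * cis (t/2))"]) measurable
    also have "\<dots> = (\<integral>\<^sup>+z. f z \<partial>lborel)" by (rule m) measurable
    finally show ?thesis .
  qed
qed

lemma measurable_rotation_pair [measurable]:
  "(\<lambda>p. fst p * cis (snd p)) \<in> borel_measurable (borel \<Otimes>\<^sub>M (lborel :: real measure))"
proof -
  have cis: "(\<lambda>p. fst p * cis (snd p)) \<in> borel_measurable (borel :: (complex \<times> real) measure)"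
    by (intro borel_measurable_continuous_onI continuous_intros)
  show ?thesis
    using cis by (simp add: borel_prod[symmetric] cong: measurable_cong_sets sets_pair_measure_cong)
qed

text \<open>
  Tonelli's theorem and rotation invariance, for every angle separately.
\<close>

lemma nn_integral_average:
  fixes u :: "complex \<Rightarrow> ennreal" and k :: "real \<Rightarrow> ennreal"
  assumes [measurable]: "u \<in> borel_measurable borel" "k \<in> borel_measurable borel"
  shows "(\<integral>\<^sup>+z. (\<integral>\<^sup>+t\<in>{0..2*pi}. u (z * cis t) \<partial>lborel) * k (cmod z) \<partial>lborel) =
    ennreal (2 * pi) * (\<integral>\<^sup>+z. u z * k (cmod z) \<partial>lborel)"
proof -
  have [measurable]: "(\<lambda>p. fst p * cis (snd p)) \<in> borel_measurable (lborel \<Otimes>\<^sub>M (lborel :: real measure))"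
    "(\<lambda>p. snd p * cis (fst p)) \<in> borel_measurable ((lborel :: real measure) \<Otimes>\<^sub>M lborel)"
    unfolding lborel_prod by (auto intro!: borel_measurable_continuous_onI continuous_intros)
  have [measurable]: "(\<lambda>z. z * cis t) \<in> borel_measurable borel" "(\<lambda>t. z * cis t) \<in> borel_measurable borel" for t z
    by (intro borel_measurable_continuous_onI continuous_intros)+
  have "(\<integral>\<^sup>+z. (\<integral>\<^sup>+t\<in>{0..2*pi}. u (z * cis t) \<partial>lborel) * k (cmod z) \<partial>lborel) =
    (\<integral>\<^sup>+z. (\<integral>\<^sup>+t. u (z * cis t) * k (cmod z) * indicator {0..2*pi} t \<partial>lborel) \<partial>lborel)"
    by (intro nn_integral_cong, subst nn_integral_multc[symmetric]) (auto simp: mult_ac)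
  also have "\<dots> = (\<integral>\<^sup>+t. (\<integral>\<^sup>+z. u (z * cis t) * k (cmod z) * indicator {0..2*pi} t \<partial>lborel) \<partial>lborel)"
    by (rule lborel_pair.Fubini'[symmetric]) measurable
  also have "\<dots> = (\<integral>\<^sup>+t. (\<integral>\<^sup>+z. u (z * cis t) * k (cmod (z * cis t)) \<partial>lborel) * indicator {0..2*pi} t \<partial>lborel)"
    by (intro nn_integral_cong, subst nn_integral_multc[symmetric]) (auto simp: norm_mult)
  also have "\<dots> = (\<integral>\<^sup>+t. (\<integral>\<^sup>+z. u z * k (cmod z) \<partial>lborel) * indicator {0..2*pi} (t::real) \<partial>lborel)"
    by (subst nn_integral_rotate[of "\<lambda>z. u z * k (cmod z)"]) auto
  also have "\<dots> = ennreal (2 * pi) * (\<integral>\<^sup>+z. u z * k (cmod z) \<partial>lborel)"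
    by (subst nn_integral_cmult_indicator) (auto simp: mult.commute)
  finally show ?thesis .
qed

lemma emeasure_ball_complex: "r \<ge> 0 \<Longrightarrow> emeasure lborel (ball (c::complex) r) = ennreal (pi * r\<^sup>2)"
  by (simp add: emeasure_ball unit_ball_vol_2)

text \<open>
  The image of area measure on the disc under the modulus and the measure \<open>2\<pi>s ds\<close> agree on
  all half-lines, since the area of an annulus is known.
\<close>

lemma nn_integral_radial:
  fixes k :: "real \<Rightarrow> ennreal"
  assumes [measurable]: "k \<in> borel_measurable borel"
  shows "(\<integral>\<^sup>+z\<in>ball 0 1. k (cmod z) \<partial>lborel) = (\<integral>\<^sup>+s\<in>{0..<1}. k s * ennreal (2 * pi * s) \<partial>lborel)"
proof -
  have [measurable]: "(indicator (ball (0::complex) 1) :: complex \<Rightarrow> ennreal) \<in> borel_measurable borel"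
    by (rule borel_measurable_indicator) simp
  define M where "M = distr (density lborel (indicator (ball 0 1))) borel cmod"
  have [measurable]: "(cmod -` A) \<in> sets borel" if "A \<in> sets borel" for A
    using measurable_sets[of cmod borel borel A] that by simp
  define L where "L = density lborel (\<lambda>s::real. ennreal (2 * pi * s) * indicator {0..<1} s)"
  have M_eq: "emeasure M {x<..} = ennreal (pi * (1 - (max 0 (min x 1))\<^sup>2))" if "0 \<le> x" for x
  proof -
    have "emeasure M {x<..} = emeasure lborel (ball 0 1 - cball (0::complex) x)"
      unfolding M_def
      by (subst emeasure_distr, measurable, subst emeasure_density, measurable)
         (auto intro!: nn_integral_cong simp: indicator_def simp flip: nn_integral_indicator)
    also have "\<dots> = ennreal (pi * (1 - (max 0 (min x 1))\<^sup>2))"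
    proof (cases "x < 1")
      case True
      have "emeasure lborel (ball 0 1 - cball (0::complex) x) = emeasure lborel (ball (0::complex) 1) - emeasure lborel (cball (0::complex) x)"
        using True that by (intro emeasure_Diff) (auto simp: emeasure_cball)
      also have "\<dots> = ennreal pi - ennreal (pi * x\<^sup>2)"
        using that by (simp add: emeasure_cball emeasure_ball unit_ball_vol_2)
      also have "\<dots> = ennreal (pi - pi * x\<^sup>2)" by (subst ennreal_minus) auto
      finally show ?thesis using True that by (simp add: algebra_simps max_def min_def)
    next
      case False
      then have empty: "ball 0 1 - cball (0::complex) x = {}" by auto
      show ?thesis unfolding empty using False by (simp add: max_def min_def)
    qed
    finally show ?thesis .
  qed
  have L_eq: "emeasure L {x<..} = ennreal (pi * (1 - (max 0 (min x 1))\<^sup>2))" if "0 \<le> x" for x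
  proof -
    have "emeasure L {x<..} = (\<integral>\<^sup>+s. ennreal (2 * pi * s) * indicator {0..<1} s * indicator {x<..} s \<partial>lborel)"
      unfolding L_def by (subst emeasure_density) auto
    also have "\<dots> = (\<integral>\<^sup>+s. ennreal (2 * pi * s) * indicator {min x 1..1} s \<partial>lborel)"
      by (rule nn_integral_cong_AE, rule AE_I'[of "{x, 1}"])
         (use that in \<open>auto simp: indicator_def finite_imp_null_set_lborel split: if_splits\<close>)
    also have "\<dots> = ennreal (pi * 1\<^sup>2 - pi * (min x 1)\<^sup>2)"
      using that
      by (intro nn_integral_FTC_Icc) (auto intro!: derivative_eq_intros)
    finally show ?thesis using that by (simp add: algebra_simps max_def)
  qed
  have neg: "emeasure N {x<..} = emeasure N {0<..}" if "x < 0" "N = M \<or> N = L" for x N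
  proof -
    have nul: "emeasure M {x<..0} = 0"
    proof -
      have "emeasure M {x<..0} = (\<integral>\<^sup>+z. indicator (ball 0 1) z * indicator (cmod -` {x<..0}) z \<partial>lborel)"
        unfolding M_def by (subst emeasure_distr, measurable, subst emeasure_density) auto
      also have "\<dots> = (\<integral>\<^sup>+z. indicator {0::complex} z \<partial>lborel)"
        using that by (intro nn_integral_cong) (auto simp: indicator_def)
      finally have "emeasure M {x<..0} = emeasure lborel {0::complex}" by simp
      then show ?thesis by simp
    qed
    have nul2: "emeasure L {x<..0} = 0"
    proof -
      have "emeasure L {x<..0} = (\<integral>\<^sup>+s. ennreal (2 * pi * s) * indicator {0..<1} s * indicator {x<..0} s \<partial>lborel)"
        unfolding L_def by (subst emeasure_density) auto
      also have "\<dots> = (\<integral>\<^sup>+s. 0 \<partial>(lborel::real measure))"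
        by (intro nn_integral_cong) (auto simp: indicator_def)
      finally show ?thesis by simp
    qed
    have "{x<..} = {x<..0} \<union> {0<..}" using that by auto
    also have "emeasure N \<dots> = emeasure N {0<..}"
    proof (subst Un_commute, rule emeasure_Un_null_set)
      show "{x<..0} \<in> null_sets N" using that nul nul2 by (auto simp: null_sets_def M_def L_def)
    qed (use that in \<open>auto simp: M_def L_def\<close>)
    finally show ?thesis .
  qed
  have "M = L"
  proof (rule measure_eqI_lessThan)
    show "emeasure M {x<..} = emeasure L {x<..}" for x
      using neg[of x] M_eq L_eq by (cases "x < 0") auto
    show "emeasure M {x<..} < \<infinity>" for x
      using neg[of x] M_eq by (cases "x < 0") auto
  qed (auto simp: M_def L_def)
  have "(\<integral>\<^sup>+z\<in>ball 0 1. k (cmod z) \<partial>lborel) = (\<integral>\<^sup>+s. k s \<partial>M)"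
    by (simp add: M_def nn_integral_distr nn_integral_density mult.commute)
  also have "\<dots> = (\<integral>\<^sup>+s. k s \<partial>L)" by (simp add: \<open>M = L\<close>)
  also have "\<dots> = (\<integral>\<^sup>+s\<in>{0..<1}. k s * ennreal (2 * pi * s) \<partial>lborel)"
    by (simp add: L_def nn_integral_density mult_ac)
  finally show ?thesis .
qed


section \<open>Mean value inequalities for growth functions\<close>

lemma class_L_measurable:
  assumes "\<Psi> \<in> class_L" and [measurable]: "g \<in> borel_measurable M" and "\<And>x. x \<in> space M \<Longrightarrow> 0 \<le> g x"
  shows "(\<lambda>x. \<Psi> (g x)) \<in> borel_measurable M"
proof -
  have "\<Psi> \<in> borel_measurable (restrict_space borel {0..})"
    using assms(1) by (simp add: class_L_def)
  moreover have "g \<in> M \<rightarrow>\<^sub>M restrict_space borel {0..}"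
    using assms by (intro measurable_restrict_space2) auto
  ultimately show ?thesis by (rule measurable_compose[rotated])
qed

lemma growth_measurable:
  assumes "\<Psi> \<in> class_L" and [measurable]: "g \<in> borel_measurable M" and "\<And>x. x \<in> space M \<Longrightarrow> 0 \<le> g x"
  shows "(\<lambda>x. growth p \<Psi> (g x)) \<in> borel_measurable M"
  unfolding growth_def using class_L_measurable[OF assms] by measurable

lemma growth_holomorphic_measurable:
  assumes "\<Psi> \<in> class_L" and "f holomorphic_on A" "open A"
  shows "(\<lambda>z. ennreal (growth p \<Psi> (cmod (f z))) * indicator A z) \<in> borel_measurable borel"
proof -
  have "(\<lambda>z. if z \<in> A then f z else 0) \<in> borel_measurable borel"
    using assms by (intro borel_measurable_continuous_on_if holomorphic_on_imp_continuous_on) auto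
  then have "(\<lambda>z. growth p \<Psi> (cmod (if z \<in> A then f z else 0))) \<in> borel_measurable borel"
    by (intro growth_measurable[OF assms(1)]) auto
  then have "(\<lambda>z. ennreal (growth p \<Psi> (cmod (if z \<in> A then f z else 0)))) \<in> borel_measurable borel"
    by measurable
  also have "(\<lambda>z. ennreal (growth p \<Psi> (cmod (if z \<in> A then f z else 0)))) =
      (\<lambda>z. ennreal (growth p \<Psi> (cmod (f z))) * indicator A z)"
    by (auto simp: indicator_def fun_eq_iff)
  finally show ?thesis .
qed

lemma nn_integral_continuous_Icc:
  fixes h :: "real \<Rightarrow> real"
  assumes cont: "continuous_on {a..b} h" and nonneg: "\<And>x. x \<in> {a..b} \<Longrightarrow> 0 \<le> h x"
  shows "(\<integral>\<^sup>+x\<in>{a..b}. ennreal (h x) \<partial>lborel) = ennreal (integral {a..b} h)"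
proof -
  have int: "set_integrable lborel {a..b} h"
    by (rule borel_integrable_atLeastAtMost'[OF cont])
  have "(\<integral>\<^sup>+x\<in>{a..b}. ennreal (h x) \<partial>lborel) = (\<integral>\<^sup>+x. ennreal (indicator {a..b} x *\<^sub>R h x) \<partial>lborel)"
    by (intro nn_integral_cong) (auto simp: indicator_def)
  also have "\<dots> = ennreal (\<integral>x. indicator {a..b} x *\<^sub>R h x \<partial>lborel)"
    using int nonneg by (intro nn_integral_eq_integral) (auto simp: set_integrable_def indicator_def)
  also have "(\<integral>x. indicator {a..b} x *\<^sub>R h x \<partial>lborel) = integral {a..b} h"
    using set_borel_integral_eq_integral(2)[OF int] by (simp add: set_lebesgue_integral_def)
  finally show ?thesis .
qed

text \<open>
  The convex model has increasing circle means; going to the model and back costs \<open>C\<^sup>2\<close>.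
\<close>

lemma growth_circle_mean:
  assumes \<Psi>: "\<Psi> \<in> class_L" and p: "p > 0"
  obtains C where "C \<ge> 1"
    "\<And>f R z w. f holomorphic_on ball 0 R \<Longrightarrow> cmod z \<le> cmod w \<Longrightarrow> cmod w < R \<Longrightarrow>
      (\<integral>\<^sup>+t\<in>{0..2*pi}. ennreal (growth p \<Psi> (cmod (f (z * cis t)))) \<partial>lborel)
       \<le> ennreal C * (\<integral>\<^sup>+t\<in>{0..2*pi}. ennreal (growth p \<Psi> (cmod (f (w * cis t)))) \<partial>lborel)"
proof -
  obtain N C where C: "C \<ge> 1" and N: "convex_on UNIV N" "mono N" and
    low: "\<And>x. 0 \<le> x \<Longrightarrow> growth p \<Psi> x \<le> C * N (x powr (p / 2))" and
    up: "\<And>x. 0 \<le> x \<Longrightarrow> N (x powr (p / 2)) \<le> C * growth p \<Psi> x"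
    by (rule growth_convex_model[OF \<Psi> p]) (rule that)
  have N0: "N (x powr (p / 2)) \<ge> 0" if "x \<ge> 0" for x
  proof -
    have "0 \<le> C * N (x powr (p / 2))" using low[OF that] growth_nonneg[OF \<Psi> that] by (rule order_trans[rotated])
    then show ?thesis using C by (simp add: zero_le_mult_iff)
  qed
  have contN: "continuous_on UNIV N"
    using N(1) by (intro convex_on_continuous) auto
  show ?thesis
  proof (rule that[of "C * C"])
    show "1 \<le> C * C" using C mult_mono[of 1 C 1 C] by simp
    fix f R and z w :: complex
    assume hol: "f holomorphic_on ball 0 R" and zw: "cmod z \<le> cmod w" "cmod w < R"
    define I where "I v = integral {0..2*pi} (\<lambda>t. N (cmod (f (v * cis t)) powr (p/2)))" for v
    define u where "u v t = N (cmod (f (v * cis t)) powr (p/2))" for v t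
    have cont: "continuous_on {0..2*pi} (u v)" if "cmod v < R" for v
    proof -
      have "continuous_on {0..2*pi} (\<lambda>t. f (v * cis t))"
        using that by (intro continuous_on_compose2[OF holomorphic_on_imp_continuous_on[OF hol]] continuous_intros)
           (auto simp: norm_mult)
      then show ?thesis unfolding u_def using p
        by (intro continuous_on_compose2[OF contN] continuous_on_powr' continuous_intros) auto
    qed
    have eqI: "(\<integral>\<^sup>+t\<in>{0..2*pi}. ennreal (u v t) \<partial>lborel) = ennreal (I v)" if "cmod v < R" for v
      unfolding I_def u_def[symmetric] using cont[OF that] N0
      by (intro nn_integral_continuous_Icc) (auto simp: u_def)
    have bm: "(\<lambda>t. ennreal (u v t) * indicator {0..2*pi} t) \<in> borel_measurable lborel" if "cmod v < R" for v
    proof -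
      have "(\<lambda>t. indicator {0..2*pi} t *\<^sub>R u v t) \<in> borel_measurable borel"
        using cont[OF that] by (intro borel_measurable_continuous_on_indicator) auto
      then have "(\<lambda>t. ennreal (indicator {0..2*pi} t *\<^sub>R u v t)) \<in> borel_measurable borel" by measurable
      also have "(\<lambda>t. ennreal (indicator {0..2*pi} t *\<^sub>R u v t)) = (\<lambda>t. ennreal (u v t) * indicator {0..2*pi} t)"
        by (auto simp: fun_eq_iff indicator_def)
      finally show ?thesis by simp
    qed
    have mg: "(\<lambda>t. ennreal (growth p \<Psi> (cmod (f (v * cis t)))) * indicator {0..2*pi} t) \<in> borel_measurable lborel"
      if "cmod v < R" for v
    proof -
      have "(\<lambda>t. v * cis t) \<in> borel_measurable borel"
        by (intro borel_measurable_continuous_onI continuous_intros)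
      from measurable_compose[OF this growth_holomorphic_measurable[OF \<Psi> hol open_ball]]
      have "(\<lambda>t. ennreal (growth p \<Psi> (cmod (f (v * cis t)))) * indicator (ball 0 R) (v * cis t)) \<in> borel_measurable borel" .
      then have "(\<lambda>t. ennreal (growth p \<Psi> (cmod (f (v * cis t))))) \<in> borel_measurable borel"
        using that by (simp add: norm_mult)
      then show ?thesis by measurable
    qed
    have "(\<integral>\<^sup>+t\<in>{0..2*pi}. ennreal (growth p \<Psi> (cmod (f (z * cis t)))) \<partial>lborel)
      \<le> (\<integral>\<^sup>+t. ennreal C * (ennreal (u z t) * indicator {0..2*pi} t) \<partial>lborel)"
      using low C N0 by (intro nn_integral_mono)
        (auto simp: u_def indicator_def ennreal_mult[symmetric] intro!: ennreal_leI)
    also have "\<dots> = ennreal C * ennreal (I z)"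
      using zw bm[of z] by (subst nn_integral_cmult) (auto simp: eqI)
    also have "\<dots> \<le> ennreal C * ennreal (I w)"
      unfolding I_def using p by (intro mult_left_mono ennreal_leI circle_mean_mono[OF N _ hol zw]) auto
    also have "ennreal (I w) = (\<integral>\<^sup>+t\<in>{0..2*pi}. ennreal (u w t) \<partial>lborel)"
      using zw by (simp add: eqI)
    also have "\<dots> \<le> (\<integral>\<^sup>+t. ennreal C * (ennreal (growth p \<Psi> (cmod (f (w * cis t)))) * indicator {0..2*pi} t) \<partial>lborel)"
      using up C growth_nonneg[OF \<Psi>] by (intro nn_integral_mono)
        (auto simp: u_def indicator_def ennreal_mult[symmetric] intro!: ennreal_leI)
    also have "\<dots> = ennreal C * (\<integral>\<^sup>+t\<in>{0..2*pi}. ennreal (growth p \<Psi> (cmod (f (w * cis t)))) \<partial>lborel)"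
      using mg[OF zw(2)] by (intro nn_integral_cmult) auto
    finally show "(\<integral>\<^sup>+t\<in>{0..2*pi}. ennreal (growth p \<Psi> (cmod (f (z * cis t)))) \<partial>lborel)
       \<le> ennreal (C * C) * (\<integral>\<^sup>+t\<in>{0..2*pi}. ennreal (growth p \<Psi> (cmod (f (w * cis t)))) \<partial>lborel)"
      using C by (simp add: ennreal_mult mult.assoc mult_left_mono)
  qed
qed

text \<open>
  The case of radius 0 in \<open>growth_circle_mean\<close>, integrated over the radii.
\<close>

lemma growth_area_submean:
  assumes \<Psi>: "\<Psi> \<in> class_L" and p: "p > 0"
  obtains C where "C \<ge> 1"
    "\<And>f z \<rho>. \<rho> > 0 \<Longrightarrow> f holomorphic_on ball z \<rho> \<Longrightarrow>
      ennreal (growth p \<Psi> (cmod (f z))) * ennreal (pi * \<rho>\<^sup>2)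
       \<le> ennreal C * (\<integral>\<^sup>+w\<in>ball z \<rho>. ennreal (growth p \<Psi> (cmod (f w))) \<partial>lborel)"
proof -
  obtain C where C: "C \<ge> 1" and mean:
    "\<And>f R z w. f holomorphic_on ball 0 R \<Longrightarrow> cmod z \<le> cmod w \<Longrightarrow> cmod w < R \<Longrightarrow>
      (\<integral>\<^sup>+t\<in>{0..2*pi}. ennreal (growth p \<Psi> (cmod (f (z * cis t)))) \<partial>lborel)
       \<le> ennreal C * (\<integral>\<^sup>+t\<in>{0..2*pi}. ennreal (growth p \<Psi> (cmod (f (w * cis t)))) \<partial>lborel)"
    by (rule growth_circle_mean[OF \<Psi> p]) (rule that)
  show ?thesis
  proof (rule that[OF C])
    fix f z and \<rho> :: real assume \<rho>: "\<rho> > 0" and hol: "f holomorphic_on ball z \<rho>"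
    define g where "g w = f (z + w)" for w
    have holg: "g holomorphic_on ball 0 \<rho>"
      unfolding g_def by (intro holomorphic_on_compose_gen[OF _ hol, unfolded o_def] holomorphic_intros)
         (auto simp: dist_norm)
    define U where "U w = ennreal (growth p \<Psi> (cmod (g w))) * indicator (ball 0 \<rho>) w" for w
    have [measurable]: "U \<in> borel_measurable borel"
      unfolding U_def by (intro growth_holomorphic_measurable[OF \<Psi> holg]) auto
    define G where "G = ennreal (growth p \<Psi> (cmod (f z)))"
    have pt: "ennreal (2 * pi) * G * indicator {..<\<rho>} (cmod w) \<le>
        ennreal C * ((\<integral>\<^sup>+t\<in>{0..2*pi}. U (w * cis t) \<partial>lborel) * indicator {..<\<rho>} (cmod w))" for w
    proof (cases "cmod w < \<rho>")
      case True
      have "ennreal (2 * pi) * G = (\<integral>\<^sup>+t. G * indicator {0..2*pi} (t::real) \<partial>lborel)"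
        by (subst nn_integral_cmult_indicator) (auto simp: mult.commute)
      also have "\<dots> = (\<integral>\<^sup>+t\<in>{0..2*pi}. ennreal (growth p \<Psi> (cmod (g (0 * cis t)))) \<partial>lborel)"
        by (simp add: g_def G_def)
      also have "\<dots> \<le> ennreal C * (\<integral>\<^sup>+t\<in>{0..2*pi}. ennreal (growth p \<Psi> (cmod (g (w * cis t)))) \<partial>lborel)"
        using True by (intro mean[OF holg]) auto
      also have "(\<integral>\<^sup>+t\<in>{0..2*pi}. ennreal (growth p \<Psi> (cmod (g (w * cis t)))) \<partial>lborel) = (\<integral>\<^sup>+t\<in>{0..2*pi}. U (w * cis t) \<partial>lborel)"
        using True by (intro nn_integral_cong) (simp add: U_def norm_mult)
      finally show ?thesis using True by simp
    qed auto
    have "ennreal (2 * pi) * (G * ennreal (pi * \<rho>\<^sup>2)) = ennreal (2 * pi) * G * emeasure lborel (ball (0::complex) \<rho>)"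
      using \<rho> by (simp add: emeasure_ball_complex mult_ac)
    also have "\<dots> = (\<integral>\<^sup>+w. ennreal (2 * pi) * G * indicator (ball 0 \<rho>) (w::complex) \<partial>lborel)"
      by (subst nn_integral_cmult_indicator) auto
    also have "\<dots> = (\<integral>\<^sup>+w. ennreal (2 * pi) * G * indicator {..<\<rho>} (cmod w) \<partial>lborel)"
      by (intro nn_integral_cong) (auto simp: indicator_def)
    also have "\<dots> \<le> (\<integral>\<^sup>+w. ennreal C * ((\<integral>\<^sup>+t\<in>{0..2*pi}. U (w * cis t) \<partial>lborel) * indicator {..<\<rho>} (cmod w)) \<partial>lborel)"
      by (intro nn_integral_mono pt)
    also have "\<dots> = ennreal C * (ennreal (2 * pi) * (\<integral>\<^sup>+w. U w * indicator {..<\<rho>} (cmod w) \<partial>lborel))"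
      by (subst nn_integral_cmult) (auto simp: nn_integral_average)
    also have "(\<integral>\<^sup>+w. U w * indicator {..<\<rho>} (cmod w) \<partial>lborel) = (\<integral>\<^sup>+w. U w \<partial>lborel)"
      by (intro nn_integral_cong) (auto simp: U_def indicator_def)
    also have "\<dots> = (\<integral>\<^sup>+w. U (-z + w) \<partial>lborel)"
    proof -
      have "(\<integral>\<^sup>+w. U w \<partial>lborel) = (\<integral>\<^sup>+w. U w \<partial>(distr lborel borel ((+) (-z))))"
        by (simp only: lborel_distr_plus)
      also have "\<dots> = (\<integral>\<^sup>+w. U (-z + w) \<partial>lborel)" by (subst nn_integral_distr) auto
      finally show ?thesis .
    qed
    also have "\<dots> = (\<integral>\<^sup>+w\<in>ball z \<rho>. ennreal (growth p \<Psi> (cmod (f w))) \<partial>lborel)"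
      by (intro nn_integral_cong) (auto simp: U_def g_def indicator_def dist_norm norm_minus_commute)
    finally have "ennreal (2 * pi) * (G * ennreal (pi * \<rho>\<^sup>2)) \<le> ennreal (2 * pi) *
       (ennreal C * (\<integral>\<^sup>+w\<in>ball z \<rho>. ennreal (growth p \<Psi> (cmod (f w))) \<partial>lborel))"
      by (simp add: mult_ac)
    then show "ennreal (growth p \<Psi> (cmod (f z))) * ennreal (pi * \<rho>\<^sup>2)
       \<le> ennreal C * (\<integral>\<^sup>+w\<in>ball z \<rho>. ennreal (growth p \<Psi> (cmod (f w))) \<partial>lborel)"
      unfolding G_def by (subst (asm) ennreal_mult_le_mult_iff) auto
  qed
qed


section \<open>Radial weights\<close>

lemma nn_integral_disc_area:
  fixes u :: "complex \<Rightarrow> ennreal"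
  assumes [measurable]: "u \<in> borel_measurable lebesgue"
  shows "(\<integral>\<^sup>+z. u z \<partial>disc_area) = (\<integral>\<^sup>+z\<in>ball 0 1. u z * ennreal (1 / pi) \<partial>lebesgue)"
proof -
  have [measurable]: "ball (0::complex) 1 \<in> sets lebesgue" by simp
  have "(\<integral>\<^sup>+z. u z \<partial>disc_area) = ennreal (1 / pi) * (\<integral>\<^sup>+z. u z \<partial>(lebesgue_on (ball 0 1)))"
    unfolding disc_area_def by (intro nn_integral_scale_measure measurable_restrict_space1) measurable
  also have "(\<integral>\<^sup>+z. u z \<partial>(lebesgue_on (ball 0 1))) = (\<integral>\<^sup>+z\<in>ball 0 1. u z \<partial>lebesgue)"
    by (intro nn_integral_restrict_space) auto
  also have "ennreal (1 / pi) * \<dots> = (\<integral>\<^sup>+z\<in>ball 0 1. u z * ennreal (1 / pi) \<partial>lebesgue)"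
    by (subst nn_integral_cmult[symmetric]) (measurable, auto simp: mult_ac)
  finally show ?thesis .
qed

text \<open>
  The weight is only Lebesgue measurable, and a statement about almost all points of the
  disc says nothing about a particular radius. Replacing the profile by a Borel function \<open>b\<close>
  that agrees with it almost everywhere gives a density to which the polar formula applies.
  The profile is integrable up to 0: otherwise \<open>weight_hat \<omega> 0\<close> would be 0.
\<close>

lemma radial_weight_density:
  assumes \<omega>: "radial_weight \<omega>"
  obtains b :: "real \<Rightarrow> real" where "b \<in> borel_measurable borel" "\<And>s. b s \<ge> 0"
    "\<And>u. u \<in> borel_measurable borel \<Longrightarrow>
       (\<integral>\<^sup>+z. u z \<partial>weighted_area \<omega>) = (\<integral>\<^sup>+z\<in>ball 0 1. u z * ennreal (b (cmod z) / pi) \<partial>lborel)"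
    "\<And>r. 0 \<le> r \<Longrightarrow> r < 1 \<Longrightarrow> ennreal (weight_hat \<omega> (of_real r)) = (\<integral>\<^sup>+s\<in>{r..<1}. ennreal (b s) \<partial>lborel)"
proof -
  have nonneg: "\<And>z. z \<in> ball 0 1 \<Longrightarrow> \<omega> z \<ge> 0" and int: "integrable disc_area \<omega>"
    and rad: "\<And>z. z \<in> ball 0 1 \<Longrightarrow> \<omega> z = \<omega> (of_real (cmod z))"
    and pos: "\<And>z. z \<in> ball 0 1 \<Longrightarrow> weight_hat \<omega> z > 0"
    using \<omega> unfolding radial_weight_def weight_def radial_def by blast+
  define g where "g s = indicator {0..<1} s *\<^sub>R \<omega> (of_real s)" for s :: real
  have "set_integrable lebesgue {0..<1} (\<lambda>s::real. \<omega> (of_real s))"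
  proof (rule ccontr)
    assume "\<not> ?thesis"
    then have "weight_hat \<omega> 0 = 0"
      unfolding weight_hat_def set_lebesgue_integral_def set_integrable_def
      by (simp add: not_integrable_integral_eq)
    with pos[of 0] show False by simp
  qed
  then have intg: "integrable lebesgue g"
    by (simp add: set_integrable_def g_def[abs_def])
  then have "g \<in> borel_measurable (completion lborel)" by simp
  then obtain b0 where b0: "b0 \<in> borel_measurable lborel" "AE s in lborel. g s = b0 s"
    using completion_ex_borel_measurable_real by blast
  define b where "b s = max 0 (b0 s)" for s
  have bm [measurable]: "b \<in> borel_measurable borel" using b0(1) unfolding b_def by simp
  have g0: "g s \<ge> 0" for s using nonneg[of "of_real s"] by (auto simp: g_def indicator_def)
  have aeb: "AE s in lborel. g s = b s"
    using b0(2)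
  proof eventually_elim
    case (elim s) then show ?case using g0[of s] by (simp add: b_def)
  qed
  show ?thesis
  proof (rule that[of b])
    fix r :: real assume r: "0 \<le> r" "r < 1"
    have "integrable lebesgue (\<lambda>s. indicator {r..<1} s *\<^sub>R g s)"
      using intg by (intro integrable_mult_indicator) auto
    then have "ennreal (\<integral>s. indicator {r..<1} s *\<^sub>R g s \<partial>lebesgue) = (\<integral>\<^sup>+s. ennreal (indicator {r..<1} s *\<^sub>R g s) \<partial>lebesgue)"
      using g0 by (intro nn_integral_eq_integral[symmetric]) auto
    also have "(\<lambda>s. indicator {r..<1} s *\<^sub>R g s) = (\<lambda>s. indicator {r..<1} s *\<^sub>R \<omega> (of_real s))"
      using r by (auto simp: g_def indicator_def fun_eq_iff)
    also have "(\<integral>s. indicator {r..<1} s *\<^sub>R \<omega> (of_real s) \<partial>lebesgue) = weight_hat \<omega> (of_real r)"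
      using r by (simp add: weight_hat_def set_lebesgue_integral_def)
    also have "(\<integral>\<^sup>+s. ennreal (indicator {r..<1} s *\<^sub>R \<omega> (of_real s)) \<partial>lebesgue) = (\<integral>\<^sup>+s. ennreal (b s) * indicator {r..<1} s \<partial>lebesgue)"
      using AE_completion[OF aeb] r by (intro nn_integral_cong_AE) (auto simp: g_def indicator_def elim!: eventually_mono)
    also have "\<dots> = (\<integral>\<^sup>+s. ennreal (b s) * indicator {r..<1} s \<partial>lborel)"
      by (rule nn_integral_completion)
    finally show "ennreal (weight_hat \<omega> (of_real r)) = (\<integral>\<^sup>+s\<in>{r..<1}. ennreal (b s) \<partial>lborel)" .
  next
    fix u :: "complex \<Rightarrow> ennreal" assume u [measurable]: "u \<in> borel_measurable borel"
    have ulb [measurable]: "u \<in> borel_measurable lebesgue"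
      using u by (simp add: measurable_completion)
    have "(\<lambda>z. b (cmod z)) \<in> borel_measurable borel" by measurable
    then have blb [measurable]: "(\<lambda>z::complex. b (cmod z)) \<in> borel_measurable lebesgue"
      by (intro measurable_completion) simp
    obtain S where S: "{s \<in> space lborel. \<not> g s = b s} \<subseteq> S" "emeasure lborel S = 0" "S \<in> sets lborel"
      using AE_E[OF aeb] by blast
    have SB [measurable]: "S \<in> sets borel" using S by simp
    have [measurable]: "(indicator (ball (0::complex) 1) :: complex \<Rightarrow> ennreal) \<in> borel_measurable borel"
      "(\<lambda>z::complex. indicator S (cmod z) :: ennreal) \<in> borel_measurable borel"
      by (simp_all add: borel_measurable_indicator measurable_compose[of cmod borel borel])
    \<comment> \<open>the null set \<open>S\<close> of exceptional radii fills a null set of the disc\<close>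
    have "(\<integral>\<^sup>+z\<in>ball 0 1. indicator S (cmod z) \<partial>(lborel :: complex measure))
        = (\<integral>\<^sup>+s\<in>{0..<1}. indicator S s * ennreal (2 * pi * s) \<partial>lborel)"
      by (rule nn_integral_radial) simp
    also have "\<dots> = 0"
    proof -
      have "AE s in lborel. s \<notin> S" using S by (intro AE_not_in) (auto simp: null_sets_def)
      then show ?thesis
        by (subst nn_integral_0_iff_AE) (auto elim!: eventually_mono)
    qed
    finally have "AE z in (lborel :: complex measure). indicator S (cmod z) * indicator (ball 0 1) z = (0::ennreal)"
      by (subst (asm) nn_integral_0_iff_AE) auto
    then have aew: "AE z in (lborel :: complex measure). z \<in> ball 0 1 \<longrightarrow> \<omega> z = b (cmod z)"
    proof eventually_elim
      case (elim z)
      show ?case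
      proof
        assume z: "z \<in> ball 0 1"
        then have "cmod z \<notin> S" using elim by auto
        then have "g (cmod z) = b (cmod z)" using S(1) by auto
        then show "\<omega> z = b (cmod z)" using rad[OF z] z by (simp add: g_def)
      qed
    qed
    have wm: "\<omega> \<in> borel_measurable disc_area" using int by simp
    have um: "u \<in> borel_measurable disc_area"
      using measurable_restrict_space1[OF ulb] by (simp add: disc_area_def cong: measurable_cong_sets)
    have "(\<integral>\<^sup>+z. u z \<partial>weighted_area \<omega>) = (\<integral>\<^sup>+z. ennreal (\<omega> z) * u z \<partial>disc_area)"
      unfolding weighted_area_def using wm um by (intro nn_integral_density) auto
    also have "\<dots> = (\<integral>\<^sup>+z. ennreal (b (cmod z)) * u z \<partial>disc_area)"
    proof (rule nn_integral_cong_AE)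
      have "AE z in lebesgue_on (ball 0 1). \<omega> z = b (cmod z)"
        using AE_completion[OF aew] by (subst AE_restrict_space_iff) auto
      then have "AE z in disc_area. \<omega> z = b (cmod z)"
        unfolding disc_area_def
        by (auto simp: eventually_ae_filter space_scale_measure null_sets_def)
      then show "AE z in disc_area. ennreal (\<omega> z) * u z = ennreal (b (cmod z)) * u z"
        by eventually_elim simp
    qed
    also have "\<dots> = (\<integral>\<^sup>+z\<in>ball 0 1. (ennreal (b (cmod z)) * u z) * ennreal (1 / pi) \<partial>lebesgue)"
      by (rule nn_integral_disc_area) measurable
    also have "\<dots> = (\<integral>\<^sup>+z\<in>ball 0 1. u z * ennreal (b (cmod z) / pi) \<partial>lebesgue)"
      by (intro nn_integral_cong)
        (auto simp: b_def divide_inverse ennreal_mult mult_ac indicator_def)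
    also have "\<dots> = (\<integral>\<^sup>+z\<in>ball 0 1. u z * ennreal (b (cmod z) / pi) \<partial>lborel)"
      by (rule nn_integral_completion)
    finally show "(\<integral>\<^sup>+z. u z \<partial>weighted_area \<omega>) = (\<integral>\<^sup>+z\<in>ball 0 1. u z * ennreal (b (cmod z) / pi) \<partial>lborel)" .
  qed (auto simp: b_def)
qed

lemma space_weighted_area [simp]: "space (weighted_area \<omega>) = ball 0 1"
  by (simp add: weighted_area_def disc_area_def space_scale_measure)

lemma borel_measurable_weighted_area:
  "u \<in> borel_measurable borel \<Longrightarrow> u \<in> borel_measurable (weighted_area \<omega>)"
proof -
  assume "u \<in> borel_measurable borel"
  then have "u \<in> borel_measurable (lebesgue_on (ball 0 1))"
    by (intro measurable_restrict_space1 measurable_completion) simp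
  then show ?thesis
    by (simp add: weighted_area_def disc_area_def cong: measurable_cong_sets)
qed

lemma weighted_area_average:
  assumes \<omega>: "radial_weight \<omega>" and [measurable]: "u \<in> borel_measurable borel" "k \<in> borel_measurable borel"
  shows "(\<integral>\<^sup>+z. (\<integral>\<^sup>+t\<in>{0..2*pi}. u (z * cis t) \<partial>lborel) * k (cmod z) \<partial>weighted_area \<omega>) =
    ennreal (2 * pi) * (\<integral>\<^sup>+z. u z * k (cmod z) \<partial>weighted_area \<omega>)"
proof -
  obtain b where [measurable]: "b \<in> borel_measurable borel" and
    eq: "\<And>u. u \<in> borel_measurable borel \<Longrightarrow>
       (\<integral>\<^sup>+z. u z \<partial>weighted_area \<omega>) = (\<integral>\<^sup>+z\<in>ball 0 1. u z * ennreal (b (cmod z) / pi) \<partial>lborel)"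
    using radial_weight_density[OF \<omega>] by metis
  define h where "h s = k s * ennreal (b s / pi) * indicator {..<1} s" for s
  have [measurable]: "h \<in> borel_measurable borel" unfolding h_def by measurable
  have ind: "indicator (ball 0 1) z = (indicator {..<1} (cmod z) :: ennreal)" for z :: complex
    by (simp add: indicator_def)
  have "(\<integral>\<^sup>+z. (\<integral>\<^sup>+t\<in>{0..2*pi}. u (z * cis t) \<partial>lborel) * k (cmod z) \<partial>weighted_area \<omega>)
    = (\<integral>\<^sup>+z. (\<integral>\<^sup>+t\<in>{0..2*pi}. u (z * cis t) \<partial>lborel) * h (cmod z) \<partial>lborel)"
    by (subst eq) (auto simp: h_def ind mult_ac)
  also have "\<dots> = ennreal (2 * pi) * (\<integral>\<^sup>+z. u z * h (cmod z) \<partial>lborel)"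
    by (rule nn_integral_average) measurable
  also have "(\<integral>\<^sup>+z. u z * h (cmod z) \<partial>lborel) = (\<integral>\<^sup>+z. u z * k (cmod z) \<partial>weighted_area \<omega>)"
    by (subst eq) (auto simp: h_def ind mult_ac)
  finally show ?thesis .
qed

text \<open>
  In polar coordinates \<open>\<omega> dA\<close> becomes \<open>2s \<omega>(s) ds\<close>. The factor \<open>2s\<close> is at most 2, and at least 1
  for \<open>s \<ge> 1/2\<close>; this is why the lower bound is restricted to \<open>r \<ge> 1/2\<close>.
\<close>

lemma weighted_area_radial:
  assumes \<omega>: "radial_weight \<omega>"
  shows "0 \<le> r \<Longrightarrow> r < 1 \<Longrightarrow> (\<integral>\<^sup>+z. indicator {r..} (cmod z) \<partial>weighted_area \<omega>) \<le> ennreal (2 * weight_hat \<omega> (of_real r))"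
    and "1/2 \<le> r \<Longrightarrow> r < s \<Longrightarrow> s < 1 \<Longrightarrow>
     ennreal (weight_hat \<omega> (of_real r)) \<le> (\<integral>\<^sup>+z. indicator {r..<s} (cmod z) \<partial>weighted_area \<omega>) + ennreal (weight_hat \<omega> (of_real s))"
    and "0 \<le> r \<Longrightarrow> r \<le> s \<Longrightarrow> s < 1 \<Longrightarrow> weight_hat \<omega> (of_real s) \<le> weight_hat \<omega> (of_real r)"
proof -
  obtain b where bm [measurable]: "b \<in> borel_measurable borel" and b0: "\<And>s. b s \<ge> 0" and
    eq: "\<And>u. u \<in> borel_measurable borel \<Longrightarrow>
       (\<integral>\<^sup>+z. u z \<partial>weighted_area \<omega>) = (\<integral>\<^sup>+z\<in>ball 0 1. u z * ennreal (b (cmod z) / pi) \<partial>lborel)" and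
    W: "\<And>r. 0 \<le> r \<Longrightarrow> r < 1 \<Longrightarrow> ennreal (weight_hat \<omega> (of_real r)) = (\<integral>\<^sup>+s\<in>{r..<1}. ennreal (b s) \<partial>lborel)"
    by (rule radial_weight_density[OF \<omega>]) (rule that)
  have Wpos: "0 < weight_hat \<omega> (of_real r)" if "0 \<le> r" "r < 1" for r
    using \<omega> that by (auto simp: radial_weight_def)
  have key: "(\<integral>\<^sup>+z. k (cmod z) \<partial>weighted_area \<omega>) = (\<integral>\<^sup>+s\<in>{0..<1}. k s * ennreal (b s) * ennreal (2 * s) \<partial>lborel)"
    if [measurable]: "k \<in> borel_measurable borel" for k
  proof -
    have "(\<integral>\<^sup>+z. k (cmod z) \<partial>weighted_area \<omega>) = (\<integral>\<^sup>+z\<in>ball 0 1. k (cmod z) * ennreal (b (cmod z) / pi) \<partial>lborel)"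
      by (rule eq) measurable
    also have "\<dots> = (\<integral>\<^sup>+s\<in>{0..<1}. k s * ennreal (b s / pi) * ennreal (2 * pi * s) \<partial>lborel)"
      by (rule nn_integral_radial) measurable
    also have "\<dots> = (\<integral>\<^sup>+s\<in>{0..<1}. k s * ennreal (b s) * ennreal (2 * s) \<partial>lborel)"
      using b0 by (intro nn_integral_cong) (auto simp: indicator_def ennreal_mult[symmetric] mult.assoc)
    finally show ?thesis .
  qed
  {
    assume r: "0 \<le> r" "r < 1"
    have "(\<integral>\<^sup>+z. indicator {r..} (cmod z) \<partial>weighted_area \<omega>) =
        (\<integral>\<^sup>+s\<in>{0..<1}. indicator {r..} s * ennreal (b s) * ennreal (2 * s) \<partial>lborel)"
      by (rule key) simp
    also have "\<dots> \<le> (\<integral>\<^sup>+s. 2 * (ennreal (b s) * indicator {r..<1} s) \<partial>lborel)"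
      using r b0 by (intro nn_integral_mono)
        (auto simp: indicator_def ennreal_mult[symmetric] mult_left_le_one_le mult.commute
           simp flip: ennreal_numeral intro!: ennreal_leI mult_left_mono)
    also have "\<dots> = 2 * ennreal (weight_hat \<omega> (of_real r))"
      by (subst nn_integral_cmult) (auto simp: W[OF r])
    finally show "(\<integral>\<^sup>+z. indicator {r..} (cmod z) \<partial>weighted_area \<omega>) \<le> ennreal (2 * weight_hat \<omega> (of_real r))"
      by (simp add: ennreal_mult')
  }
  {
    assume r: "1/2 \<le> r" "r < s" "s < 1"
    have "ennreal (weight_hat \<omega> (of_real r)) = (\<integral>\<^sup>+x\<in>{r..<1}. ennreal (b x) \<partial>lborel)"
      using r by (intro W) auto
    also have "\<dots> \<le> (\<integral>\<^sup>+x. indicator {r..<s} x * ennreal (b x) * ennreal (2 * x) * indicator {0..<1} x + ennreal (b x) * indicator {s..<1} x \<partial>lborel)"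
    proof (rule nn_integral_mono)
      fix x :: real
      show "ennreal (b x) * indicator {r..<1} x \<le> indicator {r..<s} x * ennreal (b x) * ennreal (2 * x) * indicator {0..<1} x + ennreal (b x) * indicator {s..<1} x"
        using r b0[of x] mult_left_mono[of 1 "2 * x" "b x"]
        by (auto simp: indicator_def ennreal_mult[symmetric] intro!: ennreal_leI)
    qed
    also have "\<dots> = (\<integral>\<^sup>+x\<in>{0..<1}. indicator {r..<s} x * ennreal (b x) * ennreal (2 * x) \<partial>lborel) + (\<integral>\<^sup>+x\<in>{s..<1}. ennreal (b x) \<partial>lborel)"
      by (rule nn_integral_add) measurable
    also have "(\<integral>\<^sup>+x\<in>{0..<1}. indicator {r..<s} x * ennreal (b x) * ennreal (2 * x) \<partial>lborel) = (\<integral>\<^sup>+z. indicator {r..<s} (cmod z) \<partial>weighted_area \<omega>)"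
      by (rule key[symmetric]) simp
    also have "(\<integral>\<^sup>+x\<in>{s..<1}. ennreal (b x) \<partial>lborel) = ennreal (weight_hat \<omega> (of_real s))"
      using r by (intro W[symmetric]) auto
    finally show "ennreal (weight_hat \<omega> (of_real r)) \<le> (\<integral>\<^sup>+z. indicator {r..<s} (cmod z) \<partial>weighted_area \<omega>) + ennreal (weight_hat \<omega> (of_real s))" .
  }
  {
    assume r: "0 \<le> r" "r \<le> s" "s < 1"
    have "ennreal (weight_hat \<omega> (of_real s)) \<le> ennreal (weight_hat \<omega> (of_real r))"
      using r by (simp add: W, intro nn_integral_mono) (auto simp: indicator_def)
    then show "weight_hat \<omega> (of_real s) \<le> weight_hat \<omega> (of_real r)"
      using Wpos[of r] r by (subst (asm) ennreal_le_iff) auto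
  }
qed


section \<open>Carleson squares and dyadic annuli\<close>

lemma one_minus_cos_bounds:
  fixes x :: real
  shows "1 - cos x \<le> x\<^sup>2 / 2" and "\<bar>x\<bar> \<le> 1 \<Longrightarrow> x\<^sup>2 / 4 \<le> 1 - cos x"
proof -
  have dbl: "1 - cos x = 2 * (sin (x / 2))\<^sup>2"
    using cos_double_sin[of "x / 2"] by simp
  have "(sin (x / 2))\<^sup>2 \<le> (x / 2)\<^sup>2"
    using abs_sin_x_le_abs_x[of "x/2"] by (simp only: abs_le_square_iff)
  then show "1 - cos x \<le> x\<^sup>2 / 2" by (simp add: dbl power_divide)
  assume x: "\<bar>x\<bar> \<le> 1"
  define y where "y = \<bar>x\<bar> / 2"
  have y: "0 \<le> y" "y \<le> 1/2" using x by (auto simp: y_def)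
  have "\<bar>sin y - y\<bar> \<le> y ^ 3 / 6"
    using Maclaurin_sin_bound[of y 3] y(1)
    by (simp add: eval_nat_numeral sin_coeff_def field_simps)
  moreover have "y ^ 3 \<le> y / 4"
    using y mult_left_mono[OF power_mono[OF y(2,1), of 2] y(1)]
    by (simp add: eval_nat_numeral power2_eq_square)
  ultimately have s: "sin y \<ge> 3/4 * y" using y by linarith
  have "(3/4 * y)\<^sup>2 \<le> (sin y)\<^sup>2" using s y by (intro power_mono) auto
  also have "(sin y)\<^sup>2 = (sin (x/2))\<^sup>2" by (auto simp: y_def abs_if)
  finally have "9 / 16 * (x\<^sup>2 / 4) \<le> (sin (x/2))\<^sup>2" by (simp add: y_def power_mult_distrib power_divide)
  moreover have "0 \<le> x\<^sup>2" by simp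
  ultimately show "x\<^sup>2 / 4 \<le> 1 - cos x" unfolding dbl by linarith
qed

text \<open>
  Distances of angles modulo \<open>2\<pi>\<close> are compared through the cosine, which removes the integer
  shift.
\<close>

lemma ex_shift_abs_less_iff:
  assumes d: "0 < d" "d < pi"
  shows "(\<exists>k::int. \<bar>x + 2 * pi * of_int k\<bar> < d) \<longleftrightarrow> cos x > cos d"
proof
  have per: "cos (x + 2 * pi * of_int k) = cos x" for k :: int
    by (simp add: cos_add cos_int_2pin[unfolded mult.assoc] sin_int_2pin[unfolded mult.assoc] mult.assoc)
  assume "\<exists>k::int. \<bar>x + 2 * pi * of_int k\<bar> < d"
  then obtain k :: int where k: "\<bar>x + 2 * pi * of_int k\<bar> < d" by blast
  have "cos d < cos \<bar>x + 2 * pi * of_int k\<bar>" using d k by (intro cos_monotone_0_pi) auto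
  also have "\<dots> = cos x" by (simp only: cos_abs_real per)
  finally show "cos x > cos d" .
next
  assume c: "cos x > cos d"
  define k where "k = - round (x / (2 * pi))"
  define y where "y = x + 2 * pi * of_int k"
  have "\<bar>of_int (round (x / (2 * pi))) - x / (2 * pi)\<bar> \<le> 1 / 2" by (rule of_int_round_abs_le)
  then have "2 * pi * \<bar>of_int (round (x / (2 * pi))) - x / (2 * pi)\<bar> \<le> 2 * pi * (1 / 2)"
    by (intro mult_left_mono) auto
  also have "2 * pi * \<bar>of_int (round (x / (2 * pi))) - x / (2 * pi)\<bar> = \<bar>y\<bar>"
  proof -
    have "2 * pi * (of_int (round (x / (2 * pi))) - x / (2 * pi)) = - y"
      by (simp add: y_def k_def field_simps)
    then show ?thesis by (metis abs_minus_cancel abs_mult abs_of_pos mult_pos_pos pi_gt_zero zero_less_numeral)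
  qed
  finally have y: "\<bar>y\<bar> \<le> pi" by simp
  have "cos \<bar>y\<bar> = cos x"
    unfolding y_def by (simp only: cos_abs_real cos_add cos_int_2pin sin_int_2pin mult_1_right mult_zero_right diff_0_right)
  with c have "cos \<bar>y\<bar> > cos d" by simp
  then have "\<bar>y\<bar> < d" using y d by (subst (asm) cos_mono_less_eq) auto
  then show "\<exists>k::int. \<bar>x + 2 * pi * of_int k\<bar> < d" unfolding y_def by blast
qed

text \<open>
  A description without arguments: \<open>Re (z * cnj a)\<close> is \<open>|z| |a|\<close> times the cosine of the angle
  between \<open>z\<close> and \<open>a\<close>.
\<close>

lemma carleson_square_eq:
  assumes a: "a \<noteq> 0" "cmod a < 1"
  shows "carleson_square a =
    {z. cmod a \<le> cmod z \<and> cmod z < 1 \<and> cmod z * cmod a * cos ((1 - cmod a) / 2) < Re (z * cnj a)}"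
proof -
  have "(\<exists>k::int. \<bar>Arg a - Arg z + 2 * pi * of_int k\<bar> < (1 - cmod a) / 2) \<longleftrightarrow>
      cmod z * cmod a * cos ((1 - cmod a) / 2) < Re (z * cnj a)" if z: "z \<noteq> 0" for z
  proof -
    have "z * cnj a = rcis (cmod z) (Arg z) * cnj (rcis (cmod a) (Arg a))"
      using a z by (simp add: rcis_cmod_Arg)
    also have "\<dots> = rcis (cmod z * cmod a) (Arg z - Arg a)"
      by (simp add: rcis_def cis_cnj cis_mult mult_ac)
    finally have "Re (z * cnj a) = cmod z * cmod a * cos (Arg a - Arg z)"
      by (simp add: cos_diff)
    moreover have "cmod z * cmod a > 0" using a z by simp
    ultimately have "cmod z * cmod a * cos ((1 - cmod a) / 2) < Re (z * cnj a) \<longleftrightarrow>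
        cos ((1 - cmod a) / 2) < cos (Arg a - Arg z)"
      by (simp only: mult_less_cancel_left_pos)
    moreover have "(1 - cmod a) / 2 < pi"
      using pi_gt3 by (intro le_less_trans[of "(1 - cmod a) / 2" "1 / 2" pi]) auto
    ultimately show ?thesis using a by (subst ex_shift_abs_less_iff) auto
  qed
  note * = this
  have "carleson_square a = {z. cmod a \<le> cmod z \<and> cmod z < 1 \<and>
      (\<exists>k::int. \<bar>Arg a - Arg z + 2 * pi * of_int k\<bar> < (1 - cmod a) / 2)}"
    using a by (auto simp: carleson_square_def)
  also have "\<dots> = {z. cmod a \<le> cmod z \<and> cmod z < 1 \<and> cmod z * cmod a * cos ((1 - cmod a) / 2) < Re (z * cnj a)}"
    by (rule Collect_cong) (metis * a(1) norm_le_zero_iff norm_zero)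
  finally show ?thesis .
qed

lemma carleson_square_borel [measurable]: "carleson_square a \<in> sets borel"
proof -
  consider "a = 0" | "a \<noteq> 0" "cmod a < 1" | "a \<noteq> 0" "cmod a \<ge> 1" by linarith
  then show ?thesis
  proof cases
    case 2
    have "closed {z. cmod a \<le> cmod z}" by (intro closed_Collect_le continuous_intros)
    moreover have "open {z. cmod z < 1}" by (intro open_Collect_less continuous_intros)
    moreover have "open {z. cmod z * cmod a * cos ((1 - cmod a) / 2) < Re (z * cnj a)}"
      by (intro open_Collect_less continuous_intros)
    ultimately have "{z. cmod a \<le> cmod z} \<inter> ({z. cmod z < 1} \<inter>
        {z. cmod z * cmod a * cos ((1 - cmod a) / 2) < Re (z * cnj a)}) \<in> sets borel"
      by (intro sets.Int borel_open borel_closed) auto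
    also have "{z. cmod a \<le> cmod z} \<inter> ({z. cmod z < 1} \<inter>
        {z. cmod z * cmod a * cos ((1 - cmod a) / 2) < Re (z * cnj a)}) = carleson_square a"
      using carleson_square_eq[OF 2] by auto
    finally show ?thesis .
  next
    case 3
    then have "carleson_square a = {}" by (auto simp: carleson_square_def)
    then show ?thesis by simp
  qed (auto simp: carleson_square_def)
qed

lemma carleson_square_subset: "carleson_square a \<subseteq> ball 0 1"
  by (auto simp: carleson_square_def)

definition dyadic_radius :: "nat \<Rightarrow> real" where
  "dyadic_radius j = 1 - (1 / 2) ^ j"

lemma dyadic_radius_0 [simp]: "dyadic_radius 0 = 0"
  by (simp add: dyadic_radius_def)

lemma dyadic_radius_bounds: "0 \<le> dyadic_radius j" "dyadic_radius j < 1"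
  by (auto simp: dyadic_radius_def power_le_one)

lemma dyadic_radius_ge_half: "j \<ge> 1 \<Longrightarrow> dyadic_radius j \<ge> 1 / 2"
  using power_decreasing[of 1 j "1/2::real"] by (simp add: dyadic_radius_def)

lemma dyadic_radius_mono: "i \<le> j \<Longrightarrow> dyadic_radius i \<le> dyadic_radius j"
  by (simp add: dyadic_radius_def power_decreasing)

lemma dyadic_radius_strict_mono: "i < j \<Longrightarrow> dyadic_radius i < dyadic_radius j"
  by (simp add: dyadic_radius_def power_strict_decreasing)

lemma dyadic_radius_ex:
  assumes "0 \<le> r" "r < 1"
  obtains j where "dyadic_radius j \<le> r" "r < dyadic_radius (Suc j)"
proof -
  obtain n where n: "(1 / 2) ^ n < 1 - r" using real_arch_pow_inv[of "1 - r" "1 / 2"] assms by auto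
  define n0 where "n0 = (LEAST n. r < dyadic_radius n)"
  have ex: "r < dyadic_radius n" using n by (simp add: dyadic_radius_def)
  have n0: "r < dyadic_radius n0" unfolding n0_def by (rule LeastI[of _ n]) (rule ex)
  then have "n0 \<noteq> 0" using assms by (intro notI) simp
  then obtain j where j: "n0 = Suc j" using not0_implies_Suc by blast
  have "\<not> r < dyadic_radius j" using not_less_Least[of j "\<lambda>n. r < dyadic_radius n"] j by (simp add: n0_def)
  then show ?thesis using that[of j] n0 j by auto
qed

text \<open>
  Points of the dyadic annulus that are close to \<open>w\<close> all lie in one Carleson square that
  depends only on \<open>w\<close>. This makes coverings by squares unnecessary: the inner integral in
  \<open>carleson_covering\<close> is bounded by the mass of this square. For \<open>j = 0\<close> the radius is 0 and the
  square is the whole disc, whatever the value of \<open>sgn w\<close> is.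
\<close>

lemma near_point_in_carleson_square:
  assumes z: "dyadic_radius j \<le> cmod z" "cmod z < 1" and zw: "cmod (z - w) < (1 / 2) ^ j / 16"
  shows "z \<in> carleson_square (of_real (dyadic_radius j) * sgn w)"
    and "cmod (of_real (dyadic_radius j) * sgn w) = dyadic_radius j"
proof -
  have "z \<in> carleson_square (of_real (dyadic_radius j) * sgn w) \<and>
      cmod (of_real (dyadic_radius j) * sgn w) = dyadic_radius j"
  proof (cases "j = 0")
    case True
    then show ?thesis using z by (simp add: carleson_square_def)
  next
    case False
    define h :: real where "h = (1 / 2) ^ j"
    have h: "0 < h" "h \<le> 1 / 2" using power_decreasing[of 1 j "1/2::real"] False by (auto simp: h_def)
    define r where "r = dyadic_radius j"
    have r: "r = 1 - h" by (simp add: r_def h_def dyadic_radius_def)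
    have zr: "cmod z \<ge> 1 / 2" using z(1) h by (simp add: r_def[symmetric] r)
    have wr: "cmod w \<ge> 7 / 16"
      using zr zw h norm_triangle_sub[of z w] by (simp add: h_def[symmetric])
    then have w0: "w \<noteq> 0" by auto
    define a where "a = of_real r * sgn w"
    have "r \<ge> 0" using h r by simp
    then have ca: "cmod a = r" using w0 by (simp add: a_def norm_mult norm_sgn)
    have a0: "a \<noteq> 0" using ca h r by auto
    have "z \<in> carleson_square a"
    proof (subst carleson_square_eq)
      have "2 * Re (z * cnj w) = (cmod z)\<^sup>2 + (cmod w)\<^sup>2 - (cmod (z - w))\<^sup>2"
        unfolding cmod_power2 by (simp add: power2_eq_square algebra_simps)
      moreover have "(cmod z)\<^sup>2 + (cmod w)\<^sup>2 \<ge> 2 * (cmod z * cmod w)"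
        using sum_squares_bound[of "cmod z" "cmod w"] by simp
      moreover have "(cmod (z - w))\<^sup>2 < (h / 16)\<^sup>2"
        using zw by (intro power_strict_mono) (auto simp: h_def)
      moreover define X where "X = cmod z * cmod w * (1 - cos (h / 2))"
      moreover have "(h / 16)\<^sup>2 \<le> 2 * X"
      proof -
        have "(h / 2)\<^sup>2 / 4 \<le> 1 - cos (h / 2)" using h by (intro one_minus_cos_bounds) auto
        then have "(1/2 * (7/16)) * ((h / 2)\<^sup>2 / 4) \<le> X"
          unfolding X_def using zr wr by (intro mult_mono) auto
        then have "7 * h\<^sup>2 \<le> 512 * X" by (simp add: power_divide)
        moreover have "h\<^sup>2 \<ge> 0" by simp
        ultimately have "h\<^sup>2 \<le> 512 * X" by linarith
        then show ?thesis by (simp add: power_divide)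
      qed
      ultimately have "cmod z * cmod w * cos (h / 2) < Re (z * cnj w)"
        by (simp add: algebra_simps)
      then have "r / cmod w * (cmod z * cmod w * cos (h / 2)) < r / cmod w * Re (z * cnj w)"
        using w0 h r by (intro mult_strict_left_mono) auto
      also have "r / cmod w * Re (z * cnj w) = Re (z * cnj a)"
        by (simp add: a_def sgn_div_norm field_simps)
      also have "r / cmod w * (cmod z * cmod w * cos (h / 2)) = cmod z * r * cos (h / 2)"
        using w0 by simp
      finally show "z \<in> {z. cmod a \<le> cmod z \<and> cmod z < 1 \<and> cmod z * cmod a * cos ((1 - cmod a) / 2) < Re (z * cnj a)}"
        using z ca by (simp add: r r_def[symmetric])
    qed (use a0 ca h r in auto)
    then show ?thesis using ca by (simp add: a_def r_def)
  qed
  then show "z \<in> carleson_square (of_real (dyadic_radius j) * sgn w)"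
    "cmod (of_real (dyadic_radius j) * sgn w) = dyadic_radius j" by auto
qed

lemma carleson_square_weighted_sets: "carleson_square a \<in> sets (weighted_area \<omega>)"
proof -
  have "carleson_square a \<in> sets (lebesgue_on (ball 0 1))"
    using carleson_square_subset carleson_square_borel
    by (auto simp: sets_restrict_space image_iff intro!: bexI[of _ "carleson_square a"])
  then show ?thesis by (simp add: weighted_area_def disc_area_def)
qed

text \<open>
  Every circle of radius at least \<open>|a|\<close> meets the square in an arc of angular length at least
  \<open>(1 - |a|) / 2\<close>; the claim follows by averaging over rotations.
\<close>

lemma weighted_area_carleson_square_ge:
  assumes \<omega>: "radial_weight \<omega>" and a: "a \<noteq> 0" "cmod a < 1"
  shows "ennreal ((1 - cmod a) / 2) * (\<integral>\<^sup>+z. indicator {cmod a..} (cmod z) \<partial>weighted_area \<omega>)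
    \<le> ennreal (2 * pi) * emeasure (weighted_area \<omega>) (carleson_square a)"
proof -
  define d where "d = (1 - cmod a) / 2"
  have "0 < d" "d < 1" using a by (auto simp: d_def intro: less_le_trans[OF _ norm_ge_zero])
  then have d: "0 < d" "d < pi" "d < 1" using pi_gt3 by auto
  have low: "ennreal d \<le> (\<integral>\<^sup>+t\<in>{0..2*pi}. indicator (carleson_square a) (z * cis t) \<partial>lborel)"
    if z: "cmod a \<le> cmod z" "cmod z < 1" for z
  proof -
    define s where "s = Arg2pi (a / z)"
    have z0: "z \<noteq> 0" using z a by auto
    have s: "0 \<le> s" "s < 2 * pi" by (auto simp: s_def Arg2pi_ge_0 Arg2pi_lt_2pi)
    have "a / z = of_real (cmod (a / z)) * exp (\<i> * of_real s)"
      unfolding s_def by (rule Arg2pi_eq)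
    then have az: "a = z * of_real (cmod a / cmod z) * cis s"
      using z0 by (simp add: cis_conv_exp norm_divide field_simps)
    have mem: "z * cis t \<in> carleson_square a" if t: "\<bar>t - s\<bar> < d" for t
    proof (subst carleson_square_eq[OF a])
      have "z * cis t * cnj a = (z * cnj z) * of_real (cmod a / cmod z) * (cis t * cnj (cis s))"
        by (subst az) (simp add: mult_ac)
      also have "cis t * cnj (cis s) = cis (t - s)" by (simp add: cis_cnj cis_mult)
      also have "z * cnj z * of_real (cmod a / cmod z) = of_real (cmod z * cmod a)"
        using z0 by (simp add: complex_norm_square[symmetric] power2_eq_square)
      finally have "Re (z * cis t * cnj a) = cmod z * cmod a * cos \<bar>t - s\<bar>" by simp
      moreover have "cos d < cos \<bar>t - s\<bar>" using t d by (intro cos_monotone_0_pi) auto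
      then have "cmod z * cmod a * cos d < cmod z * cmod a * cos \<bar>t - s\<bar>"
        using z0 a by (intro mult_strict_left_mono) auto
      ultimately show "z * cis t \<in> {z. cmod a \<le> cmod z \<and> cmod z < 1 \<and> cmod z * cmod a * cos ((1 - cmod a) / 2) < Re (z * cnj a)}"
        using z by (simp add: norm_mult d_def)
    qed
    \<comment> \<open>\<open>t\<close> runs through \<open>{0..2*pi}\<close> without wrapping around, so only one half of the arc around \<open>s\<close>
      is kept\<close>
    define T where "T = (if s \<le> pi then {s..<s+d} else {s-d<..s})"
    have "ennreal d = emeasure lborel T" using d by (auto simp: T_def)
    also have "\<dots> = (\<integral>\<^sup>+t. indicator T t \<partial>lborel)" by (auto simp: T_def)
    also have "\<dots> \<le> (\<integral>\<^sup>+t\<in>{0..2*pi}. indicator (carleson_square a) (z * cis t) \<partial>lborel)"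
      using mem s d by (intro nn_integral_mono) (auto simp: T_def indicator_def)
    finally show ?thesis .
  qed
  have "ennreal d * (\<integral>\<^sup>+z. indicator {cmod a..} (cmod z) \<partial>weighted_area \<omega>) =
      (\<integral>\<^sup>+z. ennreal d * indicator {cmod a..} (cmod z) \<partial>weighted_area \<omega>)"
    by (intro nn_integral_cmult[symmetric] borel_measurable_weighted_area) measurable
  also have "\<dots> \<le> (\<integral>\<^sup>+z. (\<integral>\<^sup>+t\<in>{0..2*pi}. indicator (carleson_square a) (z * cis t) \<partial>lborel) * indicator {cmod a..} (cmod z) \<partial>weighted_area \<omega>)"
    using low by (intro nn_integral_mono) (auto simp: indicator_def)
  also have "\<dots> = ennreal (2 * pi) * (\<integral>\<^sup>+z. indicator (carleson_square a) z * indicator {cmod a..} (cmod z) \<partial>weighted_area \<omega>)"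
    by (rule weighted_area_average[OF \<omega>]) auto
  also have "(\<integral>\<^sup>+z. indicator (carleson_square a) z * indicator {cmod a..} (cmod z) \<partial>weighted_area \<omega>) = (\<integral>\<^sup>+z. indicator (carleson_square a) z \<partial>weighted_area \<omega>)"
    using a by (intro nn_integral_cong) (auto simp: indicator_def carleson_square_def)
  also have "\<dots> = emeasure (weighted_area \<omega>) (carleson_square a)"
    by (rule nn_integral_indicator[OF carleson_square_weighted_sets])
  finally show ?thesis by (simp add: d_def)
qed

definition dyadic_tail :: "(complex \<Rightarrow> real) \<Rightarrow> nat \<Rightarrow> real" where
  "dyadic_tail \<omega> j = weight_hat \<omega> (of_real (dyadic_radius j))"

lemma class_D_radial: "\<omega> \<in> class_D \<Longrightarrow> radial_weight \<omega>"
  by (simp add: class_D_def class_D_hat_def)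

lemma dyadic_tail_pos: "\<omega> \<in> class_D \<Longrightarrow> dyadic_tail \<omega> j > 0"
  using class_D_radial[of \<omega>] dyadic_radius_bounds[of j]
  by (auto simp: dyadic_tail_def radial_weight_def)

lemma dyadic_tail_mono: "\<omega> \<in> class_D \<Longrightarrow> i \<le> j \<Longrightarrow> dyadic_tail \<omega> j \<le> dyadic_tail \<omega> i"
  unfolding dyadic_tail_def
  by (intro weighted_area_radial(3) class_D_radial dyadic_radius_mono dyadic_radius_bounds)

text \<open>
  The doubling conditions in the only form that is used: tails at consecutive dyadic radii
  are comparable, and \<open>m\<close> steps decrease the tail by a definite factor.
\<close>

lemma class_D_dyadic:
  assumes \<omega>: "\<omega> \<in> class_D"
  obtains C \<kappa> :: real and m :: nat where "C \<ge> 1" "\<kappa> > 1" "m \<ge> 1"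
    "\<And>j. dyadic_tail \<omega> j \<le> C * dyadic_tail \<omega> (Suc j)"
    "\<And>j. \<kappa> * dyadic_tail \<omega> (j + m) \<le> dyadic_tail \<omega> j"
proof -
  obtain C where C: "C \<ge> 1" "\<And>r::real. 0 \<le> r \<Longrightarrow> r < 1 \<Longrightarrow>
        weight_hat \<omega> (of_real r) \<le> C * weight_hat \<omega> (of_real ((1 + r) / 2))"
    using \<omega> by (auto simp: class_D_def class_D_hat_def)
  obtain K \<kappa> where K: "K > 1" "\<kappa> > 1" "\<And>r::real. 0 \<le> r \<Longrightarrow> r < 1 \<Longrightarrow>
        weight_hat \<omega> (of_real r) \<ge> \<kappa> * weight_hat \<omega> (of_real (1 - (1 - r) / K))"
    using \<omega> unfolding class_D_def class_D_check_def by blast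
  obtain m0 :: nat where m0: "K < 2 ^ m0" using real_arch_pow[of 2 K] by auto
  define m where "m = Suc m0"
  have "K < 2 ^ m" using m0 K by (simp add: m_def)
  show ?thesis
  proof (rule that[OF C(1) K(2), of m])
    fix j
    have "(1 + dyadic_radius j) / 2 = dyadic_radius (Suc j)" by (simp add: dyadic_radius_def field_simps)
    then show "dyadic_tail \<omega> j \<le> C * dyadic_tail \<omega> (Suc j)"
      using C(2)[OF dyadic_radius_bounds, of j] unfolding dyadic_tail_def by metis
    have le: "1 - (1 - dyadic_radius j) / K \<le> dyadic_radius (j + m)"
    proof -
      have "(1/2::real) ^ (j + m) = (1/2) ^ j / 2 ^ m" by (simp add: power_add power_divide)
      also have "\<dots> \<le> (1/2) ^ j / K" using \<open>K < 2 ^ m\<close> K(1) by (intro divide_left_mono) auto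
      finally show ?thesis by (simp add: dyadic_radius_def)
    qed
    have "0 \<le> 1 - (1 - dyadic_radius j) / K"
      using K(1) dyadic_radius_bounds[of j] by (simp add: field_simps)
    then have "dyadic_tail \<omega> (j + m) \<le> weight_hat \<omega> (of_real (1 - (1 - dyadic_radius j) / K))"
      unfolding dyadic_tail_def using le dyadic_radius_bounds
      by (intro weighted_area_radial(3) class_D_radial \<omega>) auto
    then have "\<kappa> * dyadic_tail \<omega> (j + m) \<le> \<kappa> * weight_hat \<omega> (of_real (1 - (1 - dyadic_radius j) / K))"
      using K(2) by (intro mult_left_mono) auto
    also have "\<dots> \<le> dyadic_tail \<omega> j" unfolding dyadic_tail_def by (intro K(3) dyadic_radius_bounds)
    finally show "\<kappa> * dyadic_tail \<omega> (j + m) \<le> dyadic_tail \<omega> j" .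
  qed (auto simp: m_def)
qed


section \<open>Integrals over dyadic annuli\<close>

lemma nn_integral_radial_band_le:
  fixes a b :: real
  assumes "a \<le> b" "b < 1"
  shows "(\<integral>\<^sup>+z. indicator {a..<b} (cmod z) \<partial>lborel) \<le> ennreal (2 * pi * (b - a))"
proof -
  have "(\<integral>\<^sup>+z. indicator {a..<b} (cmod z) \<partial>lborel) = (\<integral>\<^sup>+z\<in>ball 0 1. indicator {a..<b} (cmod z) \<partial>(lborel :: complex measure))"
    using assms by (intro nn_integral_cong) (auto simp: indicator_def)
  also have "\<dots> = (\<integral>\<^sup>+s\<in>{0..<1}. indicator {a..<b} s * ennreal (2 * pi * s) \<partial>lborel)"
    by (rule nn_integral_radial) simp
  also have "\<dots> \<le> (\<integral>\<^sup>+s. ennreal (2 * pi) * indicator {a..<b} s \<partial>lborel)"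
    by (intro nn_integral_mono) (auto simp: indicator_def intro!: ennreal_leI)
  also have "\<dots> = ennreal (2 * pi) * emeasure lborel {a..<b}"
    by (rule nn_integral_cmult_indicator) simp
  also have "\<dots> = ennreal (2 * pi * (b - a))" using assms by (simp add: ennreal_mult)
  finally show ?thesis .
qed

text \<open>
  The weight may vanish on the band on the left, whose area is at most a multiple of \<open>2\<^sup>-\<^sup>j\<close>. By
  \<open>growth_circle_mean\<close> all circle means over the band are, up to a constant, at most the one
  of radius \<open>r\<^sub>j\<^sub>+\<^sub>2\<close>, and this is at most those over the annulus on the right. The latter has
  \<open>\<omega>\<close>-mass comparable to the tail at \<open>r\<^sub>j\<close>, because over \<open>m\<close> steps the tail drops by the factor \<open>\<kappa>\<close>.
\<close>

lemma annulus_transfer: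
  assumes \<omega>: "\<omega> \<in> class_D" and \<Psi>: "\<Psi> \<in> class_L" and p: "p > 0"
  obtains C :: real and m :: nat where "C \<ge> 1"
    "\<And>f j. f holomorphic_on ball 0 1 \<Longrightarrow>
       ennreal (2 ^ j * dyadic_tail \<omega> j) * (\<integral>\<^sup>+z. ennreal (growth p \<Psi> (cmod (f z))) * indicator (ball 0 1) z *
         indicator {dyadic_radius (j + 2) - 2 * (1 / 2) ^ j..<dyadic_radius (j + 2)} (cmod z) \<partial>lborel)
       \<le> ennreal C * (\<integral>\<^sup>+z. ennreal (growth p \<Psi> (cmod (f z))) * indicator (ball 0 1) z *
         indicator {dyadic_radius (j + 2)..<dyadic_radius (j + 2 + m)} (cmod z) \<partial>weighted_area \<omega>)"
proof -
  obtain C where C: "C \<ge> 1" and mean: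
    "\<And>f R z w. f holomorphic_on ball 0 R \<Longrightarrow> cmod z \<le> cmod w \<Longrightarrow> cmod w < R \<Longrightarrow>
      (\<integral>\<^sup>+t\<in>{0..2*pi}. ennreal (growth p \<Psi> (cmod (f (z * cis t)))) \<partial>lborel)
       \<le> ennreal C * (\<integral>\<^sup>+t\<in>{0..2*pi}. ennreal (growth p \<Psi> (cmod (f (w * cis t)))) \<partial>lborel)"
    by (rule growth_circle_mean[OF \<Psi> p]) (rule that)
  obtain D \<kappa> and m :: nat where D: "D \<ge> 1" and \<kappa>: "\<kappa> > 1" and m: "m \<ge> 1" and
    dbl: "\<And>j. dyadic_tail \<omega> j \<le> D * dyadic_tail \<omega> (Suc j)" and
    dec: "\<And>j. \<kappa> * dyadic_tail \<omega> (j + m) \<le> dyadic_tail \<omega> j"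
    by (rule class_D_dyadic[OF \<omega>]) (rule that)
  note rw = class_D_radial[OF \<omega>]
  define E where "E = D * D / (1 - 1 / \<kappa>)"
  have k1: "0 < 1 - 1 / \<kappa>" using \<kappa> by simp
  have E: "E \<ge> 1"
  proof -
    have "1 \<le> D * D" using D mult_mono[of 1 D 1 D] by simp
    moreover have "1 - 1 / \<kappa> \<le> 1" using \<kappa> by simp
    ultimately show ?thesis unfolding E_def le_divide_eq_1_pos[OF k1] by linarith
  qed
  define B where "B = 4 * C * E * C * (2 * pi)"
  show ?thesis
  proof (rule that[of B m])
    have "1 \<le> C * C" using C mult_mono[of 1 C 1 C] by simp
    then have "1 * 1 \<le> (C * C) * E" using E by (intro mult_mono) auto
    then have "1 * 1 \<le> (C * C * E) * (4 * (2 * pi))" using pi_gt3 by (intro mult_mono) auto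
    then show "B \<ge> 1" by (simp add: B_def mult_ac)
    fix f :: "complex \<Rightarrow> complex" and j :: nat assume hol: "f holomorphic_on ball 0 1"
    define U where "U z = ennreal (growth p \<Psi> (cmod (f z))) * indicator (ball 0 1) z" for z
    have [measurable]: "U \<in> borel_measurable borel"
      unfolding U_def by (intro growth_holomorphic_measurable[OF \<Psi> hol]) auto
    define r where "r = dyadic_radius (j + 2)"
    define r' where "r' = dyadic_radius (j + 2 + m)"
    have r: "1/2 \<le> r" "r < r'" "r' < 1" "0 \<le> r"
      unfolding r_def r'_def using dyadic_radius_ge_half[of "j + 2"] m
      by (auto intro: dyadic_radius_strict_mono dyadic_radius_bounds)
    define k :: "real \<Rightarrow> ennreal" where "k = indicator {r - 2 * (1 / 2) ^ j..<r}"
    define k' :: "real \<Rightarrow> ennreal" where "k' = indicator {r..<r'}"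
    have [measurable]: "k \<in> borel_measurable borel" "k' \<in> borel_measurable borel" by (auto simp: k_def k'_def)
    \<comment> \<open>the mean over the circle that separates the two annuli\<close>
    define X where "X = (\<integral>\<^sup>+t\<in>{0..2*pi}. U (of_real r * cis t) \<partial>lborel)"
    have MU: "(\<integral>\<^sup>+t\<in>{0..2*pi}. U (z * cis t) \<partial>lborel) \<le> ennreal C * (\<integral>\<^sup>+t\<in>{0..2*pi}. U (w * cis t) \<partial>lborel)"
      if "cmod z \<le> cmod w" "cmod w < 1" for z w
    proof -
      have *: "(\<integral>\<^sup>+t\<in>{0..2*pi}. U (v * cis t) \<partial>lborel) =
        (\<integral>\<^sup>+t\<in>{0..2*pi}. ennreal (growth p \<Psi> (cmod (f (v * cis t)))) \<partial>lborel)" if "cmod v < 1" for v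
        using that by (intro nn_integral_cong) (auto simp: U_def norm_mult)
      show ?thesis using mean[OF hol that] that by (simp add: *)
    qed
    have upper: "ennreal (2 * pi) * (\<integral>\<^sup>+z. U z * k (cmod z) \<partial>lborel) \<le> ennreal (4 * pi * (1 / 2) ^ j) * (ennreal C * X)"
    proof -
      have "ennreal (2 * pi) * (\<integral>\<^sup>+z. U z * k (cmod z) \<partial>lborel) =
          (\<integral>\<^sup>+z. (\<integral>\<^sup>+t\<in>{0..2*pi}. U (z * cis t) \<partial>lborel) * k (cmod z) \<partial>lborel)"
        by (rule nn_integral_average[symmetric]) measurable
      also have "\<dots> \<le> (\<integral>\<^sup>+z. ennreal C * X * k (cmod z) \<partial>(lborel :: complex measure))"
      proof (rule nn_integral_mono)
        fix z :: complex
        show "(\<integral>\<^sup>+t\<in>{0..2*pi}. U (z * cis t) \<partial>lborel) * k (cmod z) \<le> ennreal C * X * k (cmod z)"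
          unfolding X_def using r
          by (cases "cmod z < r") (auto simp: k_def intro!: mult_right_mono MU)
      qed
      also have "\<dots> = ennreal C * X * (\<integral>\<^sup>+z. k (cmod z) \<partial>(lborel :: complex measure))"
        by (rule nn_integral_cmult) measurable
      also have "\<dots> \<le> ennreal C * X * ennreal (2 * pi * (r - (r - 2 * (1 / 2) ^ j)))"
        unfolding k_def using r by (intro mult_left_mono nn_integral_radial_band_le) auto
      finally show ?thesis by (simp add: mult_ac)
    qed
    have lower: "X * (\<integral>\<^sup>+z. k' (cmod z) \<partial>weighted_area \<omega>) \<le> ennreal C * (ennreal (2 * pi) * (\<integral>\<^sup>+z. U z * k' (cmod z) \<partial>weighted_area \<omega>))"
    proof -
      have "X * (\<integral>\<^sup>+z. k' (cmod z) \<partial>weighted_area \<omega>) = (\<integral>\<^sup>+z. X * k' (cmod z) \<partial>weighted_area \<omega>)"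
        by (intro nn_integral_cmult[symmetric] borel_measurable_weighted_area) measurable
      also have "\<dots> \<le> (\<integral>\<^sup>+z. ennreal C * ((\<integral>\<^sup>+t\<in>{0..2*pi}. U (z * cis t) \<partial>lborel) * k' (cmod z)) \<partial>weighted_area \<omega>)"
      proof (rule nn_integral_mono)
        fix z :: complex
        show "X * k' (cmod z) \<le> ennreal C * ((\<integral>\<^sup>+t\<in>{0..2*pi}. U (z * cis t) \<partial>lborel) * k' (cmod z))"
        proof (cases "cmod z \<in> {r..<r'}")
          case True
          have "X \<le> ennreal C * (\<integral>\<^sup>+t\<in>{0..2*pi}. U (z * cis t) \<partial>lborel)"
            unfolding X_def using True r by (intro MU) auto
          then show ?thesis using True by (simp add: k'_def)
        qed (simp add: k'_def)
      qed
      also have "\<dots> = ennreal C * (\<integral>\<^sup>+z. (\<integral>\<^sup>+t\<in>{0..2*pi}. U (z * cis t) \<partial>lborel) * k' (cmod z) \<partial>weighted_area \<omega>)"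
        by (intro nn_integral_cmult borel_measurable_weighted_area) measurable
      also have "(\<integral>\<^sup>+z. (\<integral>\<^sup>+t\<in>{0..2*pi}. U (z * cis t) \<partial>lborel) * k' (cmod z) \<partial>weighted_area \<omega>) =
          ennreal (2 * pi) * (\<integral>\<^sup>+z. U z * k' (cmod z) \<partial>weighted_area \<omega>)"
        by (rule weighted_area_average[OF rw]) measurable
      finally show ?thesis .
    qed
    define W where "W = dyadic_tail \<omega>"
    have Wp: "W i > 0" for i using dyadic_tail_pos[OF \<omega>] by (simp add: W_def)
    have mass: "ennreal (W j) \<le> ennreal E * (\<integral>\<^sup>+z. k' (cmod z) \<partial>weighted_area \<omega>)"
    proof -
      define V where "V = (\<integral>\<^sup>+z. k' (cmod z) \<partial>weighted_area \<omega>)"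
      have "ennreal (W (j + 2)) \<le> V + ennreal (W (j + 2 + m))"
        unfolding V_def W_def k'_def dyadic_tail_def r_def[symmetric] r'_def[symmetric]
        using r by (intro weighted_area_radial(2)[OF rw]) auto
      moreover have "W (j + 2 + m) \<le> W (j + 2) / \<kappa>"
        using dec[of "j + 2"] \<kappa> by (simp add: W_def field_simps)
      then have "ennreal (W (j + 2 + m)) \<le> ennreal (W (j + 2) / \<kappa>)" by (rule ennreal_leI)
      ultimately have "ennreal (W (j + 2)) \<le> V + ennreal (W (j + 2) / \<kappa>)"
        by (meson add_left_mono order_trans)
      then have "ennreal (W (j + 2)) - ennreal (W (j + 2) / \<kappa>) \<le> V"
        by (simp add: ennreal_minus_le_iff add.commute)
      then have V: "ennreal (W (j + 2) * (1 - 1 / \<kappa>)) \<le> V"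
        using Wp[of "j + 2"] \<kappa> by (simp add: ennreal_minus algebra_simps)
      have "W j \<le> D * W (Suc j)" using dbl by (simp add: W_def)
      also have "\<dots> \<le> D * (D * W (j + 2))" using dbl[of "Suc j"] D by (simp add: W_def)
      also have "\<dots> = E * (W (j + 2) * (1 - 1 / \<kappa>))" using k1 \<kappa> by (simp add: E_def)
      finally have "ennreal (W j) \<le> ennreal (E * (W (j + 2) * (1 - 1 / \<kappa>)))" by (rule ennreal_leI)
      also have "\<dots> = ennreal E * ennreal (W (j + 2) * (1 - 1 / \<kappa>))"
        using E by (intro ennreal_mult') auto
      also have "\<dots> \<le> ennreal E * V" using V by (intro mult_left_mono) auto
      finally show ?thesis by (simp add: V_def)
    qed
    have "ennreal (2 * pi) * (ennreal (2 ^ j * W j) * (\<integral>\<^sup>+z. U z * k (cmod z) \<partial>lborel))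
        = ennreal (2 ^ j * W j) * (ennreal (2 * pi) * (\<integral>\<^sup>+z. U z * k (cmod z) \<partial>lborel))" by (simp add: mult_ac)
    also have "\<dots> \<le> ennreal (2 ^ j * W j) * (ennreal (4 * pi * (1 / 2) ^ j) * (ennreal C * X))"
      using upper by (intro mult_left_mono) auto
    also have "\<dots> = ennreal (2 ^ j * W j * (4 * pi * (1 / 2) ^ j)) * (ennreal C * X)"
      using Wp[of j] by (simp add: ennreal_mult mult.assoc)
    also have "2 ^ j * W j * (4 * pi * (1 / 2) ^ j) = 4 * pi * W j"
      by (simp add: power_divide)
    also have "ennreal (4 * pi * W j) * (ennreal C * X) = ennreal (4 * pi) * (ennreal C * (ennreal (W j) * X))"
      using Wp[of j] by (simp add: ennreal_mult mult_ac)
    also have "\<dots> \<le> ennreal (4 * pi) * (ennreal C * (ennreal E * (\<integral>\<^sup>+z. k' (cmod z) \<partial>weighted_area \<omega>) * X))"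
      using mass by (intro mult_left_mono mult_right_mono) auto
    also have "\<dots> = ennreal (4 * pi) * (ennreal C * (ennreal E * (X * (\<integral>\<^sup>+z. k' (cmod z) \<partial>weighted_area \<omega>))))"
      by (simp add: mult_ac)
    also have "\<dots> \<le> ennreal (4 * pi) * (ennreal C * (ennreal E *
        (ennreal C * (ennreal (2 * pi) * (\<integral>\<^sup>+z. U z * k' (cmod z) \<partial>weighted_area \<omega>)))))"
      using lower by (intro mult_left_mono) auto
    also have "\<dots> = ennreal (2 * pi) * ((ennreal 2 * ennreal C * ennreal E * ennreal C * ennreal (2 * pi)) * (\<integral>\<^sup>+z. U z * k' (cmod z) \<partial>weighted_area \<omega>))"
    proof -
      have "ennreal (4 * pi) = ennreal 2 * ennreal (2 * pi)"
        by (subst ennreal_mult[symmetric]) auto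
      then show ?thesis by (simp add: mult_ac)
    qed
    also have "\<dots> \<le> ennreal (2 * pi) * (ennreal B * (\<integral>\<^sup>+z. U z * k' (cmod z) \<partial>weighted_area \<omega>))"
    proof -
      have "ennreal 2 * ennreal C * ennreal E * ennreal C * ennreal (2 * pi) = ennreal (2 * C * E * C * (2 * pi))"
      proof -
        have "0 \<le> C" "0 \<le> E" using C E by auto
        then show ?thesis
          by (simp only: ennreal_mult zero_le_numeral mult_nonneg_nonneg pi_ge_zero)
      qed
      also have "\<dots> \<le> ennreal B"
        unfolding B_def using C E by (intro ennreal_leI mult_right_mono) auto
      finally show ?thesis by (intro mult_left_mono mult_right_mono) auto
    qed
    finally have "ennreal (2 ^ j * W j) * (\<integral>\<^sup>+z. U z * k (cmod z) \<partial>lborel) \<le> ennreal B * (\<integral>\<^sup>+z. U z * k' (cmod z) \<partial>weighted_area \<omega>)"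
      by (subst (asm) ennreal_mult_le_mult_iff) auto
    then show "ennreal (2 ^ j * dyadic_tail \<omega> j) * (\<integral>\<^sup>+z. ennreal (growth p \<Psi> (cmod (f z))) * indicator (ball 0 1) z *
         indicator {dyadic_radius (j + 2) - 2 * (1 / 2) ^ j..<dyadic_radius (j + 2)} (cmod z) \<partial>lborel)
       \<le> ennreal B * (\<integral>\<^sup>+z. ennreal (growth p \<Psi> (cmod (f z))) * indicator (ball 0 1) z *
         indicator {dyadic_radius (j + 2)..<dyadic_radius (j + 2 + m)} (cmod z) \<partial>weighted_area \<omega>)"
      by (simp add: U_def k_def k'_def r_def r'_def W_def)
  qed
qed

lemma finite_borel_disc_measurable:
  assumes "finite_borel_measure_on_disc \<mu>"
  shows "u \<in> borel_measurable borel \<Longrightarrow> u \<in> borel_measurable \<mu>" and "space \<mu> = ball 0 1"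
    and "S \<in> sets borel \<Longrightarrow> S \<subseteq> ball 0 1 \<Longrightarrow> S \<in> sets \<mu>"
proof -
  have s: "sets \<mu> = sets (restrict_space borel (ball 0 1))"
    using assms by (simp add: finite_borel_measure_on_disc_def)
  show "u \<in> borel_measurable \<mu>" if "u \<in> borel_measurable borel"
    using measurable_restrict_space1[OF that, of "ball 0 1"] by (simp add: measurable_cong_sets[OF s refl])
  show "space \<mu> = ball 0 1"
    using sets_eq_imp_space_eq[OF s] by (simp add: space_restrict_space)
  show "S \<in> sets \<mu>" if "S \<in> sets borel" "S \<subseteq> ball 0 1"
    using that unfolding s by (auto simp: sets_restrict_space)
qed

text \<open>
  Integrate the sub-mean value inequality for \<open>u\<close> over the annulus with respect to \<open>\<mu>\<close> and
  exchange the integrals. The points \<open>z\<close> of the annulus within distance \<open>2\<^sup>-\<^sup>j / 16\<close> of a given \<open>w\<close>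
  lie in a single Carleson square, whose \<open>\<mu>\<close>-mass is at most \<open>T\<close>; and \<open>w\<close> lies in the band on the
  right.
\<close>

lemma carleson_covering:
  fixes u :: "complex \<Rightarrow> ennreal"
  assumes \<mu>: "finite_borel_measure_on_disc \<mu>"
    and T: "\<And>a. cmod a = dyadic_radius j \<Longrightarrow> measure \<mu> (carleson_square a) \<le> T"
    and u [measurable]: "u \<in> borel_measurable borel"
    and sub: "\<And>z. dyadic_radius j \<le> cmod z \<Longrightarrow> cmod z < dyadic_radius (Suc j) \<Longrightarrow>
       u z * ennreal (pi * ((1/2) ^ j / 16)\<^sup>2) \<le> ennreal C * (\<integral>\<^sup>+w\<in>ball z ((1/2) ^ j / 16). u w \<partial>lborel)"
  shows "ennreal (pi * ((1/2) ^ j / 16)\<^sup>2) * (\<integral>\<^sup>+z. u z * indicator {dyadic_radius j..<dyadic_radius (Suc j)} (cmod z) \<partial>\<mu>)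
    \<le> ennreal C * (ennreal T * (\<integral>\<^sup>+z. u z * indicator {dyadic_radius (j + 2) - 2 * (1 / 2) ^ j..<dyadic_radius (j + 2)} (cmod z) \<partial>lborel))"
proof -
  \<comment> \<open>a point within \<open>h / 16\<close> of the annulus \<open>[1 - h, 1 - h/2)\<close> has modulus in the interval
    \<open>[1 - h/4 - 2h, 1 - h/4)\<close>\<close>
  define h :: real where "h = (1/2) ^ j"
  have h: "h > 0" by (simp add: h_def)
  define g :: "complex \<Rightarrow> ennreal" where "g z = indicator {dyadic_radius j..<dyadic_radius (Suc j)} (cmod z)" for z
  define a where "a z = (indicator {dyadic_radius (j + 2) - 2 * (1 / 2) ^ j..<dyadic_radius (j + 2)} (cmod z) :: ennreal)" for z :: complex
  have [measurable]: "g \<in> borel_measurable borel" "a \<in> borel_measurable borel"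
    unfolding g_def a_def by measurable
  note m\<mu> = finite_borel_disc_measurable[OF \<mu>]
  have fin: "finite_measure \<mu>" using \<mu> by (simp add: finite_borel_measure_on_disc_def)
  interpret \<mu>: finite_measure \<mu> by fact
  interpret pair_sigma_finite \<mu> "lborel :: complex measure" ..
  have id\<mu> [measurable]: "(\<lambda>z. z) \<in> borel_measurable \<mu>" by (rule m\<mu>) simp
  have fst\<mu> [measurable]: "fst \<in> borel_measurable (\<mu> \<Otimes>\<^sub>M (lborel :: complex measure))"
    using measurable_compose[OF measurable_fst id\<mu>] by simp
  define i :: "complex \<Rightarrow> complex \<Rightarrow> ennreal" where "i z w = indicator {..<h / 16} (dist z w)" for z w
  have [measurable]: "(\<lambda>p. i (fst p) (snd p)) \<in> borel_measurable (\<mu> \<Otimes>\<^sub>M (lborel :: complex measure))"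
    unfolding i_def by measurable
  have rad: "dyadic_radius j = 1 - h" "dyadic_radius (Suc j) = 1 - h / 2" "dyadic_radius (j + 2) = 1 - h / 4" "dyadic_radius (Suc (Suc j)) = 1 - h / 4"
    by (simp_all add: dyadic_radius_def h_def)
  have inner: "u w * (\<integral>\<^sup>+z. i z w * g z \<partial>\<mu>) \<le> u w * a w * ennreal T" for w
  proof (cases "\<exists>z. dist z w < h / 16 \<and> dyadic_radius j \<le> cmod z \<and> cmod z < dyadic_radius (Suc j)")
    case False
    then have "(\<lambda>z. i z w * g z) = (\<lambda>z. 0)" by (auto simp: i_def g_def indicator_def fun_eq_iff)
    then show ?thesis by simp
  next
    case True
    then obtain z where z: "dist z w < h / 16" "dyadic_radius j \<le> cmod z" "cmod z < dyadic_radius (Suc j)" by blast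
    have "cmod z - cmod w < h / 16" "cmod w - cmod z < h / 16"
      using norm_triangle_ineq2[of z w] norm_triangle_ineq2[of w z] z(1)
      by (simp_all add: dist_norm norm_minus_commute)
    then have "1 - h / 4 - 2 * h \<le> cmod w" "cmod w < 1 - h / 4"
      using z(2,3) h unfolding rad by linarith+
    then have "a w = 1" by (simp add: a_def rad h_def[symmetric] indicator_def)
    define c where "c = of_real (dyadic_radius j) * sgn w"
    have zs: "cmod (z - w) < (1 / 2) ^ j / 16" using z(1) by (simp add: dist_norm h_def)
    have z1: "cmod z < 1" using z(3) dyadic_radius_bounds(2)[of "Suc j"] by simp
    have cc: "cmod c = dyadic_radius j"
      unfolding c_def using near_point_in_carleson_square(2)[OF z(2) z1 zs] .
    have "(\<integral>\<^sup>+z. i z w * g z \<partial>\<mu>) \<le> (\<integral>\<^sup>+z. indicator (carleson_square c) z \<partial>\<mu>)"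
    proof (rule nn_integral_mono)
      fix v assume "v \<in> space \<mu>"
      then have "cmod v < 1" by (simp add: m\<mu>)
      then show "i v w * g v \<le> indicator (carleson_square c) v"
        unfolding c_def using near_point_in_carleson_square(1)[of j v w]
        by (auto simp: i_def g_def indicator_def dist_norm h_def)
    qed
    also have "\<dots> = emeasure \<mu> (carleson_square c)"
      by (intro nn_integral_indicator m\<mu> carleson_square_borel carleson_square_subset)
    also have "\<dots> \<le> ennreal T"
      using T[OF cc] by (simp add: \<mu>.emeasure_eq_measure ennreal_leI)
    finally show ?thesis using \<open>a w = 1\<close> by (simp add: mult_left_mono)
  qed
  have gm: "g \<in> borel_measurable \<mu>" "u \<in> borel_measurable \<mu>" by (auto intro!: m\<mu>)
  have last_eq: "(\<integral>\<^sup>+w. ennreal C * (u w * a w * ennreal T) \<partial>lborel) = ennreal C * (ennreal T * (\<integral>\<^sup>+w. u w * a w \<partial>lborel))"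
    by (simp add: nn_integral_cmult nn_integral_multc mult.commute)
  note [measurable] = gm
  have "ennreal (pi * (h / 16)\<^sup>2) * (\<integral>\<^sup>+z. u z * g z \<partial>\<mu>) = (\<integral>\<^sup>+z. ennreal (pi * (h / 16)\<^sup>2) * (u z * g z) \<partial>\<mu>)"
    by (rule nn_integral_cmult[symmetric]) measurable
  also have "\<dots> \<le> (\<integral>\<^sup>+z. (\<integral>\<^sup>+w. ennreal C * u w * (i z w * g z) \<partial>lborel) \<partial>\<mu>)"
  proof (rule nn_integral_mono)
    fix z assume "z \<in> space \<mu>"
    show "ennreal (pi * (h / 16)\<^sup>2) * (u z * g z) \<le> (\<integral>\<^sup>+w. ennreal C * u w * (i z w * g z) \<partial>lborel)"
    proof (cases "dyadic_radius j \<le> cmod z \<and> cmod z < dyadic_radius (Suc j)")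
      case True
      then have "ennreal (pi * (h / 16)\<^sup>2) * (u z * g z) = u z * ennreal (pi * (h / 16)\<^sup>2)"
        by (simp add: g_def mult.commute)
      also have "\<dots> \<le> ennreal C * (\<integral>\<^sup>+w\<in>ball z (h / 16). u w \<partial>lborel)"
        using sub True by (simp add: h_def)
      also have "\<dots> = (\<integral>\<^sup>+w. ennreal C * (u w * indicator (ball z (h / 16)) w) \<partial>lborel)"
      proof -
        have "(indicator (ball z (h / 16)) :: complex \<Rightarrow> ennreal) \<in> borel_measurable lborel"
          by (rule borel_measurable_indicator) simp
        moreover have "u \<in> borel_measurable lborel" using u by simp
        ultimately show ?thesis by (intro nn_integral_cmult[symmetric] borel_measurable_times_ennreal)
      qed
      also have "\<dots> = (\<integral>\<^sup>+w. ennreal C * u w * (i z w * g z) \<partial>lborel)"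
        using True by (intro nn_integral_cong) (simp add: i_def g_def indicator_def mult.assoc)
      finally show ?thesis .
    qed (auto simp: g_def)
  qed
  also have "\<dots> = (\<integral>\<^sup>+w. (\<integral>\<^sup>+z. ennreal C * u w * (i z w * g z) \<partial>\<mu>) \<partial>lborel)"
    by (rule Fubini'[symmetric]) (simp add: case_prod_beta, measurable)
  also have "\<dots> = (\<integral>\<^sup>+w. ennreal C * (u w * (\<integral>\<^sup>+z. i z w * g z \<partial>\<mu>)) \<partial>lborel)"
  proof (rule nn_integral_cong)
    fix w :: complex
    have "(\<lambda>z. i z w * g z) \<in> borel_measurable \<mu>" unfolding i_def by measurable
    then show "(\<integral>\<^sup>+z. ennreal C * u w * (i z w * g z) \<partial>\<mu>) = ennreal C * (u w * (\<integral>\<^sup>+z. i z w * g z \<partial>\<mu>))"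
      by (simp add: nn_integral_cmult mult.assoc)
  qed
  also have "\<dots> \<le> (\<integral>\<^sup>+w. ennreal C * (u w * a w * ennreal T) \<partial>lborel)"
    using inner by (intro nn_integral_mono mult_left_mono) auto
  also have "\<dots> = ennreal C * (ennreal T * (\<integral>\<^sup>+w. u w * a w \<partial>lborel))"
    by (rule last_eq)
  finally show ?thesis by (simp add: g_def a_def h_def)
qed


section \<open>Peak values\<close>

text \<open>
  Up to constants the size \<open>c\<close> of a function that has \<open>p\<close>-modular 1 and lives on a set of mass
  \<open>v\<close>, that is, \<open>v c\<^sup>p \<Psi>(c) = 1\<close>. The formula is explicit because \<open>\<Psi>(c)\<close> has been replaced by
  \<open>\<Psi>(1 / v)\<close>, to which it is comparable by \<open>class_L_peak_compare\<close>.
\<close>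

definition peak :: "real \<Rightarrow> (real \<Rightarrow> real) \<Rightarrow> real \<Rightarrow> real" where
  "peak p \<Psi> v = (v * \<Psi> (1 / v)) powr (- 1 / p)"

lemma peak_pos: "\<Psi> \<in> class_L \<Longrightarrow> v > 0 \<Longrightarrow> peak p \<Psi> v > 0"
  using class_L_pos[of \<Psi> "1 / v"] by (simp add: peak_def)

lemma peak_powr:
  assumes "\<Psi> \<in> class_L" "v > 0" "p > 0"
  shows "peak p \<Psi> v powr p = 1 / (v * \<Psi> (1 / v))"
    and "peak p \<Psi> v powr q = (v * \<Psi> (1 / v)) powr (- (q / p))"
proof -
  define a where "a = v * \<Psi> (1 / v)"
  have a: "a > 0" using assms class_L_pos[of \<Psi> "1 / v"] by (simp add: a_def)
  have e: "- 1 / p * p = - 1" "- 1 / p * q = - (q / p)" using assms(3) by auto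
  have "(a powr (- 1 / p)) powr p = 1 / a"
    using a by (simp only: powr_powr e) (simp add: powr_minus divide_inverse)
  then show "peak p \<Psi> v powr p = 1 / (v * \<Psi> (1 / v))" by (simp add: peak_def a_def)
  have "(a powr (- 1 / p)) powr q = a powr (- (q / p))" by (simp only: powr_powr e)
  then show "peak p \<Psi> v powr q = (v * \<Psi> (1 / v)) powr (- (q / p))" by (simp add: peak_def a_def)
qed

lemma powr_le_power:
  fixes x :: real
  assumes "x \<ge> 1" "e \<le> real k"
  shows "x powr e \<le> x ^ k"
proof -
  have "x powr e \<le> x powr real k" using assms by (intro powr_mono) auto
  then show ?thesis using assms by (simp add: powr_realpow)
qed

text \<open>
  Since \<open>\<Psi>\<close> lies between two powers with small exponents, the peak value lies between powers
  of \<open>1 / v\<close>. The bound \<open>v \<le> V\<close> keeps \<open>1 / v\<close> away from 0.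
\<close>

lemma peak_comparable:
  assumes \<Psi>: "\<Psi> \<in> class_L" and p: "p > 0" and V: "V > 0"
  obtains A :: real and k :: nat where "A \<ge> 1"
    "\<And>v. 0 < v \<Longrightarrow> v \<le> V \<Longrightarrow> 1 + peak p \<Psi> v \<le> A * (1 + 1 / v) ^ k"
    "\<And>v. 0 < v \<Longrightarrow> v \<le> V \<Longrightarrow> 1 + 1 / v \<le> A * (1 + peak p \<Psi> v) ^ k"
proof -
  obtain C where C: "C \<ge> 1" "\<And>x. x \<ge> 0 \<Longrightarrow> \<Psi> x \<le> C * (1 + x) powr (1/2)"
    "\<And>x. x \<ge> 0 \<Longrightarrow> 1 \<le> C * (1 + x) powr (1/2) * \<Psi> x"
    by (rule class_L_power_bounds[OF \<Psi> half_gt_zero[OF zero_less_one]]) (rule that)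
  obtain k :: nat where k: "real k \<ge> 2 / p" "real k \<ge> 2 * p"
    using real_arch_simple[of "max (2/p) (2*p)"] by auto
  define A1 where "A1 = 1 + C powr (1 / p)"
  define A2 where "A2 = ((1 + V) * C)\<^sup>2"
  define A where "A = A1 + A2"
  have A1: "A1 \<ge> 1" and A2: "A2 \<ge> 0" by (auto simp: A1_def A2_def)
  show ?thesis
  proof (rule that[of A k])
    show "A \<ge> 1" using A1 A2 by (simp add: A_def)
    fix v :: real assume v: "0 < v" "v \<le> V"
    define X where "X = 1 + 1 / v"
    define c where "c = peak p \<Psi> v"
    have X: "X \<ge> 1" "1 / v \<le> X" using v by (auto simp: X_def)
    have Xk: "X ^ k \<ge> 1" using X by (intro one_le_power)
    have c: "c > 0" using peak_pos[OF \<Psi> v(1)] by (simp add: c_def)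
    have ps: "\<Psi> (1/v) > 0" using class_L_pos[OF \<Psi>] v by simp
    have cp: "c powr p = 1 / (v * \<Psi> (1 / v))" using peak_powr(1)[OF \<Psi> v(1) p] by (simp add: c_def)
    \<comment> \<open>the bounds for \<open>\<Psi>\<close> cost \<open>X powr (1/2)\<close>, half of the available power of \<open>X\<close>\<close>
    have XX: "X = X powr (1/2) * X powr (1/2)" using X by (simp add: powr_add[symmetric])
    have "1 / \<Psi> (1/v) \<le> C * X powr (1/2)" using C(3)[of "1/v"] v ps by (simp add: X_def field_simps)
    also have "\<dots> \<le> C * X powr 1" using C(1) X by (intro mult_left_mono powr_mono) auto
    finally have "(1 / v) * (1 / \<Psi> (1/v)) \<le> X * (C * X)" using X v ps by (intro mult_mono) auto
    then have "c powr p \<le> C * X powr 2" using X by (simp add: cp powr_numeral power2_eq_square mult_ac)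
    then have "(c powr p) powr (1/p) \<le> (C * X powr 2) powr (1/p)" using p by (intro powr_mono2) auto
    also have "(c powr p) powr (1/p) = c" using c p by (simp add: powr_powr)
    also have "(C * X powr 2) powr (1/p) = C powr (1/p) * X powr (2/p)"
    proof -
      have "(X powr 2) powr (1/p) = X powr (2/p)" by (simp only: powr_powr) simp
      moreover have "(C * X powr 2) powr (1/p) = C powr (1/p) * (X powr 2) powr (1/p)"
        by (rule powr_mult)
      ultimately show ?thesis by (simp only:)
    qed
    also have "\<dots> \<le> C powr (1/p) * X ^ k" using k X by (intro mult_left_mono powr_le_power) auto
    finally have "1 + c \<le> 1 * X ^ k + C powr (1/p) * X ^ k" using Xk by simp
    also have "\<dots> = A1 * X ^ k" by (simp add: A1_def algebra_simps)
    also have "\<dots> \<le> A * X ^ k" using A2 Xk by (intro mult_right_mono) (auto simp: A_def)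
    finally show "1 + peak p \<Psi> v \<le> A * (1 + 1 / v) ^ k" by (simp add: c_def X_def)
    have "X \<le> (1 + V) * (1 / v)" using v by (simp add: X_def field_simps)
    also have "\<dots> = (1 + V) * (c powr p * \<Psi> (1/v))" using ps v by (simp add: cp)
    also have "\<dots> \<le> (1 + V) * (c powr p * (C * X powr (1/2)))"
      using C(2)[of "1/v"] v V by (intro mult_left_mono) (auto simp: X_def)
    finally have "X powr (1/2) * X powr (1/2) \<le> ((1 + V) * C * c powr p) * X powr (1/2)"
      using XX by (simp add: mult_ac)
    then have "X powr (1/2) \<le> (1 + V) * C * c powr p" using X by (simp add: mult_le_cancel_right)
    then have "(X powr (1/2))\<^sup>2 \<le> ((1 + V) * C * c powr p)\<^sup>2" by (intro power_mono) auto
    also have "(X powr (1/2))\<^sup>2 = X" using X XX by (simp add: power2_eq_square)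
    also have "((1 + V) * C * c powr p)\<^sup>2 = A2 * c powr (2 * p)"
      by (simp add: A2_def power_mult_distrib power2_eq_square powr_add[symmetric])
    also have "\<dots> \<le> A2 * (1 + c) powr (2 * p)" using c p A2 by (intro mult_left_mono powr_mono2) auto
    also have "\<dots> \<le> A2 * (1 + c) ^ k" using k c A2 by (intro mult_left_mono powr_le_power) auto
    also have "\<dots> \<le> A * (1 + c) ^ k" using A1 c by (intro mult_right_mono) (auto simp: A_def)
    finally show "1 + 1 / v \<le> A * (1 + peak p \<Psi> v) ^ k" by (simp add: c_def X_def)
  qed
qed

text \<open>
  Functions of \<open>class_L\<close> do not distinguish the peak value from \<open>1 / w\<close> when \<open>v\<close> and \<open>w\<close> are
  comparable: the arguments are bounded by powers of each other.
\<close>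

lemma class_L_peak_compare:
  assumes \<Psi>: "\<Psi> \<in> class_L" and \<Phi>: "\<Phi> \<in> class_L" and p: "p > 0" and V: "V > 0" and K: "K \<ge> 1"
  obtains C where "C \<ge> 1"
    "\<And>v w. 0 < v \<Longrightarrow> 0 < w \<Longrightarrow> v \<le> V \<Longrightarrow> v \<le> K * w \<Longrightarrow> w \<le> K * v \<Longrightarrow> \<Phi> (peak p \<Psi> v) \<le> C * \<Phi> (1 / w)"
    "\<And>v w. 0 < v \<Longrightarrow> 0 < w \<Longrightarrow> v \<le> V \<Longrightarrow> v \<le> K * w \<Longrightarrow> w \<le> K * v \<Longrightarrow> \<Phi> (1 / w) \<le> C * \<Phi> (peak p \<Psi> v)"
proof -
  obtain A :: real and k :: nat where A: "A \<ge> 1"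
    "\<And>v. 0 < v \<Longrightarrow> v \<le> V \<Longrightarrow> 1 + peak p \<Psi> v \<le> A * (1 + 1 / v) ^ k"
    "\<And>v. 0 < v \<Longrightarrow> v \<le> V \<Longrightarrow> 1 + 1 / v \<le> A * (1 + peak p \<Psi> v) ^ k"
    by (rule peak_comparable[OF \<Psi> p V]) (rule that)
  define B where "B = A * K ^ Suc k"
  have "1 * 1 \<le> A * K ^ Suc k" using A(1) K by (intro mult_mono one_le_power) auto
  then have B: "B \<ge> 1" by (simp add: B_def)
  obtain C where C: "C \<ge> 1" "\<And>x y. 0 \<le> x \<Longrightarrow> 0 \<le> y \<Longrightarrow> 1 + y \<le> B * (1 + x) ^ Suc k
      \<Longrightarrow> 1 + x \<le> B * (1 + y) ^ Suc k \<Longrightarrow> \<Phi> x \<le> C * \<Phi> y"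
    by (rule class_L_slow[OF \<Phi> B]) (rule that)
  have *: "1 + peak p \<Psi> v \<le> B * (1 + 1 / w) ^ Suc k \<and> 1 + 1 / w \<le> B * (1 + peak p \<Psi> v) ^ Suc k"
    if v: "0 < v" "0 < w" "v \<le> V" "v \<le> K * w" "w \<le> K * v" for v w
  proof
    have vw: "1 + 1 / v \<le> K * (1 + 1 / w)" "1 + 1 / w \<le> K * (1 + 1 / v)"
    proof -
      have "1 / v \<le> K / w" "1 / w \<le> K / v" using v by (auto simp: field_simps)
      then show "1 + 1 / v \<le> K * (1 + 1 / w)" "1 + 1 / w \<le> K * (1 + 1 / v)"
        using K by (auto simp: algebra_simps)
    qed
    have "1 + peak p \<Psi> v \<le> A * (1 + 1 / v) ^ k" using A v by auto
    also have "\<dots> \<le> A * (K * (1 + 1 / w)) ^ k" using A(1) v vw by (intro mult_left_mono power_mono) auto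
    also have "\<dots> \<le> A * (K * (1 + 1 / w)) ^ Suc k"
    proof (intro mult_left_mono power_increasing)
      have "1 * 1 \<le> K * (1 + 1 / w)" using K v by (intro mult_mono) auto
      then show "1 \<le> K * (1 + 1 / w)" by simp
    qed (use A(1) in auto)
    finally show "1 + peak p \<Psi> v \<le> B * (1 + 1 / w) ^ Suc k"
      by (simp add: B_def power_mult_distrib mult_ac)
    have pk: "1 + peak p \<Psi> v \<ge> 1" using peak_pos[OF \<Psi> v(1), of p] by simp
    have "1 + 1 / w \<le> K * (1 + 1 / v)" by (rule vw)
    also have "\<dots> \<le> K * (A * (1 + peak p \<Psi> v) ^ k)" using K A v by (intro mult_left_mono) auto
    also have "\<dots> = (K * A) * (1 + peak p \<Psi> v) ^ k" by simp
    also have "\<dots> \<le> B * (1 + peak p \<Psi> v) ^ Suc k"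
    proof (intro mult_mono power_increasing)
      have "K ^ 1 \<le> K ^ Suc k" using K by (intro power_increasing) auto
      then show "K * A \<le> B" unfolding B_def using A(1) by (simp add: mult.commute)
    qed (use pk B in auto)
    finally show "1 + 1 / w \<le> B * (1 + peak p \<Psi> v) ^ Suc k" .
  qed
  show ?thesis
  proof (rule that[OF C(1)])
    fix v w assume v: "0 < v" "0 < w" "v \<le> V" "v \<le> K * w" "w \<le> K * v"
    have "0 \<le> peak p \<Psi> v" using peak_pos[OF \<Psi> v(1), of p] by simp
    then show "\<Phi> (peak p \<Psi> v) \<le> C * \<Phi> (1 / w)" "\<Phi> (1 / w) \<le> C * \<Phi> (peak p \<Psi> v)"
      using *[OF v] v by (auto intro!: C(2))
  qed
qed

text \<open>
  By definition \<open>(peak p \<Psi> v)\<^sup>q = (v \<Psi>(1 / v))\<^bsup>-q/p\<^esup>\<close>, so \<open>growth q \<Phi>\<close> at the peak value is the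
  expression that multiplies \<open>\<mu>(S(a))\<close> in the Carleson condition, with \<open>\<Phi>\<close> taken at the peak
  value instead of \<open>1 / v\<close>. Slow variation allows this, and passing from \<open>v\<close> to \<open>w\<close>.
\<close>

lemma growth_peak_compare:
  assumes \<Psi>: "\<Psi> \<in> class_L" and \<Phi>: "\<Phi> \<in> class_L" and p: "p > 0" and q: "q > 0" and V: "V > 0" and K: "K \<ge> 1"
  obtains C where "C \<ge> 1"
    "\<And>v w. 0 < v \<Longrightarrow> 0 < w \<Longrightarrow> v \<le> V \<Longrightarrow> v \<le> K * w \<Longrightarrow> w \<le> K * v \<Longrightarrow>
       growth q \<Phi> (peak p \<Psi> v) \<le> C * (\<Phi> (1 / w) / (w * \<Psi> (1 / w)) powr (q / p))"
    "\<And>v w. 0 < v \<Longrightarrow> 0 < w \<Longrightarrow> v \<le> V \<Longrightarrow> v \<le> K * w \<Longrightarrow> w \<le> K * v \<Longrightarrow>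
       \<Phi> (1 / w) / (w * \<Psi> (1 / w)) powr (q / p) \<le> C * growth q \<Phi> (peak p \<Psi> v)"
proof -
  obtain C1 where C1: "C1 \<ge> 1"
    "\<And>v w. 0 < v \<Longrightarrow> 0 < w \<Longrightarrow> v \<le> V \<Longrightarrow> v \<le> K * w \<Longrightarrow> w \<le> K * v \<Longrightarrow> \<Phi> (peak p \<Psi> v) \<le> C1 * \<Phi> (1 / w)"
    "\<And>v w. 0 < v \<Longrightarrow> 0 < w \<Longrightarrow> v \<le> V \<Longrightarrow> v \<le> K * w \<Longrightarrow> w \<le> K * v \<Longrightarrow> \<Phi> (1 / w) \<le> C1 * \<Phi> (peak p \<Psi> v)"
    by (rule class_L_peak_compare[OF \<Psi> \<Phi> p V K]) (rule that)
  obtain C2 where C2: "C2 \<ge> 1" "\<And>x y. 0 \<le> x \<Longrightarrow> 0 \<le> y \<Longrightarrow> 1 + y \<le> K * (1 + x) ^ 1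
      \<Longrightarrow> 1 + x \<le> K * (1 + y) ^ 1 \<Longrightarrow> \<Psi> x \<le> C2 * \<Psi> y"
    by (rule class_L_slow[OF \<Psi> K]) (rule that)
  have cmp: "v * \<Psi> (1/v) \<le> (K * C2) * (w * \<Psi> (1/w))"
    if v: "0 < v" "0 < w" "v \<le> K * w" "w \<le> K * v" for v w
  proof -
    have "1 / v \<le> K / w" "1 / w \<le> K / v" using v by (auto simp: field_simps)
    then have "1 + 1 / v \<le> K * (1 + 1 / w) ^ 1" "1 + 1 / w \<le> K * (1 + 1 / v) ^ 1"
      using K by (auto simp: algebra_simps)
    then have "\<Psi> (1/v) \<le> C2 * \<Psi> (1/w)" using v by (intro C2) auto
    then have "v * \<Psi> (1/v) \<le> (K * w) * (C2 * \<Psi> (1/w))"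
      using v K class_L_pos[OF \<Psi>, of "1/v"] by (intro mult_mono) auto
    then show ?thesis by (simp add: mult_ac)
  qed
  define B where "B = K * C2"
  have "1 * 1 \<le> K * C2" using K C2(1) by (intro mult_mono) auto
  then have B: "B \<ge> 1" by (simp add: B_def)
  define D where "D = B powr (q / p)"
  have D: "D \<ge> 1" unfolding D_def using B p q by (intro ge_one_powr_ge_zero) auto
  show ?thesis
  proof (rule that[of "C1 * D"])
    have "1 * 1 \<le> C1 * D" using C1(1) D by (intro mult_mono) auto
    then show "1 \<le> C1 * D" by simp
    fix v w assume v: "0 < v" "0 < w" "v \<le> V" "v \<le> K * w" "w \<le> K * v"
    define a where "a = (v * \<Psi> (1/v)) powr (q / p)"
    define b where "b = (w * \<Psi> (1/w)) powr (q / p)"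
    have ps: "\<Psi> (1/v) > 0" "\<Psi> (1/w) > 0" "\<Phi> (1/w) > 0" "\<Phi> (peak p \<Psi> v) > 0"
      using v class_L_pos[OF \<Psi>] class_L_pos[OF \<Phi>] peak_pos[OF \<Psi> v(1), of p] by auto
    have ab: "a > 0" "b > 0" using ps v by (auto simp: a_def b_def)
    have "a \<le> (B * (w * \<Psi> (1/w))) powr (q/p)"
      unfolding a_def B_def using cmp[OF v(1,2,4,5)] v ps p q by (intro powr_mono2) auto
    then have 1: "a \<le> D * b" using B ps v by (simp add: powr_mult D_def b_def)
    have "b \<le> (B * (v * \<Psi> (1/v))) powr (q/p)"
      unfolding b_def B_def using cmp[OF v(2,1,5,4)] v ps p q by (intro powr_mono2) auto
    then have 2: "b \<le> D * a" using B ps v by (simp add: powr_mult D_def a_def)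
    have g: "growth q \<Phi> (peak p \<Psi> v) = \<Phi> (peak p \<Psi> v) / a"
      using peak_powr(2)[OF \<Psi> v(1) p, of q] by (simp add: growth_def a_def powr_minus divide_inverse mult.commute)
    have "growth q \<Phi> (peak p \<Psi> v) \<le> (C1 * \<Phi> (1 / w)) / (b / D)"
      unfolding g using C1(2)[OF v] 2 ab ps D C1(1)
      by (intro frac_le) (auto simp: field_simps)
    then show "growth q \<Phi> (peak p \<Psi> v) \<le> C1 * D * (\<Phi> (1 / w) / (w * \<Psi> (1 / w)) powr (q / p))"
      by (simp add: b_def mult_ac)
    have "\<Phi> (1 / w) / b \<le> (C1 * \<Phi> (peak p \<Psi> v)) / (a / D)"
      using C1(3)[OF v] 1 ab ps D C1(1) by (intro frac_le) (auto simp: field_simps)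
    then show "\<Phi> (1 / w) / (w * \<Psi> (1 / w)) powr (q / p) \<le> C1 * D * growth q \<Phi> (peak p \<Psi> v)"
      unfolding g by (simp add: b_def mult_ac)
  qed
qed

text \<open>
  For \<open>\<Psi> = \<Phi> = 1\<close> the right-hand side is \<open>v\<^bsup>-q/p\<^esup>\<close>, which is at least \<open>1 / v\<close> for small \<open>v\<close>. In
  general the exponent \<open>e\<close> pays for the variation of \<open>\<Psi>\<close> and \<open>\<Phi>\<close>.
\<close>

lemma growth_peak_lower:
  assumes \<Psi>: "\<Psi> \<in> class_L" and \<Phi>: "\<Phi> \<in> class_L" and p: "p > 0" and q: "p \<le> q" and V: "V > 0"
    and e: "0 < e" "e \<le> 1"
  obtains C where "C \<ge> 1"
    "\<And>v. 0 < v \<Longrightarrow> v \<le> V \<Longrightarrow> (1 + 1 / v) powr (1 - e) \<le> C * growth q \<Phi> (peak p \<Psi> v)"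
proof -
  define d where "d = e / 2"
  have d: "0 < d" "d \<le> 1/2" using e by (auto simp: d_def)
  obtain C1 where C1: "C1 \<ge> 1" "\<And>x. x \<ge> 0 \<Longrightarrow> \<Psi> x \<le> C1 * (1 + x) powr d"
    "\<And>x. x \<ge> 0 \<Longrightarrow> 1 \<le> C1 * (1 + x) powr d * \<Psi> x"
    by (rule class_L_power_bounds[OF \<Psi> d(1)]) (rule that)
  obtain C2 where C2: "C2 \<ge> 1" "\<And>x. x \<ge> 0 \<Longrightarrow> \<Phi> x \<le> C2 * (1 + x) powr d"
    "\<And>x. x \<ge> 0 \<Longrightarrow> 1 \<le> C2 * (1 + x) powr d * \<Phi> x"
    by (rule class_L_power_bounds[OF \<Phi> d(1)]) (rule that)
  obtain C3 where C3: "C3 \<ge> 1"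
    "\<And>v w. 0 < v \<Longrightarrow> 0 < w \<Longrightarrow> v \<le> V \<Longrightarrow> v \<le> 1 * w \<Longrightarrow> w \<le> 1 * v \<Longrightarrow> \<Phi> (peak p \<Psi> v) \<le> C3 * \<Phi> (1 / w)"
    "\<And>v w. 0 < v \<Longrightarrow> 0 < w \<Longrightarrow> v \<le> V \<Longrightarrow> v \<le> 1 * w \<Longrightarrow> w \<le> 1 * v \<Longrightarrow> \<Phi> (1 / w) \<le> C3 * \<Phi> (peak p \<Psi> v)"
    by (rule class_L_peak_compare[OF \<Psi> \<Phi> p V order_refl]) (rule that)
  define B where "B = (1 + V) * C1"
  have "1 * 1 \<le> (1 + V) * C1" using V C1(1) by (intro mult_mono) auto
  then have B: "B \<ge> 1" by (simp add: B_def)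
  define D where "D = B powr (q / p)"
  have qp: "q / p \<ge> 1" using p q by simp
  have D: "D \<ge> 1" unfolding D_def using B qp by (intro ge_one_powr_ge_zero) auto
  show ?thesis
  proof (rule that[of "D * (C2 * C3)"])
    have "1 * (1 * 1) \<le> D * (C2 * C3)" using D C2(1) C3(1) by (intro mult_mono) auto
    then show "D * (C2 * C3) \<ge> 1" by simp
    fix v :: real assume v: "0 < v" "v \<le> V"
    define X where "X = 1 + 1 / v"
    define c where "c = peak p \<Psi> v"
    have X: "X \<ge> 1" using v by (auto simp: X_def)
    have c: "c > 0" using peak_pos[OF \<Psi> v(1)] by (simp add: c_def)
    have ps: "\<Psi> (1/v) > 0" "\<Phi> (1/v) > 0" "\<Phi> c > 0" using class_L_pos[OF \<Psi>] class_L_pos[OF \<Phi>] v c by auto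
    have cp: "c powr p = 1 / (v * \<Psi> (1 / v))" using peak_powr(1)[OF \<Psi> v(1) p] by (simp add: c_def)
    have "X \<le> (1 + V) * (1 / v)" using v by (simp add: X_def field_simps)
    also have "\<dots> = (1 + V) * (c powr p * \<Psi> (1/v))" using ps v by (simp add: cp)
    also have "\<dots> \<le> (1 + V) * (c powr p * (C1 * X powr d))"
      using C1(2)[of "1/v"] v V by (intro mult_left_mono) (auto simp: X_def)
    finally have "X powr (1 - d) * X powr d \<le> (B * c powr p) * X powr d"
      using X by (simp add: B_def mult_ac powr_add[symmetric])
    then have a: "X powr (1 - d) \<le> B * c powr p" using X by (simp add: mult_le_cancel_right)
    have "X powr (1 - d) = (X powr (1 - d)) powr 1" using X by simp
    also have "\<dots> \<le> (X powr (1 - d)) powr (q / p)"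
      using qp X d by (intro powr_mono ge_one_powr_ge_zero) auto
    also have "\<dots> \<le> (B * c powr p) powr (q / p)" using a qp by (intro powr_mono2) auto
    also have "\<dots> = D * c powr q" using B p by (simp add: powr_mult D_def powr_powr)
    finally have b: "X powr (1 - d) \<le> D * c powr q" .
    have "1 \<le> C2 * X powr d * \<Phi> (1/v)" using C2(3)[of "1/v"] v by (simp add: X_def)
    also have "\<dots> \<le> C2 * X powr d * (C3 * \<Phi> c)"
      using C2(1) v by (intro mult_left_mono) (auto simp: c_def intro!: C3(3))
    finally have f: "1 \<le> (C2 * C3) * X powr d * \<Phi> c" by (simp add: mult_ac)
    have "X powr (1 - e) * X powr d = X powr (1 - d)" using X by (simp add: powr_add[symmetric] d_def)
    also have "\<dots> * 1 \<le> (D * c powr q) * ((C2 * C3) * X powr d * \<Phi> c)"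
      using b f D by (intro mult_mono) auto
    finally have "X powr (1 - e) * X powr d \<le> (D * (C2 * C3) * growth q \<Phi> c) * X powr d"
      by (simp add: growth_def mult_ac)
    then have "X powr (1 - e) \<le> D * (C2 * C3) * growth q \<Phi> c" using X by (simp add: mult_le_cancel_right)
    then show "(1 + 1 / v) powr (1 - e) \<le> D * (C2 * C3) * growth q \<Phi> (peak p \<Psi> v)"
      by (simp add: X_def c_def)
  qed
qed

text \<open>
  Let \<open>c = peak p \<Psi> v\<close>. The bound on \<open>v * growth p \<Psi> x\<close> and the lower bound on \<open>x\<close> make \<open>x\<close> and
  \<open>1 / v\<close> comparable up to powers, so that \<open>\<Psi>(x) \<asymp> \<Psi>(1 / v)\<close> and \<open>\<Phi>(x) \<asymp> \<Phi>(c)\<close>. Consequently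
  \<open>(x / c)\<^sup>p = v x\<^sup>p \<Psi>(1 / v)\<close> is comparable to \<open>v * growth p \<Psi> x\<close>, in particular bounded, and
  since \<open>q \<ge> p\<close> the power \<open>(x / c)\<^sup>q\<close> is bounded by a multiple of \<open>(x / c)\<^sup>p\<close>.
\<close>

lemma growth_dominated_at_large_values:
  assumes \<Psi>: "\<Psi> \<in> class_L" and \<Phi>: "\<Phi> \<in> class_L" and p: "p > 0" and q: "p \<le> q" and V: "V > 0"
    and R: "R \<ge> 1" and A: "A \<ge> 1"
  obtains C where "C \<ge> 1"
    "\<And>v x. 0 < v \<Longrightarrow> v \<le> V \<Longrightarrow> 1 \<le> x \<Longrightarrow> v * growth p \<Psi> x \<le> R \<Longrightarrow> 1 + 1 / v \<le> A * (1 + x) ^ k \<Longrightarrow>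
       growth q \<Phi> x \<le> C * (v * growth q \<Phi> (peak p \<Psi> v)) * growth p \<Psi> x"
proof -
  obtain C1 where C1: "C1 \<ge> 1" "\<And>x. x \<ge> 0 \<Longrightarrow> \<Psi> x \<le> C1 * (1 + x) powr (p/2)"
    "\<And>x. x \<ge> 0 \<Longrightarrow> 1 \<le> C1 * (1 + x) powr (p/2) * \<Psi> x"
    by (rule class_L_power_bounds[OF \<Psi> half_gt_zero[OF p]]) (rule that)
  obtain m :: nat where m: "real m \<ge> 2 / p" using real_arch_simple by blast
  define B0 where "B0 = 1 + (2 powr (p/2) * C1 * R) powr (2/p)"
  have B0: "B0 \<ge> 1" by (simp add: B0_def)
  define n where "n = max m k"
  define B where "B = max A B0"
  have B: "B \<ge> 1" using A by (simp add: B_def)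
  obtain C2 where C2: "C2 \<ge> 1" "\<And>x y. 0 \<le> x \<Longrightarrow> 0 \<le> y \<Longrightarrow> 1 + y \<le> B * (1 + x) ^ n
      \<Longrightarrow> 1 + x \<le> B * (1 + y) ^ n \<Longrightarrow> \<Psi> x \<le> C2 * \<Psi> y"
    by (rule class_L_slow[OF \<Psi> B]) (rule that)
  obtain C3 where C3: "C3 \<ge> 1" "\<And>x y. 0 \<le> x \<Longrightarrow> 0 \<le> y \<Longrightarrow> 1 + y \<le> B * (1 + x) ^ n
      \<Longrightarrow> 1 + x \<le> B * (1 + y) ^ n \<Longrightarrow> \<Phi> x \<le> C3 * \<Phi> y"
    by (rule class_L_slow[OF \<Phi> B]) (rule that)
  obtain C4 where C4: "C4 \<ge> 1"
    "\<And>v w. 0 < v \<Longrightarrow> 0 < w \<Longrightarrow> v \<le> V \<Longrightarrow> v \<le> 1 * w \<Longrightarrow> w \<le> 1 * v \<Longrightarrow> \<Phi> (peak p \<Psi> v) \<le> C4 * \<Phi> (1 / w)"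
    "\<And>v w. 0 < v \<Longrightarrow> 0 < w \<Longrightarrow> v \<le> V \<Longrightarrow> v \<le> 1 * w \<Longrightarrow> w \<le> 1 * v \<Longrightarrow> \<Phi> (1 / w) \<le> C4 * \<Phi> (peak p \<Psi> v)"
    by (rule class_L_peak_compare[OF \<Psi> \<Phi> p V order_refl]) (rule that)
  have qp: "q / p \<ge> 1" using p q by simp
  define E where "E = (C2 * R) powr (q / p - 1)"
  have C2R: "C2 * R \<ge> 1" using mult_mono[of 1 C2 1 R] C2(1) R by simp
  have E: "E \<ge> 1" unfolding E_def using C2R qp by (intro ge_one_powr_ge_zero) auto
  show ?thesis
  proof (rule that[of "C3 * C4 * (E * C2)"])
    have "1 * 1 * (1 * 1) \<le> C3 * C4 * (E * C2)"
      using C3(1) C4(1) C2(1) E by (intro mult_mono) auto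
    then show "C3 * C4 * (E * C2) \<ge> 1" by simp
    fix v x :: real
    assume v: "0 < v" "v \<le> V" and x: "1 \<le> x" and bd: "v * growth p \<Psi> x \<le> R"
      and vx: "1 + 1 / v \<le> A * (1 + x) ^ k"
    define X where "X = 1 + 1 / v"
    have X: "X \<ge> 1" "1 / v \<le> X" using v by (auto simp: X_def)
    define c where "c = peak p \<Psi> v"
    have c: "c > 0" using peak_pos[OF \<Psi> v(1)] by (simp add: c_def)
    have ps: "\<Psi> (1/v) > 0" "\<Phi> (1/v) > 0" "\<Phi> c > 0" "\<Psi> x > 0"
      using class_L_pos[OF \<Psi>] class_L_pos[OF \<Phi>] v c x by auto
    have cp: "c powr p = 1 / (v * \<Psi> (1 / v))" using peak_powr(1)[OF \<Psi> v(1) p] by (simp add: c_def)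
    \<comment> \<open>x is at most a power of X\<close>
    have "(1 + x) powr (p/2) \<le> (2 * x) powr (p/2)" using x p by (intro powr_mono2) auto
    then have "1 \<le> C1 * (2 * x) powr (p/2) * \<Psi> x"
      using C1(3)[of x] C1(1) x ps
      by (meson dual_order.trans less_imp_le mult_left_mono mult_right_mono order_trans zero_le_one)
    then have "x powr p * 1 \<le> x powr p * (C1 * (2 * x) powr (p/2) * \<Psi> x)"
      by (rule mult_left_mono) simp
    also have "\<dots> = (C1 * (2 * x) powr (p/2)) * growth p \<Psi> x" by (simp add: growth_def)
    also have "\<dots> \<le> (C1 * (2 * x) powr (p/2)) * (R / v)"
      using bd v C1(1) by (intro mult_left_mono) (auto simp: field_simps)
    also have "\<dots> \<le> (C1 * (2 * x) powr (p/2)) * (R * X)"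
      using X R C1(1) mult_left_mono[OF X(2), of R] by (intro mult_left_mono) auto
    also have "\<dots> = (2 powr (p/2) * C1 * R * X) * x powr (p/2)" using x by (simp add: powr_mult mult_ac)
    finally have "x powr (p/2) * x powr (p/2) \<le> (2 powr (p/2) * C1 * R * X) * x powr (p/2)"
      by (simp add: powr_add[symmetric])
    then have "x powr (p/2) \<le> 2 powr (p/2) * C1 * R * X" using x by (simp add: mult_le_cancel_right)
    then have "(x powr (p/2)) powr (2/p) \<le> (2 powr (p/2) * C1 * R * X) powr (2/p)"
      using p by (intro powr_mono2) auto
    also have "(x powr (p/2)) powr (2/p) = x" using x p by (simp add: powr_powr)
    also have "(2 powr (p/2) * C1 * R * X) powr (2/p) = (2 powr (p/2) * C1 * R) powr (2/p) * X powr (2/p)"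
      by (rule powr_mult)
    also have "\<dots> \<le> (2 powr (p/2) * C1 * R) powr (2/p) * X ^ m"
      using X m by (intro mult_left_mono powr_le_power) auto
    finally have "1 + x \<le> 1 * X ^ m + (2 powr (p/2) * C1 * R) powr (2/p) * X ^ m"
      using one_le_power[OF X(1), of m] by simp
    also have "\<dots> = B0 * X ^ m" by (simp add: B0_def algebra_simps)
    also have "\<dots> \<le> B * X ^ n" using B0 X by (intro mult_mono power_increasing) (auto simp: B_def n_def)
    finally have x1: "1 + x \<le> B * (1 + 1 / v) ^ n" by (simp add: X_def)
    have "A * (1 + x) ^ k \<le> B * (1 + x) ^ n"
      using A x by (intro mult_mono power_increasing) (auto simp: B_def n_def)
    with vx have x2: "1 + 1 / v \<le> B * (1 + x) ^ n" by simp
    have "\<Phi> x \<le> C3 * \<Phi> (1/v)" using x1 x2 x v by (intro C3) auto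
    also have "\<dots> \<le> C3 * (C4 * \<Phi> c)" using C3(1) v by (intro mult_left_mono) (auto simp: c_def intro!: C4(3))
    finally have phi: "\<Phi> x \<le> C3 * C4 * \<Phi> c" by simp
    have "\<Psi> (1/v) \<le> C2 * \<Psi> x" using x1 x2 x v by (intro C2) auto
    then have "v * (x powr p * \<Psi> (1/v)) \<le> v * (x powr p * (C2 * \<Psi> x))"
      using v by (intro mult_left_mono) auto
    then have y1: "v * (x powr p * \<Psi> (1/v)) \<le> C2 * (v * growth p \<Psi> x)"
      by (simp add: growth_def mult_ac)
    define y where "y = (x / c) powr p"
    have y: "y = v * (x powr p * \<Psi> (1/v))" using x c ps v by (simp add: y_def powr_divide cp)
    have y0: "y > 0" using x c by (simp add: y_def)
    have "C2 * (v * growth p \<Psi> x) \<le> C2 * R" using bd C2(1) by (intro mult_left_mono) auto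
    with y1 have yR: "y \<le> C2 * R" unfolding y by (rule order_trans)
    have "(x / c) powr q = y powr (q / p)" using x c p by (simp add: y_def powr_powr)
    also have "\<dots> = y powr (q / p - 1) * y" using y0 by (simp add: powr_diff)
    also have "\<dots> \<le> E * y" unfolding E_def using yR y0 qp by (intro mult_right_mono powr_mono2) auto
    also have "\<dots> \<le> E * (C2 * (v * growth p \<Psi> x))" using y1 y E by (intro mult_left_mono) auto
    finally have xc: "(x / c) powr q \<le> E * C2 * (v * growth p \<Psi> x)" by simp
    have "growth q \<Phi> x = (x / c) powr q * c powr q * \<Phi> x"
      using x c by (simp add: growth_def powr_divide)
    also have "\<dots> \<le> (E * C2 * (v * growth p \<Psi> x)) * c powr q * (C3 * C4 * \<Phi> c)"
      using xc phi class_L_pos[OF \<Phi>, of x] x growth_nonneg[OF \<Psi>, of x p] E C2(1) v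
      by (intro mult_mono) auto
    also have "\<dots> = C3 * C4 * (E * C2) * (v * growth q \<Phi> c) * growth p \<Psi> x"
      by (simp add: growth_def mult_ac)
    finally show "growth q \<Phi> x \<le> C3 * C4 * (E * C2) * (v * growth q \<Phi> (peak p \<Psi> v)) * growth p \<Psi> x"
      by (simp add: c_def)
  qed
qed


section \<open>The embedding estimate\<close>

text \<open>
  The \<open>\<omega>\<close>-mass of a Carleson square at level \<open>j\<close>, up to constants; see \<open>carleson_square_mass\<close>.
\<close>

definition box_mass :: "(complex \<Rightarrow> real) \<Rightarrow> nat \<Rightarrow> real" where
  "box_mass \<omega> j = (1 / 2) ^ j * dyadic_tail \<omega> j"

lemma box_mass_pos: "\<omega> \<in> class_D \<Longrightarrow> box_mass \<omega> j > 0"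
  by (simp add: box_mass_def dyadic_tail_pos)

lemma box_mass_le:
  assumes \<omega>: "\<omega> \<in> class_D" shows "box_mass \<omega> j \<le> dyadic_tail \<omega> 0"
proof -
  have "box_mass \<omega> j \<le> 1 * dyadic_tail \<omega> 0"
    unfolding box_mass_def using dyadic_tail_mono[OF \<omega>, of 0 j] dyadic_tail_pos[OF \<omega>, of j]
    by (intro mult_mono) (auto simp: power_le_one)
  then show ?thesis by simp
qed

text \<open>
  The first doubling condition: the tail decays at most geometrically.
\<close>

lemma box_mass_lower:
  assumes \<omega>: "\<omega> \<in> class_D"
  obtains A B where "A \<ge> 1" "B \<ge> 1" "\<And>j. 1 + 1 / box_mass \<omega> j \<le> A * B ^ j"
proof -
  obtain D :: real where D: "D \<ge> 1" and
    dbl: "\<And>j. dyadic_tail \<omega> j \<le> D * dyadic_tail \<omega> (Suc j)"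
    using class_D_dyadic[OF \<omega>] by metis
  have Wp: "dyadic_tail \<omega> i > 0" for i using dyadic_tail_pos[OF \<omega>] .
  have W: "dyadic_tail \<omega> 0 \<le> D ^ j * dyadic_tail \<omega> j" for j
  proof (induction j)
    case (Suc j)
    have "D ^ j * dyadic_tail \<omega> j \<le> D ^ j * (D * dyadic_tail \<omega> (Suc j))"
      using dbl D by (intro mult_left_mono) auto
    with Suc show ?case by (simp add: mult_ac)
  qed simp
  show ?thesis
  proof (rule that[of "1 + 1 / dyadic_tail \<omega> 0" "2 * D"])
    show "1 \<le> 1 + 1 / dyadic_tail \<omega> 0" using Wp[of 0] by simp
    show "1 \<le> 2 * D" using D by simp
    fix j
    have "1 / box_mass \<omega> j = 2 ^ j / dyadic_tail \<omega> j" by (simp add: box_mass_def power_divide)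
    also have "\<dots> \<le> 2 ^ j * (D ^ j / dyadic_tail \<omega> 0)"
      using W[of j] Wp[of j] Wp[of 0] by (simp add: field_simps)
    also have "\<dots> = 1 / dyadic_tail \<omega> 0 * (2 * D) ^ j" by (simp add: power_mult_distrib)
    finally have "1 / box_mass \<omega> j \<le> 1 / dyadic_tail \<omega> 0 * (2 * D) ^ j" .
    moreover have "1 \<le> (2 * D) ^ j" using D by (intro one_le_power) auto
    ultimately show "1 + 1 / box_mass \<omega> j \<le> (1 + 1 / dyadic_tail \<omega> 0) * (2 * D) ^ j"
      unfolding distrib_right by (intro add_mono) auto
  qed
qed

text \<open>
  The second doubling condition: the tail decays at least geometrically, so the mass of a
  square beats \<open>2\<^sup>-\<^sup>j\<close> by an exponential factor. The gain \<open>L\<close> is what makes the series in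
  \<open>embedding_estimate\<close> converge.
\<close>

lemma box_mass_upper:
  assumes \<omega>: "\<omega> \<in> class_D"
  obtains A L where "A \<ge> 1" "L > 0" "\<And>j. 2 powr (real j * (1 + L)) \<le> A * (1 + 1 / box_mass \<omega> j)"
proof -
  obtain \<kappa> :: real and m :: nat where k: "\<kappa> > 1" "m \<ge> 1" and
    dec: "\<And>j. \<kappa> * dyadic_tail \<omega> (j + m) \<le> dyadic_tail \<omega> j"
    using class_D_dyadic[OF \<omega>] by metis
  define W where "W = dyadic_tail \<omega>"
  have Wp: "W i > 0" for i using dyadic_tail_pos[OF \<omega>] by (simp add: W_def)
  have it: "\<kappa> ^ i * W (i * m) \<le> W 0" for i
  proof (induction i)
    case (Suc i)
    have "\<kappa> ^ Suc i * W (Suc i * m) = \<kappa> ^ i * (\<kappa> * W (i * m + m))" by (simp add: add.commute)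
    also have "\<dots> \<le> \<kappa> ^ i * W (i * m)" using dec k by (intro mult_left_mono) (auto simp: W_def)
    also have "\<dots> \<le> W 0" by (rule Suc)
    finally show ?case .
  qed simp
  define L where "L = log 2 \<kappa> / real m"
  have L: "L > 0" using k by (simp add: L_def)
  define A where "A = max 1 (\<kappa> * W 0)"
  show ?thesis
  proof (rule that[of A L])
    fix j
    define i where "i = j div m"
    have jm: "real j \<le> real m * real i + real m"
    proof -
      have "j \<le> m * i + m" using k mod_less_divisor[of m j] unfolding i_def
        by (metis add_left_mono less_imp_le_nat less_le_trans mult_div_mod_eq zero_less_one)
      then show ?thesis by (metis of_nat_add of_nat_mono of_nat_mult)
    qed
    have "2 powr (real j * L) \<le> 2 powr ((real m * real i + real m) * L)"
      using jm L by (intro powr_mono mult_right_mono) auto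
    also have "(real m * real i + real m) * L = log 2 \<kappa> * real i + log 2 \<kappa>"
      using k by (simp add: L_def field_simps)
    also have "2 powr \<dots> = \<kappa> ^ i * \<kappa>"
      using k by (simp add: powr_add powr_powr[symmetric] powr_realpow)
    finally have 1: "2 powr (real j * L) \<le> \<kappa> ^ i * \<kappa>" .
    have "W j \<le> W (i * m)" unfolding W_def i_def by (intro dyadic_tail_mono[OF \<omega>]) simp
    then have "\<kappa> ^ i * W j \<le> \<kappa> ^ i * W (i * m)" using k by (intro mult_left_mono) auto
    also have "\<dots> \<le> W 0" by (rule it)
    finally have 2: "\<kappa> ^ i \<le> W 0 / W j" using Wp[of j] by (simp add: field_simps)
    have "2 powr (real j * L) \<le> (W 0 / W j) * \<kappa>"
      using 1 2 k mult_right_mono[OF 2, of \<kappa>] by linarith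
    then have "2 ^ j * 2 powr (real j * L) \<le> 2 ^ j * ((W 0 / W j) * \<kappa>)" by (intro mult_left_mono) auto
    also have "\<dots> = \<kappa> * W 0 * (1 / box_mass \<omega> j)" by (simp add: box_mass_def W_def power_divide)
    also have "\<dots> \<le> A * (1 + 1 / box_mass \<omega> j)"
      using box_mass_pos[OF \<omega>, of j] k Wp[of 0] by (intro mult_mono) (auto simp: A_def)
    also have "2 ^ j * 2 powr (real j * L) = 2 powr (real j * (1 + L))"
      by (simp add: powr_add distrib_left powr_realpow)
    finally show "2 powr (real j * (1 + L)) \<le> A * (1 + 1 / box_mass \<omega> j)" .
  qed (use L in \<open>auto simp: A_def\<close>)
qed

lemma ennreal_le_divide_mult:
  fixes x y :: ennreal
  assumes "ennreal a * x \<le> ennreal b * y" "a > 0" "b \<ge> 0"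
  shows "x \<le> ennreal (b / a) * y"
proof -
  have "ennreal a * x \<le> ennreal (a * (b / a)) * y" using assms by simp
  also have "\<dots> = ennreal a * (ennreal (b / a) * y)"
    using assms by (subst ennreal_mult) (auto simp: mult.assoc)
  finally show ?thesis using assms by (subst (asm) ennreal_mult_le_mult_iff) auto
qed

lemma suminf_dyadic_indicator_le:
  "(\<Sum>j. indicator {dyadic_radius (j + i)..<dyadic_radius (Suc (j + i))} x) \<le> (1 :: ennreal)"
proof -
  have "disjoint_family (\<lambda>j. {dyadic_radius (j + i)..<dyadic_radius (Suc (j + i))})"
    unfolding disjoint_family_on_def
  proof (intro ballI impI)
    fix a b :: nat assume "a \<noteq> b"
    then consider "Suc (a + i) \<le> b + i" | "Suc (b + i) \<le> a + i" by linarith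
    then show "{dyadic_radius (a + i)..<dyadic_radius (Suc (a + i))} \<inter> {dyadic_radius (b + i)..<dyadic_radius (Suc (b + i))} = {}"
    proof cases
      case 1 from dyadic_radius_mono[OF this] show ?thesis by auto
    next
      case 2 from dyadic_radius_mono[OF this] show ?thesis by auto
    qed
  qed
  from suminf_indicator[OF this] show ?thesis by (simp add: indicator_def)
qed

lemma dyadic_indicator_split:
  "indicator {dyadic_radius n..<dyadic_radius (n + m)} x =
    (\<Sum>i<m. indicator {dyadic_radius (n + i)..<dyadic_radius (Suc (n + i))} x :: ennreal)"
proof (induction m)
  case (Suc m)
  have "dyadic_radius n \<le> dyadic_radius (n + m)" "dyadic_radius (n + m) \<le> dyadic_radius (Suc (n + m))"
    by (auto intro: dyadic_radius_mono)
  then have "indicator {dyadic_radius n..<dyadic_radius (n + Suc m)} x =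
    indicator {dyadic_radius n..<dyadic_radius (n + m)} x + (indicator {dyadic_radius (n + m)..<dyadic_radius (Suc (n + m))} x :: ennreal)"
    by (auto simp: indicator_def)
  with Suc show ?case by simp
qed simp

text \<open>
  The sub-mean value inequality on a disc of radius \<open>2\<^sup>-\<^sup>j / 16\<close>, followed by \<open>annulus_transfer\<close>.
\<close>

lemma growth_pointwise:
  assumes \<omega>: "\<omega> \<in> class_D" and \<Psi>: "\<Psi> \<in> class_L" and p: "p > 0"
  obtains C where "C \<ge> 1"
    "\<And>f j z R. f holomorphic_on ball 0 1 \<Longrightarrow> dyadic_radius j \<le> cmod z \<Longrightarrow> cmod z < dyadic_radius (Suc j) \<Longrightarrow>
       modular p \<Psi> (weighted_area \<omega>) f \<le> ennreal R \<Longrightarrow> R \<ge> 0 \<Longrightarrow> box_mass \<omega> j * growth p \<Psi> (cmod (f z)) \<le> C * R"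
proof -
  obtain C1 where C1: "C1 \<ge> 1" and subm:
    "\<And>f z \<rho>. \<rho> > 0 \<Longrightarrow> f holomorphic_on ball z \<rho> \<Longrightarrow>
      ennreal (growth p \<Psi> (cmod (f z))) * ennreal (pi * \<rho>\<^sup>2)
       \<le> ennreal C1 * (\<integral>\<^sup>+w\<in>ball z \<rho>. ennreal (growth p \<Psi> (cmod (f w))) \<partial>lborel)"
    by (rule growth_area_submean[OF \<Psi> p]) (rule that)
  obtain C2 :: real and m :: nat where C2: "C2 \<ge> 1" and trans:
    "\<And>f j. f holomorphic_on ball 0 1 \<Longrightarrow>
       ennreal (2 ^ j * dyadic_tail \<omega> j) * (\<integral>\<^sup>+z. ennreal (growth p \<Psi> (cmod (f z))) * indicator (ball 0 1) z *
         indicator {dyadic_radius (j + 2) - 2 * (1 / 2) ^ j..<dyadic_radius (j + 2)} (cmod z) \<partial>lborel)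
       \<le> ennreal C2 * (\<integral>\<^sup>+z. ennreal (growth p \<Psi> (cmod (f z))) * indicator (ball 0 1) z *
         indicator {dyadic_radius (j + 2)..<dyadic_radius (j + 2 + m)} (cmod z) \<partial>weighted_area \<omega>)"
    by (rule annulus_transfer[OF \<omega> \<Psi> p]) (rule that)
  define B where "B = C1 * C2 * 256"
  have "1 * 1 * 1 \<le> B" unfolding B_def using C1 C2 by (intro mult_mono) auto
  then have B: "B \<ge> 1" by simp
  show ?thesis
  proof (rule that[OF B])
    fix f j z R
    assume hol: "f holomorphic_on ball 0 1" and z: "dyadic_radius j \<le> cmod z" "cmod z < dyadic_radius (Suc j)"
      and R: "modular p \<Psi> (weighted_area \<omega>) f \<le> ennreal R" "R \<ge> 0"
    define h :: real where "h = (1/2) ^ j"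
    have h: "h > 0" by (simp add: h_def)
    have rad: "dyadic_radius j = 1 - h" "dyadic_radius (Suc j) = 1 - h / 2" "dyadic_radius (j + 2) = 1 - h / 4"
      by (simp_all add: dyadic_radius_def h_def)
    have in_ann: "1 - h / 4 - 2 * h \<le> cmod w \<and> cmod w < 1 - h / 4" if "w \<in> ball z (h / 16)" for w
    proof -
      have "cmod z - cmod w < h / 16" "cmod w - cmod z < h / 16"
        using norm_triangle_ineq2[of z w] norm_triangle_ineq2[of w z] that
        by (simp_all add: dist_norm norm_minus_commute)
      then show ?thesis using z h unfolding rad by linarith
    qed
    define U where "U z = ennreal (growth p \<Psi> (cmod (f z))) * indicator (ball 0 1) z" for z
    define k where "k = (indicator {dyadic_radius (j + 2) - 2 * (1 / 2) ^ j..<dyadic_radius (j + 2)} :: real \<Rightarrow> ennreal)"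
    define g where "g = growth p \<Psi> (cmod (f z))"
    have g: "g \<ge> 0" unfolding g_def by (intro growth_nonneg[OF \<Psi>]) auto
    have "ennreal g * ennreal (pi * (h / 16)\<^sup>2) \<le> ennreal C1 * (\<integral>\<^sup>+w\<in>ball z (h / 16). ennreal (growth p \<Psi> (cmod (f w))) \<partial>lborel)"
      unfolding g_def
    proof (rule subm)
      show "f holomorphic_on ball z (h / 16)"
        by (rule holomorphic_on_subset[OF hol]) (use in_ann h in force)
    qed (use h in simp)
    also have "\<dots> \<le> ennreal C1 * (\<integral>\<^sup>+w. U w * k (cmod w) \<partial>lborel)"
    proof (intro mult_left_mono nn_integral_mono)
      fix w
      show "ennreal (growth p \<Psi> (cmod (f w))) * indicator (ball z (h / 16)) w \<le> U w * k (cmod w)"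
      proof (cases "w \<in> ball z (h / 16)")
        case True
        from in_ann[OF this] have "cmod w < 1" "k (cmod w) = 1"
          using h by (auto simp: k_def rad[simplified] h_def[symmetric] indicator_def)
        then show ?thesis using True by (simp add: U_def)
      qed simp
    qed simp
    finally have 1: "ennreal g * ennreal (pi * (h / 16)\<^sup>2) \<le> ennreal C1 * (\<integral>\<^sup>+w. U w * k (cmod w) \<partial>lborel)" .
    define w where "w = 2 ^ j * dyadic_tail \<omega> j"
    have w: "w > 0" using dyadic_tail_pos[OF \<omega>] by (simp add: w_def)
    have vw: "w * h\<^sup>2 = box_mass \<omega> j"
      by (simp add: w_def h_def box_mass_def power2_eq_square power_divide)
    have "ennreal (box_mass \<omega> j * g * (pi / 256)) = ennreal w * (ennreal g * ennreal (pi * (h / 16)\<^sup>2))"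
      using g w h by (simp add: vw[symmetric] ennreal_mult[symmetric] power_divide mult_ac)
    also have "\<dots> \<le> ennreal w * (ennreal C1 * (\<integral>\<^sup>+w. U w * k (cmod w) \<partial>lborel))"
      using 1 by (intro mult_left_mono) auto
    also have "\<dots> = ennreal C1 * (ennreal w * (\<integral>\<^sup>+w. U w * k (cmod w) \<partial>lborel))" by (simp add: mult_ac)
    also have "\<dots> \<le> ennreal C1 * (ennreal C2 * (\<integral>\<^sup>+z. U z * indicator {dyadic_radius (j + 2)..<dyadic_radius (j + 2 + m)} (cmod z) \<partial>weighted_area \<omega>))"
      unfolding U_def k_def w_def by (intro mult_left_mono trans hol) auto
    also have "\<dots> \<le> ennreal C1 * (ennreal C2 * modular p \<Psi> (weighted_area \<omega>) f)"
      unfolding modular_def U_def growth_def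
      by (intro mult_left_mono nn_integral_mono) (auto simp: indicator_def)
    also have "\<dots> \<le> ennreal C1 * (ennreal C2 * ennreal R)" using R by (intro mult_left_mono) auto
    also have "\<dots> = ennreal (C1 * C2 * R)" using C1 C2 R by (simp add: ennreal_mult mult.assoc)
    finally have "box_mass \<omega> j * g * (pi / 256) \<le> C1 * C2 * R"
      using C1 C2 R(2) by (subst (asm) ennreal_le_iff) auto
    then have "box_mass \<omega> j * g * pi \<le> B * R" by (simp add: B_def)
    moreover have "box_mass \<omega> j * g * 1 \<le> box_mass \<omega> j * g * pi"
      using box_mass_pos[OF \<omega>, of j] g pi_gt3 by (intro mult_left_mono) auto
    ultimately show "box_mass \<omega> j * growth p \<Psi> (cmod (f z)) \<le> B * R" by (simp add: g_def)
  qed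
qed

text \<open>
  On the annulus at level \<open>j\<close>, split the values of \<open>|f|\<close> at the threshold \<open>t\<^sub>j = 2\<^bsup>jd\<^esup>\<close>. Above it,
  \<open>growth_dominated_at_large_values\<close> reduces \<open>q\<close> to \<open>p\<close>, and \<open>carleson_covering\<close> with
  \<open>annulus_transfer\<close> bounds the \<open>\<mu>\<close>-integral by \<open>G\<close> times the part of the modular of \<open>f\<close> over an
  annulus; these annuli overlap at most \<open>m\<close> times. Below it, the integrand is at most \<open>C 2\<^bsup>jL/4\<^esup>\<close>,
  and the \<open>\<mu>\<close>-mass of the annulus is at most \<open>C 2\<^sup>j G / Q\<^sub>j\<close> by \<open>carleson_covering\<close> for the constant
  1. Since \<open>Q\<^sub>j\<close> is at least a multiple of \<open>2\<^bsup>j(1 + 3L/4)\<^esup>\<close>, this contributes a geometric series.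
  For compactness it matters that the bound is linear in \<open>G\<close>, with a constant that does not
  depend on \<open>J\<close>.
\<close>

lemma embedding_estimate:
  assumes \<omega>: "\<omega> \<in> class_D" and \<Psi>: "\<Psi> \<in> class_L" and \<Phi>: "\<Phi> \<in> class_L" and p: "p > 0" and q: "p \<le> q"
    and R: "R \<ge> 0"
  obtains C where "C \<ge> 0"
    "\<And>\<mu> J G f. finite_borel_measure_on_disc \<mu> \<Longrightarrow> G \<ge> 0 \<Longrightarrow>
      \<forall>j\<ge>J. \<forall>a. cmod a = dyadic_radius j \<longrightarrow>
          measure \<mu> (carleson_square a) * growth q \<Phi> (peak p \<Psi> (box_mass \<omega> j)) \<le> G \<Longrightarrow>
      f holomorphic_on ball 0 1 \<Longrightarrow> modular p \<Psi> (weighted_area \<omega>) f \<le> ennreal R \<Longrightarrow>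
      (\<integral>\<^sup>+z. ennreal (growth q \<Phi> (cmod (f z))) * indicator {dyadic_radius J..} (cmod z) \<partial>\<mu>) \<le> ennreal (C * G)"
proof -
  have q0: "q > 0" using p q by simp
  obtain C1 where C1: "C1 \<ge> 1" and subm:
    "\<And>f z \<rho>. \<rho> > 0 \<Longrightarrow> f holomorphic_on ball z \<rho> \<Longrightarrow>
      ennreal (growth p \<Psi> (cmod (f z))) * ennreal (pi * \<rho>\<^sup>2)
       \<le> ennreal C1 * (\<integral>\<^sup>+w\<in>ball z \<rho>. ennreal (growth p \<Psi> (cmod (f w))) \<partial>lborel)"
    by (rule growth_area_submean[OF \<Psi> p]) (rule that)
  obtain C2 :: real and m :: nat where C2: "C2 \<ge> 1" and trans:
    "\<And>f j. f holomorphic_on ball 0 1 \<Longrightarrow>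
       ennreal (2 ^ j * dyadic_tail \<omega> j) * (\<integral>\<^sup>+z. ennreal (growth p \<Psi> (cmod (f z))) * indicator (ball 0 1) z *
         indicator {dyadic_radius (j + 2) - 2 * (1 / 2) ^ j..<dyadic_radius (j + 2)} (cmod z) \<partial>lborel)
       \<le> ennreal C2 * (\<integral>\<^sup>+z. ennreal (growth p \<Psi> (cmod (f z))) * indicator (ball 0 1) z *
         indicator {dyadic_radius (j + 2)..<dyadic_radius (j + 2 + m)} (cmod z) \<partial>weighted_area \<omega>)"
    by (rule annulus_transfer[OF \<omega> \<Psi> p]) (rule that)
  obtain C5 where C5: "C5 \<ge> 1"
    "\<And>f j z R. f holomorphic_on ball 0 1 \<Longrightarrow> dyadic_radius j \<le> cmod z \<Longrightarrow> cmod z < dyadic_radius (Suc j) \<Longrightarrow>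
       modular p \<Psi> (weighted_area \<omega>) f \<le> ennreal R \<Longrightarrow> R \<ge> 0 \<Longrightarrow> box_mass \<omega> j * growth p \<Psi> (cmod (f z)) \<le> C5 * R"
    by (rule growth_pointwise[OF \<omega> \<Psi> p]) (rule that)
  obtain A B where AB: "A \<ge> 1" "B \<ge> 1" and vlow: "\<And>j. 1 + 1 / box_mass \<omega> j \<le> A * B ^ j"
    by (rule box_mass_lower[OF \<omega>]) (rule that)
  obtain A' L where A': "A' \<ge> 1" and L: "L > 0" and
    vup: "\<And>j. 2 powr (real j * (1 + L)) \<le> A' * (1 + 1 / box_mass \<omega> j)"
    by (rule box_mass_upper[OF \<omega>]) (rule that)
  define V where "V = dyadic_tail \<omega> 0"
  have V: "V > 0" using dyadic_tail_pos[OF \<omega>] by (simp add: V_def)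
  define v where "v = box_mass \<omega>"
  have v: "v j > 0" "v j \<le> V" for j using box_mass_pos[OF \<omega>] box_mass_le[OF \<omega>] by (auto simp: v_def V_def)
  \<comment> \<open>\<open>(1 + L) (1 - e) = 1 + 3L/4\<close>; together with the values \<open>2\<^bsup>jL/4\<^esup>\<close> below the threshold this leaves
    the factor \<open>2\<^bsup>-jL/2\<^esup>\<close>\<close>
  define e where "e = L / (4 * (1 + L))"
  have e: "0 < e" "e \<le> 1" "e * (1 + L) = L / 4" using L by (auto simp: e_def field_simps)
  define d' where "d' = L / 4"
  define d where "d = d' / (2 * q)"
  have d: "d > 0" "d' > 0" "2 * q * d = d'" using L q0 by (auto simp: d_def d'_def)
  define t where "t j = 2 powr (real j * d)" for j
  have t1: "t j \<ge> 1" for j unfolding t_def using d by (intro ge_one_powr_ge_zero) auto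
  \<comment> \<open>above the threshold, \<open>1 / v\<^sub>j \<le> A B\<^sup>j \<le> A t\<^sub>j\<^sup>k\<close> is bounded by a power of the value\<close>
  obtain k :: nat where k: "real k \<ge> log 2 B / d" using real_arch_simple by blast
  have Bt: "B ^ j \<le> t j ^ k" for j
  proof -
    have "B ^ j = 2 powr (log 2 B * real j)" using AB by (simp add: powr_powr[symmetric] powr_realpow)
    also have "\<dots> \<le> 2 powr (real k * d * real j)"
      using k d by (intro powr_mono mult_right_mono) (auto simp: field_simps)
    also have "\<dots> = t j ^ k"
    proof -
      have "t j ^ k = t j powr real k" using t1[of j] by (simp add: powr_realpow)
      then show ?thesis by (simp add: t_def powr_powr mult_ac)
    qed
    finally show ?thesis .
  qed
  define R' where "R' = max 1 (C5 * R)"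
  have R': "R' \<ge> 1" by (simp add: R'_def)
  obtain C3 where C3: "C3 \<ge> 1" and high:
    "\<And>v x. 0 < v \<Longrightarrow> v \<le> V \<Longrightarrow> 1 \<le> x \<Longrightarrow> v * growth p \<Psi> x \<le> R' \<Longrightarrow> 1 + 1 / v \<le> A * (1 + x) ^ k \<Longrightarrow>
       growth q \<Phi> x \<le> C3 * (v * growth q \<Phi> (peak p \<Psi> v)) * growth p \<Psi> x"
    by (rule growth_dominated_at_large_values[OF \<Psi> \<Phi> p q V R' AB(1)]) (rule that)
  obtain C4 where C4: "C4 \<ge> 1" "\<And>x. x \<ge> 0 \<Longrightarrow> \<Phi> x \<le> C4 * (1 + x) powr q"
    "\<And>x. x \<ge> 0 \<Longrightarrow> 1 \<le> C4 * (1 + x) powr q * \<Phi> x"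
    by (rule class_L_power_bounds[OF \<Phi> q0]) (rule that)
  obtain C6 where C6: "C6 \<ge> 1"
    "\<And>v. 0 < v \<Longrightarrow> v \<le> V \<Longrightarrow> (1 + 1 / v) powr (1 - e) \<le> C6 * growth q \<Phi> (peak p \<Psi> v)"
    by (rule growth_peak_lower[OF \<Psi> \<Phi> p q V e(1,2)]) (rule that)
  define Q where "Q j = growth q \<Phi> (peak p \<Psi> (v j))" for j
  have Q: "Q j > 0" for j unfolding Q_def by (intro growth_pos \<Phi> peak_pos \<Psi> v)
  define C7 where "C7 = C4 * 2 powr q"
  have C7: "C7 > 0" using C4(1) by (simp add: C7_def)
  have low: "growth q \<Phi> x \<le> C7 * 2 powr (real j * d')" if x: "0 \<le> x" "x \<le> t j" for x j
  proof -
    have "\<Phi> x \<le> C4 * (1 + x) powr q" by (rule C4(2)[OF x(1)])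
    also have "\<dots> \<le> C4 * (2 * t j) powr q"
      using C4(1) x t1[of j] q0 by (intro mult_left_mono powr_mono2) auto
    finally have "growth q \<Phi> x \<le> t j powr q * (C4 * (2 * t j) powr q)"
      unfolding growth_def using x q0 class_L_pos[OF \<Phi> x(1)] by (intro mult_mono powr_mono2) auto
    also have "\<dots> = C7 * (t j powr q * t j powr q)" by (simp add: C7_def powr_mult)
    also have "t j powr q * t j powr q = 2 powr (real j * d')"
      unfolding t_def by (simp add: powr_powr powr_add[symmetric] d(3)[symmetric]) (simp add: field_simps)
    finally show ?thesis .
  qed
  have split: "growth q \<Phi> x \<le> C7 * 2 powr (real j * d') + C3 * (v j * Q j) * growth p \<Psi> x"
    if x: "0 \<le> x" "v j * growth p \<Psi> x \<le> R'" for x j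
  proof (cases "x \<le> t j")
    case True
    have "0 \<le> C3 * (v j * Q j) * growth p \<Psi> x"
      using C3 v[of j] Q[of j] growth_nonneg[OF \<Psi> x(1)] by auto
    then show ?thesis using low[OF x(1) True] by linarith
  next
    case False
    have "1 + 1 / v j \<le> A * B ^ j" using vlow by (simp add: v_def)
    also have "\<dots> \<le> A * (1 + x) ^ k"
      using AB False t1[of j] by (intro mult_left_mono order_trans[OF Bt] power_mono) auto
    finally have "growth q \<Phi> x \<le> C3 * (v j * Q j) * growth p \<Psi> x"
      unfolding Q_def using x False t1[of j] v by (intro high) auto
    moreover have "0 \<le> C7 * 2 powr (real j * d')" using C7 by simp
    ultimately show ?thesis by linarith
  qed
  define \<theta> where "\<theta> = 2 powr (- (L / 2))"
  have \<theta>: "0 < \<theta>" "\<theta> < 1" unfolding \<theta>_def using L by (auto simp: powr_less_one)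
  define C8 where "C8 = C6 * A'"
  have Qlow: "2 ^ j / Q j * 2 powr (real j * d') \<le> C8 * \<theta> ^ j" for j
  proof -
    have "2 powr (real j * (1 + L) * (1 - e)) = (2 powr (real j * (1 + L))) powr (1 - e)"
      by (simp add: powr_powr)
    also have "\<dots> \<le> (A' * (1 + 1 / v j)) powr (1 - e)"
      using vup[of j] e by (intro powr_mono2) (auto simp: v_def)
    also have "\<dots> = A' powr (1 - e) * (1 + 1 / v j) powr (1 - e)" by (rule powr_mult)
    also have "\<dots> \<le> A' powr 1 * (C6 * Q j)"
      using A' e C6 v[of j] by (intro mult_mono powr_mono) (auto simp: Q_def)
    finally have 1: "2 powr (real j * (1 + L) * (1 - e)) \<le> C8 * Q j" using A' by (simp add: C8_def mult_ac)
    have "(1 + L) * (1 - e) = 1 + L - e * (1 + L)" by (simp add: algebra_simps)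
    then have "(1 + L) * (1 - e) = 1 + 3 / 4 * L" unfolding e(3) by simp
    then have "real j * (1 + L) * (1 - e) = real j * (1 + 3 / 4 * L)" by (simp only: mult.assoc)
    then have "2 powr (real j * (1 + L) * (1 - e)) = 2 powr (real j * (1 + 3 / 4 * L))" by (simp only:)
    moreover have "2 ^ j * 2 powr (real j * d') = 2 powr (real j * (1 + 3 / 4 * L)) * \<theta> ^ j"
      by (simp add: powr_realpow[symmetric] \<theta>_def powr_powr powr_add[symmetric] d'_def) (simp add: algebra_simps)
    ultimately have "2 ^ j * 2 powr (real j * d') \<le> C8 * Q j * \<theta> ^ j"
      using 1 \<theta> by (metis less_imp_le mult_right_mono zero_le_power)
    then show ?thesis using Q[of j] by (simp add: field_simps)
  qed
  \<comment> \<open>\<open>1024\<close> and \<open>256\<close> come from dividing the area of the band, at most \<open>4\<pi>h\<close>, and the factor \<open>1\<close> by the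
    area \<open>\<pi> (h/16)\<^sup>2\<close> of the discs in the sub-mean value inequality\<close>
  define C9 where "C9 = 1024 * C7 * C8"
  have C8: "C8 \<ge> 0" using C6 A' by (simp add: C8_def)
  have C9: "C9 \<ge> 0" using C7 C8 by (simp add: C9_def)
  define C10 where "C10 = C3 * C1 * 256 * C2"
  have C10: "C10 \<ge> 0" using C3 C1 C2 by (simp add: C10_def)
  define C where "C = C9 / (1 - \<theta>) + C10 * (real m * R)"
  show ?thesis
  proof (rule that[of C])
    show "C \<ge> 0" using C9 C10 \<theta> R by (simp add: C_def)
    fix \<mu> J G f
    assume \<mu>: "finite_borel_measure_on_disc \<mu>" and G: "G \<ge> 0"
      and sq0: "\<forall>j\<ge>J. \<forall>a. cmod a = dyadic_radius j \<longrightarrow>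
          measure \<mu> (carleson_square a) * growth q \<Phi> (peak p \<Psi> (box_mass \<omega> j)) \<le> G"
      and hol: "f holomorphic_on ball 0 1" and md: "modular p \<Psi> (weighted_area \<omega>) f \<le> ennreal R"
    note m\<mu> = finite_borel_disc_measurable[OF \<mu>]
    define U where "U z = ennreal (growth p \<Psi> (cmod (f z))) * indicator (ball 0 1) z" for z
    have Um: "U \<in> borel_measurable borel"
      unfolding U_def by (intro growth_holomorphic_measurable[OF \<Psi> hol]) auto
    define g where "g j = (indicator {dyadic_radius j..<dyadic_radius (Suc j)} :: real \<Rightarrow> ennreal)" for j
    define I where "I j = (\<integral>\<^sup>+z. U z * indicator {dyadic_radius (j + 2)..<dyadic_radius (j + 2 + m)} (cmod z) \<partial>weighted_area \<omega>)" for j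
    have gm: "(\<lambda>z. g j (cmod z)) \<in> borel_measurable borel" for j unfolding g_def by measurable
    \<comment> \<open>one annulus: the first summand comes from the small values, the second from the large
      ones\<close>
    have step: "(\<integral>\<^sup>+z. ennreal (growth q \<Phi> (cmod (f z))) * g j (cmod z) \<partial>\<mu>)
        \<le> ennreal (G * (C9 * \<theta> ^ j)) + ennreal (C10 * G) * I j" if j: "J \<le> j" for j
    proof -
      define h :: real where "h = (1/2) ^ j"
      have h: "h > 0" by (simp add: h_def)
      define a where "a = pi * (h / 16)\<^sup>2"
      have a: "a > 0" using h by (simp add: a_def)
      define T where "T = G / Q j"
      have T: "T \<ge> 0" using G Q[of j] by (simp add: T_def)
      have Tsq: "measure \<mu> (carleson_square c) \<le> T" if "cmod c = dyadic_radius j" for c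
        using sq0[rule_format, OF j that] Q[of j] by (simp add: T_def Q_def v_def field_simps)
      have rad: "dyadic_radius j = 1 - h" "dyadic_radius (Suc j) = 1 - h / 2" "dyadic_radius (j + 2) = 1 - h / 4"
        by (simp_all add: dyadic_radius_def h_def)
      have 1: "(\<integral>\<^sup>+z. g j (cmod z) \<partial>\<mu>) \<le> ennreal (1024 * T * 2 ^ j)"
      proof -
        have "ennreal a * (\<integral>\<^sup>+z. 1 * g j (cmod z) \<partial>\<mu>) \<le> ennreal 1 * (ennreal T * (\<integral>\<^sup>+z. 1 * indicator {dyadic_radius (j + 2) - 2 * (1 / 2) ^ j..<dyadic_radius (j + 2)} (cmod z) \<partial>lborel))"
          unfolding a_def g_def h_def
          by (rule carleson_covering[OF \<mu> Tsq])
             (auto simp: emeasure_ball_complex mult.commute)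
        also have "\<dots> \<le> ennreal 1 * (ennreal T * ennreal (2 * pi * (2 * h)))"
        proof (intro mult_left_mono)
          have "(\<integral>\<^sup>+z. indicator {dyadic_radius (j + 2) - 2 * (1 / 2) ^ j..<dyadic_radius (j + 2)} (cmod z) \<partial>(lborel::complex measure))
             \<le> ennreal (2 * pi * (dyadic_radius (j + 2) - (dyadic_radius (j + 2) - 2 * (1 / 2) ^ j)))"
            by (intro nn_integral_radial_band_le) (auto simp: dyadic_radius_bounds)
          then show "(\<integral>\<^sup>+z. 1 * indicator {dyadic_radius (j + 2) - 2 * (1 / 2) ^ j..<dyadic_radius (j + 2)} (cmod z) \<partial>(lborel::complex measure))
             \<le> ennreal (2 * pi * (2 * h))" by (simp add: h_def)
        qed auto
        also have "\<dots> = ennreal (T * (2 * pi * (2 * h))) * 1" using T h by (simp add: ennreal_mult)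
        finally have "(\<integral>\<^sup>+z. 1 * g j (cmod z) \<partial>\<mu>) \<le> ennreal (T * (2 * pi * (2 * h)) / a) * 1"
          using a T h by (intro ennreal_le_divide_mult) auto
        also have "T * (2 * pi * (2 * h)) / a = 1024 * T * 2 ^ j"
          using h by (simp add: a_def field_simps power2_eq_square) (simp add: h_def power_divide)
        finally show ?thesis by simp
      qed
      have 2: "(\<integral>\<^sup>+z. U z * g j (cmod z) \<partial>\<mu>) \<le> ennreal (C1 * T * 256 * C2 / v j) * I j"
      proof -
        define P where "P = (\<integral>\<^sup>+z. U z * indicator {dyadic_radius (j + 2) - 2 * (1 / 2) ^ j..<dyadic_radius (j + 2)} (cmod z) \<partial>lborel)"
        have "ennreal a * (\<integral>\<^sup>+z. U z * g j (cmod z) \<partial>\<mu>) \<le> ennreal C1 * (ennreal T * P)"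
          unfolding a_def g_def h_def P_def
        proof (rule carleson_covering[OF \<mu> Tsq Um])
          fix z assume z: "dyadic_radius j \<le> cmod z" "cmod z < dyadic_radius (Suc j)"
          have sub: "ball z (h / 16) \<subseteq> ball 0 1"
          proof
            fix w assume "w \<in> ball z (h / 16)"
            then have "cmod w - cmod z < h / 16"
              using norm_triangle_ineq2[of w z] by (simp add: dist_norm norm_minus_commute)
            then show "w \<in> ball 0 1" using z h unfolding rad by simp
          qed
          have "U z * ennreal (pi * (h / 16)\<^sup>2) \<le> ennreal (growth p \<Psi> (cmod (f z))) * ennreal (pi * (h / 16)\<^sup>2)"
            by (intro mult_right_mono) (auto simp: U_def indicator_def)
          also have "\<dots> \<le> ennreal C1 * (\<integral>\<^sup>+w\<in>ball z (h / 16). ennreal (growth p \<Psi> (cmod (f w))) \<partial>lborel)"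
            using h by (intro subm holomorphic_on_subset[OF hol sub]) auto
          also have "(\<integral>\<^sup>+w\<in>ball z (h / 16). ennreal (growth p \<Psi> (cmod (f w))) \<partial>lborel) = (\<integral>\<^sup>+w\<in>ball z (h / 16). U w \<partial>lborel)"
            using sub by (intro nn_integral_cong) (auto simp: U_def indicator_def)
          finally show "U z * ennreal (pi * ((1 / 2) ^ j / 16)\<^sup>2) \<le> ennreal C1 * (\<integral>\<^sup>+w\<in>ball z ((1 / 2) ^ j / 16). U w \<partial>lborel)"
            by (simp add: h_def)
        qed
        also have "\<dots> = ennreal (C1 * T) * P" using C1 T by (simp add: ennreal_mult mult.assoc)
        finally have x1: "(\<integral>\<^sup>+z. U z * g j (cmod z) \<partial>\<mu>) \<le> ennreal (C1 * T / a) * P"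
          using a C1 T by (intro ennreal_le_divide_mult) auto
        define w where "w = 2 ^ j * dyadic_tail \<omega> j"
        have w: "w > 0" using dyadic_tail_pos[OF \<omega>] by (simp add: w_def)
        have vw: "w * h\<^sup>2 = v j"
          by (simp add: w_def h_def v_def box_mass_def power2_eq_square power_divide)
        have "ennreal w * P \<le> ennreal C2 * I j"
          unfolding w_def P_def I_def U_def by (rule trans[OF hol])
        then have "P \<le> ennreal (C2 / w) * I j" using w C2 by (intro ennreal_le_divide_mult) auto
        then have "ennreal (C1 * T / a) * P \<le> ennreal (C1 * T / a) * (ennreal (C2 / w) * I j)"
          by (intro mult_left_mono) auto
        also have "\<dots> = ennreal (C1 * T / a * (C2 / w)) * I j"
        proof (subst ennreal_mult)
          show "0 \<le> C1 * T / a" "0 \<le> C2 / w" using C1 T a C2 w by auto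
        qed (simp only: mult.assoc)
        also have "\<dots> \<le> ennreal (C1 * T * 256 * C2 / v j) * I j"
        proof (intro mult_right_mono ennreal_leI)
          have "C1 * T / a * (C2 / w) = (C1 * T * 256 * C2 / v j) * (1 / pi)"
            using h w by (simp add: a_def vw[symmetric] field_simps)
          also have "\<dots> \<le> (C1 * T * 256 * C2 / v j) * 1"
            using C1 T C2 v[of j] pi_gt3 by (intro mult_left_mono) auto
          finally show "C1 * T / a * (C2 / w) \<le> C1 * T * 256 * C2 / v j" by simp
        qed auto
        finally show ?thesis using x1 by (rule order_trans[rotated])
      qed
      have gmu: "(\<lambda>z. g j (cmod z)) \<in> borel_measurable \<mu>" "(\<lambda>z. U z * g j (cmod z)) \<in> borel_measurable \<mu>"
        using gm[of j] Um by (auto intro!: m\<mu>)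
      have "(\<integral>\<^sup>+z. ennreal (growth q \<Phi> (cmod (f z))) * g j (cmod z) \<partial>\<mu>) \<le>
         (\<integral>\<^sup>+z. ennreal (C7 * 2 powr (real j * d')) * g j (cmod z) + ennreal (C3 * (v j * Q j)) * (U z * g j (cmod z)) \<partial>\<mu>)"
      proof (rule nn_integral_mono)
        fix z assume "z \<in> space \<mu>"
        then have z: "cmod z < 1" by (simp add: m\<mu>)
        show "ennreal (growth q \<Phi> (cmod (f z))) * g j (cmod z) \<le>
          ennreal (C7 * 2 powr (real j * d')) * g j (cmod z) + ennreal (C3 * (v j * Q j)) * (U z * g j (cmod z))"
        proof (cases "dyadic_radius j \<le> cmod z \<and> cmod z < dyadic_radius (Suc j)")
          case True
          have "v j * growth p \<Psi> (cmod (f z)) \<le> R'"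
            using C5(2)[OF hol _ _ md R, of j z] True by (simp add: v_def R'_def)
          then have "growth q \<Phi> (cmod (f z)) \<le> C7 * 2 powr (real j * d') + C3 * (v j * Q j) * growth p \<Psi> (cmod (f z))"
            by (intro split) auto
          then have "ennreal (growth q \<Phi> (cmod (f z))) \<le> ennreal (C7 * 2 powr (real j * d') + C3 * (v j * Q j) * growth p \<Psi> (cmod (f z)))"
            by (rule ennreal_leI)
          also have "\<dots> = ennreal (C7 * 2 powr (real j * d')) + ennreal (C3 * (v j * Q j)) * ennreal (growth p \<Psi> (cmod (f z)))"
            using C7 C3 v[of j] Q[of j] growth_nonneg[OF \<Psi>, of "cmod (f z)" p]
            by (subst ennreal_plus) (auto simp: ennreal_mult)
          finally show ?thesis using True z by (simp add: g_def U_def)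
        qed (auto simp: g_def)
      qed
      also have "\<dots> = ennreal (C7 * 2 powr (real j * d')) * (\<integral>\<^sup>+z. g j (cmod z) \<partial>\<mu>) + ennreal (C3 * (v j * Q j)) * (\<integral>\<^sup>+z. U z * g j (cmod z) \<partial>\<mu>)"
        using gmu by (simp add: nn_integral_add nn_integral_cmult)
      also have "\<dots> \<le> ennreal (C7 * 2 powr (real j * d')) * ennreal (1024 * T * 2 ^ j) +
          ennreal (C3 * (v j * Q j)) * (ennreal (C1 * T * 256 * C2 / v j) * I j)"
        using 1 2 by (intro add_mono mult_left_mono) auto
      also have "\<dots> = ennreal (C7 * 2 powr (real j * d') * (1024 * T * 2 ^ j)) +
          ennreal (C3 * (v j * Q j) * (C1 * T * 256 * C2 / v j)) * I j"
      proof -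
        have "ennreal (C7 * 2 powr (real j * d') * (1024 * T * 2 ^ j)) =
            ennreal (C7 * 2 powr (real j * d')) * ennreal (1024 * T * 2 ^ j)"
          using C7 T by (intro ennreal_mult) auto
        moreover have "ennreal (C3 * (v j * Q j) * (C1 * T * 256 * C2 / v j)) =
            ennreal (C3 * (v j * Q j)) * ennreal (C1 * T * 256 * C2 / v j)"
          using C3 C1 C2 T v(1)[of j] Q[of j] by (intro ennreal_mult) auto
        ultimately show ?thesis by (simp only: mult.assoc)
      qed
      also have "C3 * (v j * Q j) * (C1 * T * 256 * C2 / v j) = C10 * G"
        using v(1)[of j] Q[of j] by (simp add: C10_def T_def)
      also have "C7 * 2 powr (real j * d') * (1024 * T * 2 ^ j) = 1024 * C7 * G * (2 ^ j / Q j * 2 powr (real j * d'))"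
        by (simp add: T_def)
      also have "ennreal \<dots> \<le> ennreal (1024 * C7 * G * (C8 * \<theta> ^ j))"
        using Qlow[of j] C7 G by (intro ennreal_leI mult_left_mono) auto
      also have "1024 * C7 * G * (C8 * \<theta> ^ j) = G * (C9 * \<theta> ^ j)" by (simp add: C9_def)
      finally show ?thesis by (simp add: add_right_mono)
    qed
    have cover: "indicator {dyadic_radius J..} (cmod z) \<le> (\<Sum>j. if J \<le> j then g j (cmod z) else 0)" if z: "cmod z < 1" for z :: complex
    proof (cases "dyadic_radius J \<le> cmod z")
      case True
      obtain j where j: "dyadic_radius j \<le> cmod z" "cmod z < dyadic_radius (Suc j)"
        using dyadic_radius_ex[OF norm_ge_zero z] by blast
      have "J \<le> j"
      proof (rule ccontr)
        assume "\<not> J \<le> j"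
        then have "dyadic_radius (Suc j) \<le> dyadic_radius J" by (intro dyadic_radius_mono) simp
        then show False using j True by simp
      qed
      have "(\<Sum>j\<in>{j}. if J \<le> j then g j (cmod z) else 0) \<le> (\<Sum>j. if J \<le> j then g j (cmod z) else 0)"
        by (intro sum_le_suminf summableI) auto
      then show ?thesis using \<open>J \<le> j\<close> j True by (simp add: g_def)
    qed auto
    have fgm: "(\<lambda>z. ennreal (growth q \<Phi> (cmod (f z))) * g j (cmod z)) \<in> borel_measurable \<mu>" for j
    proof -
      have "(\<lambda>z. ennreal (growth q \<Phi> (cmod (f z))) * indicator (ball 0 1) z * g j (cmod z)) \<in> borel_measurable \<mu>"
        by (rule m\<mu>(1)[OF borel_measurable_times_ennreal[OF growth_holomorphic_measurable[OF \<Phi> hol open_ball] gm]])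
      then show ?thesis by (rule measurable_cong[THEN iffD1, rotated]) (simp add: m\<mu>)
    qed
    have "(\<integral>\<^sup>+z. ennreal (growth q \<Phi> (cmod (f z))) * indicator {dyadic_radius J..} (cmod z) \<partial>\<mu>)
      \<le> (\<integral>\<^sup>+z. (\<Sum>j. if J \<le> j then ennreal (growth q \<Phi> (cmod (f z))) * g j (cmod z) else 0) \<partial>\<mu>)"
    proof (rule nn_integral_mono)
      fix z assume "z \<in> space \<mu>"
      then have z: "cmod z < 1" by (simp add: m\<mu>)
      have "ennreal (growth q \<Phi> (cmod (f z))) * indicator {dyadic_radius J..} (cmod z) \<le>
         ennreal (growth q \<Phi> (cmod (f z))) * (\<Sum>j. if J \<le> j then g j (cmod z) else 0)"
        using cover[OF z] by (intro mult_left_mono) auto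
      also have "\<dots> = (\<Sum>j. ennreal (growth q \<Phi> (cmod (f z))) * (if J \<le> j then g j (cmod z) else 0))"
        by (rule ennreal_suminf_cmult[symmetric])
      also have "\<dots> = (\<Sum>j. if J \<le> j then ennreal (growth q \<Phi> (cmod (f z))) * g j (cmod z) else 0)"
        by (intro suminf_cong) auto
      finally show "ennreal (growth q \<Phi> (cmod (f z))) * indicator {dyadic_radius J..} (cmod z) \<le>
          (\<Sum>j. if J \<le> j then ennreal (growth q \<Phi> (cmod (f z))) * g j (cmod z) else 0)" .
    qed
    also have "\<dots> = (\<Sum>j. \<integral>\<^sup>+z. (if J \<le> j then ennreal (growth q \<Phi> (cmod (f z))) * g j (cmod z) else 0) \<partial>\<mu>)"
    proof (rule nn_integral_suminf)
      show "(\<lambda>z. if J \<le> j then ennreal (growth q \<Phi> (cmod (f z))) * g j (cmod z) else 0) \<in> borel_measurable \<mu>" for j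
        using fgm[of j] by (cases "J \<le> j") auto
    qed
    also have "\<dots> \<le> (\<Sum>j. ennreal (G * (C9 * \<theta> ^ j)) + ennreal (C10 * G) * I j)"
    proof (intro suminf_le summableI)
      fix j show "(\<integral>\<^sup>+z. (if J \<le> j then ennreal (growth q \<Phi> (cmod (f z))) * g j (cmod z) else 0) \<partial>\<mu>)
          \<le> ennreal (G * (C9 * \<theta> ^ j)) + ennreal (C10 * G) * I j"
        using step[of j] by (cases "J \<le> j") auto
    qed
    also have "\<dots> = (\<Sum>j. ennreal (G * (C9 * \<theta> ^ j))) + ennreal (C10 * G) * (\<Sum>j. I j)"
      by (simp add: suminf_add[symmetric] ennreal_suminf_cmult)
    also have "(\<Sum>j. ennreal (G * (C9 * \<theta> ^ j))) = ennreal (G * (C9 * (1 / (1 - \<theta>))))"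
      using G C9 \<theta> by (intro suminf_ennreal_eq sums_mult geometric_sums) auto
    also have "(\<Sum>j. I j) \<le> ennreal (real m * R)"
    proof -
      have bm: "(\<lambda>z. U z * indicator {dyadic_radius a..<dyadic_radius b} (cmod z)) \<in> borel_measurable (weighted_area \<omega>)" for a b
      proof -
        have "(\<lambda>z::complex. indicator {dyadic_radius a..<dyadic_radius b} (cmod z) :: ennreal) \<in> borel_measurable borel"
          by (rule measurable_compose[of cmod borel borel]) auto
        then show ?thesis
          using Um by (intro borel_measurable_weighted_area borel_measurable_times_ennreal)
      qed
      have "(\<Sum>j. I j) = (\<integral>\<^sup>+z. (\<Sum>j. U z * indicator {dyadic_radius (j + 2)..<dyadic_radius (j + 2 + m)} (cmod z)) \<partial>weighted_area \<omega>)"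
        unfolding I_def using bm by (intro nn_integral_suminf[symmetric]) auto
      also have "\<dots> \<le> (\<integral>\<^sup>+z. ennreal (real m) * U z \<partial>weighted_area \<omega>)"
      proof (rule nn_integral_mono)
        fix z :: complex
        have sp: "indicator {dyadic_radius (j + 2)..<dyadic_radius (j + 2 + m)} (cmod z) =
          (\<Sum>i<m. indicator {dyadic_radius (j + (2 + i))..<dyadic_radius (Suc (j + (2 + i)))} (cmod z) :: ennreal)" for j
          using dyadic_indicator_split[of "j + 2" m "cmod z"] by (simp only: add.assoc)
        have "(\<Sum>j. U z * indicator {dyadic_radius (j + 2)..<dyadic_radius (j + 2 + m)} (cmod z)) =
          U z * (\<Sum>j. \<Sum>i<m. indicator {dyadic_radius (j + (2 + i))..<dyadic_radius (Suc (j + (2 + i)))} (cmod z))"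
          by (simp only: ennreal_suminf_cmult sp)
        also have "\<dots> \<le> U z * ennreal (real m)"
        proof (rule mult_left_mono)
          have "(\<Sum>j. \<Sum>i<m. indicator {dyadic_radius (j + (2 + i))..<dyadic_radius (Suc (j + (2 + i)))} (cmod z) :: ennreal)
             = (\<Sum>i<m. \<Sum>j. indicator {dyadic_radius (j + (2 + i))..<dyadic_radius (Suc (j + (2 + i)))} (cmod z))"
            by (rule suminf_sum) simp
          also have "\<dots> \<le> (\<Sum>i<m. 1)" by (intro sum_mono suminf_dyadic_indicator_le)
          also have "\<dots> = ennreal (real m)" by (simp add: ennreal_of_nat_eq_real_of_nat)
          finally show "(\<Sum>j. \<Sum>i<m. indicator {dyadic_radius (j + (2 + i))..<dyadic_radius (Suc (j + (2 + i)))} (cmod z))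
              \<le> ennreal (real m)" .
        qed simp
        finally show "(\<Sum>j. U z * indicator {dyadic_radius (j + 2)..<dyadic_radius (j + 2 + m)} (cmod z)) \<le> ennreal (real m) * U z"
          by (simp only: mult.commute)
      qed
      also have "\<dots> = ennreal (real m) * (\<integral>\<^sup>+z. U z \<partial>weighted_area \<omega>)"
        using Um by (intro nn_integral_cmult borel_measurable_weighted_area)
      also have "(\<integral>\<^sup>+z. U z \<partial>weighted_area \<omega>) \<le> modular p \<Psi> (weighted_area \<omega>) f"
        unfolding modular_def U_def growth_def by (intro nn_integral_mono) (auto simp: indicator_def)
      also note md
      finally show ?thesis using R by (simp add: ennreal_mult mult_left_mono)
    qed
    also have "ennreal (G * (C9 * (1 / (1 - \<theta>)))) + ennreal (C10 * G) * ennreal (real m * R) = ennreal (C * G)"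
      using G C9 C10 \<theta> R
      by (simp add: ennreal_mult[symmetric] ennreal_plus[symmetric] C_def algebra_simps del: ennreal_plus)
    finally show "(\<integral>\<^sup>+z. ennreal (growth q \<Phi> (cmod (f z))) * indicator {dyadic_radius J..} (cmod z) \<partial>\<mu>) \<le> ennreal (C * G)"
      by (simp add: mult_left_mono add_left_mono)
  qed
qed


section \<open>Integrals of kernels against the weight\<close>

text \<open>
  \<open>(1 - |u|\<^sup>2) / |1 - u e\<^sup>i\<^sup>t|\<^sup>2\<close> is the real part of \<open>(1 + u e\<^sup>i\<^sup>t) / (1 - u e\<^sup>i\<^sup>t)\<close>, which has an
  explicit antiderivative in \<open>t\<close>.
\<close>

lemma poisson_kernel_mean:
  assumes u: "cmod u < 1"
  shows "(\<integral>\<^sup>+t\<in>{0..2*pi}. ennreal (1 / (cmod (1 - u * cis t))\<^sup>2) \<partial>lborel) = ennreal (2 * pi / (1 - (cmod u)\<^sup>2))"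
proof -
  have uw: "cmod (u * cis t) < 1" for t using u by (simp add: norm_mult)
  have re: "Re (1 - u * cis t) > 0" for t
    using uw[of t] complex_Re_le_cmod[of "u * cis t"] by simp
  then have nz: "1 - u * cis t \<noteq> 0" for t by (metis less_irrefl zero_complex.simps(1))
  define G where "G t = of_real t + 2 * \<i> * Ln (1 - u * cis t)" for t
  have "(G has_vector_derivative (1 + u * cis t) / (1 - u * cis t)) (at t within {0..2*pi})" for t
  proof -
    have np: "1 - u * cis t \<notin> \<real>\<^sub>\<le>\<^sub>0" using re[of t] by (auto simp: complex_nonpos_Reals_iff)
    have 1: "((\<lambda>t. 1 - u * cis t) has_vector_derivative (- (u * (\<i> * cis t)))) (at t within {0..2*pi})"
    proof -
      have "(cis has_vector_derivative \<i> * cis t) (at t within {0..2*pi})"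
        unfolding has_vector_derivative_def
        by (rule has_derivative_cis[OF has_derivative_ident])
      then have "((\<lambda>t. 1 - u * cis t) has_vector_derivative (0 - u * (\<i> * cis t))) (at t within {0..2*pi})"
        by (intro has_vector_derivative_diff has_vector_derivative_const has_vector_derivative_mult_right)
      then show ?thesis by simp
    qed
    have "((Ln \<circ> (\<lambda>t. 1 - u * cis t)) has_vector_derivative (- (u * (\<i> * cis t))) * inverse (1 - u * cis t)) (at t within {0..2*pi})"
      by (rule field_vector_diff_chain_within[OF 1])
         (rule has_field_derivative_at_within[OF has_field_derivative_Ln[OF np]])
    then have 2: "((\<lambda>t. Ln (1 - u * cis t)) has_vector_derivative (- (u * (\<i> * cis t))) * inverse (1 - u * cis t)) (at t within {0..2*pi})"
      by (simp add: o_def)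
    have "(G has_vector_derivative (1 + 2 * \<i> * ((- (u * (\<i> * cis t))) * inverse (1 - u * cis t)))) (at t within {0..2*pi})"
      unfolding G_def[abs_def]
      by (intro has_vector_derivative_add has_vector_derivative_mult_right 2)
         (auto intro!: derivative_eq_intros)
    also have "1 + 2 * \<i> * ((- (u * (\<i> * cis t))) * inverse (1 - u * cis t)) = (1 + u * cis t) / (1 - u * cis t)"
      using nz[of t] by (simp add: field_simps)
    finally show ?thesis .
  qed
  then have "((\<lambda>t. (1 + u * cis t) / (1 - u * cis t)) has_integral (G (2 * pi) - G 0)) {0..2*pi}"
    by (intro fundamental_theorem_of_calculus) auto
  also have "G (2 * pi) - G 0 = of_real (2 * pi)" by (simp add: G_def)
  finally have "((\<lambda>t. Re ((1 + u * cis t) / (1 - u * cis t))) has_integral Re (of_real (2 * pi))) {0..2*pi}"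
    by (rule has_integral_linear[OF _ bounded_linear_Re, unfolded o_def])
  moreover have "Re ((1 + u * cis t) / (1 - u * cis t)) = (1 - (cmod u)\<^sup>2) * (1 / (cmod (1 - u * cis t))\<^sup>2)" for t
  proof -
    define w where "w = u * cis t"
    have "(cmod w)\<^sup>2 = (cmod u)\<^sup>2" by (simp add: w_def norm_mult)
    moreover have "Re ((1 + w) / (1 - w)) = (1 - (cmod w)\<^sup>2) / (cmod (1 - w))\<^sup>2"
      by (simp add: Re_divide cmod_power2) (simp add: power2_eq_square algebra_simps)
    ultimately show ?thesis by (simp add: w_def)
  qed
  ultimately have "((\<lambda>t. (1 - (cmod u)\<^sup>2) * (1 / (cmod (1 - u * cis t))\<^sup>2)) has_integral (2 * pi)) {0..2*pi}" by simp
  then have "((\<lambda>t. inverse (1 - (cmod u)\<^sup>2) * ((1 - (cmod u)\<^sup>2) * (1 / (cmod (1 - u * cis t))\<^sup>2))) has_integral (inverse (1 - (cmod u)\<^sup>2) * (2 * pi))) {0..2*pi}"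
    by (rule has_integral_mult_right)
  moreover have "1 - (cmod u)\<^sup>2 > 0" using u by (simp add: power_less_one_iff abs_square_less_1)
  ultimately have "((\<lambda>t. 1 / (cmod (1 - u * cis t))\<^sup>2) has_integral (2 * pi / (1 - (cmod u)\<^sup>2))) {0..2*pi}"
    by (simp add: mult.assoc[symmetric] divide_inverse mult.commute)
  then have "integral {0..2*pi} (\<lambda>t. 1 / (cmod (1 - u * cis t))\<^sup>2) = 2 * pi / (1 - (cmod u)\<^sup>2)"
    by (rule integral_unique)
  moreover have "(\<integral>\<^sup>+t\<in>{0..2*pi}. ennreal (1 / (cmod (1 - u * cis t))\<^sup>2) \<partial>lborel) = ennreal (integral {0..2*pi} (\<lambda>t. 1 / (cmod (1 - u * cis t))\<^sup>2))"
    using nz by (intro nn_integral_continuous_Icc) (auto intro!: continuous_intros)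
  ultimately show ?thesis by simp
qed

text \<open>
  Two powers of the kernel are averaged over circles with \<open>poisson_kernel_mean\<close>; the remaining
  ones are estimated by their maximum. What is left is a radial function, at most
  \<open>2\<^sup>-\<^sup>J (2\<^bsup>j-J\<^esup>)\<^sup>M\<close> at level \<open>j \<le> J\<close> up to a constant. The tail of \<open>\<omega>\<close> at level \<open>j\<close> is at most \<open>D\<^bsup>J-j\<^esup>\<close>
  times the one at level \<open>J\<close>, and \<open>2\<^sup>M \<ge> 2D\<close> leaves a geometric sum dominated by its last term.
\<close>

lemma kernel_integral:
  assumes \<omega>: "\<omega> \<in> class_D"
  obtains N :: nat and C where "C \<ge> 1"
    "\<And>J \<zeta>. cmod \<zeta> = 1 \<Longrightarrow>
      (\<integral>\<^sup>+z. ennreal (((1/2) ^ J / cmod (1 - of_real (dyadic_radius J) * cnj \<zeta> * z)) ^ N) \<partial>weighted_area \<omega>)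
       \<le> ennreal (C * box_mass \<omega> J)"
proof -
  obtain D :: real where D: "D \<ge> 1" and
    dbl: "\<And>j. dyadic_tail \<omega> j \<le> D * dyadic_tail \<omega> (Suc j)"
    using class_D_dyadic[OF \<omega>] by metis
  note rw = class_D_radial[OF \<omega>]
  obtain M0 :: nat where M0: "2 * D < 2 ^ M0" using real_arch_pow[of 2 "2 * D"] by auto
  define M where "M = Suc M0"
  have M: "2 * D \<le> 2 ^ M" using M0 D by (simp add: M_def)
  define W where "W = dyadic_tail \<omega>"
  have Wp: "W i > 0" for i using dyadic_tail_pos[OF \<omega>] by (simp add: W_def)
  have WD: "W j \<le> D ^ i * W (j + i)" for j i
  proof (induction i)
    case (Suc i)
    have "D ^ i * W (j + i) \<le> D ^ i * (D * W (Suc (j + i)))"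
      using dbl D by (intro mult_left_mono) (auto simp: W_def)
    with Suc show ?case by (simp add: mult_ac)
  qed simp
  show ?thesis
  proof (rule that[of "4 * 2 ^ M" "Suc M"])
    have "1 * 1 \<le> (4::real) * 2 ^ M" by (intro mult_mono one_le_power) auto
    then show "(1::real) \<le> 4 * 2 ^ M" by simp
    fix J and \<zeta> :: complex assume \<zeta>: "cmod \<zeta> = 1"
    define h :: real where "h = (1/2) ^ J"
    define r where "r = dyadic_radius J"
    have r: "r = 1 - h" "0 \<le> r" "r < 1" and h: "0 < h" "h \<le> 1"
      using dyadic_radius_bounds[of J] by (auto simp: r_def h_def dyadic_radius_def)
    define K where "K z = ennreal ((h / cmod (1 - of_real r * cnj \<zeta> * z)) ^ Suc M)" for z
    have Km: "K \<in> borel_measurable borel"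
    proof -
      have "(\<lambda>z. cmod (1 - of_real r * cnj \<zeta> * z)) \<in> borel_measurable borel"
        by (intro borel_measurable_continuous_onI continuous_intros)
      then show ?thesis unfolding K_def by measurable
    qed
    \<comment> \<open>a bound for the mean of the kernel over the circle of radius \<open>s\<close>\<close>
    define P where "P s = h * (h / (1 - r * s)) ^ M" for s
    have mean: "(\<integral>\<^sup>+t\<in>{0..2*pi}. K (z * cis t) \<partial>lborel) \<le> ennreal (2 * pi) * ennreal (P (cmod z))"
      if z: "cmod z < 1" for z
    proof -
      define u where "u = of_real r * cnj \<zeta> * z"
      define s where "s = r * cmod z"
      have cu: "cmod u = s" using \<zeta> r(2) by (simp add: u_def s_def norm_mult)
      have s: "0 \<le> s" "s < 1"
        using r z mult_strict_mono'[of r 1 "cmod z" 1] by (auto simp: s_def)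
      have bd: "K (z * cis t) \<le> ennreal (h ^ Suc M / (1 - s) ^ (M - 1)) * ennreal (1 / (cmod (1 - u * cis t))\<^sup>2)" for t
      proof -
        have eq: "of_real r * cnj \<zeta> * (z * cis t) = u * cis t" by (simp add: u_def mult_ac)
        define d where "d = cmod (1 - u * cis t)"
        have d: "1 - s \<le> d"
          using norm_triangle_ineq2[of 1 "u * cis t"] by (simp add: d_def norm_mult cu)
        have d0: "d > 0" using d s by simp
        have "d ^ Suc M = d ^ (M - 1) * d\<^sup>2" by (simp add: M_def power2_eq_square mult_ac)
        moreover have "(1 - s) ^ (M - 1) \<le> d ^ (M - 1)" using d s by (intro power_mono) auto
        ultimately have "(1 - s) ^ (M - 1) * d\<^sup>2 \<le> d ^ Suc M" by (simp add: mult_right_mono)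
        then have "h ^ Suc M / d ^ Suc M \<le> h ^ Suc M / ((1 - s) ^ (M - 1) * d\<^sup>2)"
          using h s d0 by (intro divide_left_mono) auto
        also have "\<dots> = h ^ Suc M / (1 - s) ^ (M - 1) * (1 / d\<^sup>2)" by simp
        finally have "(h / d) ^ Suc M \<le> h ^ Suc M / (1 - s) ^ (M - 1) * (1 / d\<^sup>2)"
          by (simp add: power_divide)
        then have "ennreal ((h / d) ^ Suc M) \<le> ennreal (h ^ Suc M / (1 - s) ^ (M - 1) * (1 / d\<^sup>2))"
          by (rule ennreal_leI)
        also have "\<dots> = ennreal (h ^ Suc M / (1 - s) ^ (M - 1)) * ennreal (1 / d\<^sup>2)"
          using h s by (intro ennreal_mult) auto
        finally show ?thesis by (simp only: K_def eq d_def)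
      qed
      have "(\<integral>\<^sup>+t\<in>{0..2*pi}. K (z * cis t) \<partial>lborel) \<le>
          (\<integral>\<^sup>+t. ennreal (h ^ Suc M / (1 - s) ^ (M - 1)) * (ennreal (1 / (cmod (1 - u * cis t))\<^sup>2) * indicator {0..2*pi} t) \<partial>lborel)"
        using bd by (intro nn_integral_mono) (auto simp: indicator_def)
      also have "\<dots> = ennreal (h ^ Suc M / (1 - s) ^ (M - 1)) * (\<integral>\<^sup>+t\<in>{0..2*pi}. ennreal (1 / (cmod (1 - u * cis t))\<^sup>2) \<partial>lborel)"
      proof (rule nn_integral_cmult)
        have "(\<lambda>t. cmod (1 - u * cis t)) \<in> borel_measurable borel"
          by (intro borel_measurable_continuous_onI continuous_intros)
        then show "(\<lambda>t. ennreal (1 / (cmod (1 - u * cis t))\<^sup>2) * indicator {0..2*pi} t) \<in> borel_measurable lborel"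
          by measurable
      qed
      also have "\<dots> = ennreal (h ^ Suc M / (1 - s) ^ (M - 1)) * ennreal (2 * pi / (1 - s\<^sup>2))"
        using poisson_kernel_mean[of u] s by (simp add: cu)
      also have "\<dots> \<le> ennreal (h ^ Suc M / (1 - s) ^ (M - 1)) * ennreal (2 * pi / (1 - s))"
      proof (intro mult_left_mono ennreal_leI divide_left_mono)
        show "1 - s \<le> 1 - s\<^sup>2" using s by (simp add: power2_eq_square mult_left_le)
        then have "0 < 1 - s\<^sup>2" using s by linarith
        then show "0 < (1 - s\<^sup>2) * (1 - s)" using s by simp
      qed auto
      also have "\<dots> = ennreal (2 * pi * P (cmod z))"
        using h s by (subst ennreal_mult[symmetric])
          (auto simp: P_def s_def M_def power_divide field_simps)
      also have "\<dots> = ennreal (2 * pi) * ennreal (P (cmod z))"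
        using h s by (intro ennreal_mult) (auto simp: P_def s_def)
      finally show ?thesis .
    qed
    define coef where "coef j = h * (2 ^ Suc j * h) ^ M" for j
    have coef: "coef j \<ge> 0" for j using h by (simp add: coef_def)
    \<comment> \<open>replacing the radial function by a sum over levels makes it integrable against tails
      only\<close>
    have P_le: "ennreal (P (cmod z)) \<le> (\<Sum>j\<le>J. ennreal (coef j) * indicator {dyadic_radius j..} (cmod z))"
      if z: "cmod z < 1" for z
    proof -
      obtain j where j: "dyadic_radius j \<le> cmod z" "cmod z < dyadic_radius (Suc j)"
        using dyadic_radius_ex[OF norm_ge_zero z] by blast
      define i where "i = min j J"
      have i: "i \<le> J" "dyadic_radius i \<le> cmod z"
        using j dyadic_radius_mono[of i j] by (auto simp: i_def)
      have rz: "0 < 1 - r * cmod z" using r z mult_strict_mono'[of r 1 "cmod z" 1] by auto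
      have "h / (1 - r * cmod z) \<le> 2 ^ Suc i * h"
      proof (cases "j \<le> J")
        case True
        have "r * cmod z \<le> 1 * cmod z" using r by (intro mult_right_mono) auto
        then have "(1/2) ^ Suc j \<le> 1 - r * cmod z" using j(2) by (simp add: dyadic_radius_def)
        then have "h / (1 - r * cmod z) \<le> h / (1/2) ^ Suc j" using h rz by (intro divide_left_mono) auto
        then show ?thesis using True by (simp add: i_def power_divide mult.commute)
      next
        case False
        have "r * cmod z \<le> r * 1" using r z by (intro mult_left_mono) auto
        then have "h \<le> 1 - r * cmod z" using r by simp
        then have "h / (1 - r * cmod z) \<le> 1" using rz by simp
        also have "1 \<le> 2 ^ Suc i * h" using False by (simp add: i_def h_def power_divide)
        finally show ?thesis .
      qed
      then have "P (cmod z) \<le> coef i"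
        unfolding P_def coef_def using h rz by (intro mult_left_mono power_mono) auto
      then have "ennreal (P (cmod z)) \<le> ennreal (coef i) * indicator {dyadic_radius i..} (cmod z)"
        using i by (simp add: ennreal_leI)
      also have "\<dots> \<le> (\<Sum>j\<le>J. ennreal (coef j) * indicator {dyadic_radius j..} (cmod z))"
        using i by (intro member_le_sum) auto
      finally show ?thesis .
    qed
    have coef_sum: "(\<Sum>j\<le>J. coef j * (2 * W j)) \<le> 4 * 2 ^ M * box_mass \<omega> J"
    proof -
      have "coef j * (2 * W j) \<le> 2 * 2 ^ M * box_mass \<omega> J * (1/2) ^ (J - j)" if "j \<le> J" for j
      proof -
        define i where "i = J - j"
        have i: "J = j + i" using that by (simp add: i_def)
        have hh: "2 ^ Suc j * h = 2 * (1/2) ^ i" by (simp add: h_def i power_add power_divide)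
        have "coef j * (2 * W j) \<le> coef j * (2 * (D ^ i * W J))"
          using WD[of j i] coef by (intro mult_left_mono) (auto simp: i)
        also have "\<dots> = 2 * 2 ^ M * (h * W J) * (((1/2) ^ M) ^ i * D ^ i)"
        proof -
          have "((1/2::real) ^ i) ^ M = ((1/2) ^ M) ^ i" by (metis mult.commute power_mult)
          then show ?thesis unfolding coef_def hh power_mult_distrib by (simp only: mult_ac)
        qed
        also have "((1/2) ^ M) ^ i * D ^ i = (D / 2 ^ M) ^ i"
          by (simp add: power_mult_distrib[symmetric] power_divide)
        also have "2 * 2 ^ M * (h * W J) * (D / 2 ^ M) ^ i \<le> 2 * 2 ^ M * (h * W J) * (1/2) ^ i"
          using M D h Wp[of J] by (intro mult_left_mono power_mono) (auto simp: field_simps)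
        finally show ?thesis by (simp add: i box_mass_def W_def h_def)
      qed
      then have "(\<Sum>j\<le>J. coef j * (2 * W j)) \<le> (\<Sum>j\<le>J. 2 * 2 ^ M * box_mass \<omega> J * (1/2) ^ (J - j))"
        by (intro sum_mono) auto
      also have "\<dots> = 2 * 2 ^ M * box_mass \<omega> J * (\<Sum>j\<le>J. (1/2) ^ (J - j))" by (simp add: sum_distrib_left)
      also have "(\<Sum>j\<le>J. (1/2::real) ^ (J - j)) = (\<Sum>j\<le>J. (1/2) ^ j)"
        by (rule sum.reindex_bij_witness[of _ "\<lambda>j. J - j" "\<lambda>j. J - j"]) auto
      also have "\<dots> \<le> 2"
      proof -
        define S where "S = (\<Sum>j\<le>J. (1/2::real) ^ j)"
        define x where "x = (1/2::real) ^ Suc J"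
        have "(1 - 1/2) * S = 1 - x" unfolding S_def x_def by (rule sum_gp_basic)
        then have "S = 2 - 2 * x" by simp
        moreover have "x \<ge> 0" by (simp add: x_def)
        ultimately have "S \<le> 2" by simp
        then show ?thesis by (simp only: S_def)
      qed
      finally show ?thesis using box_mass_pos[OF \<omega>, of J] by (simp add: mult_left_mono)
    qed
    have "ennreal (2 * pi) * (\<integral>\<^sup>+z. K z * 1 \<partial>weighted_area \<omega>) =
        (\<integral>\<^sup>+z. (\<integral>\<^sup>+t\<in>{0..2*pi}. K (z * cis t) \<partial>lborel) * 1 \<partial>weighted_area \<omega>)"
      using weighted_area_average[OF rw Km, of "\<lambda>_. 1"] by simp
    also have "\<dots> \<le> (\<integral>\<^sup>+z. ennreal (2 * pi) * (\<Sum>j\<le>J. ennreal (coef j) * indicator {dyadic_radius j..} (cmod z)) \<partial>weighted_area \<omega>)"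
    proof (rule nn_integral_mono)
      fix z assume "z \<in> space (weighted_area \<omega>)"
      then have z: "cmod z < 1" by simp
      have "(\<integral>\<^sup>+t\<in>{0..2*pi}. K (z * cis t) \<partial>lborel) * 1 \<le> ennreal (2 * pi) * ennreal (P (cmod z))"
        using mean[OF z] by simp
      also have "\<dots> \<le> ennreal (2 * pi) * (\<Sum>j\<le>J. ennreal (coef j) * indicator {dyadic_radius j..} (cmod z))"
        by (intro mult_left_mono P_le z) auto
      finally show "(\<integral>\<^sup>+t\<in>{0..2*pi}. K (z * cis t) \<partial>lborel) * 1 \<le> ennreal (2 * pi) * (\<Sum>j\<le>J. ennreal (coef j) * indicator {dyadic_radius j..} (cmod z))" .
    qed
    also have "\<dots> = ennreal (2 * pi) * (\<Sum>j\<le>J. ennreal (coef j) * (\<integral>\<^sup>+z. indicator {dyadic_radius j..} (cmod z) \<partial>weighted_area \<omega>))"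
    proof -
      have im: "(\<lambda>z. indicator {dyadic_radius j..} (cmod z) :: ennreal) \<in> borel_measurable (weighted_area \<omega>)" for j
        by (intro borel_measurable_weighted_area, rule measurable_compose[of cmod borel borel]) auto
      then have tm: "(\<lambda>z. ennreal (coef j) * indicator {dyadic_radius j..} (cmod z)) \<in> borel_measurable (weighted_area \<omega>)" for j
        by (intro borel_measurable_times_ennreal borel_measurable_const)
      have "(\<integral>\<^sup>+z. (\<Sum>j\<le>J. ennreal (coef j) * indicator {dyadic_radius j..} (cmod z)) \<partial>weighted_area \<omega>) =
          (\<Sum>j\<le>J. \<integral>\<^sup>+z. ennreal (coef j) * indicator {dyadic_radius j..} (cmod z) \<partial>weighted_area \<omega>)"
        by (rule nn_integral_sum) (rule tm)
      also have "\<dots> = (\<Sum>j\<le>J. ennreal (coef j) * (\<integral>\<^sup>+z. indicator {dyadic_radius j..} (cmod z) \<partial>weighted_area \<omega>))"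
        by (intro sum.cong refl nn_integral_cmult im)
      finally have X: "(\<integral>\<^sup>+z. (\<Sum>j\<le>J. ennreal (coef j) * indicator {dyadic_radius j..} (cmod z)) \<partial>weighted_area \<omega>) =
          (\<Sum>j\<le>J. ennreal (coef j) * (\<integral>\<^sup>+z. indicator {dyadic_radius j..} (cmod z) \<partial>weighted_area \<omega>))" .
      show ?thesis unfolding X[symmetric]
        by (intro nn_integral_cmult borel_measurable_sum tm)
    qed
    also have "\<dots> \<le> ennreal (2 * pi) * (\<Sum>j\<le>J. ennreal (coef j) * ennreal (2 * W j))"
      unfolding W_def dyadic_tail_def
      by (intro mult_left_mono sum_mono weighted_area_radial(1)[OF rw] dyadic_radius_bounds) auto
    also have "(\<Sum>j\<le>J. ennreal (coef j) * ennreal (2 * W j)) = ennreal (\<Sum>j\<le>J. coef j * (2 * W j))"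
      using coef Wp by (simp add: ennreal_mult[symmetric] less_imp_le)
    also have "ennreal (2 * pi) * \<dots> \<le> ennreal (2 * pi) * ennreal (4 * 2 ^ M * box_mass \<omega> J)"
      by (intro mult_left_mono ennreal_leI coef_sum) auto
    finally have "(\<integral>\<^sup>+z. K z * 1 \<partial>weighted_area \<omega>) \<le> ennreal (4 * 2 ^ M * box_mass \<omega> J)"
      by (subst (asm) ennreal_mult_le_mult_iff) auto
    then show "(\<integral>\<^sup>+z. ennreal (((1/2) ^ J / cmod (1 - of_real (dyadic_radius J) * cnj \<zeta> * z)) ^ Suc M) \<partial>weighted_area \<omega>)
       \<le> ennreal (4 * 2 ^ M * box_mass \<omega> J)"
      by (simp add: K_def h_def r_def)
  qed
qed

text \<open>
  The square of the point 0 has level \<open>J = 0\<close>, where the kernel is constant, so any number of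
  modulus 1 can serve as the direction of 0.
\<close>

definition direction :: "complex \<Rightarrow> complex" where
  "direction a = (if a = 0 then 1 else sgn a)"

lemma norm_direction [simp]: "cmod (direction a) = 1"
  by (simp add: direction_def norm_sgn)

text \<open>
  On the square, the distance of \<open>r\<^sub>J cnj(\<zeta>) z\<close> from 1 is at most \<open>2h\<close> in radial and \<open>h / 2\<close> in
  angular direction, where \<open>h = 2\<^sup>-\<^sup>J\<close>.
\<close>

lemma kernel_on_carleson_square:
  assumes a: "dyadic_radius J \<le> cmod a" "cmod a < 1" and z: "z \<in> carleson_square a"
  shows "1 / 3 \<le> (1/2) ^ J / cmod (1 - of_real (dyadic_radius J) * cnj (direction a) * z)"
proof -
  define h :: real where "h = (1/2) ^ J"
  define r where "r = dyadic_radius J"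
  have r: "r = 1 - h" "0 \<le> r" "r < 1" and h: "0 < h" "h \<le> 1"
    using dyadic_radius_bounds[of J] by (auto simp: r_def h_def dyadic_radius_def)
  define x where "x = of_real r * cnj (direction a) * z"
  have z1: "cmod z < 1" using z carleson_square_subset[of a] by auto
  have cx: "cmod x = r * cmod z" using r(2) by (simp add: x_def norm_mult)
  have rz: "r * cmod z < 1" "0 \<le> r * cmod z" using r z1 mult_strict_mono'[of r 1 "cmod z" 1] by auto
  have "cmod (1 - x) \<le> 3 * h"
  proof (cases "a = 0")
    case True
    then have "r = 0" using a r by (simp add: r_def)
    then show ?thesis using r by (simp add: x_def)
  next
    case False
    define d where "d = (1 - cmod a) / 2"
    have d: "0 \<le> d" "d \<le> h / 2" using a r by (auto simp: d_def r_def[symmetric])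
    have mem: "cmod a \<le> cmod z" "cmod z * cmod a * cos d < Re (z * cnj a)"
      using z carleson_square_eq[OF False a(2)] by (auto simp: d_def)
    have "r / cmod a * (cmod z * cmod a * cos d) \<le> r / cmod a * Re (z * cnj a)"
      using mem r False by (intro mult_left_mono) auto
    also have "r / cmod a * Re (z * cnj a) = Re x"
      using False by (simp add: x_def direction_def sgn_div_norm field_simps)
    also have "r / cmod a * (cmod z * cmod a * cos d) = r * cmod z * cos d" using False by simp
    finally have rx: "r * cmod z * cos d \<le> Re x" .
    have "(cmod (1 - x))\<^sup>2 = 1 - 2 * Re x + (cmod x)\<^sup>2"
      by (simp only: cmod_power2) (simp add: power2_eq_square algebra_simps)
    also have "\<dots> \<le> 1 - 2 * (r * cmod z * cos d) + (r * cmod z)\<^sup>2" using rx cx by simp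
    also have "\<dots> = (1 - r * cmod z)\<^sup>2 + 2 * (r * cmod z) * (1 - cos d)"
      by (simp add: power2_eq_square algebra_simps)
    also have "\<dots> \<le> (2 * h)\<^sup>2 + 2 * 1 * (d\<^sup>2 / 2)"
    proof (intro add_mono power_mono mult_mono)
      have "r * r \<le> r * cmod z" using r a mem by (intro mult_left_mono) (auto simp: r_def)
      moreover have "r * r \<ge> 1 - 2 * h" by (simp add: r(1) algebra_simps)
      ultimately show "1 - r * cmod z \<le> 2 * h" by linarith
      show "1 - cos d \<le> d\<^sup>2 / 2" by (rule one_minus_cos_bounds)
    qed (use rz in auto)
    also have "\<dots> \<le> (2 * h)\<^sup>2 + (h / 2)\<^sup>2" using power_mono[OF d(2,1), of 2] by simp
    also have "\<dots> \<le> (3 * h)\<^sup>2" by (simp add: power2_eq_square)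
    finally show ?thesis using h by (intro power2_le_imp_le[of "cmod (1 - x)"]) auto
  qed
  moreover have "cmod (1 - x) > 0"
  proof -
    have "1 - r * cmod z \<le> cmod (1 - x)" using norm_triangle_ineq2[of 1 x] by (simp add: cx)
    then show ?thesis using rz by linarith
  qed
  ultimately have "1 / 3 \<le> h / cmod (1 - x)" by (simp add: field_simps)
  then show ?thesis by (simp add: h_def x_def r_def)
qed


section \<open>Mass of Carleson squares and test functions\<close>

text \<open>
  For the upper bound, the kernel is at least \<open>1/3\<close> on the square, so the mass is at most \<open>3\<^sup>N\<close>
  times the integral in \<open>kernel_integral\<close>. The lower bound is \<open>weighted_area_carleson_square_ge\<close>
  together with the mass of an annulus.
\<close>

lemma carleson_square_mass:
  assumes \<omega>: "\<omega> \<in> class_D"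
  obtains K where "K \<ge> 1"
    "\<And>J a. dyadic_radius J \<le> cmod a \<Longrightarrow> cmod a < dyadic_radius (Suc J) \<Longrightarrow>
       0 < measure (weighted_area \<omega>) (carleson_square a)"
    "\<And>J a. dyadic_radius J \<le> cmod a \<Longrightarrow> cmod a < dyadic_radius (Suc J) \<Longrightarrow>
       box_mass \<omega> J \<le> K * measure (weighted_area \<omega>) (carleson_square a)"
    "\<And>J a. dyadic_radius J \<le> cmod a \<Longrightarrow> cmod a < dyadic_radius (Suc J) \<Longrightarrow>
       measure (weighted_area \<omega>) (carleson_square a) \<le> K * box_mass \<omega> J"
proof -
  obtain N C where C: "C \<ge> 1" and ker:
    "\<And>J \<zeta>. cmod \<zeta> = 1 \<Longrightarrow>
      (\<integral>\<^sup>+z. ennreal (((1/2) ^ J / cmod (1 - of_real (dyadic_radius J) * cnj \<zeta> * z)) ^ N) \<partial>weighted_area \<omega>)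
       \<le> ennreal (C * box_mass \<omega> J)"
    by (rule kernel_integral[OF \<omega>]) (rule that)
  obtain D \<kappa> and m :: nat where D: "D \<ge> 1" and \<kappa>: "\<kappa> > 1" and m: "m \<ge> 1" and
    dbl: "\<And>j. dyadic_tail \<omega> j \<le> D * dyadic_tail \<omega> (Suc j)" and
    dec: "\<And>j. \<kappa> * dyadic_tail \<omega> (j + m) \<le> dyadic_tail \<omega> j"
    by (rule class_D_dyadic[OF \<omega>]) (rule that)
  note rw = class_D_radial[OF \<omega>]
  define c where "c = (1 - 1 / \<kappa>) / D / (8 * pi)"
  have k1: "0 < 1 - 1 / \<kappa>" using \<kappa> by simp
  have c: "c > 0" using k1 D by (simp add: c_def)
  define K where "K = max (1 / c) (3 ^ N * C)"
  have "1 * 1 \<le> 3 ^ N * C" using C by (intro mult_mono one_le_power) auto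
  then have K: "K \<ge> 1" by (simp add: K_def)
  {
    fix J a assume a: "dyadic_radius J \<le> cmod a" "cmod a < dyadic_radius (Suc J)"
    have a1: "cmod a < 1" using a dyadic_radius_bounds(2)[of "Suc J"] by simp
    define h :: real where "h = (1/2) ^ J"
    have h: "0 < h" "h \<le> 1" by (auto simp: h_def power_le_one)
    define W where "W = dyadic_tail \<omega>"
    have Wp: "W i > 0" for i using dyadic_tail_pos[OF \<omega>] by (simp add: W_def)
    define w where "w = emeasure (weighted_area \<omega>) (carleson_square a)"
    have up: "w \<le> ennreal (K * box_mass \<omega> J)"
    proof -
      have "w = (\<integral>\<^sup>+z. indicator (carleson_square a) z \<partial>weighted_area \<omega>)"
        unfolding w_def by (rule nn_integral_indicator[symmetric, OF carleson_square_weighted_sets])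
      also have "\<dots> \<le> (\<integral>\<^sup>+z. ennreal (3 ^ N) * ennreal (((1/2) ^ J / cmod (1 - of_real (dyadic_radius J) * cnj (direction a) * z)) ^ N) \<partial>weighted_area \<omega>)"
      proof (rule nn_integral_mono)
        fix z :: complex
        define x where "x = (1/2) ^ J / cmod (1 - of_real (dyadic_radius J) * cnj (direction a) * z)"
        have "indicator (carleson_square a) z \<le> ennreal (3 ^ N * x ^ N)"
        proof (cases "z \<in> carleson_square a")
          case True
          have "1 / 3 \<le> x" unfolding x_def by (rule kernel_on_carleson_square[OF a(1) a1 True])
          then have "1 \<le> (3 * x) ^ N" by (intro one_le_power) simp
          then show ?thesis using True by (simp add: power_mult_distrib)
        qed simp
        also have "\<dots> = ennreal (3 ^ N) * ennreal (x ^ N)" by (intro ennreal_mult) (auto simp: x_def)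
        finally show "indicator (carleson_square a) z \<le> ennreal (3 ^ N) * ennreal (((1/2) ^ J / cmod (1 - of_real (dyadic_radius J) * cnj (direction a) * z)) ^ N)"
          by (simp add: x_def)
      qed
      also have "\<dots> = ennreal (3 ^ N) * (\<integral>\<^sup>+z. ennreal (((1/2) ^ J / cmod (1 - of_real (dyadic_radius J) * cnj (direction a) * z)) ^ N) \<partial>weighted_area \<omega>)"
      proof (intro nn_integral_cmult borel_measurable_weighted_area)
        have "(\<lambda>z. cmod (1 - of_real (dyadic_radius J) * cnj (direction a) * z)) \<in> borel_measurable borel"
          by (intro borel_measurable_continuous_onI continuous_intros)
        then show "(\<lambda>z. ennreal (((1/2) ^ J / cmod (1 - of_real (dyadic_radius J) * cnj (direction a) * z)) ^ N)) \<in> borel_measurable borel"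
          by measurable
      qed
      also have "\<dots> \<le> ennreal (3 ^ N) * ennreal (C * box_mass \<omega> J)"
        by (intro mult_left_mono ker) auto
      also have "\<dots> = ennreal (3 ^ N * C * box_mass \<omega> J)"
        using C box_mass_pos[OF \<omega>, of J] by (subst ennreal_mult[symmetric]) (auto simp: mult.assoc)
      also have "\<dots> \<le> ennreal (K * box_mass \<omega> J)"
        using box_mass_pos[OF \<omega>, of J] by (intro ennreal_leI mult_right_mono) (auto simp: K_def)
      finally show ?thesis .
    qed
    define V where "V = (\<integral>\<^sup>+z. indicator {dyadic_radius (Suc J)..} (cmod z) \<partial>weighted_area \<omega>)"
    have V: "ennreal ((1 - 1 / \<kappa>) / D * W J) \<le> V"
    proof -
      define V' where "V' = (\<integral>\<^sup>+z. indicator {dyadic_radius (Suc J)..<dyadic_radius (Suc J + m)} (cmod z) \<partial>weighted_area \<omega>)"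
      have "ennreal (W (Suc J)) \<le> V' + ennreal (W (Suc J + m))"
        unfolding V'_def W_def dyadic_tail_def using m
        by (intro weighted_area_radial(2)[OF rw] dyadic_radius_ge_half dyadic_radius_bounds dyadic_radius_strict_mono) auto
      moreover have "W (Suc J + m) \<le> W (Suc J) / \<kappa>"
        using dec[of "Suc J"] \<kappa> by (simp add: W_def field_simps)
      then have "ennreal (W (Suc J + m)) \<le> ennreal (W (Suc J) / \<kappa>)" by (rule ennreal_leI)
      ultimately have "ennreal (W (Suc J)) \<le> V' + ennreal (W (Suc J) / \<kappa>)"
        by (meson add_left_mono order_trans)
      then have "ennreal (W (Suc J)) - ennreal (W (Suc J) / \<kappa>) \<le> V'"
        by (simp add: ennreal_minus_le_iff add.commute)
      then have 1: "ennreal (W (Suc J) * (1 - 1 / \<kappa>)) \<le> V'"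
        using Wp[of "Suc J"] \<kappa> by (simp add: ennreal_minus algebra_simps)
      have "W J / D \<le> W (Suc J)" using dbl[of J] D by (simp add: W_def field_simps)
      then have "(1 - 1 / \<kappa>) * (W J / D) \<le> (1 - 1 / \<kappa>) * W (Suc J)" using k1 by (intro mult_left_mono) auto
      then have "ennreal ((1 - 1 / \<kappa>) / D * W J) \<le> ennreal (W (Suc J) * (1 - 1 / \<kappa>))"
        by (intro ennreal_leI) (simp add: mult.commute)
      also note 1
      also have "V' \<le> V" unfolding V'_def V_def by (intro nn_integral_mono) (auto simp: indicator_def)
      finally show ?thesis .
    qed
    have low: "ennreal (c * box_mass \<omega> J) \<le> w"
    proof (cases "a = 0")
      case True
      then have "J = 0" using a dyadic_radius_ge_half[of J] by (cases J) auto
      have "c * box_mass \<omega> J \<le> (1 - 1 / \<kappa>) / D * W J"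
      proof -
        have "(1 - 1 / \<kappa>) / D / (8 * pi) \<le> (1 - 1 / \<kappa>) / D / 1"
          using k1 D pi_gt3 by (intro divide_left_mono) auto
        then have "c * W J \<le> (1 - 1 / \<kappa>) / D * W J"
          unfolding c_def using Wp[of J] by (intro mult_right_mono) auto
        then show ?thesis using \<open>J = 0\<close> by (simp add: box_mass_def W_def)
      qed
      then have "ennreal (c * box_mass \<omega> J) \<le> ennreal ((1 - 1 / \<kappa>) / D * W J)" by (rule ennreal_leI)
      also note V
      also have "V \<le> (\<integral>\<^sup>+z. indicator (carleson_square a) z \<partial>weighted_area \<omega>)"
        unfolding V_def using True by (intro nn_integral_mono) (auto simp: carleson_square_def indicator_def)
      also have "\<dots> = w" unfolding w_def by (rule nn_integral_indicator[OF carleson_square_weighted_sets])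
      finally show ?thesis .
    next
      case False
      have "ennreal (2 * pi) * ennreal (c * box_mass \<omega> J) = ennreal (2 * pi * (c * box_mass \<omega> J))"
        using c box_mass_pos[OF \<omega>, of J] by (intro ennreal_mult[symmetric]) auto
      also have "2 * pi * (c * box_mass \<omega> J) = h / 4 * ((1 - 1 / \<kappa>) / D * W J)"
        by (simp add: c_def box_mass_def W_def h_def)
      also have "ennreal \<dots> = ennreal (h / 4) * ennreal ((1 - 1 / \<kappa>) / D * W J)"
        using h k1 D Wp[of J] by (intro ennreal_mult) auto
      also have "\<dots> \<le> ennreal ((1 - cmod a) / 2) * (\<integral>\<^sup>+z. indicator {cmod a..} (cmod z) \<partial>weighted_area \<omega>)"
      proof (intro mult_mono ennreal_leI)
        show "h / 4 \<le> (1 - cmod a) / 2" using a(2) by (simp add: dyadic_radius_def h_def)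
        have "V \<le> (\<integral>\<^sup>+z. indicator {cmod a..} (cmod z) \<partial>weighted_area \<omega>)"
          unfolding V_def using a(2) by (intro nn_integral_mono) (auto simp: indicator_def)
        with V show "ennreal ((1 - 1 / \<kappa>) / D * W J) \<le> (\<integral>\<^sup>+z. indicator {cmod a..} (cmod z) \<partial>weighted_area \<omega>)"
          by (rule order_trans)
      qed auto
      also have "\<dots> \<le> ennreal (2 * pi) * w"
        unfolding w_def by (rule weighted_area_carleson_square_ge[OF rw False a1])
      finally show ?thesis by (subst (asm) ennreal_mult_le_mult_iff) auto
    qed
    have fin: "w < top" using up by (rule le_less_trans) simp
    define x where "x = measure (weighted_area \<omega>) (carleson_square a)"
    have wx: "w = ennreal x" using fin by (simp add: w_def x_def emeasure_eq_ennreal_measure)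
    have x0: "x \<ge> 0" by (simp add: x_def)
    have lowx: "c * box_mass \<omega> J \<le> x" using low x0 by (simp add: wx)
    have "x > 0" using lowx c box_mass_pos[OF \<omega>, of J] mult_pos_pos[of c "box_mass \<omega> J"] by linarith
    moreover have "x \<le> K * box_mass \<omega> J"
      using up K box_mass_pos[OF \<omega>, of J] by (simp add: wx)
    moreover have "box_mass \<omega> J \<le> K * x"
    proof -
      have "box_mass \<omega> J \<le> 1 / c * x" using lowx c by (simp add: field_simps)
      also have "\<dots> \<le> K * x" using x0 by (intro mult_right_mono) (auto simp: K_def)
      finally show ?thesis .
    qed
    ultimately have "0 < x \<and> box_mass \<omega> J \<le> K * x \<and> x \<le> K * box_mass \<omega> J" by blast
  }
  note * = this
  show ?thesis by (rule that[OF K]) (use * in auto)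
qed

text \<open>
  The number \<open>Q\<^sub>j\<close> that replaces \<open>\<Phi>(1 / \<omega>(S)) / (\<omega>(S) \<Psi>(1 / \<omega>(S)))\<^bsup>q/p\<^esup>\<close> for all squares at level
  \<open>j\<close>.
\<close>

definition peak_growth :: "real \<Rightarrow> (real \<Rightarrow> real) \<Rightarrow> real \<Rightarrow> (real \<Rightarrow> real) \<Rightarrow> (complex \<Rightarrow> real) \<Rightarrow> nat \<Rightarrow> real" where
  "peak_growth q \<Phi> p \<Psi> \<omega> j = growth q \<Phi> (peak p \<Psi> (box_mass \<omega> j))"

lemma peak_growth_pos:
  "\<omega> \<in> class_D \<Longrightarrow> \<Phi> \<in> class_L \<Longrightarrow> \<Psi> \<in> class_L \<Longrightarrow> peak_growth q \<Phi> p \<Psi> \<omega> j > 0"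
  unfolding peak_growth_def by (intro growth_pos peak_pos box_mass_pos)

lemma carleson_quotient_compare:
  assumes \<omega>: "\<omega> \<in> class_D" and \<Psi>: "\<Psi> \<in> class_L" and \<Phi>: "\<Phi> \<in> class_L" and p: "p > 0" and q: "p \<le> q"
  obtains K where "K \<ge> 1"
    "\<And>\<mu> J a. dyadic_radius J \<le> cmod a \<Longrightarrow> cmod a < dyadic_radius (Suc J) \<Longrightarrow>
       carleson_quotient q \<Phi> p \<Psi> \<omega> \<mu> a \<le> K * (measure \<mu> (carleson_square a) * peak_growth q \<Phi> p \<Psi> \<omega> J)"
    "\<And>\<mu> J a. dyadic_radius J \<le> cmod a \<Longrightarrow> cmod a < dyadic_radius (Suc J) \<Longrightarrow>
       measure \<mu> (carleson_square a) * peak_growth q \<Phi> p \<Psi> \<omega> J \<le> K * carleson_quotient q \<Phi> p \<Psi> \<omega> \<mu> a"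
proof -
  obtain K where K: "K \<ge> 1"
    "\<And>J a. dyadic_radius J \<le> cmod a \<Longrightarrow> cmod a < dyadic_radius (Suc J) \<Longrightarrow>
       0 < measure (weighted_area \<omega>) (carleson_square a)"
    "\<And>J a. dyadic_radius J \<le> cmod a \<Longrightarrow> cmod a < dyadic_radius (Suc J) \<Longrightarrow>
       box_mass \<omega> J \<le> K * measure (weighted_area \<omega>) (carleson_square a)"
    "\<And>J a. dyadic_radius J \<le> cmod a \<Longrightarrow> cmod a < dyadic_radius (Suc J) \<Longrightarrow>
       measure (weighted_area \<omega>) (carleson_square a) \<le> K * box_mass \<omega> J"
    by (rule carleson_square_mass[OF \<omega>]) (rule that)
  define V where "V = dyadic_tail \<omega> 0"
  have V: "V > 0" using dyadic_tail_pos[OF \<omega>] by (simp add: V_def)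
  have q0: "q > 0" using p q by simp
  obtain C where C: "C \<ge> 1"
    "\<And>v w. 0 < v \<Longrightarrow> 0 < w \<Longrightarrow> v \<le> V \<Longrightarrow> v \<le> K * w \<Longrightarrow> w \<le> K * v \<Longrightarrow>
       growth q \<Phi> (peak p \<Psi> v) \<le> C * (\<Phi> (1 / w) / (w * \<Psi> (1 / w)) powr (q / p))"
    "\<And>v w. 0 < v \<Longrightarrow> 0 < w \<Longrightarrow> v \<le> V \<Longrightarrow> v \<le> K * w \<Longrightarrow> w \<le> K * v \<Longrightarrow>
       \<Phi> (1 / w) / (w * \<Psi> (1 / w)) powr (q / p) \<le> C * growth q \<Phi> (peak p \<Psi> v)"
    by (rule growth_peak_compare[OF \<Psi> \<Phi> p q0 V K(1)]) (rule that)
  show ?thesis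
  proof (rule that[OF C(1)])
    fix \<mu> J and a :: complex assume a: "dyadic_radius J \<le> cmod a" "cmod a < dyadic_radius (Suc J)"
    define w where "w = measure (weighted_area \<omega>) (carleson_square a)"
    define v where "v = box_mass \<omega> J"
    have vw: "0 < v" "0 < w" "v \<le> V" "v \<le> K * w" "w \<le> K * v"
      using K(2-4)[OF a] box_mass_pos[OF \<omega>, of J] box_mass_le[OF \<omega>, of J] by (auto simp: v_def w_def V_def)
    define M where "M = measure \<mu> (carleson_square a)"
    have M: "M \<ge> 0" by (simp add: M_def)
    have cq: "carleson_quotient q \<Phi> p \<Psi> \<omega> \<mu> a = M * (\<Phi> (1 / w) / (w * \<Psi> (1 / w)) powr (q / p))"
      by (simp add: carleson_quotient_def M_def w_def Let_def)
    have pg: "peak_growth q \<Phi> p \<Psi> \<omega> J = growth q \<Phi> (peak p \<Psi> v)" by (simp add: peak_growth_def v_def)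
    show "carleson_quotient q \<Phi> p \<Psi> \<omega> \<mu> a \<le> C * (measure \<mu> (carleson_square a) * peak_growth q \<Phi> p \<Psi> \<omega> J)"
      using mult_left_mono[OF C(3)[OF vw] M] by (simp add: cq pg M_def mult_ac)
    show "measure \<mu> (carleson_square a) * peak_growth q \<Phi> p \<Psi> \<omega> J \<le> C * carleson_quotient q \<Phi> p \<Psi> \<omega> \<mu> a"
      using mult_left_mono[OF C(2)[OF vw] M] by (simp add: cq pg M_def mult_ac)
  qed
qed

text \<open>
  \<open>F J \<zeta>\<close> is the peak value \<open>c\<^sub>J\<close> times the \<open>n\<close>-th power of the kernel \<open>x = h / (1 - r\<^sub>J cnj(\<zeta>) z)\<close>
  with \<open>h = 2\<^sup>-\<^sup>J\<close>. As \<open>|x| \<le> 1\<close>, \<open>growth_contract\<close> gives \<open>M\<^sub>p(e c\<^sub>J |x|\<^sup>n) \<le> C e\<^bsup>p/2\<^esup> M\<^sub>p(c\<^sub>J) |x|\<^bsup>np/2\<^esup>\<close>,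
  whose integral is controlled by \<open>kernel_integral\<close> once \<open>n p / 2 \<ge> N\<close>, and \<open>v\<^sub>J M\<^sub>p(c\<^sub>J)\<close> is
  bounded. The factor \<open>e\<close> allows moving the functions into any neighbourhood of the origin, as
  the modular is not homogeneous. For the local decay \<open>n\<close> is taken so large that \<open>h\<^sup>n\<close> beats the
  exponential growth of \<open>c\<^sub>J\<close>.
\<close>

lemma test_functions:
  assumes \<omega>: "\<omega> \<in> class_D" and \<Psi>: "\<Psi> \<in> class_L" and p: "p > 0"
  obtains F :: "nat \<Rightarrow> complex \<Rightarrow> complex \<Rightarrow> complex" and C :: real and n :: nat where "C \<ge> 1"
    "\<And>J \<zeta>. cmod \<zeta> = 1 \<Longrightarrow> F J \<zeta> holomorphic_on ball 0 1"
    "\<And>J \<zeta> e. cmod \<zeta> = 1 \<Longrightarrow> 0 < e \<Longrightarrow> e \<le> 1 \<Longrightarrow>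
       modular p \<Psi> (weighted_area \<omega>) (\<lambda>z. of_real e * F J \<zeta> z) \<le> ennreal (C * e powr (p / 2))"
    "\<And>J a z. dyadic_radius J \<le> cmod a \<Longrightarrow> cmod a < 1 \<Longrightarrow> z \<in> carleson_square a \<Longrightarrow>
       peak p \<Psi> (box_mass \<omega> J) \<le> C * cmod (F J (direction a) z)"
    "\<And>J \<zeta> z. cmod \<zeta> = 1 \<Longrightarrow> cmod z < 1 \<Longrightarrow> cmod (F J \<zeta> z) \<le> C * (1/2) ^ J / (1 - cmod z) ^ n"
proof -
  define V where "V = dyadic_tail \<omega> 0"
  have V: "V > 0" using dyadic_tail_pos[OF \<omega>] by (simp add: V_def)
  define v where "v = box_mass \<omega>"
  have v: "v j > 0" "v j \<le> V" for j using box_mass_pos[OF \<omega>] box_mass_le[OF \<omega>] by (auto simp: v_def V_def)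
  define c where "c J = peak p \<Psi> (v J)" for J
  have c: "c J > 0" for J unfolding c_def by (intro peak_pos \<Psi> v)
  obtain A1 B where AB: "A1 \<ge> 1" "B \<ge> 1" and vlow: "\<And>j. 1 + 1 / box_mass \<omega> j \<le> A1 * B ^ j"
    by (rule box_mass_lower[OF \<omega>]) (rule that)
  obtain A2 :: real and k :: nat where A2: "A2 \<ge> 1"
    "\<And>v. 0 < v \<Longrightarrow> v \<le> V \<Longrightarrow> 1 + peak p \<Psi> v \<le> A2 * (1 + 1 / v) ^ k"
    "\<And>v. 0 < v \<Longrightarrow> v \<le> V \<Longrightarrow> 1 + 1 / v \<le> A2 * (1 + peak p \<Psi> v) ^ k"
    by (rule peak_comparable[OF \<Psi> p V]) (rule that)
  obtain N C1 where C1: "C1 \<ge> 1" and ker: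
    "\<And>J \<zeta>. cmod \<zeta> = 1 \<Longrightarrow>
      (\<integral>\<^sup>+z. ennreal (((1/2) ^ J / cmod (1 - of_real (dyadic_radius J) * cnj \<zeta> * z)) ^ N) \<partial>weighted_area \<omega>)
       \<le> ennreal (C1 * box_mass \<omega> J)"
    by (rule kernel_integral[OF \<omega>]) (rule that)
  obtain C2 where C2: "C2 \<ge> 1"
    "\<And>x y. 0 \<le> x \<Longrightarrow> x \<le> y \<Longrightarrow> growth p \<Psi> x \<le> C2 * (x / y) powr (p / 2) * growth p \<Psi> y"
    by (rule growth_contract[OF \<Psi> p]) (rule that)
  obtain C3 where C3: "C3 \<ge> 1"
    "\<And>v w. 0 < v \<Longrightarrow> 0 < w \<Longrightarrow> v \<le> V \<Longrightarrow> v \<le> 1 * w \<Longrightarrow> w \<le> 1 * v \<Longrightarrow> \<Psi> (peak p \<Psi> v) \<le> C3 * \<Psi> (1 / w)"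
    "\<And>v w. 0 < v \<Longrightarrow> 0 < w \<Longrightarrow> v \<le> V \<Longrightarrow> v \<le> 1 * w \<Longrightarrow> w \<le> 1 * v \<Longrightarrow> \<Psi> (1 / w) \<le> C3 * \<Psi> (peak p \<Psi> v)"
    by (rule class_L_peak_compare[OF \<Psi> \<Psi> p V order_refl]) (rule that)
  have gc: "v J * growth p \<Psi> (c J) \<le> C3" for J
  proof -
    have ps: "\<Psi> (1 / v J) > 0" using class_L_pos[OF \<Psi>] v(1)[of J] by simp
    have "v J * growth p \<Psi> (c J) = \<Psi> (c J) / \<Psi> (1 / v J)"
      using peak_powr(1)[OF \<Psi> v(1)[of J] p] v(1)[of J] by (simp add: growth_def c_def)
    also have "\<dots> \<le> C3" using C3(2)[of "v J" "v J"] v[of J] ps by (simp add: c_def field_simps)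
    finally show ?thesis .
  qed
  \<comment> \<open>\<open>n1\<close> is for the modular, \<open>n2\<close> for the decay as \<open>J\<close> tends to infinity\<close>
  obtain n1 :: nat where n1: "real n1 \<ge> 2 * real N / p" using real_arch_simple by blast
  obtain n2 :: nat where n2: "2 * B ^ k < 2 ^ n2" using real_arch_pow[of 2 "2 * B ^ k"] by auto
  define n where "n = max n1 n2"
  have nN: "real N \<le> real n * (p / 2)"
  proof -
    have "2 * real N / p \<le> real n" using n1 by (simp add: n_def)
    then show ?thesis using p by (simp add: field_simps)
  qed
  have nB: "2 * B ^ k \<le> 2 ^ n"
  proof -
    have "(2::real) ^ n2 \<le> 2 ^ n" by (intro power_increasing) (auto simp: n_def)
    with n2 show ?thesis by (meson less_imp_le order_trans)
  qed
  define x where "x J \<zeta> z = (1/2) ^ J / cmod (1 - of_real (dyadic_radius J) * cnj \<zeta> * z)" for J \<zeta> z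
  define F where "F J \<zeta> z = of_real (c J) * (of_real ((1/2) ^ J) / (1 - of_real (dyadic_radius J) * cnj \<zeta> * z)) ^ n" for J \<zeta> z
  have cF: "cmod (F J \<zeta> z) = c J * x J \<zeta> z ^ n" for J \<zeta> z
    using c[of J] by (simp add: F_def x_def norm_mult norm_power norm_divide)
  have den: "1 - cmod z \<le> cmod (1 - of_real (dyadic_radius J) * cnj \<zeta> * z) \<and>
      (1/2) ^ J \<le> cmod (1 - of_real (dyadic_radius J) * cnj \<zeta> * z)" if "cmod \<zeta> = 1" "cmod z < 1" for J \<zeta> z
  proof -
    define r where "r = dyadic_radius J"
    have r: "0 \<le> r" "r < 1" using dyadic_radius_bounds by (auto simp: r_def)
    have "1 - r * cmod z \<le> cmod (1 - of_real r * cnj \<zeta> * z)"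
      using norm_triangle_ineq2[of 1 "of_real r * cnj \<zeta> * z"] r that by (simp add: norm_mult)
    moreover have "r * cmod z \<le> 1 * cmod z" "r * cmod z \<le> r * 1"
      using r that by (intro mult_right_mono mult_left_mono; simp)+
    ultimately show ?thesis by (auto simp: r_def dyadic_radius_def)
  qed
  have x1: "0 \<le> x J \<zeta> z \<and> x J \<zeta> z \<le> 1" if "cmod \<zeta> = 1" "cmod z < 1" for J \<zeta> z
  proof -
    have "cmod (1 - of_real (dyadic_radius J) * cnj \<zeta> * z) > 0"
      using den[OF that, of J] that by linarith
    then show ?thesis using den[OF that, of J] by (simp add: x_def)
  qed
  define Ca where "Ca = C2 * C3 * C1"
  define Cb :: real where "Cb = 3 ^ n"
  define Cc where "Cc = A2 * A1 ^ k"
  have Ca: "Ca \<ge> 1" unfolding Ca_def using C1 C2(1) C3(1) mult_mono[of 1 "C2 * C3" 1 C1] mult_mono[of 1 C2 1 C3] by simp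
  have Cb: "Cb \<ge> 1" unfolding Cb_def by (intro one_le_power) simp
  have Cc: "Cc \<ge> 1" unfolding Cc_def using A2(1) AB mult_mono[of 1 A2 1 "A1 ^ k"] one_le_power[of A1 k] by simp
  define C where "C = Ca + Cb + Cc"
  show ?thesis
  proof (rule that[of C F n])
    show "C \<ge> 1" using Ca Cb Cc by (simp add: C_def)
    show "F J \<zeta> holomorphic_on ball 0 1" if "cmod \<zeta> = 1" for J \<zeta>
    proof -
      have "1 - of_real (dyadic_radius J) * cnj \<zeta> * z \<noteq> 0" if z: "z \<in> ball 0 1" for z
        using den[OF \<open>cmod \<zeta> = 1\<close>, of z J] z by auto
      then show ?thesis unfolding F_def by (auto intro!: holomorphic_intros)
    qed
    show "modular p \<Psi> (weighted_area \<omega>) (\<lambda>z. of_real e * F J \<zeta> z) \<le> ennreal (C * e powr (p / 2))"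
      if \<zeta>: "cmod \<zeta> = 1" and e: "0 < e" "e \<le> 1" for J \<zeta> e
    proof -
      define B0 where "B0 = C2 * e powr (p / 2) * growth p \<Psi> (c J)"
      have g0: "growth p \<Psi> (c J) > 0" using c by (intro growth_pos \<Psi>)
      have B0: "B0 \<ge> 0" using C2(1) g0 by (simp add: B0_def)
      have "modular p \<Psi> (weighted_area \<omega>) (\<lambda>z. of_real e * F J \<zeta> z) =
          (\<integral>\<^sup>+z. ennreal (growth p \<Psi> (e * (c J * x J \<zeta> z ^ n))) \<partial>weighted_area \<omega>)"
        using e by (simp add: modular_def growth_def norm_mult cF)
      also have "\<dots> \<le> (\<integral>\<^sup>+z. ennreal B0 * ennreal (x J \<zeta> z ^ N) \<partial>weighted_area \<omega>)"
      proof (rule nn_integral_mono)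
        fix z assume "z \<in> space (weighted_area \<omega>)"
        then have z: "cmod z < 1" by simp
        define y where "y = x J \<zeta> z"
        have y: "0 \<le> y" "y \<le> 1" using x1[OF \<zeta> z] by (auto simp: y_def)
        have yn: "0 \<le> e * y ^ n" "e * y ^ n \<le> 1"
          using y e mult_mono[of e 1 "y ^ n" 1] by (auto simp: power_le_one)
        have "growth p \<Psi> (e * (c J * y ^ n)) \<le> C2 * ((e * (c J * y ^ n)) / c J) powr (p / 2) * growth p \<Psi> (c J)"
          using yn c[of J] mult_right_mono[OF yn(2), of "c J"] y e by (intro C2(2)) (auto simp: mult_ac)
        also have "(e * (c J * y ^ n)) / c J = e * y ^ n" using c[of J] by simp
        also have "(e * y ^ n) powr (p / 2) = e powr (p / 2) * (y ^ n) powr (p / 2)" by (rule powr_mult)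
        also have "C2 * (e powr (p / 2) * (y ^ n) powr (p / 2)) * growth p \<Psi> (c J) = B0 * (y ^ n) powr (p / 2)"
          by (simp add: B0_def mult_ac)
        also have "\<dots> \<le> B0 * y ^ N"
        proof (rule mult_left_mono[OF _ B0])
          show "(y ^ n) powr (p / 2) \<le> y ^ N"
          proof (cases "y = 0")
            case True
            show ?thesis
            proof (cases "N = 0")
              case True
              have "(y ^ n) powr (p / 2) \<le> 1" using y p by (intro powr_le1) (auto simp: power_le_one)
              then show ?thesis using True by simp
            next
              case False
              then have "n \<noteq> 0" using nN p by (intro notI) simp
              then show ?thesis using True p by (simp add: zero_power)
            qed
          next
            case False
            then have "(y ^ n) powr (p / 2) = y powr (real n * (p / 2))"
              using y by (simp add: powr_realpow[symmetric] powr_powr)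
            also have "\<dots> \<le> y powr real N" using nN y False by (intro powr_mono') auto
            finally show ?thesis using y False by (simp add: powr_realpow)
          qed
        qed
        finally have "growth p \<Psi> (e * (c J * y ^ n)) \<le> B0 * y ^ N" .
        then have "ennreal (growth p \<Psi> (e * (c J * y ^ n))) \<le> ennreal (B0 * y ^ N)" by (rule ennreal_leI)
        also have "\<dots> = ennreal B0 * ennreal (y ^ N)" using B0 y by (intro ennreal_mult) auto
        finally show "ennreal (growth p \<Psi> (e * (c J * x J \<zeta> z ^ n))) \<le> ennreal B0 * ennreal (x J \<zeta> z ^ N)"
          by (simp add: y_def)
      qed
      also have "\<dots> = ennreal B0 * (\<integral>\<^sup>+z. ennreal (x J \<zeta> z ^ N) \<partial>weighted_area \<omega>)"
      proof (intro nn_integral_cmult borel_measurable_weighted_area)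
        have "(\<lambda>z. cmod (1 - of_real (dyadic_radius J) * cnj \<zeta> * z)) \<in> borel_measurable borel"
          by (intro borel_measurable_continuous_onI continuous_intros)
        then show "(\<lambda>z. ennreal (x J \<zeta> z ^ N)) \<in> borel_measurable borel"
          unfolding x_def by measurable
      qed
      also have "\<dots> \<le> ennreal B0 * ennreal (C1 * v J)"
        unfolding x_def v_def by (intro mult_left_mono ker \<zeta>) auto
      also have "\<dots> = ennreal (B0 * (C1 * v J))"
        using B0 C1 v(1)[of J] by (intro ennreal_mult[symmetric]) auto
      also have "\<dots> \<le> ennreal (C * e powr (p / 2))"
      proof (rule ennreal_leI)
        have "B0 * (C1 * v J) = C2 * e powr (p / 2) * C1 * (v J * growth p \<Psi> (c J))" by (simp add: B0_def)
        also have "\<dots> \<le> C2 * e powr (p / 2) * C1 * C3" using gc C1 C2(1) by (intro mult_left_mono) auto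
        also have "\<dots> = Ca * e powr (p / 2)" by (simp add: Ca_def)
        also have "\<dots> \<le> C * e powr (p / 2)" using Cb Cc by (intro mult_right_mono) (auto simp: C_def)
        finally show "B0 * (C1 * v J) \<le> C * e powr (p / 2)" .
      qed
      finally show ?thesis .
    qed
    show "peak p \<Psi> (box_mass \<omega> J) \<le> C * cmod (F J (direction a) z)"
      if a: "dyadic_radius J \<le> cmod a" "cmod a < 1" and z: "z \<in> carleson_square a" for J a z
    proof -
      define y where "y = x J (direction a) z"
      have y: "1 / 3 \<le> y" unfolding y_def x_def by (rule kernel_on_carleson_square[OF a z])
      then have "1 \<le> (3 * y) ^ n" by (intro one_le_power) simp
      then have "c J * 1 \<le> c J * (3 * y) ^ n" using c[of J] by (intro mult_left_mono) auto
      also have "\<dots> = Cb * cmod (F J (direction a) z)" by (simp add: cF y_def Cb_def power_mult_distrib)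
      also have "\<dots> \<le> C * cmod (F J (direction a) z)" using Ca Cc by (intro mult_right_mono) (auto simp: C_def)
      finally show ?thesis by (simp add: c_def v_def)
    qed
    show "cmod (F J \<zeta> z) \<le> C * (1/2) ^ J / (1 - cmod z) ^ n"
      if \<zeta>: "cmod \<zeta> = 1" and z: "cmod z < 1" for J \<zeta> z
    proof -
      define h :: real where "h = (1/2) ^ J"
      have h: "h > 0" by (simp add: h_def)
      have "c J \<le> A2 * (1 + 1 / v J) ^ k" using A2(2)[OF v[of J]] by (simp add: c_def)
      also have "\<dots> \<le> A2 * (A1 * B ^ J) ^ k"
        using A2(1) vlow[of J] v(1)[of J] by (intro mult_left_mono power_mono) (auto simp: v_def)
      also have "\<dots> = Cc * (B ^ k) ^ J"
        by (simp add: Cc_def power_mult_distrib power_mult[symmetric] mult.commute)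
      also have "\<dots> \<le> Cc * (2 ^ n / 2) ^ J"
        using Cc nB AB by (intro mult_left_mono power_mono) auto
      finally have cJ: "c J \<le> Cc * (2 ^ n / 2) ^ J" .
      have "x J \<zeta> z \<le> h / (1 - cmod z)"
        unfolding x_def h_def[symmetric]
      proof (rule divide_left_mono)
        show "1 - cmod z \<le> cmod (1 - of_real (dyadic_radius J) * cnj \<zeta> * z)" using den[OF \<zeta> z, of J] by blast
        then have "0 < cmod (1 - of_real (dyadic_radius J) * cnj \<zeta> * z)" using z by linarith
        then show "0 < cmod (1 - of_real (dyadic_radius J) * cnj \<zeta> * z) * (1 - cmod z)" using z by simp
      qed (use h in simp)
      then have "x J \<zeta> z ^ n \<le> (h / (1 - cmod z)) ^ n" using x1[OF \<zeta> z] by (intro power_mono) auto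
      then have "cmod (F J \<zeta> z) \<le> (Cc * (2 ^ n / 2) ^ J) * (h / (1 - cmod z)) ^ n"
        unfolding cF using cJ c[of J] x1[OF \<zeta> z, of J] Cc by (intro mult_mono) auto
      also have "\<dots> = Cc * ((2 ^ n / 2) ^ J * h ^ n) / (1 - cmod z) ^ n" by (simp add: power_divide)
      also have "(2 ^ n / 2) ^ J * h ^ n = h"
      proof -
        have "h ^ n = (1 / 2 ^ n) ^ J"
          unfolding h_def by (simp add: power_divide power_mult[symmetric] mult.commute)
        then have "(2 ^ n / 2) ^ J * h ^ n = ((2 ^ n / 2) * (1 / 2 ^ n)) ^ J"
          by (simp only: power_mult_distrib)
        then show ?thesis by (simp add: h_def)
      qed
      also have "Cc * h / (1 - cmod z) ^ n \<le> C * h / (1 - cmod z) ^ n"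
        using Ca Cb h z by (intro divide_right_mono mult_right_mono) (auto simp: C_def)
      finally show ?thesis by (simp add: h_def)
    qed
  qed
qed


section \<open>Topologies of quasi-metrics\<close>

text \<open>
  The quasinorms satisfy the triangle inequality with a factor \<open>K\<close> only. Balls need then not
  be open, and distinct functions may have distance 0, so facts about metric spaces do not
  apply directly.
\<close>

locale quasi_metric_family =
  fixes X :: "(complex \<Rightarrow> complex) set" and N :: "(complex \<Rightarrow> complex) \<Rightarrow> real" and K :: real
  assumes K: "K \<ge> 1"
    and refl: "\<And>f. f \<in> X \<Longrightarrow> N (\<lambda>z. f z - f z) = 0"
    and sym: "\<And>f g. N (\<lambda>z. f z - g z) = N (\<lambda>z. g z - f z)"
    and tri: "\<And>f g h. f \<in> X \<Longrightarrow> g \<in> X \<Longrightarrow> h \<in> X \<Longrightarrow>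
       N (\<lambda>z. f z - h z) \<le> K * (N (\<lambda>z. f z - g z) + N (\<lambda>z. g z - h z))"
begin

definition dq :: "(complex \<Rightarrow> complex) \<Rightarrow> (complex \<Rightarrow> complex) \<Rightarrow> real" where
  "dq f g = N (\<lambda>z. g z - f z)"

lemma dq_sym: "dq f g = dq g f"
  unfolding dq_def by (rule sym)

lemma dq_refl: "f \<in> X \<Longrightarrow> dq f f = 0"
  unfolding dq_def by (rule refl)

lemma dq_tri: "f \<in> X \<Longrightarrow> g \<in> X \<Longrightarrow> h \<in> X \<Longrightarrow> dq f h \<le> K * (dq f g + dq g h)"
  unfolding dq_def using tri[of h g f] by (simp add: add.commute)

lemma openin_iff: "openin (qn_topology X N) U \<longleftrightarrow> U \<subseteq> X \<and> (\<forall>f\<in>U. \<exists>e>0. \<forall>g\<in>X. dq f g < e \<longrightarrow> g \<in> U)"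
  by (simp add: openin_qn_topology qn_open_def dq_def)

text \<open>
  The points around which some ball is contained in the given ball form an open set: if the
  ball of radius \<open>d\<close> around \<open>g\<close> is contained in it, then so is the ball of radius \<open>d / (2 * K)\<close>
  around each point of the ball of radius \<open>d / (2 * K)\<close> around \<open>g\<close>.
\<close>

lemma ball_contains_open:
  assumes f: "f \<in> X" and e: "e > 0"
  obtains V where "openin (qn_topology X N) V" "f \<in> V" "V \<subseteq> {g \<in> X. dq f g < e}"
proof -
  define V where "V = {g \<in> X. \<exists>d>0. \<forall>h\<in>X. dq g h < d \<longrightarrow> dq f h < e}"
  have "openin (qn_topology X N) V"
    unfolding openin_iff
  proof (intro conjI ballI)
    fix g assume "g \<in> V"
    then obtain d where g: "g \<in> X" and d: "d > 0" "\<And>h. h \<in> X \<Longrightarrow> dq g h < d \<Longrightarrow> dq f h < e"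
      by (auto simp: V_def)
    show "\<exists>e>0. \<forall>h\<in>X. dq g h < e \<longrightarrow> h \<in> V"
    proof (intro exI[of _ "d / (2 * K)"] conjI ballI impI)
      show "d / (2 * K) > 0" using d(1) K by simp
      fix h assume h: "h \<in> X" "dq g h < d / (2 * K)"
      show "h \<in> V" unfolding V_def
      proof (intro CollectI conjI exI[of _ "d / (2 * K)"] ballI impI)
        fix k assume k: "k \<in> X" "dq h k < d / (2 * K)"
        have "dq g k \<le> K * (dq g h + dq h k)" using g h k by (intro dq_tri)
        also have "\<dots> < K * (d / (2 * K) + d / (2 * K))" using h k K by (intro mult_strict_left_mono) auto
        also have "\<dots> = d" using K by simp
        finally show "dq f k < e" by (intro d(2) k)
      qed (use h d K in auto)
    qed
  qed (auto simp: V_def)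
  moreover have "f \<in> V" using f e by (auto simp: V_def)
  moreover have "V \<subseteq> {g \<in> X. dq f g < e}"
  proof
    fix g assume "g \<in> V"
    then obtain d where g: "g \<in> X" and d: "d > 0" "\<And>h. h \<in> X \<Longrightarrow> dq g h < d \<Longrightarrow> dq f h < e"
      by (auto simp: V_def)
    then show "g \<in> {g \<in> X. dq f g < e}" using d(2)[OF g] dq_refl[OF g] by simp
  qed
  ultimately show ?thesis using that by blast
qed

lemma closure_near:
  assumes S: "S \<subseteq> X" and f: "f \<in> qn_topology X N closure_of S" and e: "e > 0"
  obtains g where "g \<in> S" "dq f g < e"
proof -
  have fX: "f \<in> X" using f by (simp add: in_closure_of topspace_qn_topology)
  obtain V where V: "openin (qn_topology X N) V" "f \<in> V" "V \<subseteq> {g \<in> X. dq f g < e}"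
    by (rule ball_contains_open[OF fX e]) (rule that)
  then obtain g where "g \<in> S" "g \<in> V" using f by (auto simp: in_closure_of)
  then show ?thesis using V that by blast
qed

text \<open>
  The classical proof for metric spaces survives the factor \<open>K\<close>: sequential compactness of the
  closure yields a Lebesgue number for every open cover and finite \<open>e\<close>-nets for every \<open>e\<close>.
\<close>

lemma relatively_compact_if_sequentially:
  assumes S: "S \<subseteq> X"
    and seq: "\<And>s. range s \<subseteq> S \<Longrightarrow> \<exists>g\<in>X. \<exists>r :: nat \<Rightarrow> nat. strict_mono r \<and> (\<lambda>n. dq (s (r n)) g) \<longlonglongrightarrow> 0"
    and nonneg: "\<And>f g. 0 \<le> dq f g"
  shows "relatively_compact_in (qn_topology X N) S"
proof -
  let ?T = "qn_topology X N"
  define A where "A = ?T closure_of S"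
  have AX: "A \<subseteq> X" unfolding A_def using closure_of_subset_topspace[of "qn_topology X N" S] by (simp add: topspace_qn_topology)
  have K0: "K > 0" using K by simp
  \<comment> \<open>every sequence in the closure has a subsequence converging to a point of the closure\<close>
  have seqA: "\<exists>g\<in>A. \<exists>r :: nat \<Rightarrow> nat. strict_mono r \<and> (\<lambda>n. dq (s (r n)) g) \<longlonglongrightarrow> 0" if s: "range s \<subseteq> A" for s :: "nat \<Rightarrow> _"
  proof -
    have "\<exists>t\<in>S. dq (s n) t < inverse (Suc n)" for n
    proof -
      have "s n \<in> ?T closure_of S" using s by (auto simp: A_def)
      from closure_near[OF S this, of "inverse (Suc n)"] show ?thesis by (metis inverse_positive_iff_positive of_nat_0_less_iff zero_less_Suc)
    qed
    then obtain t where t: "\<And>n. t n \<in> S" "\<And>n. dq (s n) (t n) < inverse (Suc n)" by metis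
    then obtain g r where g: "g \<in> X" and r: "strict_mono (r :: nat \<Rightarrow> nat)" and lim: "(\<lambda>n. dq (t (r n)) g) \<longlonglongrightarrow> 0"
      using seq[of t] by blast
    have "(\<lambda>n. K * (inverse (Suc (r n)) + dq (t (r n)) g)) \<longlonglongrightarrow> K * (0 + 0)"
      using LIMSEQ_subseq_LIMSEQ[OF LIMSEQ_inverse_real_of_nat r] lim
      by (intro tendsto_intros) (auto simp: o_def)
    moreover have "dq (s (r n)) g \<le> K * (inverse (Suc (r n)) + dq (t (r n)) g)" for n
    proof -
      have "dq (s (r n)) g \<le> K * (dq (s (r n)) (t (r n)) + dq (t (r n)) g)"
        using s AX S t g by (intro dq_tri) auto
      also have "\<dots> \<le> K * (inverse (Suc (r n)) + dq (t (r n)) g)"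
        using t(2)[of "r n"] K0 by (intro mult_left_mono add_right_mono) auto
      finally show ?thesis .
    qed
    ultimately have sg: "(\<lambda>n. dq (s (r n)) g) \<longlonglongrightarrow> 0"
      using nonneg by (intro real_tendsto_sandwich[where f = "\<lambda>_. 0" and g = "\<lambda>n. dq (s (r n)) g"] always_eventually) auto
    have "g \<in> A" unfolding A_def in_closure_of topspace_qn_topology
    proof (intro conjI allI impI g)
      fix V assume V: "g \<in> V \<and> openin ?T V"
      then obtain e where e: "e > 0" "\<And>h. h \<in> X \<Longrightarrow> dq g h < e \<Longrightarrow> h \<in> V" by (auto simp: openin_iff)
      from order_tendstoD(2)[OF lim e(1)] obtain n where "dq (t (r n)) g < e"
        by (auto simp: eventually_sequentially)
      then have "t (r n) \<in> V" using e(2)[of "t (r n)"] t(1) S by (auto simp: dq_sym[of g])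
      then show "\<exists>y. y \<in> S \<and> y \<in> V" using t(1) by blast
    qed
    then show ?thesis using sg r by blast
  qed
  have "compactin ?T A"
    unfolding compactin_def topspace_qn_topology
  proof (intro conjI AX allI impI)
    fix \<U> assume U: "Ball \<U> (openin ?T) \<and> A \<subseteq> \<Union> \<U>"
    \<comment> \<open>a Lebesgue number of the cover\<close>
    have leb: "\<exists>e>0. \<forall>f\<in>A. \<exists>V\<in>\<U>. \<forall>h\<in>X. dq f h < e \<longrightarrow> h \<in> V"
    proof (rule ccontr)
      assume no: "\<not> ?thesis"
      have "\<exists>f\<in>A. \<forall>V\<in>\<U>. \<exists>h\<in>X. dq f h < inverse (Suc n) \<and> h \<notin> V" for n
        using no by (metis inverse_positive_iff_positive of_nat_0_less_iff zero_less_Suc)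
      then obtain s where s: "\<And>n. s n \<in> A" "\<And>n V. V \<in> \<U> \<Longrightarrow> \<exists>h\<in>X. dq (s n) h < inverse (Suc n) \<and> h \<notin> V" by metis
      then obtain g r where g: "g \<in> A" and r: "strict_mono (r :: nat \<Rightarrow> nat)" and lim: "(\<lambda>n. dq (s (r n)) g) \<longlonglongrightarrow> 0"
        using seqA[of s] by blast
      then obtain V where V: "V \<in> \<U>" "g \<in> V" using U by blast
      then have "openin ?T V \<and> g \<in> V" using U by blast
      then obtain e where e: "e > 0" "\<And>h. h \<in> X \<Longrightarrow> dq g h < e \<Longrightarrow> h \<in> V" by (auto simp: openin_iff)
      have "(\<lambda>n. K * (dq (s (r n)) g + inverse (Suc (r n)))) \<longlonglongrightarrow> K * (0 + 0)"
        using LIMSEQ_subseq_LIMSEQ[OF LIMSEQ_inverse_real_of_nat r] lim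
        by (intro tendsto_intros) (auto simp: o_def)
      then have "\<forall>\<^sub>F n in sequentially. K * (dq (s (r n)) g + inverse (Suc (r n))) < e"
        using e(1) by (intro order_tendstoD) auto
      then obtain n where n: "K * (dq (s (r n)) g + inverse (Suc (r n))) < e"
        by (auto simp: eventually_sequentially)
      obtain h where h: "h \<in> X" "dq (s (r n)) h < inverse (Suc (r n))" "h \<notin> V" using s(2)[OF V(1)] by blast
      have "dq g h \<le> K * (dq g (s (r n)) + dq (s (r n)) h)" using g s(1) AX h by (intro dq_tri) auto
      also have "\<dots> \<le> K * (dq (s (r n)) g + inverse (Suc (r n)))"
        using h K0 by (intro mult_left_mono add_mono) (auto simp: dq_sym[of g])
      finally show False using n e(2)[OF h(1)] h(3) by simp
    qed
    then obtain e V where e: "e > 0" and V: "\<And>f. f \<in> A \<Longrightarrow> V f \<in> \<U>" "\<And>f h. f \<in> A \<Longrightarrow> h \<in> X \<Longrightarrow> dq f h < e \<Longrightarrow> h \<in> V f"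
      by metis
    \<comment> \<open>an \<open>e\<close>-net: otherwise a sequence of points with mutual distances at least \<open>e\<close> could be
      chosen\<close>
    have "\<exists>F. finite F \<and> F \<subseteq> A \<and> (\<forall>h\<in>A. \<exists>f\<in>F. dq f h < e)"
    proof (rule ccontr)
      assume no: "\<not> ?thesis"
      have ex: "\<exists>h\<in>A. \<forall>f\<in>F. \<not> dq f h < e" if "finite F" "F \<subseteq> A" for F
      proof (rule ccontr)
        assume "\<not> (\<exists>h\<in>A. \<forall>f\<in>F. \<not> dq f h < e)"
        then have "finite F \<and> F \<subseteq> A \<and> (\<forall>h\<in>A. \<exists>f\<in>F. dq f h < e)" using that by simp
        then have "\<exists>F. finite F \<and> F \<subseteq> A \<and> (\<forall>h\<in>A. \<exists>f\<in>F. dq f h < e)" by (rule exI)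
        with no show False by (rule notE)
      qed
      define nx where "nx F = (SOME h. h \<in> A \<and> (\<forall>f\<in>F. \<not> dq f h < e))" for F
      have nx: "nx F \<in> A \<and> (\<forall>f\<in>F. \<not> dq f (nx F) < e)" if "finite F" "F \<subseteq> A" for F
      proof -
        have "\<exists>h. h \<in> A \<and> (\<forall>f\<in>F. \<not> dq f h < e)" using ex[OF that] by (simp only: Bex_def)
        then show ?thesis unfolding nx_def by (rule someI_ex)
      qed
      define G where "G = rec_nat {} (\<lambda>_ F. insert (nx F) F)"
      have G: "G 0 = {}" "\<And>n. G (Suc n) = insert (nx (G n)) (G n)" by (auto simp: G_def)
      have Gf: "finite (G n) \<and> G n \<subseteq> A" for n by (induction n) (auto simp: G nx)
      have Gm: "G m \<subseteq> G n" if "m \<le> n" for m n using that by (induction rule: dec_induct) (auto simp: G)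
      define s where "s n = nx (G n)" for n
      have sA: "s n \<in> A" for n using nx Gf by (auto simp: s_def)
      have sep: "\<not> dq (s m) (s n) < e" if "m < n" for m n
      proof -
        have "s m \<in> G n" using Gm[of "Suc m" n] that by (auto simp: G s_def)
        then show ?thesis using nx[of "G n"] Gf by (auto simp: s_def)
      qed
      obtain g r where g: "g \<in> A" and r: "strict_mono (r :: nat \<Rightarrow> nat)" and lim: "(\<lambda>n. dq (s (r n)) g) \<longlonglongrightarrow> 0"
        using seqA[of s] sA by blast
      have "\<forall>\<^sub>F n in sequentially. dq (s (r n)) g < e / (2 * K)"
        using lim e K0 by (intro order_tendstoD) auto
      then obtain n where n: "\<And>k. k \<ge> n \<Longrightarrow> dq (s (r k)) g < e / (2 * K)"
        by (auto simp: eventually_sequentially)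
      have "dq (s (r n)) (s (r (Suc n))) \<le> K * (dq (s (r n)) g + dq g (s (r (Suc n))))"
        using sA g AX by (intro dq_tri) auto
      also have "\<dots> < K * (e / (2 * K) + e / (2 * K))"
        using n[of n] n[of "Suc n"] K0 by (intro mult_strict_left_mono add_strict_mono) (auto simp: dq_sym[of g])
      also have "\<dots> = e" using K0 by simp
      finally show False using sep[of "r n" "r (Suc n)"] r by (simp add: strict_mono_Suc_iff)
    qed
    then obtain F where F: "finite F" "F \<subseteq> A" "\<And>h. h \<in> A \<Longrightarrow> \<exists>f\<in>F. dq f h < e" by blast
    show "\<exists>\<F>. finite \<F> \<and> \<F> \<subseteq> \<U> \<and> A \<subseteq> \<Union> \<F>"
    proof (intro exI[of _ "V ` F"] conjI)
      show "A \<subseteq> \<Union> (V ` F)"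
      proof
        fix h assume h: "h \<in> A"
        then obtain f where "f \<in> F" "dq f h < e" using F by blast
        then show "h \<in> \<Union> (V ` F)" using V(2)[of f h] F h AX by blast
      qed
    qed (use F V in auto)
  qed
  then show ?thesis
    unfolding relatively_compact_in_def topspace_qn_topology A_def using S by blast
qed

text \<open>
  Otherwise every point of the closure has an open neighbourhood that the sequence leaves
  eventually, and finitely many of them cover the closure.
\<close>

lemma relatively_compact_cluster_point:
  assumes "relatively_compact_in (qn_topology X N) S" and s: "\<And>n::nat. s n \<in> S"
  obtains g where "g \<in> X" "\<And>e m. e > 0 \<Longrightarrow> \<exists>n\<ge>m. dq (s n) g < e"
proof -
  let ?T = "qn_topology X N"
  define A where "A = ?T closure_of S"
  have S: "S \<subseteq> X" and cA: "compactin ?T A"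
    using assms by (auto simp: relatively_compact_in_def topspace_qn_topology A_def)
  have AX: "A \<subseteq> X" unfolding A_def using closure_of_subset_topspace[of "qn_topology X N" S] by (simp add: topspace_qn_topology)
  have sA: "s n \<in> A" for n
    unfolding A_def using closure_of_subset[of S ?T] S s by (auto simp: topspace_qn_topology)
  have "\<exists>g\<in>A. \<forall>e>0. \<forall>m. \<exists>n\<ge>m. dq (s n) g < e"
  proof (rule ccontr)
    assume no: "\<not> ?thesis"
    have "\<exists>V m. openin ?T V \<and> g \<in> V \<and> (\<forall>n\<ge>m. s n \<notin> V)" if g: "g \<in> A" for g
    proof -
      obtain e m where e: "e > 0" "\<And>n. n \<ge> m \<Longrightarrow> \<not> dq (s n) g < e" using no g by blast
      obtain V where "openin ?T V" "g \<in> V" "V \<subseteq> {h \<in> X. dq g h < e}"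
      proof -
        have gX: "g \<in> X" using g AX by blast
        show ?thesis by (rule ball_contains_open[OF gX e(1)]) (rule that)
      qed
      then show ?thesis using e(2) by (intro exI[of _ V] exI[of _ m]) (auto simp: dq_sym[of g])
    qed
    then obtain V m where V: "\<And>g. g \<in> A \<Longrightarrow> openin ?T (V g)" "\<And>g. g \<in> A \<Longrightarrow> g \<in> V g"
      "\<And>g n. g \<in> A \<Longrightarrow> n \<ge> m g \<Longrightarrow> s n \<notin> V g" by metis
    have "(\<forall>U\<in>V ` A. openin ?T U) \<and> A \<subseteq> \<Union> (V ` A)" using V by blast
    then obtain \<F> where \<F>: "finite \<F>" "\<F> \<subseteq> V ` A" "A \<subseteq> \<Union> \<F>"
      using cA[unfolded compactin_def, THEN conjunct2, rule_format, of "V ` A"] by blast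
    obtain F where F: "F \<subseteq> A" "finite F" "\<F> = V ` F"
      using finite_subset_image[OF \<F>(1,2)] by blast
    define M where "M = Max (insert 0 (m ` F))"
    have M: "m g \<le> M" if "g \<in> F" for g unfolding M_def using that F by (intro Max_ge) auto
    have "s M \<in> \<Union> (V ` F)" using sA[of M] \<F> F by blast
    then show False using V(3) M F by blast
  qed
  then show ?thesis using that AX by blast
qed

end


section \<open>Modulars and quasinorms\<close>

lemma modular_growth: "modular p \<Psi> M f = (\<integral>\<^sup>+z. ennreal (growth p \<Psi> (cmod (f z))) \<partial>M)"
  by (simp add: modular_def growth_def)

lemma growth_cmod_measurable:
  assumes "\<Psi> \<in> class_L" "f \<in> borel_measurable M"
  shows "(\<lambda>z. ennreal (growth p \<Psi> (cmod (f z)))) \<in> borel_measurable M"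
proof -
  have "(\<lambda>z. cmod (f z)) \<in> borel_measurable M" using assms(2) by measurable
  then have "(\<lambda>z. growth p \<Psi> (cmod (f z))) \<in> borel_measurable M"
    by (intro growth_measurable[OF assms(1)]) auto
  then show ?thesis by measurable
qed

lemma modular_add:
  assumes \<Psi>: "\<Psi> \<in> class_L" and p: "p > 0"
  obtains C where "C \<ge> 1"
    "\<And>M f g h. f \<in> borel_measurable M \<Longrightarrow> g \<in> borel_measurable M \<Longrightarrow>
       \<forall>z\<in>space M. cmod (h z) \<le> cmod (f z) + cmod (g z) \<Longrightarrow>
       modular p \<Psi> M h \<le> ennreal C * (modular p \<Psi> M f + modular p \<Psi> M g)"
proof -
  obtain C where C: "C \<ge> 1"
    "\<And>x y z. 0 \<le> x \<Longrightarrow> 0 \<le> y \<Longrightarrow> 0 \<le> z \<Longrightarrow> z \<le> x + y \<Longrightarrow> growth p \<Psi> z \<le> C * (growth p \<Psi> x + growth p \<Psi> y)"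
    by (rule growth_add[OF \<Psi> p]) (rule that)
  show ?thesis
  proof (rule that[OF C(1)])
    fix M and f g h :: "complex \<Rightarrow> complex"
    assume fg: "f \<in> borel_measurable M" "g \<in> borel_measurable M"
      and le: "\<forall>z\<in>space M. cmod (h z) \<le> cmod (f z) + cmod (g z)"
    note m = growth_cmod_measurable[OF \<Psi> fg(1)] growth_cmod_measurable[OF \<Psi> fg(2)]
    have "modular p \<Psi> M h \<le> (\<integral>\<^sup>+z. ennreal C * (ennreal (growth p \<Psi> (cmod (f z))) + ennreal (growth p \<Psi> (cmod (g z)))) \<partial>M)"
      unfolding modular_growth
    proof (rule nn_integral_mono)
      fix z assume z: "z \<in> space M"
      have g0: "growth p \<Psi> (cmod (f z)) \<ge> 0" "growth p \<Psi> (cmod (g z)) \<ge> 0"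
        by (auto intro!: growth_nonneg[OF \<Psi>])
      have "ennreal (growth p \<Psi> (cmod (h z))) \<le> ennreal (C * (growth p \<Psi> (cmod (f z)) + growth p \<Psi> (cmod (g z))))"
        using le[rule_format, OF z] by (intro ennreal_leI C(2)) auto
      also have "\<dots> = ennreal C * (ennreal (growth p \<Psi> (cmod (f z))) + ennreal (growth p \<Psi> (cmod (g z))))"
        using C(1) g0 by (simp add: ennreal_mult)
      finally show "ennreal (growth p \<Psi> (cmod (h z))) \<le> ennreal C * (ennreal (growth p \<Psi> (cmod (f z))) + ennreal (growth p \<Psi> (cmod (g z))))" .
    qed
    also have "\<dots> = ennreal C * (modular p \<Psi> M f + modular p \<Psi> M g)"
      unfolding modular_growth using m by (simp add: nn_integral_cmult nn_integral_add)
    finally show "modular p \<Psi> M h \<le> ennreal C * (modular p \<Psi> M f + modular p \<Psi> M g)" .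
  qed
qed

text \<open>
  Fatou's lemma for the modular. The integrand need not be continuous, because \<open>\<Psi>\<close> is only
  measurable, but \<open>|f| \<le> 2 |s\<^sub>n|\<close> holds eventually at every point, and \<open>growth_dilate\<close> applies.
\<close>

lemma modular_fatou:
  assumes \<Psi>: "\<Psi> \<in> class_L" and p: "p > 0"
  obtains C where "C \<ge> 1"
    "\<And>M (s :: nat \<Rightarrow> complex \<Rightarrow> complex) f. \<forall>n. s n \<in> borel_measurable M \<Longrightarrow>
       \<forall>z\<in>space M. (\<lambda>n. s n z) \<longlonglongrightarrow> f z \<Longrightarrow>
       modular p \<Psi> M f \<le> liminf (\<lambda>n. ennreal C * modular p \<Psi> M (s n))"
proof -
  have "(1::real) \<le> 2" by simp
  then obtain C where C: "C \<ge> 1"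
    "\<And>x y. 0 \<le> x \<Longrightarrow> 0 \<le> y \<Longrightarrow> y \<le> 2 * x \<Longrightarrow> growth p \<Psi> y \<le> C * growth p \<Psi> x"
    by (rule growth_dilate[OF \<Psi> p]) (rule that)
  show ?thesis
  proof (rule that[OF C(1)])
    fix M f and s :: "nat \<Rightarrow> complex \<Rightarrow> complex"
    assume s0: "\<forall>n. s n \<in> borel_measurable M" and lim: "\<forall>z\<in>space M. (\<lambda>n. s n z) \<longlonglongrightarrow> f z"
    have s: "s n \<in> borel_measurable M" for n using s0 by blast
    have "modular p \<Psi> M f \<le> (\<integral>\<^sup>+z. liminf (\<lambda>n. ennreal C * ennreal (growth p \<Psi> (cmod (s n z)))) \<partial>M)"
      unfolding modular_growth
    proof (rule nn_integral_mono)
      fix z assume z: "z \<in> space M"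
      show "ennreal (growth p \<Psi> (cmod (f z))) \<le> liminf (\<lambda>n. ennreal C * ennreal (growth p \<Psi> (cmod (s n z))))"
      proof (rule Liminf_bounded)
        have "\<forall>\<^sub>F n in sequentially. cmod (f z) \<le> 2 * cmod (s n z)"
        proof (cases "f z = 0")
          case False
          then have "\<forall>\<^sub>F n in sequentially. cmod (s n z) > cmod (f z) / 2"
            by (intro order_tendstoD(1)[OF tendsto_norm[OF lim[rule_format, OF z]]]) simp
          then show ?thesis by eventually_elim simp
        qed simp
        then show "\<forall>\<^sub>F n in sequentially. ennreal (growth p \<Psi> (cmod (f z))) \<le> ennreal C * ennreal (growth p \<Psi> (cmod (s n z)))"
        proof eventually_elim
          case (elim n)
          then have "ennreal (growth p \<Psi> (cmod (f z))) \<le> ennreal (C * growth p \<Psi> (cmod (s n z)))"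
            by (intro ennreal_leI C(2)) auto
          then show ?case using C(1) growth_nonneg[OF \<Psi>, of "cmod (s n z)" p] by (simp add: ennreal_mult)
        qed
      qed
    qed
    also have "\<dots> \<le> liminf (\<lambda>n. \<integral>\<^sup>+z. ennreal C * ennreal (growth p \<Psi> (cmod (s n z))) \<partial>M)"
      using growth_cmod_measurable[OF \<Psi> s] by (intro nn_integral_liminf borel_measurable_times_ennreal) auto
    also have "(\<lambda>n. \<integral>\<^sup>+z. ennreal C * ennreal (growth p \<Psi> (cmod (s n z))) \<partial>M) = (\<lambda>n. ennreal C * modular p \<Psi> M (s n))"
      unfolding modular_growth using growth_cmod_measurable[OF \<Psi> s] by (intro ext nn_integral_cmult) auto
    finally show "modular p \<Psi> M f \<le> liminf (\<lambda>n. ennreal C * modular p \<Psi> M (s n))" .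
  qed
qed

lemma L_norm_nonneg: "L_norm p \<Psi> M f \<ge> 0"
  by (simp add: L_norm_def)

lemma L_norm_le:
  assumes "modular p \<Psi> M f \<le> ennreal m" "m \<ge> 0" "p > 0"
  shows "L_norm p \<Psi> M f \<le> m powr (1 / p)"
proof -
  have "enn2real (modular p \<Psi> M f) \<le> enn2real (ennreal m)"
    using assms by (intro enn2real_mono) auto
  then show ?thesis unfolding L_norm_def using assms by (intro powr_mono2) auto
qed

lemma modular_eq_L_norm:
  assumes "modular p \<Psi> M f < \<infinity>" "p > 0"
  shows "modular p \<Psi> M f = ennreal (L_norm p \<Psi> M f powr p)"
proof -
  have "L_norm p \<Psi> M f powr p = enn2real (modular p \<Psi> M f)"
    using assms(2) by (simp add: L_norm_def powr_powr)
  then show ?thesis using assms by (simp add: less_top[symmetric])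
qed

lemma quasi_metric_L_space:
  assumes \<Psi>: "\<Psi> \<in> class_L" and p: "p > 0"
    and X0: "\<forall>f\<in>X. \<forall>g\<in>X. (\<lambda>z. f z - g z) \<in> L_space p \<Psi> M"
  obtains K where "quasi_metric_family X (L_norm p \<Psi> M) K"
proof -
  obtain C where C: "C \<ge> 1"
    "\<And>M f g h. f \<in> borel_measurable M \<Longrightarrow> g \<in> borel_measurable M \<Longrightarrow>
       \<forall>z\<in>space M. cmod (h z) \<le> cmod (f z) + cmod (g z) \<Longrightarrow>
       modular p \<Psi> M h \<le> ennreal C * (modular p \<Psi> M f + modular p \<Psi> M g)"
    by (rule modular_add[OF \<Psi> p]) (rule that)
  note X = X0[rule_format]
  define K where "K = (2 * C) powr (1 / p)"
  show ?thesis
  proof (rule that[of K], unfold_locales)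
    show "K \<ge> 1" unfolding K_def using C(1) p by (intro ge_one_powr_ge_zero) auto
    show "L_norm p \<Psi> M (\<lambda>z. f z - f z) = 0" for f
      by (simp add: L_norm_def modular_def)
    show "L_norm p \<Psi> M (\<lambda>z. f z - g z) = L_norm p \<Psi> M (\<lambda>z. g z - f z)" for f g
      by (simp add: L_norm_def modular_def norm_minus_commute)
    fix f g h assume fgh: "f \<in> X" "g \<in> X" "h \<in> X"
    define a where "a = L_norm p \<Psi> M (\<lambda>z. f z - g z)"
    define b where "b = L_norm p \<Psi> M (\<lambda>z. g z - h z)"
    have ab: "a \<ge> 0" "b \<ge> 0" by (auto simp: a_def b_def L_norm_nonneg)
    have ma: "modular p \<Psi> M (\<lambda>z. f z - g z) = ennreal (a powr p)"
      unfolding a_def using X[OF fgh(1,2)] p by (intro modular_eq_L_norm) (auto simp: L_space_def)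
    have mb: "modular p \<Psi> M (\<lambda>z. g z - h z) = ennreal (b powr p)"
      unfolding b_def using X[OF fgh(2,3)] p by (intro modular_eq_L_norm) (auto simp: L_space_def)
    have "modular p \<Psi> M (\<lambda>z. f z - h z) \<le> ennreal C * (modular p \<Psi> M (\<lambda>z. f z - g z) + modular p \<Psi> M (\<lambda>z. g z - h z))"
    proof (rule C(2))
      have "cmod (f z - h z) \<le> cmod (f z - g z) + cmod (g z - h z)" for z
        using norm_triangle_ineq[of "f z - g z" "g z - h z"] by simp
      then show "\<forall>z\<in>space M. cmod (f z - h z) \<le> cmod (f z - g z) + cmod (g z - h z)" by blast
    qed (use X fgh in \<open>auto simp: L_space_def\<close>)
    also have "\<dots> = ennreal (C * (a powr p + b powr p))"
      using C(1) by (simp add: ma mb ennreal_mult)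
    also have "\<dots> \<le> ennreal (2 * C * (max a b) powr p)"
    proof (rule ennreal_leI)
      have "a powr p \<le> max a b powr p" "b powr p \<le> max a b powr p"
        using ab p by (auto intro!: powr_mono2)
      then have "C * (a powr p + b powr p) \<le> C * (max a b powr p + max a b powr p)"
        using C(1) by (intro mult_left_mono add_mono) auto
      then show "C * (a powr p + b powr p) \<le> 2 * C * (max a b) powr p" by simp
    qed
    finally have "L_norm p \<Psi> M (\<lambda>z. f z - h z) \<le> (2 * C * (max a b) powr p) powr (1 / p)"
      using C(1) p by (intro L_norm_le) auto
    also have "\<dots> = K * ((max a b) powr p) powr (1 / p)" unfolding K_def by (rule powr_mult)
    also have "((max a b) powr p) powr (1 / p) = max a b" using ab p by (simp add: powr_powr)
    also have "K * max a b \<le> K * (a + b)" using ab by (intro mult_left_mono) (auto simp: K_def)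
    finally show "L_norm p \<Psi> M (\<lambda>z. f z - h z) \<le> K * (L_norm p \<Psi> M (\<lambda>z. f z - g z) + L_norm p \<Psi> M (\<lambda>z. g z - h z))"
      by (simp add: a_def b_def)
  qed
qed

lemma L_space_diff:
  assumes \<Psi>: "\<Psi> \<in> class_L" and p: "p > 0" and f: "f \<in> L_space p \<Psi> M" and g: "g \<in> L_space p \<Psi> M"
  shows "(\<lambda>z. f z - g z) \<in> L_space p \<Psi> M"
proof -
  obtain C where C: "C \<ge> 1"
    "\<And>M f g h. f \<in> borel_measurable M \<Longrightarrow> g \<in> borel_measurable M \<Longrightarrow>
       \<forall>z\<in>space M. cmod (h z) \<le> cmod (f z) + cmod (g z) \<Longrightarrow>
       modular p \<Psi> M h \<le> ennreal C * (modular p \<Psi> M f + modular p \<Psi> M g)"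
    by (rule modular_add[OF \<Psi> p]) (rule that)
  have fg: "f \<in> borel_measurable M" "g \<in> borel_measurable M" "modular p \<Psi> M f < \<infinity>" "modular p \<Psi> M g < \<infinity>"
    using f g by (auto simp: L_space_def)
  have "modular p \<Psi> M (\<lambda>z. f z - g z) \<le> ennreal C * (modular p \<Psi> M f + modular p \<Psi> M g)"
    by (rule C(2)[OF fg(1,2)]) (simp add: norm_triangle_ineq4)
  also have "\<dots> < \<infinity>" using fg by (simp add: ennreal_mult_less_top)
  finally show ?thesis using fg by (simp add: L_space_def)
qed

lemma holomorphic_disc_measurable:
  assumes "f holomorphic_on ball 0 1"
  shows "f \<in> borel_measurable (weighted_area \<omega>)"
    and "finite_borel_measure_on_disc \<mu> \<Longrightarrow> f \<in> borel_measurable \<mu>"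
proof -
  define g where "g z = (if z \<in> ball 0 1 then f z else 0)" for z
  have gb: "g \<in> borel_measurable borel"
    unfolding g_def using assms
    by (intro borel_measurable_continuous_on_if holomorphic_on_imp_continuous_on) auto
  have "g \<in> borel_measurable (lebesgue_on (ball 0 1))"
    using gb by (intro measurable_restrict_space1 measurable_completion) simp
  then have "g \<in> borel_measurable (weighted_area \<omega>)"
    by (simp add: weighted_area_def disc_area_def cong: measurable_cong_sets)
  then show "f \<in> borel_measurable (weighted_area \<omega>)"
    by (rule measurable_cong[THEN iffD1, rotated]) (simp add: g_def)
  assume \<mu>: "finite_borel_measure_on_disc \<mu>"
  then have s: "sets \<mu> = sets (restrict_space borel (ball 0 1))"
    by (simp add: finite_borel_measure_on_disc_def)
  have "g \<in> borel_measurable \<mu>"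
    using measurable_restrict_space1[OF gb, of "ball 0 1"] by (simp add: measurable_cong_sets[OF s refl])
  then show "f \<in> borel_measurable \<mu>"
    by (rule measurable_cong[THEN iffD1, rotated])
       (simp add: g_def finite_borel_disc_measurable(2)[OF \<mu>])
qed

lemma A_space_iff:
  "f \<in> A_space p \<Psi> \<omega> \<longleftrightarrow> f holomorphic_on ball 0 1 \<and> modular p \<Psi> (weighted_area \<omega>) f < \<infinity>"
  using holomorphic_disc_measurable(1)[of f \<omega>]
  by (auto simp: A_space_def L_space_def analytic_on_open)

lemma growth_sublevel_bounded:
  assumes \<Psi>: "\<Psi> \<in> class_L" and p: "p > 0"
  obtains X where "\<And>x. 0 \<le> x \<Longrightarrow> growth p \<Psi> x \<le> B \<Longrightarrow> x \<le> X"
proof -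
  obtain C where C: "C \<ge> 1"
    "\<And>x y. 0 \<le> x \<Longrightarrow> x \<le> y \<Longrightarrow> growth p \<Psi> x \<le> C * (x / y) powr (p / 2) * growth p \<Psi> y"
    by (rule growth_contract[OF \<Psi> p]) (rule that)
  have g1: "growth p \<Psi> 1 > 0" by (intro growth_pos \<Psi>) simp
  define X where "X = max 1 ((C * B / growth p \<Psi> 1) powr (2 / p))"
  have "x \<le> X" if x: "0 \<le> x" "growth p \<Psi> x \<le> B" for x
  proof (cases "x \<le> 1")
    case False
    have "growth p \<Psi> 1 \<le> C * (1 / x) powr (p / 2) * growth p \<Psi> x" using False by (intro C(2)) auto
    also have "\<dots> \<le> C * (1 / x) powr (p / 2) * B" using x C(1) by (intro mult_left_mono) auto
    also have "(1 / x) powr (p / 2) = 1 / x powr (p / 2)" using False by (simp add: powr_divide)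
    finally have "x powr (p / 2) \<le> C * B / growth p \<Psi> 1"
      using g1 False by (simp add: field_simps)
    then have "(x powr (p / 2)) powr (2 / p) \<le> (C * B / growth p \<Psi> 1) powr (2 / p)"
      using p by (intro powr_mono2) auto
    also have "(x powr (p / 2)) powr (2 / p) = x" using False p by (simp add: powr_powr)
    finally show ?thesis by (simp add: X_def)
  qed (simp add: X_def)
  then show ?thesis using that by blast
qed


section \<open>Boundedness and compactness of the embedding\<close>

context
  fixes p q :: real and \<omega> :: "complex \<Rightarrow> real" and \<Phi> \<Psi> :: "real \<Rightarrow> real" and \<mu> :: "complex measure"
  assumes p: "0 < p" and pq: "p \<le> q" and \<omega>: "\<omega> \<in> class_D" and \<Phi>: "\<Phi> \<in> class_L" and \<Psi>: "\<Psi> \<in> class_L"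
    and \<mu>: "finite_borel_measure_on_disc \<mu>"
begin

lemma q_pos: "q > 0" using p pq by simp

lemma finite_measure_mu: "finite_measure \<mu>" using \<mu> by (simp add: finite_borel_measure_on_disc_def)

text \<open>
  This turns bounds and limits for the modulars of test functions into ones for the Carleson
  quotient. The factor \<open>e\<close> costs a constant only, by \<open>growth_dilate\<close>.
\<close>

lemma test_function_lower:
  assumes e: "0 < e" and C: "C \<ge> 1"
  obtains D where "D \<ge> 1"
    "\<And>J a f. f \<in> borel_measurable \<mu> \<Longrightarrow>
       \<forall>z\<in>carleson_square a. peak p \<Psi> (box_mass \<omega> J) \<le> C * cmod (f z) \<Longrightarrow>
       ennreal (measure \<mu> (carleson_square a) * peak_growth q \<Phi> p \<Psi> \<omega> J)
         \<le> ennreal D * modular q \<Phi> \<mu> (\<lambda>z. of_real e * f z)"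
proof -
  have l: "max 1 (C / e) \<ge> 1" by simp
  obtain D where D: "D \<ge> 1"
    "\<And>x y. 0 \<le> x \<Longrightarrow> 0 \<le> y \<Longrightarrow> y \<le> max 1 (C / e) * x \<Longrightarrow> growth q \<Phi> y \<le> D * growth q \<Phi> x"
    by (rule growth_dilate[OF \<Phi> q_pos l]) (rule that)
  show ?thesis
  proof (rule that[OF D(1)])
    fix J a and f :: "complex \<Rightarrow> complex"
    assume f: "f \<in> borel_measurable \<mu>"
      and low: "\<forall>z\<in>carleson_square a. peak p \<Psi> (box_mass \<omega> J) \<le> C * cmod (f z)"
    define S where "S = carleson_square a"
    define Q where "Q = peak_growth q \<Phi> p \<Psi> \<omega> J"
    have Q: "Q > 0" unfolding Q_def by (rule peak_growth_pos[OF \<omega> \<Phi> \<Psi>])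
    have pk: "peak p \<Psi> (box_mass \<omega> J) > 0" by (intro peak_pos \<Psi> box_mass_pos \<omega>)
    have Sm: "S \<in> sets \<mu>" unfolding S_def
      by (intro finite_borel_disc_measurable(3)[OF \<mu>] carleson_square_borel carleson_square_subset)
    have ef: "(\<lambda>z. of_real e * f z) \<in> borel_measurable \<mu>" using f by measurable
    have "ennreal (measure \<mu> S * Q) = ennreal Q * emeasure \<mu> S"
      using Q by (simp add: finite_measure.emeasure_eq_measure[OF finite_measure_mu] ennreal_mult mult.commute)
    also have "\<dots> = (\<integral>\<^sup>+z. ennreal Q * indicator S z \<partial>\<mu>)"
      by (rule nn_integral_cmult_indicator[symmetric, OF Sm])
    also have "\<dots> \<le> (\<integral>\<^sup>+z. ennreal D * ennreal (growth q \<Phi> (cmod (of_real e * f z))) \<partial>\<mu>)"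
    proof (rule nn_integral_mono)
      fix z
      show "ennreal Q * indicator S z \<le> ennreal D * ennreal (growth q \<Phi> (cmod (of_real e * f z)))"
      proof (cases "z \<in> S")
        case True
        have "peak p \<Psi> (box_mass \<omega> J) \<le> C * cmod (f z)" using low True by (simp add: S_def)
        also have "\<dots> = C / e * cmod (of_real e * f z)" using e by (simp add: norm_mult)
        also have "\<dots> \<le> max 1 (C / e) * cmod (of_real e * f z)" by (intro mult_right_mono) auto
        finally have "Q \<le> D * growth q \<Phi> (cmod (of_real e * f z))"
          unfolding Q_def peak_growth_def using pk by (intro D(2)) auto
        then have "ennreal Q \<le> ennreal (D * growth q \<Phi> (cmod (of_real e * f z)))" by (rule ennreal_leI)
        then show ?thesis using True D(1) growth_nonneg[OF \<Phi>, of "cmod (of_real e * f z)" q]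
          by (simp add: ennreal_mult)
      qed simp
    qed
    also have "\<dots> = ennreal D * modular q \<Phi> \<mu> (\<lambda>z. of_real e * f z)"
      unfolding modular_growth by (intro nn_integral_cmult growth_cmod_measurable[OF \<Phi> ef])
    finally show "ennreal (measure \<mu> (carleson_square a) * peak_growth q \<Phi> p \<Psi> \<omega> J)
         \<le> ennreal D * modular q \<Phi> \<mu> (\<lambda>z. of_real e * f z)" by (simp add: S_def Q_def)
  qed
qed

text \<open>
  The test functions form a bounded set, hence so do their images.
\<close>

lemma carleson_imp_bounded:
  assumes cm: "carleson_measure q \<Phi> p \<Psi> \<omega> \<mu>"
  shows "bdd_above (carleson_quotient q \<Phi> p \<Psi> \<omega> \<mu> ` unit_disc)"
proof -
  obtain F :: "nat \<Rightarrow> complex \<Rightarrow> complex \<Rightarrow> complex" and C :: real and n :: nat where C: "C \<ge> 1" and F: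
    "\<And>J \<zeta>. cmod \<zeta> = 1 \<Longrightarrow> F J \<zeta> holomorphic_on ball 0 1"
    "\<And>J \<zeta> e. cmod \<zeta> = 1 \<Longrightarrow> 0 < e \<Longrightarrow> e \<le> 1 \<Longrightarrow>
       modular p \<Psi> (weighted_area \<omega>) (\<lambda>z. of_real e * F J \<zeta> z) \<le> ennreal (C * e powr (p / 2))"
    "\<And>J a z. dyadic_radius J \<le> cmod a \<Longrightarrow> cmod a < 1 \<Longrightarrow> z \<in> carleson_square a \<Longrightarrow>
       peak p \<Psi> (box_mass \<omega> J) \<le> C * cmod (F J (direction a) z)"
    "\<And>J \<zeta> z. cmod \<zeta> = 1 \<Longrightarrow> cmod z < 1 \<Longrightarrow> cmod (F J \<zeta> z) \<le> C * (1/2) ^ J / (1 - cmod z) ^ n"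
    by (rule test_functions[OF \<omega> \<Psi> p]) (rule that)
  have m1: "modular p \<Psi> (weighted_area \<omega>) (F J \<zeta>) \<le> ennreal C" if "cmod \<zeta> = 1" for J \<zeta>
    using F(2)[OF that, of 1 J] by simp
  define B where "B = {F J \<zeta> | J \<zeta>. cmod \<zeta> = 1}"
  have BA: "B \<subseteq> A_space p \<Psi> \<omega>"
    using F(1) le_less_trans[OF m1 ennreal_less_top] by (auto simp: B_def A_space_iff)
  have "qn_bounded (A_norm p \<Psi> \<omega>) B"
    unfolding qn_bounded_def
  proof (intro exI ballI)
    fix f assume "f \<in> B"
    then show "A_norm p \<Psi> \<omega> f \<le> C powr (1 / p)"
      using m1 C p by (auto simp: B_def intro!: L_norm_le)
  qed
  then have bY: "qn_bounded (L_norm q \<Phi> \<mu>) B" and sub: "A_space p \<Psi> \<omega> \<subseteq> L_space q \<Phi> \<mu>"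
    using cm BA unfolding carleson_measure_def bounded_operator_def by auto
  obtain R where R: "\<And>f. f \<in> B \<Longrightarrow> L_norm q \<Phi> \<mu> f \<le> R" using bY by (auto simp: qn_bounded_def)
  obtain D where D: "D \<ge> 1"
    "\<And>J a f. f \<in> borel_measurable \<mu> \<Longrightarrow>
       \<forall>z\<in>carleson_square a. peak p \<Psi> (box_mass \<omega> J) \<le> C * cmod (f z) \<Longrightarrow>
       ennreal (measure \<mu> (carleson_square a) * peak_growth q \<Phi> p \<Psi> \<omega> J)
         \<le> ennreal D * modular q \<Phi> \<mu> (\<lambda>z. of_real 1 * f z)"
    by (rule test_function_lower[OF zero_less_one C]) (rule that)
  obtain K where K: "K \<ge> 1"
    "\<And>\<mu> J a. dyadic_radius J \<le> cmod a \<Longrightarrow> cmod a < dyadic_radius (Suc J) \<Longrightarrow>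
       carleson_quotient q \<Phi> p \<Psi> \<omega> \<mu> a \<le> K * (measure \<mu> (carleson_square a) * peak_growth q \<Phi> p \<Psi> \<omega> J)"
    "\<And>\<mu> J a. dyadic_radius J \<le> cmod a \<Longrightarrow> cmod a < dyadic_radius (Suc J) \<Longrightarrow>
       measure \<mu> (carleson_square a) * peak_growth q \<Phi> p \<Psi> \<omega> J \<le> K * carleson_quotient q \<Phi> p \<Psi> \<omega> \<mu> a"
    by (rule carleson_quotient_compare[OF \<omega> \<Psi> \<Phi> p pq]) (rule that)
  show ?thesis
  proof (rule bdd_aboveI2)
    fix a :: complex assume "a \<in> unit_disc"
    then have a: "cmod a < 1" by simp
    obtain J where J: "dyadic_radius J \<le> cmod a" "cmod a < dyadic_radius (Suc J)"
      using dyadic_radius_ex[OF norm_ge_zero a] by blast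
    define f where "f = F J (direction a)"
    have fB: "f \<in> B"
      unfolding B_def f_def by (intro CollectI exI[of _ J] exI[of _ "direction a"]) simp
    have "modular q \<Phi> \<mu> f = ennreal (L_norm q \<Phi> \<mu> f powr q)"
      using fB BA sub q_pos by (intro modular_eq_L_norm) (auto simp: L_space_def)
    also have "\<dots> \<le> ennreal (R powr q)"
      using R[OF fB] q_pos by (intro ennreal_leI powr_mono2 L_norm_nonneg) auto
    finally have mf: "modular q \<Phi> \<mu> f \<le> ennreal (R powr q)" .
    have "ennreal (measure \<mu> (carleson_square a) * peak_growth q \<Phi> p \<Psi> \<omega> J)
         \<le> ennreal D * modular q \<Phi> \<mu> (\<lambda>z. of_real 1 * f z)"
      unfolding f_def
      by (rule D(2)) (use F(1,3) J a \<mu> in \<open>auto intro!: holomorphic_disc_measurable(2)\<close>)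
    also have "\<dots> \<le> ennreal D * ennreal (R powr q)" using mf by (intro mult_left_mono) auto
    also have "\<dots> = ennreal (D * R powr q)" using D(1) by (intro ennreal_mult[symmetric]) auto
    finally have "measure \<mu> (carleson_square a) * peak_growth q \<Phi> p \<Psi> \<omega> J \<le> D * R powr q"
      using D(1) by (subst (asm) ennreal_le_iff) auto
    then have "K * (measure \<mu> (carleson_square a) * peak_growth q \<Phi> p \<Psi> \<omega> J) \<le> K * (D * R powr q)"
      using K(1) by (intro mult_left_mono) auto
    then show "carleson_quotient q \<Phi> p \<Psi> \<omega> \<mu> a \<le> K * (D * R powr q)"
      using K(2)[OF J, of \<mu>] by (rule order_trans[rotated])
  qed
qed

lemma embedding_bounded:
  assumes G: "\<forall>j a. cmod a = dyadic_radius j \<longrightarrow>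
          measure \<mu> (carleson_square a) * peak_growth q \<Phi> p \<Psi> \<omega> j \<le> G" and R: "R \<ge> 0"
  obtains C where "C \<ge> 0"
    "\<And>f. f holomorphic_on ball 0 1 \<Longrightarrow> modular p \<Psi> (weighted_area \<omega>) f \<le> ennreal R \<Longrightarrow> modular q \<Phi> \<mu> f \<le> ennreal C"
proof -
  have "0 \<le> measure \<mu> (carleson_square 0) * peak_growth q \<Phi> p \<Psi> \<omega> 0"
    using peak_growth_pos[OF \<omega> \<Phi> \<Psi>, of q p 0] by simp
  also have "\<dots> \<le> G" using G by simp
  finally have G0: "G \<ge> 0" .
  obtain C where C: "C \<ge> 0"
    "\<And>\<mu> J G f. finite_borel_measure_on_disc \<mu> \<Longrightarrow> G \<ge> 0 \<Longrightarrow>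
      \<forall>j\<ge>J. \<forall>a. cmod a = dyadic_radius j \<longrightarrow>
          measure \<mu> (carleson_square a) * growth q \<Phi> (peak p \<Psi> (box_mass \<omega> j)) \<le> G \<Longrightarrow>
      f holomorphic_on ball 0 1 \<Longrightarrow> modular p \<Psi> (weighted_area \<omega>) f \<le> ennreal R \<Longrightarrow>
      (\<integral>\<^sup>+z. ennreal (growth q \<Phi> (cmod (f z))) * indicator {dyadic_radius J..} (cmod z) \<partial>\<mu>) \<le> ennreal (C * G)"
    by (rule embedding_estimate[OF \<omega> \<Psi> \<Phi> p pq R]) (rule that)
  show ?thesis
  proof (rule that[of "C * G"])
    show "C * G \<ge> 0" using C(1) G0 by simp
    fix f assume f: "f holomorphic_on ball 0 1" "modular p \<Psi> (weighted_area \<omega>) f \<le> ennreal R"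
    have "(\<integral>\<^sup>+z. ennreal (growth q \<Phi> (cmod (f z))) * indicator {dyadic_radius 0..} (cmod z) \<partial>\<mu>) \<le> ennreal (C * G)"
      using G by (intro C(2)[OF \<mu> G0 _ f]) (auto simp: peak_growth_def)
    then show "modular q \<Phi> \<mu> f \<le> ennreal (C * G)" by (simp add: modular_growth)
  qed
qed

lemma embedding_subset:
  assumes G: "\<forall>j a. cmod a = dyadic_radius j \<longrightarrow>
          measure \<mu> (carleson_square a) * peak_growth q \<Phi> p \<Psi> \<omega> j \<le> G"
  shows "A_space p \<Psi> \<omega> \<subseteq> L_space q \<Phi> \<mu>"
proof
  fix f assume "f \<in> A_space p \<Psi> \<omega>"
  then have f: "f holomorphic_on ball 0 1" "modular p \<Psi> (weighted_area \<omega>) f < \<infinity>" by (auto simp: A_space_iff)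
  define R where "R = enn2real (modular p \<Psi> (weighted_area \<omega>) f)"
  have R: "R \<ge> 0" "modular p \<Psi> (weighted_area \<omega>) f \<le> ennreal R" using f(2) by (auto simp: R_def less_top[symmetric])
  obtain C where "C \<ge> 0"
    "\<And>f. f holomorphic_on ball 0 1 \<Longrightarrow> modular p \<Psi> (weighted_area \<omega>) f \<le> ennreal R \<Longrightarrow> modular q \<Phi> \<mu> f \<le> ennreal C"
    by (rule embedding_bounded[OF G R(1)]) (rule that)
  then have "modular q \<Phi> \<mu> f < \<infinity>" using f(1) R(2) by (metis ennreal_less_top infinity_ennreal_def le_less_trans)
  then show "f \<in> L_space q \<Phi> \<mu>" using holomorphic_disc_measurable(2)[OF f(1) \<mu>] by (simp add: L_space_def)
qed

lemma bounded_imp_carleson: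
  assumes bd: "bdd_above (carleson_quotient q \<Phi> p \<Psi> \<omega> \<mu> ` unit_disc)"
  shows "carleson_measure q \<Phi> p \<Psi> \<omega> \<mu>"
proof -
  obtain K where K: "K \<ge> 1"
    "\<And>\<mu> J a. dyadic_radius J \<le> cmod a \<Longrightarrow> cmod a < dyadic_radius (Suc J) \<Longrightarrow>
       carleson_quotient q \<Phi> p \<Psi> \<omega> \<mu> a \<le> K * (measure \<mu> (carleson_square a) * peak_growth q \<Phi> p \<Psi> \<omega> J)"
    "\<And>\<mu> J a. dyadic_radius J \<le> cmod a \<Longrightarrow> cmod a < dyadic_radius (Suc J) \<Longrightarrow>
       measure \<mu> (carleson_square a) * peak_growth q \<Phi> p \<Psi> \<omega> J \<le> K * carleson_quotient q \<Phi> p \<Psi> \<omega> \<mu> a"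
    by (rule carleson_quotient_compare[OF \<omega> \<Psi> \<Phi> p pq]) (rule that)
  obtain B where B: "\<And>a. a \<in> unit_disc \<Longrightarrow> carleson_quotient q \<Phi> p \<Psi> \<omega> \<mu> a \<le> B"
    using bd unfolding bdd_above_def by (metis imageI)
  have G0: "measure \<mu> (carleson_square a) * peak_growth q \<Phi> p \<Psi> \<omega> j \<le> K * B" if "cmod a = dyadic_radius j" for j a
  proof -
    have "measure \<mu> (carleson_square a) * peak_growth q \<Phi> p \<Psi> \<omega> j \<le> K * carleson_quotient q \<Phi> p \<Psi> \<omega> \<mu> a"
      using that dyadic_radius_strict_mono[of j "Suc j"] by (intro K(3)) auto
    also have "\<dots> \<le> K * B"
      using K(1) that dyadic_radius_bounds(2)[of j] by (intro mult_left_mono B) auto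
    finally show ?thesis .
  qed
  then have G: "\<forall>j a. cmod a = dyadic_radius j \<longrightarrow>
      measure \<mu> (carleson_square a) * peak_growth q \<Phi> p \<Psi> \<omega> j \<le> K * B" by blast
  show ?thesis
    unfolding carleson_measure_def bounded_operator_def
  proof (intro conjI allI impI)
    show "(\<lambda>f. f) ` A_space p \<Psi> \<omega> \<subseteq> L_space q \<Phi> \<mu>" using embedding_subset[OF G] by simp
    fix S assume S: "S \<subseteq> A_space p \<Psi> \<omega>" "qn_bounded (A_norm p \<Psi> \<omega>) S"
    then obtain R where R: "\<And>f. f \<in> S \<Longrightarrow> A_norm p \<Psi> \<omega> f \<le> R" by (auto simp: qn_bounded_def)
    define R' where "R' = R powr p"
    have R': "R' \<ge> 0" by (simp add: R'_def)
    obtain C where C: "C \<ge> 0"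
      "\<And>f. f holomorphic_on ball 0 1 \<Longrightarrow> modular p \<Psi> (weighted_area \<omega>) f \<le> ennreal R' \<Longrightarrow> modular q \<Phi> \<mu> f \<le> ennreal C"
      by (rule embedding_bounded[OF G R']) (rule that)
    show "qn_bounded (L_norm q \<Phi> \<mu>) ((\<lambda>f. f) ` S)"
      unfolding qn_bounded_def
    proof (intro exI ballI)
      fix f assume "f \<in> (\<lambda>f. f) ` S"
      then have f: "f \<in> S" by simp
      then have fA: "f holomorphic_on ball 0 1" "modular p \<Psi> (weighted_area \<omega>) f < \<infinity>"
        using S(1) by (auto simp: A_space_iff)
      have "modular p \<Psi> (weighted_area \<omega>) f = ennreal (A_norm p \<Psi> \<omega> f powr p)"
        using fA(2) p by (rule modular_eq_L_norm)
      also have "\<dots> \<le> ennreal R'"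
        unfolding R'_def using R[OF f] p by (intro ennreal_leI powr_mono2 L_norm_nonneg) auto
      finally show "L_norm q \<Phi> \<mu> f \<le> C powr (1 / q)"
        using C fA(1) q_pos by (intro L_norm_le) auto
    qed
  qed
qed

text \<open>
  If the quotient does not vanish, there are points \<open>a\<^sub>k\<close> with \<open>|a\<^sub>k| \<rightarrow> 1\<close> at which it is at least
  \<open>\<eta>\<close>. Multiples \<open>h\<^sub>k\<close> of the corresponding test functions by a fixed small factor lie in the
  given neighbourhood of the origin, so they have a cluster point \<open>g\<close> in the target space.
  Along a subsequence \<open>g - h\<^sub>k\<close> has modular tending to 0 and tends to \<open>g\<close> pointwise; hence \<open>g\<close> has
  modular 0 by \<open>modular_fatou\<close>, and the modulars of the \<open>h\<^sub>k\<close> tend to 0 along it. This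
  contradicts \<open>test_function_lower\<close>.
\<close>

lemma compact_imp_vanishing:
  assumes co: "compact_operator (A_space p \<Psi> \<omega>) (A_norm p \<Psi> \<omega>) (L_space q \<Phi> \<mu>) (L_norm q \<Phi> \<mu>) (\<lambda>f. f)"
  shows "(carleson_quotient q \<Phi> p \<Psi> \<omega> \<mu> \<longlongrightarrow> 0) (filtercomap cmod (at_left 1))"
proof (rule ccontr)
  assume nolim: "\<not> ?thesis"
  obtain F :: "nat \<Rightarrow> complex \<Rightarrow> complex \<Rightarrow> complex" and C :: real and n :: nat where C: "C \<ge> 1" and F:
    "\<And>J \<zeta>. cmod \<zeta> = 1 \<Longrightarrow> F J \<zeta> holomorphic_on ball 0 1"
    "\<And>J \<zeta> e. cmod \<zeta> = 1 \<Longrightarrow> 0 < e \<Longrightarrow> e \<le> 1 \<Longrightarrow>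
       modular p \<Psi> (weighted_area \<omega>) (\<lambda>z. of_real e * F J \<zeta> z) \<le> ennreal (C * e powr (p / 2))"
    "\<And>J a z. dyadic_radius J \<le> cmod a \<Longrightarrow> cmod a < 1 \<Longrightarrow> z \<in> carleson_square a \<Longrightarrow>
       peak p \<Psi> (box_mass \<omega> J) \<le> C * cmod (F J (direction a) z)"
    "\<And>J \<zeta> z. cmod \<zeta> = 1 \<Longrightarrow> cmod z < 1 \<Longrightarrow> cmod (F J \<zeta> z) \<le> C * (1/2) ^ J / (1 - cmod z) ^ n"
    by (rule test_functions[OF \<omega> \<Psi> p]) (rule that)
  obtain K where K: "K \<ge> 1"
    "\<And>\<mu> J a. dyadic_radius J \<le> cmod a \<Longrightarrow> cmod a < dyadic_radius (Suc J) \<Longrightarrow>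
       carleson_quotient q \<Phi> p \<Psi> \<omega> \<mu> a \<le> K * (measure \<mu> (carleson_square a) * peak_growth q \<Phi> p \<Psi> \<omega> J)"
    "\<And>\<mu> J a. dyadic_radius J \<le> cmod a \<Longrightarrow> cmod a < dyadic_radius (Suc J) \<Longrightarrow>
       measure \<mu> (carleson_square a) * peak_growth q \<Phi> p \<Psi> \<omega> J \<le> K * carleson_quotient q \<Phi> p \<Psi> \<omega> \<mu> a"
    by (rule carleson_quotient_compare[OF \<omega> \<Psi> \<Phi> p pq]) (rule that)
  have AL: "A_space p \<Psi> \<omega> \<subseteq> L_space q \<Phi> \<mu>" using co by (auto simp: compact_operator_def)
  from co obtain U where U: "nbhd_of_origin (qn_topology (A_space p \<Psi> \<omega>) (A_norm p \<Psi> \<omega>)) U"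
    and rc: "relatively_compact_in (qn_topology (L_space q \<Phi> \<mu>) (L_norm q \<Phi> \<mu>)) U"
    by (auto simp: compact_operator_def)
  obtain V where V: "qn_open (A_space p \<Psi> \<omega>) (A_norm p \<Psi> \<omega>) V" "(\<lambda>z. 0) \<in> V" "V \<subseteq> U"
    using U[unfolded nbhd_of_origin_def openin_qn_topology] by (elim conjE exE) (rule that)
  have "\<exists>\<epsilon>>0. \<forall>g\<in>A_space p \<Psi> \<omega>. A_norm p \<Psi> \<omega> (\<lambda>z. g z - 0) < \<epsilon> \<longrightarrow> g \<in> V"
    using conjunct2[OF V(1)[unfolded qn_open_def], rule_format, OF V(2)] .
  then obtain e0 where e0: "e0 > 0" "\<forall>g\<in>A_space p \<Psi> \<omega>. A_norm p \<Psi> \<omega> (\<lambda>z. g z - 0) < e0 \<longrightarrow> g \<in> V"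
    by (elim exE conjE) (rule that)
  \<comment> \<open>the modular of \<open>e * F J \<zeta>\<close> is at most \<open>C * e powr (p / 2)\<close>, so its quasinorm is at most \<open>e0 / 2\<close>\<close>
  define e where "e = min 1 ((e0 / (2 * C powr (1 / p))) powr 2)"
  have e: "0 < e" "e \<le> 1" using e0(1) C by (auto simp: e_def)
  have small: "(C * e powr (p / 2)) powr (1 / p) < e0"
  proof -
    have "(C * e powr (p / 2)) powr (1 / p) = C powr (1 / p) * (e powr (p / 2)) powr (1 / p)" by (rule powr_mult)
    also have "(e powr (p / 2)) powr (1 / p) = e powr (1 / 2)" using p by (simp add: powr_powr)
    also have "\<dots> \<le> ((e0 / (2 * C powr (1 / p))) powr 2) powr (1 / 2)"
      using e by (intro powr_mono2) (auto simp: e_def)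
    also have "\<dots> = e0 / (2 * C powr (1 / p))" using e0(1) by (simp add: powr_powr)
    finally have "(C * e powr (p / 2)) powr (1 / p) \<le> C powr (1 / p) * (e0 / (2 * C powr (1 / p)))"
      by (simp add: mult_left_mono)
    also have "\<dots> = e0 / 2" using C by simp
    finally show ?thesis using e0(1) by linarith
  qed
  define H where "H J \<zeta> = (\<lambda>z. of_real e * F J \<zeta> z)" for J \<zeta>
  have HA: "H J \<zeta> \<in> A_space p \<Psi> \<omega>" if "cmod \<zeta> = 1" for J \<zeta>
    unfolding A_space_iff H_def using F(1)[OF that]
      le_less_trans[OF F(2)[OF that e, of J] ennreal_less_top]
    by (auto intro!: holomorphic_intros)
  have HU: "H J \<zeta> \<in> U" if "cmod \<zeta> = 1" for J \<zeta>
  proof -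
    have "A_norm p \<Psi> \<omega> (H J \<zeta>) \<le> (C * e powr (p / 2)) powr (1 / p)"
      unfolding H_def using F(2)[OF that e] C p by (intro L_norm_le) auto
    then have "A_norm p \<Psi> \<omega> (\<lambda>z. H J \<zeta> z - 0) < e0" using small by simp
    then have "H J \<zeta> \<in> V" by (rule e0(2)[rule_format, OF HA[OF that]])
    then show ?thesis by (rule subsetD[OF V(3)])
  qed
  obtain \<eta> where \<eta>: "\<eta> > 0" "\<And>b. b < 1 \<Longrightarrow> \<exists>a. b < cmod a \<and> cmod a < 1 \<and> \<not> dist (carleson_quotient q \<Phi> p \<Psi> \<omega> \<mu> a) 0 < \<eta>"
  proof -
    obtain \<eta> where \<eta>: "\<eta> > 0" "\<not> (\<forall>\<^sub>F a in filtercomap cmod (at_left 1). dist (carleson_quotient q \<Phi> p \<Psi> \<omega> \<mu> a) 0 < \<eta>)"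
      using nolim by (auto simp: tendsto_iff)
    have "\<exists>a. b < cmod a \<and> cmod a < 1 \<and> \<not> dist (carleson_quotient q \<Phi> p \<Psi> \<omega> \<mu> a) 0 < \<eta>" if b: "b < 1" for b
    proof (rule ccontr)
      assume "\<not> ?thesis"
      then have "\<And>a. b < cmod a \<Longrightarrow> cmod a < 1 \<Longrightarrow> dist (carleson_quotient q \<Phi> p \<Psi> \<omega> \<mu> a) 0 < \<eta>" by blast
      moreover have "\<forall>\<^sub>F x in at_left 1. b < x \<and> x < (1::real)"
        using b by (auto simp: eventually_at_left[OF b])
      then have "\<forall>\<^sub>F a in filtercomap cmod (at_left 1). b < cmod a \<and> cmod a < 1"
        by (rule eventually_filtercomapI)
      ultimately have "\<forall>\<^sub>F a in filtercomap cmod (at_left 1). dist (carleson_quotient q \<Phi> p \<Psi> \<omega> \<mu> a) 0 < \<eta>"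
        by (auto elim!: eventually_mono)
      with \<eta>(2) show False by contradiction
    qed
    then show ?thesis using that \<eta>(1) by blast
  qed
  have "\<exists>a. dyadic_radius k < cmod a \<and> cmod a < 1 \<and> \<not> dist (carleson_quotient q \<Phi> p \<Psi> \<omega> \<mu> a) 0 < \<eta>" for k
    by (intro \<eta>(2) dyadic_radius_bounds)
  then obtain a where a: "\<And>k. dyadic_radius k < cmod (a k)" "\<And>k. cmod (a k) < 1"
    "\<And>k. \<not> dist (carleson_quotient q \<Phi> p \<Psi> \<omega> \<mu> (a k)) 0 < \<eta>" by metis
  have "\<exists>J. dyadic_radius J \<le> cmod (a k) \<and> cmod (a k) < dyadic_radius (Suc J)" for k
    using dyadic_radius_ex[OF norm_ge_zero a(2)] by metis
  then obtain J where J: "\<And>k. dyadic_radius (J k) \<le> cmod (a k)" "\<And>k. cmod (a k) < dyadic_radius (Suc (J k))" by metis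
  have Jk: "k \<le> J k" for k
  proof (rule ccontr)
    assume "\<not> k \<le> J k"
    then have "dyadic_radius (Suc (J k)) \<le> dyadic_radius k" by (intro dyadic_radius_mono) simp
    then show False using J(2)[of k] a(1)[of k] by simp
  qed
  define h where "h k = H (J k) (direction (a k))" for k
  have hA: "h k \<in> A_space p \<Psi> \<omega>" and hU: "h k \<in> U" for k using HA HU by (auto simp: h_def)
  obtain D where D: "D \<ge> 1"
    "\<And>J a f. f \<in> borel_measurable \<mu> \<Longrightarrow>
       \<forall>z\<in>carleson_square a. peak p \<Psi> (box_mass \<omega> J) \<le> C * cmod (f z) \<Longrightarrow>
       ennreal (measure \<mu> (carleson_square a) * peak_growth q \<Phi> p \<Psi> \<omega> J)
         \<le> ennreal D * modular q \<Phi> \<mu> (\<lambda>z. of_real e * f z)"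
    by (rule test_function_lower[OF e(1) C]) (rule that)
  have lowh: "ennreal (\<eta> / K) \<le> ennreal D * modular q \<Phi> \<mu> (h k)" for k
  proof -
    define M where "M = measure \<mu> (carleson_square (a k)) * peak_growth q \<Phi> p \<Psi> \<omega> (J k)"
    have "M \<ge> 0" using peak_growth_pos[OF \<omega> \<Phi> \<Psi>, of q p "J k"] by (simp add: M_def)
    moreover have "M \<le> K * carleson_quotient q \<Phi> p \<Psi> \<omega> \<mu> (a k)" unfolding M_def by (rule K(3)[OF J])
    ultimately have "0 \<le> K * carleson_quotient q \<Phi> p \<Psi> \<omega> \<mu> (a k)" by (rule order_trans)
    then have "carleson_quotient q \<Phi> p \<Psi> \<omega> \<mu> (a k) \<ge> 0" using K(1) by (simp add: zero_le_mult_iff)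
    then have "\<eta> \<le> carleson_quotient q \<Phi> p \<Psi> \<omega> \<mu> (a k)" using a(3)[of k] by simp
    also have "\<dots> \<le> K * M" unfolding M_def by (rule K(2)[OF J])
    finally have "\<eta> / K \<le> M" using K(1) by (simp add: field_simps)
    then have "ennreal (\<eta> / K) \<le> ennreal M" by (rule ennreal_leI)
    also have "\<dots> \<le> ennreal D * modular q \<Phi> \<mu> (\<lambda>z. of_real e * F (J k) (direction (a k)) z)"
      unfolding M_def by (rule D(2)) (use F(1,3) J a \<mu> in \<open>auto intro!: holomorphic_disc_measurable(2)\<close>)
    finally show ?thesis by (simp add: h_def H_def)
  qed
  obtain Kq where "quasi_metric_family (L_space q \<Phi> \<mu>) (L_norm q \<Phi> \<mu>) Kq"
    using L_space_diff[OF \<Phi> q_pos, of _ \<mu>] by (metis quasi_metric_L_space[OF \<Phi> q_pos])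
  then interpret Y: quasi_metric_family "L_space q \<Phi> \<mu>" "L_norm q \<Phi> \<mu>" Kq .
  obtain g where g: "g \<in> L_space q \<Phi> \<mu>" and cl: "\<And>e m. e > 0 \<Longrightarrow> \<exists>n\<ge>m. Y.dq (h n) g < e"
    by (rule Y.relatively_compact_cluster_point[OF rc hU]) (rule that)
  have "\<exists>n\<ge>i. Y.dq (h n) g < inverse (Suc i)" for i by (rule cl) simp
  then obtain r where r: "\<And>i. r i \<ge> i" "\<And>i. Y.dq (h (r i)) g < inverse (Suc i)" by metis
  have gm: "g \<in> borel_measurable \<mu>" using g by (simp add: L_space_def)
  have hL: "h k \<in> L_space q \<Phi> \<mu>" for k using hA AL by (auto simp: L_space_def)
  define d where "d i = (\<lambda>z. g z - h (r i) z)" for i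
  have dL: "d i \<in> L_space q \<Phi> \<mu>" for i unfolding d_def by (rule L_space_diff[OF \<Phi> q_pos g hL])
  have dm: "d i \<in> borel_measurable \<mu>" for i using dL by (simp add: L_space_def)
  have md: "modular q \<Phi> \<mu> (d i) \<le> ennreal (inverse (Suc i) powr q)" for i
  proof -
    have "modular q \<Phi> \<mu> (d i) = ennreal (L_norm q \<Phi> \<mu> (d i) powr q)"
      using dL q_pos by (intro modular_eq_L_norm) (auto simp: L_space_def)
    also have "\<dots> \<le> ennreal (inverse (Suc i) powr q)"
      using r(2)[of i] q_pos by (intro ennreal_leI powr_mono2 L_norm_nonneg) (auto simp: Y.dq_def d_def)
    finally show ?thesis .
  qed
  have zero: "(\<lambda>i. inverse (Suc i) powr q) \<longlonglongrightarrow> 0"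
    using q_pos by (intro tendsto_zero_powrI[where b = q] LIMSEQ_inverse_real_of_nat tendsto_const) auto
  have hlim: "(\<lambda>i. h (r i) z) \<longlonglongrightarrow> 0" if z: "cmod z < 1" for z
  proof (rule Lim_null_comparison)
    show "\<forall>\<^sub>F i in sequentially. norm (h (r i) z) \<le> C / (1 - cmod z) ^ n * (1/2) ^ i"
    proof (rule always_eventually, rule allI)
      fix i
      have "cmod (h (r i) z) \<le> 1 * cmod (F (J (r i)) (direction (a (r i))) z)"
        using e unfolding h_def H_def norm_mult by (intro mult_right_mono) auto
      also have "\<dots> \<le> C * (1/2) ^ J (r i) / (1 - cmod z) ^ n" using F(4)[OF _ z] by simp
      also have "\<dots> \<le> C * (1/2) ^ i / (1 - cmod z) ^ n"
        using C z Jk[of "r i"] r(1)[of i] by (intro divide_right_mono mult_left_mono power_decreasing) auto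
      finally show "norm (h (r i) z) \<le> C / (1 - cmod z) ^ n * (1/2) ^ i" by simp
    qed
    show "(\<lambda>i. C / (1 - cmod z) ^ n * (1/2) ^ i) \<longlonglongrightarrow> 0"
      by (intro tendsto_mult_right_zero LIMSEQ_realpow_zero) auto
  qed
  obtain C1 where C1: "C1 \<ge> 1" "\<And>M (s :: nat \<Rightarrow> complex \<Rightarrow> complex) f. \<forall>n. s n \<in> borel_measurable M \<Longrightarrow>
       \<forall>z\<in>space M. (\<lambda>n. s n z) \<longlonglongrightarrow> f z \<Longrightarrow>
       modular q \<Phi> M f \<le> liminf (\<lambda>n. ennreal C1 * modular q \<Phi> M (s n))"
    by (rule modular_fatou[OF \<Phi> q_pos]) (rule that)
  have "modular q \<Phi> \<mu> g \<le> liminf (\<lambda>i. ennreal C1 * modular q \<Phi> \<mu> (d i))"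
  proof (rule C1(2))
    show "\<forall>n. d n \<in> borel_measurable \<mu>" using dm by blast
    show "\<forall>z\<in>space \<mu>. (\<lambda>n. d n z) \<longlonglongrightarrow> g z"
    proof
      fix z assume "z \<in> space \<mu>"
      then have "cmod z < 1" by (simp add: finite_borel_disc_measurable(2)[OF \<mu>])
      from tendsto_diff[OF tendsto_const hlim[OF this], of "g z"] show "(\<lambda>n. d n z) \<longlonglongrightarrow> g z"
        by (simp add: d_def)
    qed
  qed
  also have "\<dots> \<le> liminf (\<lambda>i. ennreal (C1 * inverse (Suc i) powr q))"
  proof (intro Liminf_mono always_eventually allI)
    fix i
    have "ennreal C1 * modular q \<Phi> \<mu> (d i) \<le> ennreal C1 * ennreal (inverse (Suc i) powr q)"
      by (intro mult_left_mono md) auto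
    then show "ennreal C1 * modular q \<Phi> \<mu> (d i) \<le> ennreal (C1 * inverse (Suc i) powr q)"
      using C1(1) by (simp add: ennreal_mult)
  qed
  also have "\<dots> = 0"
  proof (rule lim_imp_Liminf)
    have "(\<lambda>i. ennreal (C1 * inverse (Suc i) powr q)) \<longlonglongrightarrow> ennreal (C1 * 0)"
      by (intro tendsto_ennrealI tendsto_mult tendsto_const zero)
    then show "(\<lambda>i. ennreal (C1 * inverse (Suc i) powr q)) \<longlonglongrightarrow> 0" by simp
  qed simp
  finally have g0: "modular q \<Phi> \<mu> g = 0" by simp
  obtain C2 where C2: "C2 \<ge> 1"
    "\<And>M f g h. f \<in> borel_measurable M \<Longrightarrow> g \<in> borel_measurable M \<Longrightarrow>
       \<forall>z\<in>space M. cmod (h z) \<le> cmod (f z) + cmod (g z) \<Longrightarrow>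
       modular q \<Phi> M h \<le> ennreal C2 * (modular q \<Phi> M f + modular q \<Phi> M g)"
    by (rule modular_add[OF \<Phi> q_pos]) (rule that)
  have bound: "\<eta> / K \<le> D * (C2 * inverse (Suc i) powr q)" for i
  proof -
    have "modular q \<Phi> \<mu> (h (r i)) \<le> ennreal C2 * (modular q \<Phi> \<mu> g + modular q \<Phi> \<mu> (d i))"
    proof (rule C2(2)[OF gm dm])
      have "cmod (h (r i) z) \<le> cmod (g z) + cmod (d i z)" for z
        using norm_triangle_ineq4[of "g z" "d i z"] by (simp add: d_def)
      then show "\<forall>z\<in>space \<mu>. cmod (h (r i) z) \<le> cmod (g z) + cmod (d i z)" by blast
    qed
    also have "\<dots> \<le> ennreal C2 * ennreal (inverse (Suc i) powr q)"
      using md[of i] by (simp add: g0 mult_left_mono)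
    also have "\<dots> = ennreal (C2 * inverse (Suc i) powr q)" using C2(1) by (intro ennreal_mult[symmetric]) auto
    finally have "ennreal D * modular q \<Phi> \<mu> (h (r i)) \<le> ennreal D * ennreal (C2 * inverse (Suc i) powr q)"
      by (intro mult_left_mono) auto
    also have "\<dots> = ennreal (D * (C2 * inverse (Suc i) powr q))"
      using C2(1) D(1) by (intro ennreal_mult[symmetric]) auto
    finally have "ennreal (\<eta> / K) \<le> ennreal (D * (C2 * inverse (Suc i) powr q))"
      using lowh[of "r i"] by (rule order_trans[rotated])
    then show ?thesis using C2(1) D(1) by (subst (asm) ennreal_le_iff) auto
  qed
  have "(\<lambda>i. D * (C2 * inverse (Suc i) powr q)) \<longlonglongrightarrow> D * (C2 * 0)"
    by (intro tendsto_mult tendsto_const zero)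
  then have "\<eta> / K \<le> D * (C2 * 0)" using bound by (intro LIMSEQ_le_const) auto
  then show False using \<eta>(1) K(1) by (simp add: divide_le_0_iff)
qed

text \<open>
  The neighbourhood is the unit ball \<open>U\<close>. By \<open>growth_pointwise\<close> it is a normal family, so every
  sequence in \<open>U\<close> has a subsequence converging locally uniformly to some \<open>g\<close>, which has finite
  modular by \<open>modular_fatou\<close>. On \<open>|z| \<ge> r\<^sub>J\<close> the modulars of the differences are at most \<open>C \<eta>\<close> by
  \<open>embedding_estimate\<close>, where \<open>\<eta>\<close> bounds the quotient near the boundary; on \<open>|z| < r\<^sub>J\<close> they tend
  to 0 by uniform convergence and finiteness of \<open>\<mu>\<close>.
\<close>

lemma vanishing_imp_compact:
  assumes lim: "(carleson_quotient q \<Phi> p \<Psi> \<omega> \<mu> \<longlongrightarrow> 0) (filtercomap cmod (at_left 1))"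
  shows "compact_operator (A_space p \<Psi> \<omega>) (A_norm p \<Psi> \<omega>) (L_space q \<Phi> \<mu>) (L_norm q \<Phi> \<mu>) (\<lambda>f. f)"
proof -
  obtain K where K: "K \<ge> 1"
    "\<And>\<mu> J a. dyadic_radius J \<le> cmod a \<Longrightarrow> cmod a < dyadic_radius (Suc J) \<Longrightarrow>
       carleson_quotient q \<Phi> p \<Psi> \<omega> \<mu> a \<le> K * (measure \<mu> (carleson_square a) * peak_growth q \<Phi> p \<Psi> \<omega> J)"
    "\<And>\<mu> J a. dyadic_radius J \<le> cmod a \<Longrightarrow> cmod a < dyadic_radius (Suc J) \<Longrightarrow>
       measure \<mu> (carleson_square a) * peak_growth q \<Phi> p \<Psi> \<omega> J \<le> K * carleson_quotient q \<Phi> p \<Psi> \<omega> \<mu> a"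
    by (rule carleson_quotient_compare[OF \<omega> \<Psi> \<Phi> p pq]) (rule that)
  have pgp: "peak_growth q \<Phi> p \<Psi> \<omega> j > 0" for j by (rule peak_growth_pos[OF \<omega> \<Phi> \<Psi>])
  interpret \<mu>: finite_measure \<mu> by (rule finite_measure_mu)
  note sp = finite_borel_disc_measurable(2)[OF \<mu>]
  have tail: "\<exists>J. \<forall>j a. J \<le> j \<longrightarrow> cmod a = dyadic_radius j \<longrightarrow>
      measure \<mu> (carleson_square a) * peak_growth q \<Phi> p \<Psi> \<omega> j \<le> \<eta>" if \<eta>: "\<eta> > 0" for \<eta>
  proof -
    have "\<forall>\<^sub>F a in filtercomap cmod (at_left 1). dist (carleson_quotient q \<Phi> p \<Psi> \<omega> \<mu> a) 0 < \<eta> / K"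
      using lim \<eta> K(1) by (auto simp: tendsto_iff)
    then obtain P where P: "\<forall>\<^sub>F x in at_left 1. P x" "\<And>a. P (cmod a) \<Longrightarrow> dist (carleson_quotient q \<Phi> p \<Psi> \<omega> \<mu> a) 0 < \<eta> / K"
      by (auto simp: eventually_filtercomap)
    obtain b where b: "b < 1" "\<And>x. b < x \<Longrightarrow> x < 1 \<Longrightarrow> P x"
      using P(1) eventually_at_left[of 0 "1::real" P] by auto
    have "max b 0 < 1" using b(1) by simp
    then obtain J where J: "max b 0 < dyadic_radius (Suc J)" using dyadic_radius_ex[of "max b 0"] by auto
    show ?thesis
    proof (intro exI[of _ "Suc J"] allI impI)
      fix j a assume ja: "Suc J \<le> j" "cmod a = dyadic_radius j"
      have "b < cmod a" using J ja dyadic_radius_mono[of "Suc J" j] by simp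
      moreover have "cmod a < 1" using ja dyadic_radius_bounds(2)[of j] by simp
      ultimately have "carleson_quotient q \<Phi> p \<Psi> \<omega> \<mu> a \<le> \<eta> / K" using P(2) b(2) by fastforce
      then have "K * carleson_quotient q \<Phi> p \<Psi> \<omega> \<mu> a \<le> K * (\<eta> / K)" using K(1) by (intro mult_left_mono) auto
      also have "\<dots> = \<eta>" using K(1) by simp
      finally have "K * carleson_quotient q \<Phi> p \<Psi> \<omega> \<mu> a \<le> \<eta>" .
      moreover have "measure \<mu> (carleson_square a) * peak_growth q \<Phi> p \<Psi> \<omega> j \<le> K * carleson_quotient q \<Phi> p \<Psi> \<omega> \<mu> a"
        using ja dyadic_radius_strict_mono[of j "Suc j"] by (intro K(3)) auto
      ultimately show "measure \<mu> (carleson_square a) * peak_growth q \<Phi> p \<Psi> \<omega> j \<le> \<eta>" by simp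
    qed
  qed
  obtain J1 where J1: "\<And>j a. J1 \<le> j \<Longrightarrow> cmod a = dyadic_radius j \<Longrightarrow>
      measure \<mu> (carleson_square a) * peak_growth q \<Phi> p \<Psi> \<omega> j \<le> 1" using tail[of 1] by auto
  \<comment> \<open>finitely many levels are bounded since \<open>\<mu>\<close> is finite, the others by \<open>tail\<close>\<close>
  define G where "G = 1 + (\<Sum>j<J1. measure \<mu> (space \<mu>) * peak_growth q \<Phi> p \<Psi> \<omega> j)"
  have term0: "0 \<le> measure \<mu> (space \<mu>) * peak_growth q \<Phi> p \<Psi> \<omega> j" for j using pgp[of j] by simp
  have G0: "measure \<mu> (carleson_square a) * peak_growth q \<Phi> p \<Psi> \<omega> j \<le> G" if "cmod a = dyadic_radius j" for j a
  proof (cases "J1 \<le> j")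
    case True
    have "0 \<le> (\<Sum>j<J1. measure \<mu> (space \<mu>) * peak_growth q \<Phi> p \<Psi> \<omega> j)" by (intro sum_nonneg term0)
    then show ?thesis using J1[OF True that] by (simp add: G_def)
  next
    case False
    have "measure \<mu> (carleson_square a) * peak_growth q \<Phi> p \<Psi> \<omega> j \<le> measure \<mu> (space \<mu>) * peak_growth q \<Phi> p \<Psi> \<omega> j"
      using pgp[of j] by (intro mult_right_mono \<mu>.bounded_measure) auto
    also have "\<dots> \<le> (\<Sum>j<J1. measure \<mu> (space \<mu>) * peak_growth q \<Phi> p \<Psi> \<omega> j)"
      using False by (intro member_le_sum term0) auto
    finally show ?thesis by (simp add: G_def)
  qed
  have "\<forall>j a. cmod a = dyadic_radius j \<longrightarrow>
      measure \<mu> (carleson_square a) * peak_growth q \<Phi> p \<Psi> \<omega> j \<le> G" using G0 by blast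
  then have AL: "A_space p \<Psi> \<omega> \<subseteq> L_space q \<Phi> \<mu>" by (rule embedding_subset)
  obtain Kp where Xq: "quasi_metric_family (A_space p \<Psi> \<omega>) (A_norm p \<Psi> \<omega>) Kp"
  proof (rule quasi_metric_L_space[OF \<Psi> p])
    show "\<forall>f\<in>A_space p \<Psi> \<omega>. \<forall>g\<in>A_space p \<Psi> \<omega>. (\<lambda>z. f z - g z) \<in> L_space p \<Psi> (weighted_area \<omega>)"
      by (auto simp: A_space_def intro!: L_space_diff[OF \<Psi> p])
  qed (rule that)
  interpret X: quasi_metric_family "A_space p \<Psi> \<omega>" "A_norm p \<Psi> \<omega>" Kp by (rule Xq)
  obtain Kq where Yq: "quasi_metric_family (L_space q \<Phi> \<mu>) (L_norm q \<Phi> \<mu>) Kq"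
    using L_space_diff[OF \<Phi> q_pos, of _ \<mu>] by (metis quasi_metric_L_space[OF \<Phi> q_pos])
  interpret Y: quasi_metric_family "L_space q \<Phi> \<mu>" "L_norm q \<Phi> \<mu>" Kq by (rule Yq)
  have zA: "(\<lambda>z. 0) \<in> A_space p \<Psi> \<omega>" by (simp add: A_space_iff modular_def)
  define U where "U = {f \<in> A_space p \<Psi> \<omega>. A_norm p \<Psi> \<omega> f < 1}"
  have nb: "nbhd_of_origin (qn_topology (A_space p \<Psi> \<omega>) (A_norm p \<Psi> \<omega>)) U"
  proof -
    obtain V where V: "openin (qn_topology (A_space p \<Psi> \<omega>) (A_norm p \<Psi> \<omega>)) V" "(\<lambda>z. 0) \<in> V"
        "V \<subseteq> {g \<in> A_space p \<Psi> \<omega>. X.dq (\<lambda>z. 0) g < 1}"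
      by (rule X.ball_contains_open[OF zA zero_less_one]) (rule that)
    then have "V \<subseteq> U" by (auto simp: U_def X.dq_def)
    then show ?thesis using V unfolding nbhd_of_origin_def topspace_qn_topology by (auto simp: U_def)
  qed
  have U1: "f holomorphic_on ball 0 1" "modular p \<Psi> (weighted_area \<omega>) f \<le> ennreal 1" if "f \<in> U" for f
  proof -
    show "f holomorphic_on ball 0 1" using that by (simp add: U_def A_space_iff)
    have "modular p \<Psi> (weighted_area \<omega>) f = ennreal (A_norm p \<Psi> \<omega> f powr p)"
      using that p by (intro modular_eq_L_norm) (auto simp: U_def A_space_iff)
    also have "\<dots> \<le> ennreal 1"
      using that p L_norm_nonneg[of p \<Psi> "weighted_area \<omega>" f]
      by (intro ennreal_leI powr_le1) (auto simp: U_def)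
    finally show "modular p \<Psi> (weighted_area \<omega>) f \<le> ennreal 1" .
  qed
  obtain C5 where C5: "C5 \<ge> 1"
    "\<And>f j z R. f holomorphic_on ball 0 1 \<Longrightarrow> dyadic_radius j \<le> cmod z \<Longrightarrow> cmod z < dyadic_radius (Suc j) \<Longrightarrow>
       modular p \<Psi> (weighted_area \<omega>) f \<le> ennreal R \<Longrightarrow> R \<ge> 0 \<Longrightarrow> box_mass \<omega> j * growth p \<Psi> (cmod (f z)) \<le> C5 * R"
    by (rule growth_pointwise[OF \<omega> \<Psi> p]) (rule that)
  have locbd: "\<exists>B. \<forall>f\<in>U. \<forall>z\<in>S. norm (f z) \<le> B" if S: "compact S" "S \<subseteq> ball 0 1" for S
  proof (cases "S = {}")
    case False
    obtain w where w: "w \<in> S" "\<And>z. z \<in> S \<Longrightarrow> cmod z \<le> cmod w"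
      using continuous_attains_sup[OF S(1) False continuous_on_norm_id] by blast
    have "cmod w < 1" using w S by auto
    then obtain j0 where j0: "cmod w < dyadic_radius (Suc j0)" using dyadic_radius_ex[OF norm_ge_zero] by metis
    define B where "B = (\<Sum>j\<le>j0. C5 / box_mass \<omega> j)"
    obtain b where b: "\<And>x. 0 \<le> x \<Longrightarrow> growth p \<Psi> x \<le> B \<Longrightarrow> x \<le> b"
      by (rule growth_sublevel_bounded[OF \<Psi> p]) (rule that)
    have "norm (f z) \<le> b" if f: "f \<in> U" and z: "z \<in> S" for f z
    proof (rule b)
      have z1: "cmod z < 1" using z S by auto
      obtain j where j: "dyadic_radius j \<le> cmod z" "cmod z < dyadic_radius (Suc j)"
        using dyadic_radius_ex[OF norm_ge_zero z1] by metis
      have "j \<le> j0"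
      proof (rule ccontr)
        assume "\<not> j \<le> j0"
        then have "dyadic_radius (Suc j0) \<le> dyadic_radius j" by (intro dyadic_radius_mono) simp
        then show False using j j0 w(2)[OF z] by simp
      qed
      have "box_mass \<omega> j * growth p \<Psi> (cmod (f z)) \<le> C5 * 1"
        by (rule C5(2)[OF U1(1)[OF f] j U1(2)[OF f]]) simp
      then have "growth p \<Psi> (cmod (f z)) \<le> C5 / box_mass \<omega> j"
        using box_mass_pos[OF \<omega>, of j] by (simp add: field_simps)
      also have "\<dots> \<le> B" unfolding B_def
        using \<open>j \<le> j0\<close> C5(1) box_mass_pos[OF \<omega>] by (intro member_le_sum) (auto simp: less_imp_le)
      finally show "growth p \<Psi> (cmod (f z)) \<le> B" .
    qed simp
    then show ?thesis by blast
  qed simp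
  obtain Ca where Ca: "Ca \<ge> 1"
    "\<And>M f g h. f \<in> borel_measurable M \<Longrightarrow> g \<in> borel_measurable M \<Longrightarrow>
       \<forall>z\<in>space M. cmod (h z) \<le> cmod (f z) + cmod (g z) \<Longrightarrow>
       modular p \<Psi> M h \<le> ennreal Ca * (modular p \<Psi> M f + modular p \<Psi> M g)"
    by (rule modular_add[OF \<Psi> p]) (rule that)
  obtain Cf where Cf: "Cf \<ge> 1" "\<And>M (s :: nat \<Rightarrow> complex \<Rightarrow> complex) f. \<forall>n. s n \<in> borel_measurable M \<Longrightarrow>
       \<forall>z\<in>space M. (\<lambda>n. s n z) \<longlonglongrightarrow> f z \<Longrightarrow>
       modular p \<Psi> M f \<le> liminf (\<lambda>n. ennreal Cf * modular p \<Psi> M (s n))"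
    by (rule modular_fatou[OF \<Psi> p]) (rule that)
  define R where "R = Ca * (1 + Cf)"
  have R: "R \<ge> 0" using Ca Cf by (simp add: R_def)
  obtain Ce where Ce: "Ce \<ge> 0"
    "\<And>\<mu> J G f. finite_borel_measure_on_disc \<mu> \<Longrightarrow> G \<ge> 0 \<Longrightarrow>
      \<forall>j\<ge>J. \<forall>a. cmod a = dyadic_radius j \<longrightarrow>
          measure \<mu> (carleson_square a) * growth q \<Phi> (peak p \<Psi> (box_mass \<omega> j)) \<le> G \<Longrightarrow>
      f holomorphic_on ball 0 1 \<Longrightarrow> modular p \<Psi> (weighted_area \<omega>) f \<le> ennreal R \<Longrightarrow>
      (\<integral>\<^sup>+z. ennreal (growth q \<Phi> (cmod (f z))) * indicator {dyadic_radius J..} (cmod z) \<partial>\<mu>) \<le> ennreal (Ce * G)"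
    by (rule embedding_estimate[OF \<omega> \<Psi> \<Phi> p pq R]) (rule that)
  obtain Cg where Cg: "Cg \<ge> 1"
    "\<And>x y. 0 \<le> x \<Longrightarrow> x \<le> y \<Longrightarrow> growth q \<Phi> x \<le> Cg * (x / y) powr (q / 2) * growth q \<Phi> y"
    by (rule growth_contract[OF \<Phi> q_pos]) (rule that)
  have seq: "\<exists>g\<in>L_space q \<Phi> \<mu>. \<exists>r :: nat \<Rightarrow> nat. strict_mono r \<and> (\<lambda>n. Y.dq (s (r n)) g) \<longlonglongrightarrow> 0"
    if s: "range s \<subseteq> U" for s
  proof -
    obtain g r where g: "g holomorphic_on ball 0 1" and r: "strict_mono (r :: nat \<Rightarrow> nat)"
      and pw: "\<And>x. x \<in> ball 0 1 \<Longrightarrow> ((\<lambda>n. s (r n) x) \<longlongrightarrow> g x) sequentially"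
      and un: "\<And>S. \<lbrakk>compact S; S \<subseteq> ball 0 1\<rbrakk> \<Longrightarrow> uniform_limit S (s \<circ> r) g sequentially"
      by (rule Montel[OF open_ball U1(1) locbd s]) (auto intro: that)
    have sU: "s n \<in> U" for n using s by auto
    note sm = holomorphic_disc_measurable[OF U1(1)[OF sU]]
    note gm = holomorphic_disc_measurable[OF g]
    have mg: "modular p \<Psi> (weighted_area \<omega>) g \<le> ennreal Cf"
    proof -
      have "modular p \<Psi> (weighted_area \<omega>) g \<le> liminf (\<lambda>n. ennreal Cf * modular p \<Psi> (weighted_area \<omega>) (s (r n)))"
        using pw sm(1) by (intro Cf(2)) auto
      also have "\<dots> \<le> liminf (\<lambda>n::nat. ennreal Cf)"
      proof (intro Liminf_mono always_eventually allI)
        fix n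
        have "ennreal Cf * modular p \<Psi> (weighted_area \<omega>) (s (r n)) \<le> ennreal Cf * ennreal 1"
          by (intro mult_left_mono U1(2)[OF sU]) auto
        then show "ennreal Cf * modular p \<Psi> (weighted_area \<omega>) (s (r n)) \<le> ennreal Cf" by simp
      qed
      also have "\<dots> = ennreal Cf" by (simp add: Liminf_const)
      finally show ?thesis .
    qed
    have gA: "g \<in> A_space p \<Psi> \<omega>" using g le_less_trans[OF mg ennreal_less_top] by (simp add: A_space_iff)
    have gL: "g \<in> L_space q \<Phi> \<mu>" using gA AL by blast
    define d where "d n = (\<lambda>z. g z - s (r n) z)" for n
    have dh: "d n holomorphic_on ball 0 1" for n
      unfolding d_def by (intro holomorphic_on_diff g U1(1)[OF sU])
    have dR: "modular p \<Psi> (weighted_area \<omega>) (d n) \<le> ennreal R" for n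
    proof -
      have "modular p \<Psi> (weighted_area \<omega>) (d n) \<le> ennreal Ca * (modular p \<Psi> (weighted_area \<omega>) (s (r n)) + modular p \<Psi> (weighted_area \<omega>) g)"
      proof (rule Ca(2)[OF sm(1) gm(1)])
        have "cmod (d n z) \<le> cmod (s (r n) z) + cmod (g z)" for z
          using norm_triangle_ineq4[of "g z" "s (r n) z"] by (simp add: d_def)
        then show "\<forall>z\<in>space (weighted_area \<omega>). cmod (d n z) \<le> cmod (s (r n) z) + cmod (g z)" by blast
      qed
      also have "\<dots> \<le> ennreal Ca * (ennreal 1 + ennreal Cf)"
        by (intro mult_left_mono add_mono U1(2)[OF sU] mg) auto
      also have "\<dots> = ennreal R" using Ca(1) Cf(1) by (simp add: R_def ennreal_mult)
      finally show ?thesis .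
    qed
    \<comment> \<open>\<open>\<eta>\<close> makes the tail small, \<open>\<delta>\<close> the part over the compact disc\<close>
    have ev: "\<forall>\<^sub>F n in sequentially. modular q \<Phi> \<mu> (d n) \<le> ennreal \<epsilon>" if \<epsilon>: "\<epsilon> > 0" for \<epsilon>
    proof -
      define \<eta> where "\<eta> = \<epsilon> / (2 * (Ce + 1))"
      have \<eta>: "\<eta> > 0" "Ce * \<eta> \<le> \<epsilon> / 2"
        using \<epsilon> Ce(1) by (auto simp: \<eta>_def field_simps)
      obtain J where J: "\<And>j a. J \<le> j \<Longrightarrow> cmod a = dyadic_radius j \<Longrightarrow>
          measure \<mu> (carleson_square a) * peak_growth q \<Phi> p \<Psi> \<omega> j \<le> \<eta>" using tail[OF \<eta>(1)] by auto
      define m where "m = measure \<mu> (space \<mu>)"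
      have m: "m \<ge> 0" by (simp add: m_def)
      define g1 where "g1 = growth q \<Phi> 1"
      have g1: "g1 > 0" unfolding g1_def by (intro growth_pos \<Phi>) simp
      define \<delta> where "\<delta> = min 1 ((\<epsilon> / (2 * (Cg * g1 * (m + 1)))) powr (2 / q))"
      have \<delta>: "\<delta> > 0" "\<delta> \<le> 1" using \<epsilon> Cg(1) g1 m by (auto simp: \<delta>_def)
      have \<delta>m: "Cg * \<delta> powr (q / 2) * g1 * m \<le> \<epsilon> / 2"
      proof -
        define c where "c = Cg * g1 * (m + 1)"
        have c: "c > 0" using Cg(1) g1 m by (simp add: c_def)
        have "\<delta> powr (q / 2) \<le> ((\<epsilon> / (2 * c)) powr (2 / q)) powr (q / 2)"
          using \<delta> q_pos by (intro powr_mono2) (auto simp: \<delta>_def c_def)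
        also have "\<dots> = \<epsilon> / (2 * c)" using \<epsilon> c q_pos by (simp add: powr_powr)
        finally have "Cg * g1 * m * \<delta> powr (q / 2) \<le> c * (\<epsilon> / (2 * c))"
          using Cg(1) g1 m c by (intro mult_mono) (auto simp: c_def)
        also have "\<dots> = \<epsilon> / 2" using c by simp
        finally show ?thesis by (simp add: mult_ac)
      qed
      have "uniform_limit (cball 0 (dyadic_radius J)) (s \<circ> r) g sequentially"
        using dyadic_radius_bounds(2)[of J] by (intro un) auto
      from uniform_limitD[OF this \<delta>(1)]
      show ?thesis
      proof eventually_elim
        case (elim n)
        have inner: "growth q \<Phi> (cmod (d n z)) \<le> Cg * \<delta> powr (q / 2) * g1" if z: "cmod z < dyadic_radius J" for z
        proof -
          have dz: "cmod (d n z) \<le> \<delta>" using elim z by (simp add: d_def dist_norm norm_minus_commute less_imp_le)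
          then have "growth q \<Phi> (cmod (d n z)) \<le> Cg * (cmod (d n z) / 1) powr (q / 2) * growth q \<Phi> 1"
            using \<delta> by (intro Cg(2)) auto
          also have "\<dots> \<le> Cg * \<delta> powr (q / 2) * growth q \<Phi> 1"
            using dz q_pos Cg(1) g1 by (intro mult_right_mono mult_left_mono powr_mono2) (auto simp: g1_def)
          finally show ?thesis by (simp add: g1_def)
        qed
        have dmu: "d n \<in> borel_measurable \<mu>" by (rule holomorphic_disc_measurable(2)[OF dh \<mu>])
        have im: "(\<lambda>z. indicator {dyadic_radius J..} (cmod z) :: ennreal) \<in> borel_measurable \<mu>"
          by (rule finite_borel_disc_measurable(1)[OF \<mu>], rule measurable_compose[of cmod borel borel]) auto
        have "modular q \<Phi> \<mu> (d n) \<le> (\<integral>\<^sup>+z. ennreal (Cg * \<delta> powr (q / 2) * g1) + ennreal (growth q \<Phi> (cmod (d n z))) * indicator {dyadic_radius J..} (cmod z) \<partial>\<mu>)"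
          unfolding modular_growth
        proof (rule nn_integral_mono)
          fix z
          show "ennreal (growth q \<Phi> (cmod (d n z))) \<le> ennreal (Cg * \<delta> powr (q / 2) * g1) + ennreal (growth q \<Phi> (cmod (d n z))) * indicator {dyadic_radius J..} (cmod z)"
          proof (cases "cmod z < dyadic_radius J")
            case True
            then show ?thesis using ennreal_leI[OF inner[OF True]] by simp
          next
            case False
            then show ?thesis by (simp add: add_increasing)
          qed
        qed
        also have "\<dots> = (\<integral>\<^sup>+z. ennreal (Cg * \<delta> powr (q / 2) * g1) \<partial>\<mu>) + (\<integral>\<^sup>+z. ennreal (growth q \<Phi> (cmod (d n z))) * indicator {dyadic_radius J..} (cmod z) \<partial>\<mu>)"
          using growth_cmod_measurable[OF \<Phi> dmu] im by (intro nn_integral_add borel_measurable_times_ennreal) auto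
        also have "(\<integral>\<^sup>+z. ennreal (Cg * \<delta> powr (q / 2) * g1) \<partial>\<mu>) = ennreal (Cg * \<delta> powr (q / 2) * g1 * m)"
          using Cg(1) g1 m by (simp add: \<mu>.emeasure_eq_measure m_def ennreal_mult)
        also have "\<dots> \<le> ennreal (\<epsilon> / 2)" by (rule ennreal_leI[OF \<delta>m])
        also have "(\<integral>\<^sup>+z. ennreal (growth q \<Phi> (cmod (d n z))) * indicator {dyadic_radius J..} (cmod z) \<partial>\<mu>) \<le> ennreal (Ce * \<eta>)"
          using \<eta>(1) J by (intro Ce(2)[OF \<mu> _ _ dh dR]) (auto simp: peak_growth_def)
        also have "\<dots> \<le> ennreal (\<epsilon> / 2)" by (rule ennreal_leI[OF \<eta>(2)])
        also have "ennreal (\<epsilon> / 2) + ennreal (\<epsilon> / 2) = ennreal \<epsilon>"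
          using \<epsilon> by (simp add: ennreal_plus[symmetric] del: ennreal_plus)
        finally show "modular q \<Phi> \<mu> (d n) \<le> ennreal \<epsilon>" by (simp add: add_mono)
      qed
    qed
    have "(\<lambda>n. Y.dq (s (r n)) g) \<longlonglongrightarrow> 0"
    proof (rule tendstoI)
      fix e :: real assume e: "e > 0"
      have "(e / 2) powr q > 0" using e by simp
      from ev[OF this] show "\<forall>\<^sub>F n in sequentially. dist (Y.dq (s (r n)) g) 0 < e"
      proof eventually_elim
        case (elim n)
        have "L_norm q \<Phi> \<mu> (d n) \<le> ((e / 2) powr q) powr (1 / q)"
          using elim q_pos by (intro L_norm_le) auto
        also have "\<dots> = e / 2" using e q_pos by (simp add: powr_powr)
        finally have "L_norm q \<Phi> \<mu> (d n) < e" using e by simp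
        then show ?case using L_norm_nonneg[of q \<Phi> \<mu> "d n"] by (simp add: Y.dq_def d_def)
      qed
    qed
    then show ?thesis using gL r by blast
  qed
  have "relatively_compact_in (qn_topology (L_space q \<Phi> \<mu>) (L_norm q \<Phi> \<mu>)) U"
  proof (rule Y.relatively_compact_if_sequentially[OF _ seq])
    show "U \<subseteq> L_space q \<Phi> \<mu>" using AL by (auto simp: U_def)
    show "0 \<le> Y.dq f g" for f g by (simp add: Y.dq_def L_norm_nonneg)
  qed
  then show ?thesis
    unfolding compact_operator_def using nb AL by (intro conjI exI[of _ U]) auto
qed

end

theorem theorem1:
  fixes p q :: real and \<omega> :: "complex \<Rightarrow> real" and \<Phi> \<Psi> :: "real \<Rightarrow> real"
    and \<mu> :: "complex measure"
  assumes "0 < p" and "p \<le> q"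
    and "\<omega> \<in> class_D"
    and "\<Phi> \<in> class_L" and "\<Psi> \<in> class_L"
    and "finite_borel_measure_on_disc \<mu>"
  shows "(carleson_measure q \<Phi> p \<Psi> \<omega> \<mu> \<longleftrightarrow>
            bdd_above (carleson_quotient q \<Phi> p \<Psi> \<omega> \<mu> ` unit_disc)) \<and>
         (compact_operator (A_space p \<Psi> \<omega>) (A_norm p \<Psi> \<omega>) (L_space q \<Phi> \<mu>) (L_norm q \<Phi> \<mu>) (\<lambda>f. f) \<longleftrightarrow>
            (carleson_quotient q \<Phi> p \<Psi> \<omega> \<mu> \<longlongrightarrow> 0) (filtercomap cmod (at_left 1)))"
  using carleson_imp_bounded[OF assms] bounded_imp_carleson[OF assms]
    compact_imp_vanishing[OF assms] vanishing_imp_compact[OF assms] by (intro conjI iffI)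

end
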